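(* Let $U,V$ be real Banach spaces and let $\mathfrak{F}\in\mathcal{C}^1(\mathbb{R}\times U,V)$ satisfy: (F1) $\mathfrak{F}(\lambda,0)=0$ for all $\lambda\in\mathbb{R}$; (F2) $\mathfrak{F}$ is orientable; (F3) $D_u\mathfrak{F}(\lambda,u)\in\Phi_0(U,V)$ for all $\lambda\in\mathbb{R}$ and $u\in U$; (F4) $\mathfrak{F}$ is proper on closed and bounded subsets of $\mathbb{R}\times U$; (F5) $\lambda_0$ is an isolated eigenvalue of $\mathfrak{L}(\lambda):=D_u\mathfrak{F}(\lambda,0)$ such that $N[\mathfrak{L}(\lambda_0)]=\mathrm{span}[\varphi_0]$ for some $\varphi_0\in U$ with $\|\varphi_0\|=1$ and $\mathfrak{L}'(\lambda_0)\varphi_0\notin R[\mathfrak{L}(\lambda_0)]$, i.e., $\chi[\mathfrak{L},\lambda_0]=1$. Suppose, in addition, that $\psi$ is of class $\mathcal{C}^1$. Then the set of nontrivial solutions, $\mathcal{S}$, possesses a connected component $\mathfrak{C}$ such that $(\lambda_0,0)\in\mathfrak{C}$ and, choosing $\varepsilon>0$ and $\delta>0$ sufficiently small so that $[\mathcal{S}\setminus\{(\lambda_0,0)\}]\cap B_\delta(\lambda_0,0)\subset Q_{\varepsilon,\eta}$, there exist two closed connected subsets $\mathfrak{C}_\delta^+,\mathfrak{C}_\delta^-\subset\mathfrak{C}\cap B_\delta(\lambda_0,0)$ such that $\mathfrak{C}_\delta^+\subset Q_{\varepsilon,\eta}^+\cup\{(\lambda_0,0)\}$, $\mathfrak{C}_\delta^-\subset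 Q_{\varepsilon,\eta}^-\cup\{(\lambda_0,0)\}$ and $\mathfrak{C}_\delta^+\cap\mathfrak{C}_\delta^-=\{(\lambda_0,0)\}$. Moreover, $\mathfrak{C}_\delta^+$ and $\mathfrak{C}_\delta^-$ link $(\lambda_0,0)$ to $\partial B_\delta(\lambda_0,0)$. Furthermore, setting $\mathfrak{C}^+:=\mathscr{C}^+\cup\{(\lambda_0,0)\}$ and $\mathfrak{C}^-:=\mathscr{C}^-\cup\{(\lambda_0,0)\}$, where $\mathscr{C}^+$ (resp. $\mathscr{C}^-$) is the connected component of $\mathcal{S}\setminus\{(\lambda_0,0)\}$ containing $\mathfrak{C}_\delta^+\setminus\{(\lambda_0,0)\}$ (resp. $\mathfrak{C}_\delta^-\setminus\{(\lambda_0,0)\}$), then for every $\nu\in\{-,+\}$ some of the following alternatives hold: (i) $\mathfrak{C}^\nu$ is not compact in $\mathbb{R}\times U$. (ii) There exists $\lambda_1\neq\lambda_0$ such that $(\lambda_1,0)\in\mathfrak{C}^\nu$. (iii) There exist $\lambda\in\mathbb{R}$ and $z\in Z\setminus\{0\}$ such that $(\lambda,z)\in\mathfrak{C}^\nu$.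
   Context: $\Phi_0(U,V)$: bounded linear Fredholm operators of index zero; $GL(U,V)$: topological isomorphisms; $N[\cdot]$, $R[\cdot]$: kernel and range; $\Sigma(\mathfrak{L})=\{\lambda:\mathfrak{L}(\lambda)\notin GL(U,V)\}$. $\mathcal{T}=\{(\lambda,0):\lambda\in\mathbb{R}\}$ and the set of nontrivial solutions is $\mathcal{S}=[\mathfrak{F}^{-1}(0)\setminus\mathcal{T}]\cup\{(\lambda,0):\lambda\in\Sigma(\mathfrak{L})\}$. $B_\delta(\lambda_0,0)$ is the ball of radius $\delta$ centred at $(\lambda_0,0)$ in $\mathbb{R}\times U$. $\chi[\mathfrak{L},\lambda_0]$ is the generalized algebraic multiplicity of $\mathfrak{L}$ at $\lambda_0$; when $\mathfrak{L}'(\lambda_0)(N[\mathfrak{L}(\lambda_0)])\oplus R[\mathfrak{L}(\lambda_0)]=V$, as in (F5), it equals $\dim\mathfrak{L}'(\lambda_0)(N[\mathfrak{L}(\lambda_0)])$, which is $1$ here. Orientability of $\mathfrak{F}$: for a continuous path $\mathfrak{M}:[a,b]\to\Phi_0(U,V)$ with invertible endpoints, the parity is $\sigma(\mathfrak{M},[a,b])=\deg_{LS}(\mathfrak{P}(a)\mathfrak{M}(a))\deg_{LS}(\mathfrak{P}(b)\mathfrak{M}(b))\in\{\pm1\}$, where $\mathfrak{P}:[a,b]\to GL(V,U)$ is continuous with $\mathfrak{P}(t)\mathfrak{M}(t)-I_U$ compact for all $t$, and $\deg_{LS}(T)$ is the Leray--Schauder degree of $T$ on a small ball centred at $0$. $\mathfrak{F}$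 is orientable if there is a map $\mathfrak{o}:\{(\lambda,u):D_u\mathfrak{F}(\lambda,u)\in GL(U,V)\}\to\{-1,1\}$ with $\sigma(D_u\mathfrak{F}\circ\gamma,[a,b])=\mathfrak{o}(\gamma(a))\,\mathfrak{o}(\gamma(b))$ for every continuous $\gamma:[a,b]\to\mathbb{R}\times U$ whose endpoints lie in that set. Cones: $Z\subset U$ is a fixed closed subspace with $U=N[\mathfrak{L}(\lambda_0)]\oplus Z$, and $\varphi_0^*\in U'$ satisfies $Z=N[\varphi_0^*]$ and $\langle\varphi_0^*,\varphi_0\rangle=1$. $\psi:U\to\mathbb{R}$ is a fixed continuous functional such that, for some constants $0<C_1<C_2$, $\psi(0)=0$ and $C_1\|u\|\leq\psi(u)\leq C_2\|u\|$ for all $u\in U$; $\eta\in(0,1/C_2)$ is fixed. For $\varepsilon>0$, $Q_{\varepsilon,\eta}=\{(\lambda,u)\in\mathbb{R}\times U:|\lambda-\lambda_0|<\varepsilon,\ |\langle\varphi_0^*,u\rangle|>\eta\psi(u)\}$, $Q_{\varepsilon,\eta}^+=\{(\lambda,u)\in\mathbb{R}\times U:|\lambda-\lambda_0|<\varepsilon,\ \langle\varphi_0^*,u\rangle>\eta\psi(u)\}$, $Q_{\varepsilon,\eta}^-=\{(\lambda,u)\in\mathbb{R}\times U:|\lambda-\lambda_0|<\varepsilon,\ \langle\varphi_0^*,u\rangle<-\eta\psi(u)\}$. Under (F1)--(F5), for sufficiently small $\varepsilon>0$ there is $\delta_0=\delta_0(\eta)>0$ such that, for every $\delta\in(0,\delta_0)$,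 $[\mathcal{S}\setminus\{(\lambda_0,0)\}]\cap B_\delta(\lambda_0,0)\subset Q_{\varepsilon,\eta}$; $\varepsilon$ and $\delta$ in the claim are chosen in this way.
   Formalization: ψ is required to be of class C¹ only on U∖{0}, since ψ(0)=0 and ψ(u) ≥ C₁‖u‖ rule out differentiability at 0; B_δ(λ₀,0) is read as the closed ball, so that the closed sets C_δ^± can lie in it and reach its boundary. *)

theory Defs
  imports "HOL-Analysis.Analysis" "HOL-Homology.Homology"
begin

definition null_space :: "('u::real_normed_vector \<Rightarrow>\<^sub>L 'v::real_normed_vector) \<Rightarrow> 'u set" where
  "null_space A = {x. blinfun_apply A x = 0}"

definition GL :: "('u::real_normed_vector \<Rightarrow>\<^sub>L 'v::real_normed_vector) set" where
  "GL = {A. \<exists>B. A o\<^sub>L B = id_blinfun \<and> B o\<^sub>L A = id_blinfun}"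

definition finite_dim :: "'u::real_vector set \<Rightarrow> bool" where
  "finite_dim S \<longleftrightarrow> (\<exists>B. finite B \<and> S \<subseteq> span B)"

definition finite_codim :: "'u::real_vector set \<Rightarrow> bool" where
  "finite_codim S \<longleftrightarrow> (\<exists>C. finite C \<and> span (S \<union> C) = UNIV)"

text \<open>Dimension of the quotient by a subspace \<open>S\<close> of finite codimension.\<close>

definition codim :: "'u::real_vector set \<Rightarrow> nat" where
  "codim S = (LEAST n. \<exists>C. finite C \<and> card C = n \<and> span (S \<union> C) = UNIV)"

definition fredholm :: "('u::real_normed_vector \<Rightarrow>\<^sub>L 'v::real_normed_vector) \<Rightarrow> bool" where
  "fredholm A \<longleftrightarrow> finite_dim (null_space A) \<and>
     closed (range (blinfun_apply A)) \<and> finite_codim (range (blinfun_apply A))"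

definition fredholm_index :: "('u::real_normed_vector \<Rightarrow>\<^sub>L 'v::real_normed_vector) \<Rightarrow> int" where
  "fredholm_index A = int (dim (null_space A)) - int (codim (range (blinfun_apply A)))"

definition Fredholm0 :: "('u::real_normed_vector \<Rightarrow>\<^sub>L 'v::real_normed_vector) set" where
  "Fredholm0 = {A. fredholm A \<and> fredholm_index A = 0}"

definition compact_operator :: "('u::real_normed_vector \<Rightarrow>\<^sub>L 'v::real_normed_vector) \<Rightarrow> bool" where
  "compact_operator K \<longleftrightarrow> (\<forall>S. bounded S \<longrightarrow> compact (closure (blinfun_apply K ` S)))"

definition direct_sum_decomposition :: "'u::real_vector set \<Rightarrow> 'u set \<Rightarrow> bool" where
  "direct_sum_decomposition M Z \<longleftrightarrow> subspace M \<and> subspace Z \<and> M \<inter> Z = {0} \<and>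
     (\<forall>x. \<exists>m\<in>M. \<exists>z\<in>Z. x = m + z)"

text \<open>
  The list \<open>bs\<close> is a basis of a finite-dimensional subspace \<open>E\<close>; vectors of \<open>E\<close> are described by
  their coordinates, which are elements of \<^term>\<open>topspace (Euclidean_space (length bs))\<close>.
\<close>

definition from_coords :: "'u::real_vector list \<Rightarrow> (nat \<Rightarrow> real) \<Rightarrow> 'u" where
  "from_coords bs x = (\<Sum>i<length bs. x i *\<^sub>R bs ! i)"

definition to_coords :: "'u::real_vector list \<Rightarrow> 'u \<Rightarrow> nat \<Rightarrow> real" where
  "to_coords bs v i = (if i < length bs then representation (set bs) v (bs ! i) else 0)"

definition normalize_coords :: "nat \<Rightarrow> (nat \<Rightarrow> real) \<Rightarrow> nat \<Rightarrow> real" where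
  "normalize_coords n y i = y i / sqrt (\<Sum>j<n. (y j)\<^sup>2)"

text \<open>
  Brouwer degree with respect to \<open>0\<close> of a continuous map \<open>f\<close> from the closed ball of radius \<open>r\<close>
  of \<open>E\<close> into \<open>E\<close> without zeros on the boundary sphere: the degree of the self-map of the
  Euclidean unit sphere that projects \<open>x\<close> radially to the sphere of radius \<open>r\<close> of \<open>E\<close>, applies
  \<open>f\<close>, and normalizes. If \<open>E\<close> is trivial, \<open>f\<close> is the map of a single point and has degree \<open>1\<close>.
\<close>

definition brouwer_degree_ball :: "'u::real_normed_vector list \<Rightarrow> ('u \<Rightarrow> 'u) \<Rightarrow> real \<Rightarrow> int" where
  "brouwer_degree_ball bs f r =
     (if bs = [] then 1
      else Brouwer_degree2 (length bs - 1)
             (\<lambda>x. normalize_coords (length bs)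
                (to_coords bs (f ((r / norm (from_coords bs x)) *\<^sub>R from_coords bs x)))))"

text \<open>
  Leray--Schauder degree with respect to \<open>0\<close> on the ball of radius \<open>r\<close>, for a compact
  perturbation \<open>f\<close> of the identity without zeros on the sphere: the common Brouwer degree of all
  sufficiently close approximations \<open>x \<mapsto> x - k x\<close> by (in general nonlinear) maps \<open>k\<close> with
  values in a finite-dimensional subspace, restricted to that subspace.
\<close>

definition leray_schauder_degree_ball :: "('u::real_normed_vector \<Rightarrow> 'u) \<Rightarrow> real \<Rightarrow> int" where
  "leray_schauder_degree_ball f r =
     (THE d. \<exists>e>0. \<forall>bs k.
        distinct bs \<and> independent (set bs) \<and>
        continuous_on (cball 0 r) k \<and> k ` cball 0 r \<subseteq> span (set bs) \<and>
        (\<forall>x\<in>cball 0 r. norm (f x - (x - k x)) < e)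
        \<longrightarrow> brouwer_degree_ball bs (\<lambda>x. x - k x) r = d)"

definition deg_LS :: "('u::real_normed_vector \<Rightarrow>\<^sub>L 'u) \<Rightarrow> int" where
  "deg_LS T = (THE d. \<forall>\<^sub>F r in at_right 0. leray_schauder_degree_ball (blinfun_apply T) r = d)"

definition parametrix ::
  "(real \<Rightarrow> 'v::real_normed_vector \<Rightarrow>\<^sub>L 'u::real_normed_vector) \<Rightarrow> (real \<Rightarrow> 'u \<Rightarrow>\<^sub>L 'v) \<Rightarrow> real \<Rightarrow> real \<Rightarrow> bool" where
  "parametrix P M a b \<longleftrightarrow> continuous_on {a..b} P \<and>
     (\<forall>t\<in>{a..b}. P t \<in> GL \<and> compact_operator ((P t o\<^sub>L M t) - id_blinfun))"

definition parity ::
  "(real \<Rightarrow> 'u::real_normed_vector \<Rightarrow>\<^sub>L 'v::real_normed_vector) \<Rightarrow> real \<Rightarrow> real \<Rightarrow> int" where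
  "parity M a b =
     (THE s. \<exists>P. parametrix P M a b \<and> s = deg_LS (P a o\<^sub>L M a) * deg_LS (P b o\<^sub>L M b))"

definition D_u ::
  "(real \<times> 'u::real_normed_vector \<Rightarrow> 'v::real_normed_vector) \<Rightarrow> real \<times> 'u \<Rightarrow> 'u \<Rightarrow>\<^sub>L 'v" where
  "D_u F p = Blinfun (frechet_derivative (\<lambda>w. F (fst p, w)) (at (snd p)))"

definition orientable ::
  "(real \<times> 'u::real_normed_vector \<Rightarrow> 'v::real_normed_vector) \<Rightarrow> bool" where
  "orientable F \<longleftrightarrow> (\<exists>or :: real \<times> 'u \<Rightarrow> int.
     (\<forall>p. D_u F p \<in> GL \<longrightarrow> or p \<in> {-1, 1}) \<and>
     (\<forall>a b \<gamma>. a < b \<and> continuous_on {a..b} \<gamma> \<and> D_u F (\<gamma> a) \<in> GL \<and> D_u F (\<gamma> b) \<in> GL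
        \<longrightarrow> parity (\<lambda>t. D_u F (\<gamma> t)) a b = or (\<gamma> a) * or (\<gamma> b)))"

text \<open>Class \<open>C\<^sup>1\<close> on an open set \<open>S\<close>.\<close>

definition C1_on ::
  "'a::real_normed_vector set \<Rightarrow> ('a \<Rightarrow> 'b::real_normed_vector) \<Rightarrow> bool" where
  "C1_on S f \<longleftrightarrow> (\<exists>f'. (\<forall>x\<in>S. (f has_derivative blinfun_apply (f' x)) (at x)) \<and> continuous_on S f')"

definition proper_on_closed_bounded ::
  "('a::metric_space \<Rightarrow> 'b::topological_space) \<Rightarrow> bool" where
  "proper_on_closed_bounded F \<longleftrightarrow>
     (\<forall>B K. closed B \<and> bounded B \<and> compact K \<longrightarrow> compact {p \<in> B. F p \<in> K})"

definition linearization ::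
  "(real \<times> 'u::real_normed_vector \<Rightarrow> 'v::real_normed_vector) \<Rightarrow> real \<Rightarrow> 'u \<Rightarrow>\<^sub>L 'v" where
  "linearization F l = D_u F (l, 0)"

definition gen_spectrum ::
  "(real \<Rightarrow> 'u::real_normed_vector \<Rightarrow>\<^sub>L 'v::real_normed_vector) \<Rightarrow> real set" where
  "gen_spectrum L = {l. L l \<notin> GL}"

definition trivial_branch :: "(real \<times> 'u::zero) set" where
  "trivial_branch = {(l, 0) | l. True}"

definition nontrivial_solutions ::
  "(real \<times> 'u::real_normed_vector \<Rightarrow> 'v::real_normed_vector) \<Rightarrow> (real \<times> 'u) set" where
  "nontrivial_solutions F =
     (F -` {0} - trivial_branch) \<union> {(l, 0) | l. l \<in> gen_spectrum (linearization F)}"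

definition cone_Q ::
  "real \<Rightarrow> ('u::real_normed_vector \<Rightarrow>\<^sub>L real) \<Rightarrow> ('u \<Rightarrow> real) \<Rightarrow> real \<Rightarrow> real \<Rightarrow> (real \<times> 'u) set" where
  "cone_Q l0 \<phi>s \<psi> \<epsilon> \<eta> = {(l, u). \<bar>l - l0\<bar> < \<epsilon> \<and> \<bar>blinfun_apply \<phi>s u\<bar> > \<eta> * \<psi> u}"

definition cone_Qplus ::
  "real \<Rightarrow> ('u::real_normed_vector \<Rightarrow>\<^sub>L real) \<Rightarrow> ('u \<Rightarrow> real) \<Rightarrow> real \<Rightarrow> real \<Rightarrow> (real \<times> 'u) set" where
  "cone_Qplus l0 \<phi>s \<psi> \<epsilon> \<eta> = {(l, u). \<bar>l - l0\<bar> < \<epsilon> \<and> blinfun_apply \<phi>s u > \<eta> * \<psi> u}"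

definition cone_Qminus ::
  "real \<Rightarrow> ('u::real_normed_vector \<Rightarrow>\<^sub>L real) \<Rightarrow> ('u \<Rightarrow> real) \<Rightarrow> real \<Rightarrow> real \<Rightarrow> (real \<times> 'u) set" where
  "cone_Qminus l0 \<phi>s \<psi> \<epsilon> \<eta> = {(l, u). \<bar>l - l0\<bar> < \<epsilon> \<and> blinfun_apply \<phi>s u < - (\<eta> * \<psi> u)}"

end

theory Submission
  imports Defs
begin

text \<open>
  Let \<open>S\<^sup>+\<close> be the part of the solution set in the half space \<open>\<phi>s \<ge> 0\<close>. The core is that
  \<open>S\<^sup>+\<close> has no compact relatively open part \<open>B\<close> that contains \<open>(l0, 0)\<close> and meets \<open>{\<phi>s = 0}\<close>
  only there. Otherwise, the equations \<open>F = 0\<close>, \<open>\<phi>s = s\<close> near \<open>B\<close> have, for small \<open>s > 0\<close>, an odd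
  number of solutions: a deformation along \<open>L' \<phi>0\<close> leads to a system with one nondegenerate zero,
  because \<open>\<langle>\<omega>, F\<rangle>\<close>, with \<open>\<omega>\<close> vanishing on the range of \<open>L(l0)\<close>, changes sign with \<open>l - l0\<close> by
  transversality. For large \<open>s\<close> there is no solution. Preimages of finite-dimensional subspaces
  under Fredholm maps reduce this to manifolds of finite dimension, where the parity of the number
  of zeros is preserved by a count of simplices of a triangulation.

  A minimal closed subset of \<open>S\<^sup>+\<close> with the property just described exists by Zorn's lemma. By
  minimality it becomes connected after removing \<open>(l0, 0)\<close> and the other points with \<open>\<phi>s = 0\<close>, and
  this connected set gives the branch in the positive cone. The negative branch follows by replacing
  \<open>\<phi>0\<close> and \<open>\<phi>s\<close> by their negatives.
\<close>

section \<open>Closed subspaces and Fredholm operators\<close>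

text \<open>Zeros are counted modulo 2: the model system has exactly one zero, so an odd count only
  has to survive the deformation. The manifold that carries the deformation is not compact, and
  charts are available only at points of a compact set to which the zeros are confined. The
  deformation time is therefore made a function on the manifold and raised in one chart after the
  other. Inside a chart the map is replaced by a generic piecewise affine one, whose zeros are
  counted by shooting a ray, so that the parity depends on boundary values alone. The interpolant is
  written as an average of grid values over shifts; in this form two-point estimates on the grid
  pass to it with the same constant, which is why derivatives are used in the strict, two-point
  sense. On the topological side, a continuum through \<open>(l0, 0)\<close> can fall apart when
  this point is removed, so linking inside the solution set alone gives no connected branch off it.
  The minimal set repairs this. It is chosen before any radius, so the continua in all small balls
  belong to the same component.\<close>

lemma subspace_dist_line:
  fixes S :: "'a::real_normed_vector set"
  assumes S: "subspace S" "closed S" and b: "b \<notin> S"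
  obtains d where "d > 0" "\<And>t s. s \<in> S \<Longrightarrow> \<bar>t\<bar> * d \<le> norm (t *\<^sub>R b + s)"
proof
  have ne: "S \<noteq> {}" using S(1) subspace_0 by blast
  show pos: "infdist b S > 0"
    using in_closed_iff_infdist_zero[OF S(2) ne, of b] b infdist_nonneg[of b S] by linarith
  show "\<bar>t\<bar> * infdist b S \<le> norm (t *\<^sub>R b + s)" if s: "s \<in> S" for t s
  proof (cases "t = 0")
    case False
    have "- ((1/t) *\<^sub>R s) \<in> S"
      using S(1) s by (simp add: subspace_neg subspace_scale)
    then have "infdist b S \<le> dist b (- ((1/t) *\<^sub>R s))" by (rule infdist_le)
    also have "\<dots> = norm ((1/t) *\<^sub>R (t *\<^sub>R b + s))"
      using False by (simp add: dist_norm scaleR_add_right)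
    also have "\<dots> = norm (t *\<^sub>R b + s) / \<bar>t\<bar>" by simp
    finally show ?thesis using False by (simp add: field_simps)
  qed simp
qed

text \<open>Induction on the spanning set. The distance bound makes the coefficients of a new vector
  \<open>b\<close> Cauchy along a convergent sequence, so the limit splits into a multiple of
  \<open>b\<close> and a limit in the smaller span.\<close>

lemma closed_span_finite:
  fixes B :: "'a::real_normed_vector set"
  assumes "finite B"
  shows "closed (span B)"
  using assms
proof (induction B)
  case (insert b B)
  show ?case
  proof (cases "b \<in> span B")
    case True
    then show ?thesis using insert by (simp add: span_redundant)
  next
    case False
    obtain d where d: "d > 0" "\<And>t s. s \<in> span B \<Longrightarrow> \<bar>t\<bar> * d \<le> norm (t *\<^sub>R b + s)"
      using subspace_dist_line[OF subspace_span insert.IH False] by blast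
    show ?thesis
      unfolding closed_sequential_limits
    proof (intro allI impI, elim conjE)
      fix y l assume y: "\<forall>n. y n \<in> span (insert b B)" and l: "y \<longlonglongrightarrow> l"
      have "\<exists>t. y n - t *\<^sub>R b \<in> span B" for n
        using y by (simp add: span_insert)
      then obtain t where t: "\<And>n. y n - t n *\<^sub>R b \<in> span B" by metis
      have key: "\<bar>t m - t n\<bar> * d \<le> norm (y m - y n)" for m n
        using d(2)[of "(y m - t m *\<^sub>R b) - (y n - t n *\<^sub>R b)" "t m - t n"] span_diff[OF t t, of m n]
        by (simp add: algebra_simps)
      have "Cauchy t"
      proof (rule metric_CauchyI)
        fix e :: real assume "e > 0"
        then obtain M where M: "\<And>m n. m \<ge> M \<Longrightarrow> n \<ge> M \<Longrightarrow> dist (y m) (y n) < e * d"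
          using metric_CauchyD[OF LIMSEQ_imp_Cauchy[OF l], of "e * d"] d(1) by (meson mult_pos_pos)
        show "\<exists>M. \<forall>m\<ge>M. \<forall>n\<ge>M. dist (t m) (t n) < e"
        proof (intro exI[of _ M] allI impI)
          fix m n assume "m \<ge> M" "n \<ge> M"
          then have "\<bar>t m - t n\<bar> * d < e * d" using key[of m n] M[of m n] by (simp add: dist_norm)
          then show "dist (t m) (t n) < e" using d(1) by (simp add: dist_real_def)
        qed
      qed
      then obtain t0 where t0: "t \<longlonglongrightarrow> t0" using Cauchy_convergent convergent_def by blast
      have "(\<lambda>n. y n - t n *\<^sub>R b) \<longlonglongrightarrow> l - t0 *\<^sub>R b"
        by (intro tendsto_intros l t0)
      then have "l - t0 *\<^sub>R b \<in> span B"
        using insert.IH t by (meson closed_sequentially)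
      then show "l \<in> span (insert b B)" by (auto simp: span_insert)
    qed
  qed
qed simp

text \<open>Each coefficient is controlled by the distance of its vector from the closed span of the
  others. The constant measures the nondegeneracy of a zero, in the sum norm of coordinates used for
  all local estimates.\<close>

lemma independent_family_lower_bound:
  fixes e :: "nat \<Rightarrow> 'a::real_normed_vector"
  assumes "inj_on e {..<m}" "independent (e ` {..<m})"
  obtains c where "c > 0" "\<And>\<eta>. c * (\<Sum>i<m. \<bar>\<eta> i\<bar>) \<le> norm (\<Sum>i<m. \<eta> i *\<^sub>R e i)"
proof -
  have "\<exists>d>0. \<forall>\<eta>. \<bar>\<eta> i\<bar> * d \<le> norm (\<Sum>j<m. \<eta> j *\<^sub>R e j)" if i: "i < m" for i
  proof -
    let ?S = "span (e ` ({..<m} - {i}))"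
    have eq: "e ` ({..<m} - {i}) = e ` {..<m} - {e i}"
      using assms(1) i by (auto simp: inj_on_def)
    have "e i \<notin> ?S"
      unfolding eq using assms(2) i by (auto simp: dependent_def)
    then obtain d where d: "d > 0" "\<And>t s. s \<in> ?S \<Longrightarrow> \<bar>t\<bar> * d \<le> norm (t *\<^sub>R e i + s)"
      using subspace_dist_line[OF subspace_span closed_span_finite] by (metis finite_Diff finite_imageI finite_lessThan)
    show ?thesis
    proof (intro exI[of _ d] conjI allI d(1))
      fix \<eta> :: "nat \<Rightarrow> real"
      have "(\<Sum>j<m. \<eta> j *\<^sub>R e j) = \<eta> i *\<^sub>R e i + (\<Sum>j\<in>{..<m} - {i}. \<eta> j *\<^sub>R e j)"
        using i by (simp add: sum.remove)
      moreover have "(\<Sum>j\<in>{..<m} - {i}. \<eta> j *\<^sub>R e j) \<in> ?S"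
        by (intro span_sum span_scale span_base) auto
      ultimately show "\<bar>\<eta> i\<bar> * d \<le> norm (\<Sum>j<m. \<eta> j *\<^sub>R e j)" using d(2) by metis
    qed
  qed
  then obtain d where d: "\<And>i. i < m \<Longrightarrow> d i > 0"
    "\<And>i \<eta>. i < m \<Longrightarrow> \<bar>\<eta> i\<bar> * d i \<le> norm (\<Sum>j<m. \<eta> j *\<^sub>R e j)" by metis
  \<comment> \<open>The summand 1 keeps \<open>C\<close> positive when \<open>m = 0\<close>.\<close>
  define C where "C = 1 + (\<Sum>i<m. 1 / d i)"
  have C: "C > 0" unfolding C_def
    by (intro add_pos_nonneg sum_nonneg) (use d(1) in \<open>auto intro: less_imp_le\<close>)
  show ?thesis
  proof (rule that[of "1 / C"])
    fix \<eta> :: "nat \<Rightarrow> real"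
    let ?x = "norm (\<Sum>j<m. \<eta> j *\<^sub>R e j)"
    have "(\<Sum>i<m. \<bar>\<eta> i\<bar>) \<le> (\<Sum>i<m. ?x * (1 / d i))"
      by (intro sum_mono) (use d in \<open>auto simp: field_simps\<close>)
    also have "\<dots> = ?x * (\<Sum>i<m. 1 / d i)" by (simp add: sum_distrib_left)
    also have "\<dots> \<le> ?x * C" unfolding C_def by (intro mult_left_mono) auto
    finally show "1 / C * (\<Sum>i<m. \<bar>\<eta> i\<bar>) \<le> ?x" using C by (simp add: field_simps)
  qed (use C in simp)
qed

section \<open>Hahn-Banach separation and dual families\<close>

text \<open>One-dimensional Hahn-Banach step. Functionals are handled as graphs, so that a chain of
  extensions has its union as an upper bound; the one-sided bound by \<open>C * norm z\<close>
  already forces a subspace of pairs to be single-valued.\<close>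

lemma graph_extension_step:
  fixes G :: "('a::real_normed_vector \<times> real) set"
  assumes G: "subspace G" "\<And>z r. (z, r) \<in> G \<Longrightarrow> r \<le> C * norm z" and C: "C \<ge> 0"
  shows "\<exists>G'. G \<subseteq> G' \<and> subspace G' \<and> (\<forall>z r. (z, r) \<in> G' \<longrightarrow> r \<le> C * norm z) \<and> y \<in> fst ` G'"
proof -
  define A where "A = (\<lambda>(z, r). r - C * norm (z - y)) ` G"
  \<comment> \<open>Lower bounds for a value at \<open>y\<close> stay below the upper bounds; the
    supremum \<open>a\<close> of the lower ones is then admissible.\<close>
  have ub: "r - C * norm (z - y) \<le> C * norm (z' + y) - r'" if "(z, r) \<in> G" "(z', r') \<in> G" for z r z' r'
  proof -
    have "(z + z', r + r') \<in> G" using subspace_add[OF G(1) that] by simp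
    then have "r + r' \<le> C * norm (z + z')" by (rule G(2))
    also have "z + z' = (z - y) + (z' + y)" by simp
    also have "C * norm \<dots> \<le> C * (norm (z - y) + norm (z' + y))"
      by (intro mult_left_mono norm_triangle_ineq C)
    finally show ?thesis by (simp add: algebra_simps)
  qed
  have G0: "(0, 0) \<in> G" using subspace_0[OF G(1)] by (simp add: zero_prod_def)
  then have ne: "A \<noteq> {}" unfolding A_def by blast
  have bdd: "bdd_above A" unfolding A_def bdd_above_def using ub[OF _ G0] by fastforce
  define a where "a = Sup A"
  have a1: "r - C * norm (z - y) \<le> a" if "(z, r) \<in> G" for z r
    unfolding a_def by (rule cSup_upper) (use that bdd in \<open>auto simp: A_def\<close>)
  have a2: "a \<le> C * norm (z + y) - r" if "(z, r) \<in> G" for z r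
    unfolding a_def by (rule cSup_least[OF ne]) (use ub that in \<open>auto simp: A_def\<close>)
  have sc: "((1/t) *\<^sub>R z, r / t) \<in> G" if "(z, r) \<in> G" for z r t
    using subspace_scale[OF G(1) that, of "1/t"] by simp
  have main: "r + t * a \<le> C * norm (z + t *\<^sub>R y)" if zr: "(z, r) \<in> G" for z r t
  proof -
    consider "t = 0" | "t > 0" | "t < 0" by linarith
    then show ?thesis
    proof cases
      case 1 then show ?thesis using G(2)[OF zr] by simp
    next
      case 2
      have "a \<le> C * norm ((1/t) *\<^sub>R z + y) - r / t" using a2[OF sc[OF zr]] .
      then have "t * a \<le> C * (t * norm ((1/t) *\<^sub>R z + y)) - r" using 2 by (simp add: field_simps)
      also have "t * norm ((1/t) *\<^sub>R z + y) = norm (t *\<^sub>R ((1/t) *\<^sub>R z + y))" using 2 by simp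
      also have "t *\<^sub>R ((1/t) *\<^sub>R z + y) = z + t *\<^sub>R y" using 2 by (simp add: scaleR_add_right)
      finally show ?thesis by simp
    next
      case 3
      define u where "u = - t"
      have u: "u > 0" "t = - u" using 3 by (auto simp: u_def)
      have "r / u - C * norm ((1/u) *\<^sub>R z - y) \<le> a" using a1[OF sc[OF zr]] .
      then have "u * (r / u - C * norm ((1/u) *\<^sub>R z - y)) \<le> u * a" using u by (intro mult_left_mono) auto
      then have "r - C * (u * norm ((1/u) *\<^sub>R z - y)) \<le> u * a" using u by (simp add: right_diff_distrib mult.left_commute)
      also have "u * norm ((1/u) *\<^sub>R z - y) = norm (u *\<^sub>R ((1/u) *\<^sub>R z - y))" using u by simp
      also have "u *\<^sub>R ((1/u) *\<^sub>R z - y) = z - u *\<^sub>R y" using u by (simp add: scaleR_diff_right)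
      finally show ?thesis using u by simp
    qed
  qed
  define G' where "G' = span (insert (y, a) G)"
  have "r \<le> C * norm z" if "(z, r) \<in> G'" for z r
  proof -
    obtain t where "(z, r) - t *\<^sub>R (y, a) \<in> span G" using \<open>(z, r) \<in> G'\<close> by (auto simp: G'_def span_insert)
    then have "(z - t *\<^sub>R y, r - t * a) \<in> G" using G(1) by (simp add: span_eq_iff[THEN iffD2])
    from main[OF this, of t] show ?thesis by simp
  qed
  moreover have "G \<subseteq> G'" "subspace G'" unfolding G'_def using span_superset[of "insert (y, a) G"] by auto
  moreover have "(y, a) \<in> G'" unfolding G'_def by (simp add: span_base)
  then have "y \<in> fst ` G'" by force
  ultimately show ?thesis by blast
qed

text \<open>On the span of \<open>x\<close> and \<open>S\<close>, reading off the coefficient of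
  \<open>x\<close> is bounded by the reciprocal of the distance from \<open>x\<close> to
  \<open>S\<close>. A maximal graph above this functional is defined everywhere.\<close>

lemma hahn_banach_separation:
  fixes S :: "'a::real_normed_vector set"
  assumes S: "subspace S" "closed S" and x: "x \<notin> S"
  obtains f :: "'a \<Rightarrow>\<^sub>L real" where "blinfun_apply f x = 1" "\<And>s. s \<in> S \<Longrightarrow> blinfun_apply f s = 0"
proof -
  obtain d where d: "d > 0" "\<And>t s. s \<in> S \<Longrightarrow> \<bar>t\<bar> * d \<le> norm (t *\<^sub>R x + s)"
    using subspace_dist_line[OF S x] by blast
  define C where "C = 1 / d"
  have C: "C \<ge> 0" using d(1) by (simp add: C_def)
  define G0 where "G0 = {(t *\<^sub>R x + s, t) | t s. s \<in> S}"
  have G0: "subspace G0"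
    unfolding subspace_def
  proof (intro conjI ballI allI)
    show "0 \<in> G0" unfolding G0_def zero_prod_def using subspace_0[OF S(1)] by force
    show "p + q \<in> G0" if pq: "p \<in> G0" "q \<in> G0" for p q
    proof -
      obtain t s t' s' where "p = (t *\<^sub>R x + s, t)" "s \<in> S" "q = (t' *\<^sub>R x + s', t')" "s' \<in> S"
        using pq by (auto simp: G0_def)
      then have "p + q = ((t + t') *\<^sub>R x + (s + s'), t + t')" "s + s' \<in> S"
        using subspace_add[OF S(1)] by (auto simp: algebra_simps)
      then show ?thesis unfolding G0_def by blast
    qed
    show "c *\<^sub>R p \<in> G0" if "p \<in> G0" for c p
    proof -
      obtain t s where "p = (t *\<^sub>R x + s, t)" "s \<in> S" using \<open>p \<in> G0\<close> by (auto simp: G0_def)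
      then have "c *\<^sub>R p = ((c * t) *\<^sub>R x + c *\<^sub>R s, c * t)" "c *\<^sub>R s \<in> S"
        using subspace_scale[OF S(1)] by (auto simp: algebra_simps)
      then show ?thesis unfolding G0_def by blast
    qed
  qed
  have G0b: "r \<le> C * norm z" if zr: "(z, r) \<in> G0" for z r
  proof -
    obtain s where s: "z = r *\<^sub>R x + s" "s \<in> S" using zr by (auto simp: G0_def)
    have "r * d \<le> \<bar>r\<bar> * d" using d(1) by (intro mult_right_mono) auto
    also have "\<dots> \<le> norm z" using d(2) s by simp
    finally show ?thesis using d(1) by (simp add: C_def field_simps)
  qed
  define \<A> where "\<A> = {G. G0 \<subseteq> G \<and> subspace G \<and> (\<forall>z r. (z, r) \<in> G \<longrightarrow> r \<le> C * norm z)}"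
  have "\<exists>M\<in>\<A>. \<forall>X\<in>\<A>. M \<subseteq> X \<longrightarrow> X = M"
  proof (rule subset_Zorn_nonempty)
    show "\<A> \<noteq> {}" using G0 G0b by (auto simp: \<A>_def)
    fix \<C> assume ne: "\<C> \<noteq> {}" and ch: "subset.chain \<A> \<C>"
    have sub: "\<And>G. G \<in> \<C> \<Longrightarrow> G0 \<subseteq> G \<and> subspace G \<and> (\<forall>z r. (z, r) \<in> G \<longrightarrow> r \<le> C * norm z)"
      using ch by (auto simp: subset.chain_def \<A>_def)
    have "subspace (\<Union>\<C>)"
      unfolding subspace_def
    proof (intro conjI ballI allI)
      obtain G where "G \<in> \<C>" using ne by blast
      then show "0 \<in> \<Union>\<C>" using sub[of G] subspace_0[of G] by auto
      show "p + q \<in> \<Union>\<C>" if pq: "p \<in> \<Union>\<C>" "q \<in> \<Union>\<C>" for p q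
      proof -
        obtain G H where GH: "G \<in> \<C>" "p \<in> G" "H \<in> \<C>" "q \<in> H" using pq by blast
        then have "G \<subseteq> H \<or> H \<subseteq> G" using ch by (auto simp: subset.chain_def)
        then show ?thesis
        proof
          assume "G \<subseteq> H"
          then have "p + q \<in> H" using GH sub[OF GH(3)] subspace_add[of H p q] by auto
          then show ?thesis using GH(3) by blast
        next
          assume "H \<subseteq> G"
          then have "p + q \<in> G" using GH sub[OF GH(1)] subspace_add[of G p q] by auto
          then show ?thesis using GH(1) by blast
        qed
      qed
      show "c *\<^sub>R p \<in> \<Union>\<C>" if p: "p \<in> \<Union>\<C>" for c p
      proof -
        obtain G where "G \<in> \<C>" "p \<in> G" using p by blast
        then show ?thesis using sub[of G] subspace_scale[of G p c] by auto
      qed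
    qed
    moreover have "G0 \<subseteq> \<Union>\<C>"
    proof -
      obtain G where "G \<in> \<C>" using ne by blast
      then show ?thesis using sub[of G] by (meson Union_upper order_trans)
    qed
    moreover have "r \<le> C * norm z" if "(z, r) \<in> \<Union>\<C>" for z r
      using that sub by (elim UnionE) simp
    ultimately show "\<Union>\<C> \<in> \<A>" by (simp add: \<A>_def)
  qed
  then obtain M where MA: "M \<in> \<A>" and max: "\<And>X. X \<in> \<A> \<Longrightarrow> M \<subseteq> X \<Longrightarrow> X = M" by auto
  have M: "G0 \<subseteq> M" "subspace M" "\<And>z r. (z, r) \<in> M \<Longrightarrow> r \<le> C * norm z"
    using MA by (simp_all add: \<A>_def)
  have dom: "\<exists>r. (y, r) \<in> M" for y
  proof -
    obtain G' where G': "M \<subseteq> G'" "subspace G'" "\<forall>z r. (z, r) \<in> G' \<longrightarrow> r \<le> C * norm z" "y \<in> fst ` G'"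
      using graph_extension_step[OF M(2) M(3) C, of y] by auto
    have "G' \<in> \<A>" using G'(2,3) order_trans[OF M(1) G'(1)] by (simp add: \<A>_def)
    then have "G' = M" using max G'(1) by blast
    then show ?thesis using G'(4) by force
  qed
  \<comment> \<open>The bound applies to \<open>(0, r - r')\<close> and to its negative.\<close>
  have uniq: "r = r'" if "(y, r) \<in> M" "(y, r') \<in> M" for y r r'
  proof -
    have "(0, r - r') \<in> M" "(0, r' - r) \<in> M"
      using subspace_diff[OF M(2) that] subspace_diff[OF M(2) that(2,1)] by auto
    then show ?thesis using M(3)[of 0 "r - r'"] M(3)[of 0 "r' - r"] by simp
  qed
  define f where "f y = (THE r. (y, r) \<in> M)" for y
  have f: "(y, f y) \<in> M" for y
    unfolding f_def by (rule theI') (metis dom uniq)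
  have feq: "f y = r" if "(y, r) \<in> M" for y r using uniq f that by blast
  have "bounded_linear f"
  proof (rule bounded_linear_intro[of _ C])
    show "f (y + z) = f y + f z" for y z
      by (rule feq) (use subspace_add[OF M(2) f f, of y z] in simp)
    show "f (t *\<^sub>R y) = t *\<^sub>R f y" for t y
      by (rule feq) (use subspace_scale[OF M(2) f, of t y] in simp)
    show "norm (f y) \<le> norm y * C" for y
      using M(3)[OF f, of y] M(3)[of "- y" "- f y"] subspace_neg[OF M(2) f, of y]
      by (simp add: abs_le_iff mult.commute)
  qed
  then have ap: "blinfun_apply (Blinfun f) = f" by (rule bounded_linear_Blinfun_apply)
  have "(x, 1) \<in> G0" unfolding G0_def using subspace_0[OF S(1)] by force
  moreover have "(s, 0) \<in> G0" if "s \<in> S" for s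
    unfolding G0_def using that by force
  ultimately have "f x = 1" "\<And>s. s \<in> S \<Longrightarrow> f s = 0" using subsetD[OF M(1)] by (auto intro!: feq)
  then show ?thesis using that[of "Blinfun f"] ap by simp
qed

text \<open>Each vector is separated from the closed span of the others. The functionals obtained
  serve as linear coordinates of the charts.\<close>

lemma dual_family:
  fixes e :: "nat \<Rightarrow> 'a::real_normed_vector"
  assumes "inj_on e {..<m}" "independent (e ` {..<m})"
  obtains \<pi> :: "nat \<Rightarrow> 'a \<Rightarrow>\<^sub>L real" where
    "\<And>i j. i < m \<Longrightarrow> j < m \<Longrightarrow> blinfun_apply (\<pi> i) (e j) = (if i = j then 1 else 0)"
proof -
  have "\<exists>f :: 'a \<Rightarrow>\<^sub>L real. \<forall>j<m. blinfun_apply f (e j) = (if i = j then 1 else 0)" if i: "i < m" for i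
  proof -
    have eq: "e ` ({..<m} - {i}) = e ` {..<m} - {e i}"
      using assms(1) i by (auto simp: inj_on_def)
    have "e i \<notin> span (e ` ({..<m} - {i}))"
      unfolding eq using assms(2) i by (auto simp: dependent_def)
    then obtain f :: "'a \<Rightarrow>\<^sub>L real" where f: "blinfun_apply f (e i) = 1"
      "\<And>s. s \<in> span (e ` ({..<m} - {i})) \<Longrightarrow> blinfun_apply f s = 0"
      using hahn_banach_separation[OF subspace_span closed_span_finite] by (metis finite_Diff finite_imageI finite_lessThan)
    show ?thesis
      by (rule exI[of _ f]) (use f in \<open>auto intro!: f(2) span_base\<close>)
  qed
  then show ?thesis using that by metis
qed


section \<open>Open mapping theorem on closed subspaces\<close>

text \<open>Baire category argument: the closures of the images of balls of \<open>D\<close> cover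
  the target, so one of them contains a ball. This gives approximate preimages only; the halved
  error is what the later iteration needs.\<close>

lemma open_mapping_approximation:
  fixes T :: "'w::real_normed_vector \<Rightarrow>\<^sub>L 'v::banach"
  assumes D: "subspace D" and onto: "blinfun_apply T ` D = UNIV"
  obtains k where "k > 0" "\<And>y. \<exists>w\<in>D. norm w \<le> k * norm y \<and> norm (y - blinfun_apply T w) \<le> norm y / 2"
proof -
  define A where "A n = closure (blinfun_apply T ` (D \<inter> cball 0 (real n)))" for n :: nat
  have cover: "(\<Union>n. A n) = UNIV"
  proof -
    have "v \<in> (\<Union>n. A n)" for v
    proof -
      obtain w where w: "w \<in> D" "v = blinfun_apply T w" using onto by blast
      obtain n :: nat where "norm w \<le> real n" using real_arch_simple by blast
      then have "v \<in> A n" unfolding A_def using w by (intro closure_subset[THEN subsetD]) auto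
      then show ?thesis by blast
    qed
    then show ?thesis by blast
  qed
  have "\<exists>n. interior (A n) \<noteq> {}"
  proof (rule ccontr)
    assume "\<not> ?thesis"
    then have "\<And>X. X \<in> range A \<Longrightarrow> closedin Met_TC.mtopology X \<and> Met_TC.mtopology interior_of X = {}"
      by (auto simp: A_def euclidean_interior_of)
    then have "Met_TC.mtopology interior_of (\<Union>(range A)) = {}"
      by (intro Met_TC.metric_Baire_category_alt) (auto simp: complete_UNIV)
    then show False using cover by (simp add: euclidean_interior_of)
  qed
  then obtain n v0 \<rho> where "\<rho> > 0" and ball: "ball v0 \<rho> \<subseteq> A n"
    by (metis ex_in_conv mem_interior)
  \<comment> \<open>Subtracting approximate preimages of \<open>v0\<close> and \<open>v0 + y\<close>
    moves the ball to the origin.\<close>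
  have near: "\<exists>w\<in>D. norm w \<le> 2 * real n \<and> norm (y - blinfun_apply T w) < e" if y: "norm y < \<rho>" and e: "e > 0" for y e
  proof -
    have "v0 \<in> A n" "v0 + y \<in> A n" using ball \<open>\<rho> > 0\<close> y by (auto simp: subset_iff dist_norm)
    have app: "\<exists>w\<in>D. norm w \<le> n \<and> dist (blinfun_apply T w) x < e/2" if "x \<in> A n" for x
    proof -
      have "\<exists>y\<in>blinfun_apply T ` (D \<inter> cball 0 (real n)). dist y x < e/2"
        using that half_gt_zero[OF e] unfolding A_def closure_approachable by presburger
      then show ?thesis by auto
    qed
    obtain w1 w2 where w: "w1 \<in> D" "norm w1 \<le> n" "dist (blinfun_apply T w1) v0 < e/2"
       "w2 \<in> D" "norm w2 \<le> n" "dist (blinfun_apply T w2) (v0 + y) < e/2"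
      using app[OF \<open>v0 \<in> A n\<close>] app[OF \<open>v0 + y \<in> A n\<close>] by auto
    have "norm (w2 - w1) \<le> 2 * real n" using norm_triangle_ineq4[of w2 w1] w by simp
    moreover have "y - blinfun_apply T (w2 - w1) = (v0 + y - blinfun_apply T w2) + (blinfun_apply T w1 - v0)"
      by (simp add: blinfun.diff_right)
    then have "norm (y - blinfun_apply T (w2 - w1)) \<le> norm (v0 + y - blinfun_apply T w2) + norm (blinfun_apply T w1 - v0)"
      by (metis norm_triangle_ineq)
    then have "norm (y - blinfun_apply T (w2 - w1)) < e" using w by (simp add: dist_norm norm_minus_commute)
    ultimately show ?thesis using subspace_diff[OF D w(4,1)] by blast
  qed
  \<comment> \<open>A vector \<open>y\<close> is scaled to length \<open>\<rho> / 2\<close>, matched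
    up to \<open>\<rho> / 4\<close> and scaled back by \<open>2 * norm y / \<rho>\<close>;
    \<open>n + 1\<close> in place of \<open>n\<close> keeps \<open>k\<close> positive.\<close>
  define k where "k = 4 * (real n + 1) / \<rho>"
  have "\<exists>w\<in>D. norm w \<le> k * norm y \<and> norm (y - blinfun_apply T w) \<le> norm y / 2" for y
  proof (cases "y = 0")
    case True
    then show ?thesis using subspace_0[OF D] by (intro bexI[of _ 0]) auto
  next
    case False
    define s where "s = \<rho> / (2 * norm y)"
    have s: "s > 0" using False \<open>\<rho> > 0\<close> by (simp add: s_def)
    have "norm (s *\<^sub>R y) < \<rho>" using False \<open>\<rho> > 0\<close> by (simp add: s_def)
    then obtain w where w: "w \<in> D" "norm w \<le> 2 * real n" "norm (s *\<^sub>R y - blinfun_apply T w) < \<rho> / 4"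
      using near[of "s *\<^sub>R y" "\<rho>/4"] \<open>\<rho> > 0\<close> by auto
    have sy: "inverse s = 2 * norm y / \<rho>" by (simp add: s_def)
    have "norm (inverse s *\<^sub>R w) = inverse s * norm w" using s by simp
    also have "\<dots> \<le> inverse s * (2 * (real n + 1))" using s w by (intro mult_left_mono) auto
    also have "\<dots> = k * norm y" unfolding sy k_def by simp
    finally have 1: "norm (inverse s *\<^sub>R w) \<le> k * norm y" .
    have "y - blinfun_apply T (inverse s *\<^sub>R w) = inverse s *\<^sub>R (s *\<^sub>R y - blinfun_apply T w)"
      using s by (simp add: blinfun.scaleR_right algebra_simps)
    then have "norm (y - blinfun_apply T (inverse s *\<^sub>R w)) = inverse s * norm (s *\<^sub>R y - blinfun_apply T w)"
      using s by simp
    also have "\<dots> \<le> inverse s * (\<rho> / 4)" using s w by (intro mult_left_mono) auto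
    also have "\<dots> = norm y / 2" unfolding sy using \<open>\<rho> > 0\<close> by simp
    finally show ?thesis using 1 subspace_scale[OF D w(1)] by blast
  qed
  moreover have "k > 0" using \<open>\<rho> > 0\<close> by (simp add: k_def)
  ultimately show ?thesis using that by blast
qed

text \<open>The residuals are halved in each round, so the corrections form a geometrically
  convergent series, and closedness keeps its sum in \<open>D\<close>. A subspace is allowed as
  domain because solvability modulo a finite-dimensional space is later treated as surjectivity of
  \<open>(x, b) \<mapsto> T x + b\<close>.\<close>

lemma open_mapping_closed_subspace:
  fixes T :: "'w::banach \<Rightarrow>\<^sub>L 'v::banach"
  assumes D: "subspace D" "closed D" and onto: "blinfun_apply T ` D = UNIV"
  obtains C where "C > 0" "\<And>v. \<exists>w\<in>D. blinfun_apply T w = v \<and> norm w \<le> C * norm v"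
proof -
  obtain k where "k > 0" and k: "\<And>y. \<exists>w\<in>D. norm w \<le> k * norm y \<and> norm (y - blinfun_apply T w) \<le> norm y / 2"
    using open_mapping_approximation[OF D(1) onto] by blast
  then obtain W where W: "\<And>y. W y \<in> D" "\<And>y. norm (W y) \<le> k * norm y"
    "\<And>y. norm (y - blinfun_apply T (W y)) \<le> norm y / 2" by metis
  have "\<exists>w\<in>D. blinfun_apply T w = v \<and> norm w \<le> 2 * k * norm v" for v
  proof -
    define y where "y n = ((\<lambda>y. y - blinfun_apply T (W y)) ^^ n) v" for n
    have y0: "y 0 = v" and ySuc: "\<And>n. y (Suc n) = y n - blinfun_apply T (W (y n))"
      by (simp_all add: y_def)
    have yb: "norm (y n) \<le> norm v * (1/2)^n" for n
    proof (induction n)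
      case (Suc n)
      then show ?case using W(3)[of "y n"] by (simp add: ySuc)
    qed (simp add: y0)
    have wb: "norm (W (y n)) \<le> k * norm v * (1/2)^n" for n
      using W(2)[of "y n"] mult_left_mono[OF yb[of n], of k] \<open>k > 0\<close> by linarith
    have gs: "(\<lambda>n. k * norm v * (1/2)^n) sums (k * norm v * 2)"
      using sums_mult[OF geometric_sums[of "1/2::real"], of "k * norm v"] by simp
    have sumW: "summable (\<lambda>n. W (y n))"
      by (rule summable_comparison_test'[OF sums_summable[OF gs], of 0]) (use wb in auto)
    define w where "w = suminf (\<lambda>n. W (y n))"
    have ws: "(\<lambda>n. \<Sum>i<n. W (y i)) \<longlonglongrightarrow> w"
      unfolding w_def using sumW by (simp add: summable_LIMSEQ)
    have "w \<in> D"
      by (rule closed_sequentially[OF D(2) _ ws]) (intro subspace_sum D W(1))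
    have Ts: "blinfun_apply T (\<Sum>i<n. W (y i)) = v - y n" for n
      by (induction n) (auto simp: y0 ySuc blinfun.add_right)
    have "y \<longlonglongrightarrow> 0"
    proof (rule Lim_null_comparison)
      show "\<forall>\<^sub>F n in sequentially. norm (y n) \<le> norm v * (1/2)^n" using yb by simp
      show "(\<lambda>n. norm v * (1/2)^n) \<longlonglongrightarrow> 0"
        by (intro tendsto_mult_right_zero LIMSEQ_power_zero) simp
    qed
    then have "(\<lambda>n. v - y n) \<longlonglongrightarrow> v - 0" by (intro tendsto_intros)
    moreover have "(\<lambda>n. v - y n) \<longlonglongrightarrow> blinfun_apply T w"
      using blinfun.tendsto[OF tendsto_const[of T] ws] by (simp add: Ts)
    ultimately have "blinfun_apply T w = v" using LIMSEQ_unique by fastforce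
    moreover have "norm w \<le> k * norm v * 2"
    proof (rule Lim_bounded[OF tendsto_norm[OF ws]])
      show "\<forall>n\<ge>0. norm (\<Sum>i<n. W (y i)) \<le> k * norm v * 2"
      proof (intro allI impI)
        fix n
        have "norm (\<Sum>i<n. W (y i)) \<le> (\<Sum>i<n. k * norm v * (1/2)^i)"
          by (intro sum_norm_le wb)
        also have "\<dots> \<le> suminf (\<lambda>i. k * norm v * (1/2)^i)"
          by (rule sum_le_suminf[OF sums_summable[OF gs]]) (use \<open>k > 0\<close> in auto)
        also have "\<dots> = k * norm v * 2" using gs by (rule sums_unique[symmetric])
        finally show "norm (\<Sum>i<n. W (y i)) \<le> k * norm v * 2" .
      qed
    qed
    ultimately show ?thesis using \<open>w \<in> D\<close> by (intro bexI[of _ w]) (auto simp: mult_ac)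
  qed
  then show ?thesis using that[of "2 * k"] \<open>k > 0\<close> by simp
qed

section \<open>Codimension and the effect of index zero\<close>

lemma complement_projection:
  fixes R :: "'v::real_vector set"
  assumes R: "subspace R" and B: "subspace S" and RS: "R \<inter> S = {0}" and all: "\<And>v. \<exists>b\<in>S. v - b \<in> R"
  obtains \<phi> where "linear \<phi>" "\<And>r. r \<in> R \<Longrightarrow> \<phi> r = 0" "\<And>b. b \<in> S \<Longrightarrow> \<phi> b = b" "\<And>v. \<phi> v \<in> S" "\<And>v. v - \<phi> v \<in> R"
proof -
  obtain \<phi> where \<phi>: "\<And>v. \<phi> v \<in> S" "\<And>v. v - \<phi> v \<in> R" using all by metis
  have uniq: "\<phi> v = b" if "b \<in> S" "v - b \<in> R" for v b
  proof -
    have "\<phi> v - b \<in> S" using subspace_diff[OF B \<phi>(1) that(1)] .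
    moreover have "\<phi> v - b \<in> R" using subspace_diff[OF R that(2) \<phi>(2)[of v]] by simp
    ultimately have "\<phi> v - b \<in> {0}" unfolding RS[symmetric] by (rule IntI[rotated])
    then show ?thesis by simp
  qed
  have "linear \<phi>"
  proof
    show "\<phi> (v + w) = \<phi> v + \<phi> w" for v w
      by (rule uniq) (use subspace_add[OF B \<phi>(1) \<phi>(1)] subspace_add[OF R \<phi>(2) \<phi>(2), of v w] in \<open>auto simp: algebra_simps\<close>)
    show "\<phi> (t *\<^sub>R v) = t *\<^sub>R \<phi> v" for t v
      by (rule uniq) (use subspace_scale[OF B \<phi>(1)] subspace_scale[OF R \<phi>(2), of t v] in \<open>auto simp: algebra_simps\<close>)
  qed
  moreover have "\<phi> r = 0" if "r \<in> R" for r by (rule uniq) (use that subspace_0[OF B] in auto)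
  moreover have "\<phi> b = b" if "b \<in> S" for b by (rule uniq) (use that subspace_0[OF R] in auto)
  ultimately show ?thesis using \<phi> that by blast
qed

text \<open>\<open>codim\<close> is a least cardinality. Minimality holds because the projection
  along \<open>R\<close> maps any competitor \<open>C\<close> to a set whose span contains
  \<open>B\<close>, and such a set is at least as large as the independent \<open>B\<close>.\<close>

lemma codim_eq_card_complement:
  fixes R :: "'v::real_vector set"
  assumes R: "subspace R" and B: "finite B" "independent B" and RB: "R \<inter> span B = {0}"
    and all: "\<And>v. \<exists>b\<in>span B. v - b \<in> R"
  shows "codim R = card B"
  unfolding codim_def
proof (rule Least_equality)
  have "v \<in> span (R \<union> B)" for v
  proof -
    obtain b where "b \<in> span B" "v - b \<in> R" using all by blast
    then have "b \<in> span (R \<union> B)" "v - b \<in> span (R \<union> B)"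
      using span_mono[of B "R \<union> B"] by (auto intro: span_base)
    from span_add[OF this] show ?thesis by simp
  qed
  then show "\<exists>C. finite C \<and> card C = card B \<and> span (R \<union> C) = UNIV" using B(1) by auto
next
  fix n assume "\<exists>C. finite C \<and> card C = n \<and> span (R \<union> C) = UNIV"
  then obtain C where C: "finite C" "card C = n" "span (R \<union> C) = UNIV" by blast
  obtain \<phi> where \<phi>: "linear \<phi>" "\<And>r. r \<in> R \<Longrightarrow> \<phi> r = 0" "\<And>b. b \<in> span B \<Longrightarrow> \<phi> b = b"
    using complement_projection[OF R subspace_span RB all] by metis
  have "\<phi> ` (R \<union> C) \<subseteq> insert 0 (\<phi> ` C)" using \<phi>(2) by auto
  then have "span (\<phi> ` (R \<union> C)) \<subseteq> span (\<phi> ` C)" using span_mono span_insert_0 by metis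
  moreover have "B \<subseteq> span (\<phi> ` (R \<union> C))"
    using linear_span_image[OF \<phi>(1), of "R \<union> C"] C(3) \<phi>(3) by (metis UNIV_I image_eqI span_base subsetI)
  ultimately have "card B \<le> card (\<phi> ` C)"
    using independent_span_bound[OF _ B(2), of "\<phi> ` C"] C(1) by auto
  also have "\<dots> \<le> n" using card_image_le[OF C(1), of \<phi>] C(2) by simp
  finally show "card B \<le> n" .
qed

text \<open>Index zero makes the count work: in a basis of \<open>span B\<close> adapted to the
  range, the vectors in the range are lifted, and the number of the others is the codimension, hence
  the dimension of the kernel. Preimages of such finite-dimensional spaces keep their
  dimension.\<close>

lemma Fredholm0_preimage_basis:
  fixes T :: "'u::real_normed_vector \<Rightarrow>\<^sub>L 'v::real_normed_vector"
  assumes T: "T \<in> Fredholm0" and B: "finite B" "independent B"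
    and onto: "\<And>v. \<exists>x. v - blinfun_apply T x \<in> span B"
  obtains E where "finite E" "independent E" "card E = card B" "{x. blinfun_apply T x \<in> span B} = span E"
proof -
  let ?T = "blinfun_apply T" and ?R = "range (blinfun_apply T)" and ?K = "null_space T"
  have lin: "linear ?T" by (simp add: blinfun.bounded_linear_right bounded_linear.linear)
  have R: "subspace ?R" using linear_subspace_image[OF lin subspace_UNIV] .
  have K: "subspace ?K" unfolding null_space_def using linear_subspace_vimage[OF lin subspace_single_0] by (simp add: vimage_def)
  obtain E0 where E0: "E0 \<subseteq> ?K" "independent E0" "?K \<subseteq> span E0" "card E0 = dim ?K"
    using basis_exists[of ?K] by blast
  have K_eq: "?K = span E0" using E0(1,3) span_minimal[OF E0(1) K] by blast
  obtain F0 where "finite F0" "?K \<subseteq> span F0"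
    using T by (auto simp: Fredholm0_def fredholm_def finite_dim_def)
  then have fE0: "finite E0" using E0(1,2) independent_span_bound by blast
  obtain B0 where B0: "B0 \<subseteq> ?R \<inter> span B" "independent B0" "?R \<inter> span B \<subseteq> span B0" "card B0 = dim (?R \<inter> span B)"
    by (rule basis_exists[of "?R \<inter> span B"]) (rule that)
  have fB0: "finite B0" using B0 B(1) independent_span_bound by blast
  \<comment> \<open>\<open>B\<close> itself need not be adapted to the range; \<open>B2\<close> is
    another basis of the same span, extending a basis \<open>B0\<close> of the part inside the
    range.\<close>
  obtain B2 where B2: "B0 \<subseteq> B2" "B2 \<subseteq> span B" "independent B2" "span B \<subseteq> span B2"
    using maximal_independent_subset_extend[of B0 "span B"] B0 by (metis Int_subset_iff)
  have fB2: "finite B2" using B2 B(1) independent_span_bound by blast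
  have sB2: "span B2 = span B" using B2(4) span_minimal[OF B2(2) subspace_span] by (rule subset_antisym[rotated])
  have cB2: "card B2 = card B"
    using B2 B fB2 independent_span_bound[OF B(1) B2(3)] independent_span_bound[OF fB2 B(2)] span_superset[of B] by auto
  define B1 where "B1 = B2 - B0"
  have B1: "finite B1" "independent B1" using fB2 independent_mono[OF B2(3), of B1] by (auto simp: B1_def)
  have BB: "B2 = B0 \<union> B1" "B0 \<inter> B1 = {}" using B2 by (auto simp: B1_def)
  have sB0: "span B0 = ?R \<inter> span B"
    using B0 R by (simp add: span_minimal subset_antisym subspace_inter)
  have int0: "span B0 \<inter> span B1 = {0}"
  proof -
    have "x = 0" if x: "x \<in> span B0" "x \<in> span B1" for x
    proof -
      obtain c where c: "x = (\<Sum>b\<in>B0. c b *\<^sub>R b)" using x(1) span_finite[OF fB0] by auto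
      obtain d where d: "x = (\<Sum>b\<in>B1. d b *\<^sub>R b)" using x(2) span_finite[OF B1(1)] by auto
      have "(\<Sum>b\<in>B2. (if b \<in> B0 then c b else - d b) *\<^sub>R b) = x - x"
        unfolding BB(1) sum.union_disjoint[OF fB0 B1(1) BB(2)]
      proof (subst diff_conv_add_uminus, rule arg_cong2[where f = "(+)"])
        show "(\<Sum>b\<in>B0. (if b \<in> B0 then c b else - d b) *\<^sub>R b) = x" by (simp add: c)
        show "(\<Sum>b\<in>B1. (if b \<in> B0 then c b else - d b) *\<^sub>R b) = - x"
          using BB(2) unfolding d sum_negf[symmetric] by (intro sum.cong) auto
      qed
      then have "\<forall>b\<in>B2. (if b \<in> B0 then c b else - d b) = 0"
        using independentD[OF B2(3) fB2 subset_refl, of "\<lambda>b. if b \<in> B0 then c b else - d b"] by auto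
      then have "\<forall>b\<in>B0. c b = 0" unfolding BB(1) by (metis UnCI)
      then show ?thesis by (simp add: c)
    qed
    then show ?thesis by (auto simp: span_zero)
  qed
  have "codim ?R = card B1"
  proof (rule codim_eq_card_complement[OF R B1])
    have "span B1 \<subseteq> span B" using sB2 span_mono[of B1 B2] by (auto simp: B1_def)
    then show "?R \<inter> span B1 = {0}" using int0 sB0 by (auto simp: span_zero)
    show "\<exists>b\<in>span B1. v - b \<in> ?R" for v
    proof -
      obtain x where "v - ?T x \<in> span B" using onto by blast
      then have "v - ?T x \<in> span (B0 \<union> B1)" using sB2 BB by simp
      then obtain b0 b1 where b: "b0 \<in> span B0" "b1 \<in> span B1" "v - ?T x = b0 + b1"
        by (auto simp: span_Un)
      have "?T x + b0 \<in> ?R" using b(1) sB0 by (intro subspace_add[OF R]) auto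
      then have "v - b1 \<in> ?R" using b(3) by (simp add: algebra_simps)
      then show ?thesis using b(2) by blast
    qed
  qed
  moreover have "dim ?K = codim ?R" using T by (simp add: Fredholm0_def fredholm_index_def)
  ultimately have cE0: "card E0 = card B1" using E0(4) by simp
  have "\<forall>b\<in>B0. \<exists>x. ?T x = b" using B0(1) by blast
  then obtain s where s: "\<And>b. b \<in> B0 \<Longrightarrow> ?T (s b) = b" by metis
  have sinj: "inj_on s B0" using s by (metis inj_onI)
  have dis: "E0 \<inter> s ` B0 = {}"
  proof -
    have "b = 0" if "b \<in> B0" "s b \<in> E0" for b
      using that s E0(1) by (auto simp: null_space_def)
    then show ?thesis using B0(2) dependent_zero by blast
  qed
  define E where "E = E0 \<union> s ` B0"
  have fE: "finite E" using fE0 fB0 by (simp add: E_def)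
  have ind: "independent E"
  proof -
    have "\<forall>x\<in>E. u x = 0" if u: "(\<Sum>x\<in>E. u x *\<^sub>R x) = 0" for u
    proof -
      have eq: "(\<Sum>x\<in>E0. u x *\<^sub>R x) + (\<Sum>b\<in>B0. u (s b) *\<^sub>R s b) = 0"
        using u fE0 fB0 dis by (simp add: E_def sum.union_disjoint sum.reindex[OF sinj])
      have "?T (\<Sum>x\<in>E0. u x *\<^sub>R x) = 0"
        using K_eq span_sum[of E0 "\<lambda>x. u x *\<^sub>R x" E0] by (force simp: null_space_def intro: span_scale span_base)
      moreover have "?T (\<Sum>b\<in>B0. u (s b) *\<^sub>R s b) = (\<Sum>b\<in>B0. u (s b) *\<^sub>R b)"
        by (simp add: blinfun.sum_right blinfun.scaleR_right s)
      ultimately have "(\<Sum>b\<in>B0. u (s b) *\<^sub>R b) = 0"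
        using arg_cong[OF eq, of ?T] by (simp add: blinfun.add_right)
      then have 0: "\<forall>b\<in>B0. u (s b) = 0" using B0(2) dependent_finite[OF fB0] by (auto dest!: spec[of _ "\<lambda>b. u (s b)"])
      then have "(\<Sum>x\<in>E0. u x *\<^sub>R x) = 0" using eq by simp
      then have "\<forall>x\<in>E0. u x = 0" using E0(2) dependent_finite[OF fE0] by auto
      then show ?thesis using 0 by (auto simp: E_def)
    qed
    then show ?thesis using fE by (auto simp: dependent_finite)
  qed
  have cE: "card E = card B"
    using dis fE0 fB0 fB2 BB cB2 cE0 sinj by (simp add: E_def card_Un_disjoint card_image B1(1))
  have "{x. ?T x \<in> span B} = span E"
  proof
    have sub: "subspace {x. ?T x \<in> span B}" using linear_subspace_vimage[OF lin subspace_span, of B] by (simp add: vimage_def)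
    have "E \<subseteq> {x. ?T x \<in> span B}"
      using E0(1) s B0(1) by (auto simp: E_def null_space_def span_zero)
    then show "span E \<subseteq> {x. ?T x \<in> span B}" using sub by (rule span_minimal)
    show "{x. ?T x \<in> span B} \<subseteq> span E"
    proof safe
      fix x assume "?T x \<in> span B"
      then have "?T x \<in> span B0" using sB0 by blast
      then obtain c where c: "?T x = (\<Sum>b\<in>B0. c b *\<^sub>R b)" using span_finite[OF fB0] by auto
      let ?y = "\<Sum>b\<in>B0. c b *\<^sub>R s b"
      have "?T (x - ?y) = 0" by (simp add: blinfun.diff_right blinfun.sum_right blinfun.scaleR_right s c)
      then have "x - ?y \<in> span E0" using K_eq by (auto simp: null_space_def)
      then have "x - ?y \<in> span E" using span_mono[of E0 E] by (auto simp: E_def)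
      moreover have "?y \<in> span E" by (intro span_sum span_scale span_base) (auto simp: E_def)
      ultimately show "x \<in> span E" using span_add by fastforce
    qed
  qed
  then show ?thesis using that fE ind cE by blast
qed


section \<open>Generic rays through a simplex\<close>

text \<open>Independence of the indexed family and not of its image: equal values at two indices
  count as a dependence.\<close>

definition fam_indep :: "('k \<Rightarrow> 'w::real_vector) \<Rightarrow> 'k set \<Rightarrow> bool" where
  "fam_indep v t \<longleftrightarrow> (\<forall>c. (\<Sum>k\<in>t. c k *\<^sub>R v k) = 0 \<longrightarrow> (\<forall>k\<in>t. c k = 0))"

text \<open>With values \<open>v\<close> at the vertices, this says that the affine map on the
  simplex \<open>s\<close> has a zero.\<close>

definition conv0 :: "('k \<Rightarrow> 'w::real_vector) \<Rightarrow> 'k set \<Rightarrow> bool" where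
  "conv0 v s \<longleftrightarrow> (\<exists>a. (\<forall>k\<in>s. 0 \<le> a k) \<and> sum a s = 1 \<and> (\<Sum>k\<in>s. a k *\<^sub>R v k) = 0)"

text \<open>For nonzero \<open>d\<close> this says that the ray in direction \<open>d\<close> meets
  the convex hull of the values on \<open>f\<close>.\<close>

definition cone_hit :: "('k \<Rightarrow> 'w::real_vector) \<Rightarrow> 'w \<Rightarrow> 'k set \<Rightarrow> bool" where
  "cone_hit v d f \<longleftrightarrow> (\<exists>a. (\<forall>k\<in>f. 0 \<le> a k) \<and> (\<Sum>k\<in>f. a k *\<^sub>R v k) = d)"

lemma fam_indepD: "fam_indep v t \<Longrightarrow> (\<Sum>k\<in>t. c k *\<^sub>R v k) = 0 \<Longrightarrow> k \<in> t \<Longrightarrow> c k = 0"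
  by (auto simp: fam_indep_def)

lemma fam_indep_inj:
  assumes "fam_indep v t" "finite t"
  shows "inj_on v t"
proof (rule inj_onI, rule ccontr)
  fix x y assume xy: "x \<in> t" "y \<in> t" "v x = v y" "x \<noteq> y"
  define c where "c = (\<lambda>k. if k = x then 1 else if k = y then - 1 else (0::real))"
  have "(\<Sum>k\<in>t. c k *\<^sub>R v k) = (\<Sum>k\<in>{x, y}. c k *\<^sub>R v k)"
    using xy assms(2) by (intro sum.mono_neutral_right) (auto simp: c_def)
  also have "\<dots> = 0" using xy by (simp add: c_def)
  finally have "c x = 0" using fam_indepD[OF assms(1)] xy by blast
  then show False by (simp add: c_def)
qed

lemma fam_indep_independent:
  assumes "fam_indep v t" "finite t"
  shows "independent (v ` t)"
proof -
  have "\<forall>x\<in>v ` t. u x = 0" if "(\<Sum>x\<in>v ` t. u x *\<^sub>R x) = 0" for u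
  proof -
    have "(\<Sum>k\<in>t. u (v k) *\<^sub>R v k) = 0"
      using that by (simp add: sum.reindex[OF fam_indep_inj[OF assms]])
    then show ?thesis using fam_indepD[OF assms(1), of "\<lambda>k. u (v k)"] by auto
  qed
  then show ?thesis using assms(2) by (auto simp: dependent_finite)
qed

lemma fam_relation:
  assumes "finite s" "finite B" "card B < card s" "v ` s \<subseteq> span B"
  obtains c where "(\<Sum>k\<in>s. c k *\<^sub>R v k) = 0" "\<exists>k\<in>s. c k \<noteq> 0"
proof -
  have "\<not> fam_indep v s"
  proof
    assume f: "fam_indep v s"
    then have "card (v ` s) \<le> card B"
      using independent_span_bound[OF assms(2) fam_indep_independent[OF f assms(1)] assms(4)] by simp
    then show False using card_image[OF fam_indep_inj[OF f assms(1)]] assms(3) by simp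
  qed
  then show ?thesis using that unfolding fam_indep_def by blast
qed

lemma fam_spans:
  assumes "finite t" "finite B" "card B \<le> card t" "v ` t \<subseteq> span B" "fam_indep v t" "d \<in> span B"
  obtains a where "(\<Sum>k\<in>t. a k *\<^sub>R v k) = d"
proof -
  have inj: "inj_on v t" and ind: "independent (v ` t)"
    using fam_indep_inj fam_indep_independent assms by auto
  have "d \<in> span (v ` t)"
  proof (rule ccontr)
    assume d: "d \<notin> span (v ` t)"
    then have "independent (insert d (v ` t))" using ind by (simp add: independent_insert)
    then have "card (insert d (v ` t)) \<le> card B"
      using independent_span_bound[OF assms(2)] assms(4,6) by blast
    moreover have "d \<notin> v ` t" using d span_superset[of "v ` t"] by auto
    ultimately show False using assms(1,3) card_image[OF inj] by simp
  qed
  then obtain u where "d = (\<Sum>x\<in>v ` t. u x *\<^sub>R x)" using span_finite[of "v ` t"] assms(1) by auto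
  then have "(\<Sum>k\<in>t. u (v k) *\<^sub>R v k) = d" by (simp add: sum.reindex[OF inj])
  then show ?thesis using that[of "\<lambda>k. u (v k)"] by simp
qed

lemma card_argmax:
  fixes t :: "'k \<Rightarrow> 'b::linorder"
  assumes "finite P" "P \<noteq> {}" "inj_on t P"
  shows "\<exists>p\<in>P. {k\<in>P. \<forall>i\<in>P. t i \<le> t k} = {p}"
proof -
  have "Max (t ` P) \<in> t ` P" using assms by (intro Max_in) auto
  then obtain p where p: "p \<in> P" "t p = Max (t ` P)" by (metis imageE)
  have le: "t i \<le> t p" if "i \<in> P" for i using that p assms by simp
  have eq: "x = p" if "x \<in> P" "\<forall>i\<in>P. t i \<le> t x" for x
    using inj_onD[OF assms(3) _ that(1) p(1)] that le[of x] p(1) by (simp add: antisym)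
  have "{k\<in>P. \<forall>i\<in>P. t i \<le> t k} = {p}"
  proof
    show "{k\<in>P. \<forall>i\<in>P. t i \<le> t k} \<subseteq> {p}"
    proof
      fix x assume "x \<in> {k\<in>P. \<forall>i\<in>P. t i \<le> t k}"
      then have "x = p" by (intro eq) simp_all
      then show "x \<in> {p}" by simp
    qed
    show "{p} \<subseteq> {k\<in>P. \<forall>i\<in>P. t i \<le> t k}" using p(1) le by simp
  qed
  then show ?thesis using p(1) by (rule bexI)
qed

text \<open>The numbers between all \<open>t i\<close> with \<open>i\<close> in \<open>P\<close> and
  all \<open>t i\<close> with \<open>i\<close> in \<open>Q\<close> form an interval, and
  \<open>X\<close> collects its endpoints: one for a half-line, otherwise two or none, since
  injectivity excludes an interval that is a single point.\<close>

lemma interval_endpoint_count: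
  fixes t :: "'k \<Rightarrow> real"
  assumes fin: "finite P" "finite Q" and PQ: "P \<inter> Q = {}" and inj: "inj_on t (P \<union> Q)"
  defines "X \<equiv> {k \<in> P \<union> Q. (\<forall>i\<in>P. t i \<le> t k) \<and> (\<forall>i\<in>Q. t k \<le> t i)}"
  shows "P \<noteq> {} \<Longrightarrow> Q = {} \<Longrightarrow> card X = 1" "P = {} \<Longrightarrow> Q \<noteq> {} \<Longrightarrow> card X = 1"
    "P \<noteq> {} \<Longrightarrow> Q \<noteq> {} \<Longrightarrow> card X = 0 \<or> card X = 2"
proof -
  have injP: "inj_on t P" and injQ: "inj_on (\<lambda>k. - t k) Q" using inj by (auto simp: inj_on_def)
  show "card X = 1" if ne: "P \<noteq> {}" "Q = {}"
  proof -
    obtain p where "{k\<in>P. \<forall>i\<in>P. t i \<le> t k} = {p}" using card_argmax[OF fin(1) ne(1) injP] by (elim bexE) (rule that)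
    then have "X = {p}" using ne by (simp add: X_def)
    then show ?thesis by simp
  qed
  show "card X = 1" if ne: "P = {}" "Q \<noteq> {}"
  proof -
    obtain q where "{k\<in>Q. \<forall>i\<in>Q. - t i \<le> - t k} = {q}" using card_argmax[OF fin(2) ne(2) injQ] by (elim bexE) (rule that)
    then have "X = {q}" using ne by (simp add: X_def)
    then show ?thesis by simp
  qed
  show "card X = 0 \<or> card X = 2" if ne: "P \<noteq> {}" "Q \<noteq> {}"
  proof -
    obtain p where p: "p \<in> P" "{k\<in>P. \<forall>i\<in>P. t i \<le> t k} = {p}" using card_argmax[OF fin(1) ne(1) injP] by (elim bexE) (rule that)
    obtain q where q: "q \<in> Q" "{k\<in>Q. \<forall>i\<in>Q. - t i \<le> - t k} = {q}" using card_argmax[OF fin(2) ne(2) injQ] by (elim bexE) (rule that)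
    have p': "\<And>i. i \<in> P \<Longrightarrow> t i \<le> t p" and q': "\<And>i. i \<in> Q \<Longrightarrow> t q \<le> t i" using p q by auto
    have pq: "p \<noteq> q" "t p \<noteq> t q" using p q PQ inj by (auto simp: inj_on_def)
    have sub: "X \<subseteq> {p, q}"
    proof
      fix k assume k: "k \<in> X"
      then consider "k \<in> P" | "k \<in> Q" by (auto simp: X_def)
      then show "k \<in> {p, q}"
      proof cases
        case 1
        then have "k \<in> {k\<in>P. \<forall>i\<in>P. t i \<le> t k}" using k by (auto simp: X_def)
        then show ?thesis using p(2) by blast
      next
        case 2
        then have "k \<in> {k\<in>Q. \<forall>i\<in>Q. - t i \<le> - t k}" using k by (auto simp: X_def)
        then show ?thesis using q(2) by blast
      qed
    qed
    show ?thesis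
    proof (cases "t p < t q")
      case True
      have "p \<in> X" unfolding X_def using p(1) p' q' True by fastforce
      moreover have "q \<in> X" unfolding X_def using q(1) p' q' True by fastforce
      ultimately have "X = {p, q}" using sub by auto
      then show ?thesis using pq(1) by simp
    next
      case False
      then have lt: "t q < t p" using pq by auto
      have "p \<notin> X" "q \<notin> X" using lt p(1) q(1) unfolding X_def by fastforce+
      then have "X = {}" using sub by auto
      then show ?thesis by simp
    qed
  qed
qed

text \<open>
  Ray shooting: a generic ray from the origin leaves a simplex through exactly one facet if the
  origin lies inside, and otherwise meets none or two facets. The representations of a point of the
  ray by the vertices form a line \<open>a + \<tau> c\<close>, and its feasible part is an interval.
\<close>

lemma facet_count:
  fixes v :: "'k \<Rightarrow> 'w::real_vector"
  assumes fs: "finite s" and cs: "card s = Suc m" and B: "finite B" "card B = m" and vB: "v ` s \<subseteq> span B"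
    and ind: "\<And>t. t \<subset> s \<Longrightarrow> fam_indep v t"
    and d: "d \<in> span B" and gen: "\<And>t. t \<subseteq> s \<Longrightarrow> card t < m \<Longrightarrow> d \<notin> span (v ` t)"
  shows "conv0 v s \<Longrightarrow> card {k\<in>s. cone_hit v d (s - {k})} = 1"
    and "\<not> conv0 v s \<Longrightarrow> card {k\<in>s. cone_hit v d (s - {k})} = 0 \<or> card {k\<in>s. cone_hit v d (s - {k})} = 2"
proof -
  obtain c where c: "(\<Sum>k\<in>s. c k *\<^sub>R v k) = 0" "\<exists>k\<in>s. c k \<noteq> 0"
    using fam_relation[OF fs B(1) _ vB] B(2) cs by auto
  \<comment> \<open>Dropping one vertex leaves an independent family, so a relation that vanishes at
    one index vanishes altogether. Hence \<open>c\<close> has no zero entry and every relation is a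
    multiple of it.\<close>
  have van: "\<forall>k\<in>s. b k = 0" if b: "(\<Sum>k\<in>s. b k *\<^sub>R v k) = 0" "k0 \<in> s" "b k0 = 0" for b k0
  proof -
    have "(\<Sum>k\<in>s - {k0}. b k *\<^sub>R v k) = 0" using b fs by (simp add: sum.remove)
    moreover have "fam_indep v (s - {k0})" using b(2) by (intro ind) auto
    ultimately have "b k = 0" if "k \<in> s - {k0}" for k using fam_indepD[of v "s - {k0}" b k] that by simp
    then show ?thesis using b(3) by auto
  qed
  have cnz: "c k \<noteq> 0" if "k \<in> s" for k using van[OF c(1) that] c(2) by blast
  obtain k0 where k0: "k0 \<in> s" using c(2) by blast
  obtain a0 where a0: "(\<Sum>k\<in>s - {k0}. a0 k *\<^sub>R v k) = d"
  proof (rule fam_spans[of "s - {k0}" B v d])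
    show "fam_indep v (s - {k0})" using k0 by (intro ind) auto
  qed (use fs B cs vB k0 d in auto)
  define a where "a = a0(k0 := 0)"
  have a: "(\<Sum>k\<in>s. a k *\<^sub>R v k) = d"
    using a0 fs k0 by (simp add: sum.remove[of s k0] a_def)
  \<comment> \<open>The parameter at which the coefficient of \<open>k\<close> vanishes on the line
    \<open>a + r * c\<close>, that is, where the ray can cross the facet opposite to
    \<open>k\<close>.\<close>
  define \<tau> where "\<tau> k = - a k / c k" for k
  have atc: "(\<Sum>j\<in>s. (a j + r * c j) *\<^sub>R v j) = d" for r
  proof -
    have "(\<Sum>j\<in>s. (a j + r * c j) *\<^sub>R v j) = (\<Sum>j\<in>s. a j *\<^sub>R v j) + r *\<^sub>R (\<Sum>j\<in>s. c j *\<^sub>R v j)"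
      by (simp add: scaleR_add_left sum.distrib scaleR_sum_right)
    then show ?thesis using a c(1) by simp
  qed
  have atk: "a k + \<tau> k * c k = 0" if "k \<in> s" for k using cnz[OF that] by (simp add: \<tau>_def)
  have hit: "cone_hit v d (s - {k}) \<longleftrightarrow> (\<forall>j\<in>s. 0 \<le> a j + \<tau> k * c j)" if k: "k \<in> s" for k
  proof
    assume "cone_hit v d (s - {k})"
    then obtain b where b: "\<forall>j\<in>s - {k}. 0 \<le> b j" "(\<Sum>j\<in>s - {k}. b j *\<^sub>R v j) = d"
      by (auto simp: cone_hit_def)
    define b' where "b' = b(k := 0)"
    have b': "(\<Sum>j\<in>s. b' j *\<^sub>R v j) = d" using b(2) fs k by (simp add: sum.remove[of s k] b'_def)
    have "(\<Sum>j\<in>s. (b' j - (a j + \<tau> k * c j)) *\<^sub>R v j) = 0"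
      using b' atc[of "\<tau> k"] by (simp add: scaleR_diff_left sum_subtractf)
    then have "\<forall>j\<in>s. b' j - (a j + \<tau> k * c j) = 0"
      using van[of "\<lambda>j. b' j - (a j + \<tau> k * c j)" k] k atk[OF k] by (simp add: b'_def)
    then have eq: "a j + \<tau> k * c j = b' j" if "j \<in> s" for j using that by simp
    show "\<forall>j\<in>s. 0 \<le> a j + \<tau> k * c j"
    proof
      fix j assume "j \<in> s"
      then show "0 \<le> a j + \<tau> k * c j" using b(1) by (simp add: eq b'_def)
    qed
  next
    assume pos: "\<forall>j\<in>s. 0 \<le> a j + \<tau> k * c j"
    have "(\<Sum>j\<in>s - {k}. (a j + \<tau> k * c j) *\<^sub>R v j) = d"
      using atc[of "\<tau> k"] fs k atk[OF k] by (simp add: sum.remove[of s k])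
    then show "cone_hit v d (s - {k})" unfolding cone_hit_def using pos by (intro exI[of _ "\<lambda>j. a j + \<tau> k * c j"]) auto
  qed
  \<comment> \<open>Equal parameters would make two coefficients vanish together and put
    \<open>d\<close> into the span of \<open>m - 1\<close> vectors.\<close>
  have inj: "inj_on \<tau> s"
  proof (rule inj_onI, rule ccontr)
    fix j k assume jk: "j \<in> s" "k \<in> s" "\<tau> j = \<tau> k" "j \<noteq> k"
    let ?t = "s - {j, k}"
    have "(\<Sum>i\<in>?t. (a i + \<tau> k * c i) *\<^sub>R v i) = (\<Sum>i\<in>s. (a i + \<tau> k * c i) *\<^sub>R v i)"
      using fs atk[OF jk(1)] atk[OF jk(2)] jk(3) by (intro sum.mono_neutral_left) auto
    then have "d = (\<Sum>i\<in>?t. (a i + \<tau> k * c i) *\<^sub>R v i)" using atc by simp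
    also have "\<dots> \<in> span (v ` ?t)" by (intro span_sum span_scale span_base) auto
    finally have "d \<in> span (v ` ?t)" .
    moreover have "card {j, k} \<le> card s" using fs jk by (intro card_mono) auto
    then have "card ?t < m" using fs cs jk by (simp add: card_Diff_subset)
    ultimately show False using gen[of ?t] by simp
  qed
  define P where "P = {k\<in>s. c k > 0}"
  define Q where "Q = {k\<in>s. c k < 0}"
  have "k \<in> P \<union> Q" if "k \<in> s" for k
    using cnz[OF that] that by (cases "c k > 0") (auto simp: P_def Q_def)
  then have "s \<subseteq> P \<union> Q" by (rule subsetI)
  moreover have "P \<subseteq> s" "Q \<subseteq> s" by (simp_all add: P_def Q_def)
  ultimately have "s = P \<union> Q" by (simp add: subset_antisym)
  moreover have "finite P" "finite Q" using fs by (simp_all add: P_def Q_def)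
  moreover have "P \<inter> Q = {}" unfolding P_def Q_def using less_asym by fastforce
  ultimately have PQ: "finite P" "finite Q" "P \<inter> Q = {}" "s = P \<union> Q" by simp_all
  have feas: "(\<forall>j\<in>s. 0 \<le> a j + r * c j) \<longleftrightarrow> (\<forall>i\<in>P. \<tau> i \<le> r) \<and> (\<forall>i\<in>Q. r \<le> \<tau> i)" for r
  proof -
    have "0 \<le> a j + r * c j \<longleftrightarrow> \<tau> j \<le> r" if "j \<in> P" for j
      using that by (auto simp: P_def \<tau>_def field_simps)
    moreover have "0 \<le> a j + r * c j \<longleftrightarrow> r \<le> \<tau> j" if "j \<in> Q" for j
      using that by (auto simp: Q_def \<tau>_def field_simps)
    ultimately show ?thesis unfolding PQ(4) by blast
  qed
  have X: "{k\<in>s. cone_hit v d (s - {k})} = {k \<in> P \<union> Q. (\<forall>i\<in>P. \<tau> i \<le> \<tau> k) \<and> (\<forall>i\<in>Q. \<tau> k \<le> \<tau> i)}"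
    using hit feas PQ(4) by blast
  have injPQ: "inj_on \<tau> (P \<union> Q)" using inj PQ(4) by simp
  have "s \<noteq> {}" using k0 by blast
  \<comment> \<open>The origin lies in the hull exactly if \<open>c\<close> has constant sign, which
    is the case of an unbounded feasible interval with a single endpoint.\<close>
  have conv: "conv0 v s \<longleftrightarrow> P = {} \<or> Q = {}"
  proof
    assume "conv0 v s"
    then obtain b where b: "\<forall>k\<in>s. 0 \<le> b k" "sum b s = 1" "(\<Sum>k\<in>s. b k *\<^sub>R v k) = 0"
      by (auto simp: conv0_def)
    define r where "r = b k0 / c k0"
    have "(\<Sum>k\<in>s. (b k - r * c k) *\<^sub>R v k) = (\<Sum>k\<in>s. b k *\<^sub>R v k) - r *\<^sub>R (\<Sum>k\<in>s. c k *\<^sub>R v k)"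
      by (simp add: scaleR_diff_left sum_subtractf scaleR_sum_right)
    then have "\<forall>k\<in>s. b k - r * c k = 0"
      by (intro van[OF _ k0]) (use b(3) c(1) cnz[OF k0] in \<open>simp_all add: r_def\<close>)
    then have brc: "\<forall>k\<in>s. b k = r * c k" by simp
    have "r \<noteq> 0" using b(2) brc by auto
    then consider "r > 0" | "r < 0" by linarith
    then show "P = {} \<or> Q = {}"
      using b(1) brc by cases (auto simp: P_def Q_def zero_le_mult_iff)
  next
    assume emp: "P = {} \<or> Q = {}"
    define C where "C = sum c s"
    have "C \<noteq> 0 \<and> (\<forall>k\<in>s. 0 \<le> c k / C)"
    proof (cases "Q = {}")
      case True
      then have pos: "\<forall>k\<in>s. 0 < c k" using PQ(4) by (auto simp: P_def)
      then have "C > 0" unfolding C_def using fs \<open>s \<noteq> {}\<close> by (intro sum_pos) auto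
      then show ?thesis using pos by (auto intro: less_imp_le)
    next
      case False
      then have "s = Q" using PQ(4) emp by simp
      then have neg: "\<forall>k\<in>s. c k < 0" using Q_def by blast
      have "sum (\<lambda>k. - c k) s > 0" using fs \<open>s \<noteq> {}\<close> neg by (intro sum_pos) auto
      then have "C < 0" unfolding C_def by (simp add: sum_negf)
      then show ?thesis using neg by (auto intro: divide_nonpos_neg less_imp_le)
    qed
    moreover have "(\<Sum>k\<in>s. (c k / C) *\<^sub>R v k) = (1 / C) *\<^sub>R (\<Sum>k\<in>s. c k *\<^sub>R v k)"
      by (simp add: scaleR_sum_right)
    ultimately show "conv0 v s" unfolding conv0_def using c(1)
      by (intro exI[of _ "\<lambda>k. c k / C"]) (auto simp: sum_divide_distrib[symmetric] C_def)
  qed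
  show "card {k\<in>s. cone_hit v d (s - {k})} = 1" if "conv0 v s"
    unfolding X using interval_endpoint_count[OF PQ(1-3) injPQ] that conv PQ(4) \<open>s \<noteq> {}\<close> by blast
  show "card {k\<in>s. cone_hit v d (s - {k})} = 0 \<or> card {k\<in>s. cone_hit v d (s - {k})} = 2" if "\<not> conv0 v s"
    unfolding X using interval_endpoint_count(3)[OF PQ(1-3) injPQ] that conv by blast
qed

section \<open>General position and counting modulo 2\<close>

text \<open>A real vector space is no finite union of proper subspaces: a line
  \<open>y + \<tau> z\<close> with \<open>z\<close> outside \<open>T\<close> and \<open>y\<close>
  outside the other subspaces meets each of them at most once.\<close>

lemma direction_avoiding_subspaces:
  fixes Y :: "'w::real_vector set"
  assumes "finite \<S>" "subspace Y" "\<And>S. S \<in> \<S> \<Longrightarrow> subspace S \<and> \<not> Y \<subseteq> S"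
  shows "\<exists>y\<in>Y. \<forall>S\<in>\<S>. y \<notin> S"
  using assms(1,3)
proof (induction \<S>)
  case empty
  then show ?case using subspace_0[OF assms(2)] by blast
next
  case (insert T \<S>)
  then obtain y where y: "y \<in> Y" "\<forall>S\<in>\<S>. y \<notin> S" by auto
  obtain z where z: "z \<in> Y" "z \<notin> T" using insert.prems by blast
  have subT: "subspace T" using insert.prems by blast
  define bad where "bad = {\<tau>. \<exists>S\<in>insert T \<S>. y + \<tau> *\<^sub>R z \<in> S}"
  have one: "\<exists>\<tau>0. \<forall>\<tau>. y + \<tau> *\<^sub>R z \<in> S \<longrightarrow> \<tau> = \<tau>0" if S: "S \<in> insert T \<S>" for S
  proof (rule ccontr)
    assume "\<not> ?thesis"
    then obtain t1 t2 where t: "y + t1 *\<^sub>R z \<in> S" "y + t2 *\<^sub>R z \<in> S" "t1 \<noteq> t2" by metis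
    have subS: "subspace S" using insert.prems S by blast
    have "(t1 - t2) *\<^sub>R z \<in> S" using subspace_diff[OF subS t(1,2)] by (simp add: algebra_simps)
    then have "(1 / (t1 - t2)) *\<^sub>R ((t1 - t2) *\<^sub>R z) \<in> S" using subspace_scale[OF subS] by blast
    then have zS: "z \<in> S" using t(3) by simp
    then have "y + t1 *\<^sub>R z - t1 *\<^sub>R z \<in> S" using subspace_diff[OF subS t(1)] subspace_scale[OF subS] by blast
    then have "y \<in> S" by simp
    then show False using zS z(2) y(2) S by auto
  qed
  then obtain \<tau>0 where \<tau>0: "\<And>S \<tau>. S \<in> insert T \<S> \<Longrightarrow> y + \<tau> *\<^sub>R z \<in> S \<Longrightarrow> \<tau> = \<tau>0 S" by metis
  have "bad \<subseteq> \<tau>0 ` insert T \<S>" unfolding bad_def using \<tau>0 by blast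
  then have "finite bad" using insert.hyps finite_subset by blast
  then obtain \<tau> where "\<tau> \<notin> bad" using infinite_UNIV_char_0 ex_new_if_finite by blast
  then have "\<forall>S\<in>insert T \<S>. y + \<tau> *\<^sub>R z \<notin> S" by (auto simp: bad_def)
  moreover have "y + \<tau> *\<^sub>R z \<in> Y" using y z assms(2) by (simp add: subspace_add subspace_scale)
  ultimately show ?case by blast
qed

text \<open>Pairs of a base point and a subspace are used because the same \<open>\<rho>\<close> has
  to push several points off several subspaces. Along a direction outside all the subspaces each
  pair forbids at most one multiple, so arbitrarily small ones remain.\<close>

lemma perturbation_avoiding_subspaces:
  fixes Y :: "'w::real_normed_vector set"
  assumes fin: "finite \<P>" and Y: "subspace Y" and \<P>: "\<And>x S. (x, S) \<in> \<P> \<Longrightarrow> subspace S \<and> \<not> Y \<subseteq> S" and \<eta>: "\<eta> > 0"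
  obtains \<rho> where "\<rho> \<in> Y" "norm \<rho> < \<eta>" "\<And>x S. (x, S) \<in> \<P> \<Longrightarrow> x + \<rho> \<notin> S"
proof -
  have "\<exists>y\<in>Y. \<forall>S\<in>snd ` \<P>. y \<notin> S"
    by (rule direction_avoiding_subspaces[OF _ Y]) (use fin \<P> in auto)
  then obtain y where y: "y \<in> Y" "\<And>x S. (x, S) \<in> \<P> \<Longrightarrow> y \<notin> S" by force
  have one: "\<exists>\<tau>0. \<forall>\<tau>. fst q + \<tau> *\<^sub>R y \<in> snd q \<longrightarrow> \<tau> = \<tau>0" if q: "q \<in> \<P>" for q
  proof (rule ccontr)
    assume "\<not> ?thesis"
    then obtain t1 t2 where t: "fst q + t1 *\<^sub>R y \<in> snd q" "fst q + t2 *\<^sub>R y \<in> snd q" "t1 \<noteq> t2" by metis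
    have subS: "subspace (snd q)" using \<P>[of "fst q" "snd q"] q by simp
    have "(t1 - t2) *\<^sub>R y \<in> snd q" using subspace_diff[OF subS t(1,2)] by (simp add: algebra_simps)
    then have "(1 / (t1 - t2)) *\<^sub>R ((t1 - t2) *\<^sub>R y) \<in> snd q" using subspace_scale[OF subS] by blast
    then show False using t(3) y(2)[of "fst q" "snd q"] q by simp
  qed
  then obtain \<tau>0 where \<tau>0: "\<And>q \<tau>. q \<in> \<P> \<Longrightarrow> fst q + \<tau> *\<^sub>R y \<in> snd q \<Longrightarrow> \<tau> = \<tau>0 q" by metis
  have "infinite {0<..<\<eta> / (norm y + 1)}" using \<eta> by (intro infinite_Ioo) (simp add: add_nonneg_pos)
  then obtain \<tau> where \<tau>: "\<tau> \<in> {0<..<\<eta> / (norm y + 1)}" "\<tau> \<notin> \<tau>0 ` \<P>"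
    using fin by (meson finite_imageI finite_subset subsetI)
  have pos: "norm y + 1 > 0" by (simp add: add_nonneg_pos)
  have "\<tau> * norm y \<le> \<tau> * (norm y + 1)" using \<tau> by (intro mult_left_mono) auto
  also have "\<dots> < \<eta>" using \<tau> pos by (simp add: pos_less_divide_eq)
  finally have "norm (\<tau> *\<^sub>R y) < \<eta>" using \<tau> by simp
  moreover have "x + \<tau> *\<^sub>R y \<notin> S" if "(x, S) \<in> \<P>" for x S
    using \<tau>0[OF that, of \<tau>] \<tau>(2) that by auto
  ultimately show ?thesis using that[of "\<tau> *\<^sub>R y"] subspace_scale[OF Y y(1)] by blast
qed

lemma small_span_not_superset:
  assumes "finite B" "independent B" "finite t" "card t < card B"
  shows "\<not> span B \<subseteq> span (v ` t)"
proof
  assume "span B \<subseteq> span (v ` t)"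
  then have "B \<subseteq> span (v ` t)" using span_superset by blast
  then have "card B \<le> card (v ` t)" using independent_span_bound[OF _ assms(2)] assms(3) by blast
  then show False using card_image_le[OF assms(3), of v] assms(4) by linarith
qed

lemma fam_indep_insert:
  assumes "fam_indep v t" "finite t" "k \<notin> t" "v k \<notin> span (v ` t)"
  shows "fam_indep v (insert k t)"
  unfolding fam_indep_def
proof (intro allI impI)
  fix c assume "(\<Sum>j\<in>insert k t. c j *\<^sub>R v j) = 0"
  then have e: "c k *\<^sub>R v k + (\<Sum>j\<in>t. c j *\<^sub>R v j) = 0" using assms by simp
  have "c k = 0"
  proof (rule ccontr)
    assume ck: "c k \<noteq> 0"
    have "v k = (1 / c k) *\<^sub>R (c k *\<^sub>R v k)" using ck by simp
    also have "c k *\<^sub>R v k = - (\<Sum>j\<in>t. c j *\<^sub>R v j)" using e by (simp add: eq_neg_iff_add_eq_0)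
    also have "(1 / c k) *\<^sub>R \<dots> \<in> span (v ` t)"
      by (intro span_scale span_neg span_sum span_base) auto
    finally show False using assms(4) by blast
  qed
  then show "\<forall>j\<in>insert k t. c j = 0" using e fam_indepD[OF assms(1)] by auto
qed

text \<open>The indices are treated one at a time, each new vector being moved off the spans of
  fewer than \<open>card B\<close> earlier ones. Both families receive the same
  \<open>\<rho>\<close>, so they keep equal values wherever \<open>b\<close> and \<open>b'\<close>
  agree; the comparison on the boundary rests on this.\<close>

lemma generic_perturbation:
  fixes b b' :: "'k \<Rightarrow> 'w::real_normed_vector"
  assumes "finite G" and B: "finite B" "independent B" and \<eta>: "\<eta> > 0"
  shows "\<exists>\<rho>. (\<forall>k\<in>G. \<rho> k \<in> span B \<and> norm (\<rho> k) < \<eta>) \<and>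
    (\<forall>t\<subseteq>G. card t \<le> card B \<longrightarrow> fam_indep (\<lambda>k. b k + \<rho> k) t \<and> fam_indep (\<lambda>k. b' k + \<rho> k) t)"
  using assms(1)
proof (induction G)
  case empty
  then show ?case by (auto simp: fam_indep_def)
next
  case (insert k G)
  then obtain \<rho> where \<rho>: "\<forall>k\<in>G. \<rho> k \<in> span B \<and> norm (\<rho> k) < \<eta>"
    "\<And>t. t \<subseteq> G \<Longrightarrow> card t \<le> card B \<Longrightarrow> fam_indep (\<lambda>k. b k + \<rho> k) t \<and> fam_indep (\<lambda>k. b' k + \<rho> k) t"
    by metis
  define \<T> where "\<T> = {t. t \<subseteq> G \<and> card t < card B}"
  define \<P> where "\<P> = (\<lambda>t. (b k, span ((\<lambda>k. b k + \<rho> k) ` t))) ` \<T> \<union> (\<lambda>t. (b' k, span ((\<lambda>k. b' k + \<rho> k) ` t))) ` \<T>"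
  have "finite \<T>" using insert.hyps(1) by (simp add: \<T>_def)
  then have "finite \<P>" by (simp add: \<P>_def)
  moreover have "subspace S \<and> \<not> span B \<subseteq> S" if "(x, S) \<in> \<P>" for x S
    using that small_span_not_superset[OF B] finite_subset[OF _ insert.hyps(1)] by (auto simp: \<P>_def \<T>_def)
  ultimately obtain r where r: "r \<in> span B" "norm r < \<eta>" "\<And>x S. (x, S) \<in> \<P> \<Longrightarrow> x + r \<notin> S"
    using perturbation_avoiding_subspaces[OF _ subspace_span _ \<eta>, of \<P> B] by metis
  define \<rho>' where "\<rho>' = \<rho>(k := r)"
  have ext: "fam_indep (\<lambda>j. \<beta> j + \<rho>' j) t"
    if t: "t \<subseteq> insert k G" "card t \<le> card B"
      and ind: "\<And>t. t \<subseteq> G \<Longrightarrow> card t \<le> card B \<Longrightarrow> fam_indep (\<lambda>k. \<beta> k + \<rho> k) t"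
      and av: "\<And>t. t \<in> \<T> \<Longrightarrow> \<beta> k + r \<notin> span ((\<lambda>k. \<beta> k + \<rho> k) ` t)" for \<beta> t
  proof -
    let ?v = "\<lambda>j. \<beta> j + \<rho>' j"
    have ft: "finite t" using t(1) insert.hyps(1) finite_subset by blast
    have same: "\<And>j. j \<in> t - {k} \<Longrightarrow> ?v j = \<beta> j + \<rho> j" by (auto simp: \<rho>'_def)
    have sub: "t - {k} \<subseteq> G" "card (t - {k}) \<le> card B" using t ft card_Diff1_le[of t k] by auto
    have "(\<Sum>j\<in>t - {k}. c j *\<^sub>R ?v j) = (\<Sum>j\<in>t - {k}. c j *\<^sub>R (\<beta> j + \<rho> j))" for c
      by (rule sum.cong[OF refl]) (simp add: same)
    then have i0: "fam_indep ?v (t - {k})" using ind[OF sub] by (simp add: fam_indep_def)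
    show ?thesis
    proof (cases "k \<in> t")
      case True
      have "t - {k} \<in> \<T>" using sub True ft t(2) card_Diff1_less[OF ft True] by (simp add: \<T>_def)
      then have "?v k \<notin> span (?v ` (t - {k}))"
        using av[of "t - {k}"] image_cong[OF refl same] by (simp add: \<rho>'_def)
      then have "fam_indep ?v (insert k (t - {k}))" by (intro fam_indep_insert[OF i0]) (use ft in auto)
      then show ?thesis using True by (simp add: insert_absorb)
    qed (use i0 in simp)
  qed
  have "fam_indep (\<lambda>k. b k + \<rho>' k) t \<and> fam_indep (\<lambda>k. b' k + \<rho>' k) t" if "t \<subseteq> insert k G" "card t \<le> card B" for t
    using that by (intro conjI ext) (use \<rho>(2) r(3) in \<open>auto simp: \<P>_def\<close>)
  moreover have "\<forall>j\<in>insert k G. \<rho>' j \<in> span B \<and> norm (\<rho>' j) < \<eta>" using \<rho>(1) r by (auto simp: \<rho>'_def)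
  ultimately show ?case by blast
qed

text \<open>Incidences between simplices and selected facets are counted in two ways modulo 2:
  interior facets cancel, and so do simplices with none or two selected facets.\<close>

lemma counting_parity:
  fixes bnd compo compo' face S F
  defines "nF s \<equiv> card {f\<in>F. face f s \<and> compo' f}"
  assumes fin: "finite F" "finite S"
    and one: "\<And>f. f \<in> F \<Longrightarrow> bnd f \<Longrightarrow> card {s\<in>S. face f s} = 1"
    and two: "\<And>f. f \<in> F \<Longrightarrow> \<not> bnd f \<Longrightarrow> card {s\<in>S. face f s} = 2"
    and yes: "\<And>s. s \<in> S \<Longrightarrow> compo s \<Longrightarrow> nF s = 1"
    and no: "\<And>s. s \<in> S \<Longrightarrow> \<not> compo s \<Longrightarrow> nF s = 0 \<or> nF s = 2"
  shows "even (card {s\<in>S. compo s}) \<longleftrightarrow> even (card {f\<in>F. compo' f \<and> bnd f})"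
proof -
  let ?F = "{f\<in>F. compo' f}"
  have "(\<Sum>s\<in>S. nF s) = (\<Sum>s\<in>S. card {f\<in>?F. face f s})"
    by (intro sum.cong refl) (auto simp: nF_def intro!: arg_cong[where f=card])
  also have "\<dots> = (\<Sum>f\<in>?F. card {s\<in>S. face f s})"
    by (rule sum_multicount_gen) (use fin in auto)
  finally have eq: "(\<Sum>s\<in>S. nF s) = (\<Sum>f\<in>?F. card {s\<in>S. face f s})" .
  have "even (\<Sum>s\<in>S. nF s) \<longleftrightarrow> even (card {s\<in>S. odd (nF s)})"
    by (rule even_sum_iff[OF fin(2)])
  also have "{s\<in>S. odd (nF s)} = {s\<in>S. compo s}" using yes no by fastforce
  finally have 1: "even (\<Sum>s\<in>S. nF s) \<longleftrightarrow> even (card {s\<in>S. compo s})" .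
  have "even (\<Sum>f\<in>?F. card {s\<in>S. face f s}) \<longleftrightarrow> even (card {f\<in>?F. odd (card {s\<in>S. face f s})})"
    by (rule even_sum_iff) (use fin(1) in simp)
  also have "{f\<in>?F. odd (card {s\<in>S. face f s})} = {f\<in>F. compo' f \<and> bnd f}" using one two by fastforce
  finally show ?thesis using 1 eq by simp
qed


section \<open>Interpolation on the Kuhn triangulation\<close>

text \<open>The value \<open>p\<close> beyond the first \<open>m\<close> indices follows the
  convention for vertices of \<open>ksimplex\<close>.\<close>

definition kuhn_grid :: "nat \<Rightarrow> nat \<Rightarrow> (nat \<Rightarrow> nat) set" where
  "kuhn_grid p m = {k. (\<forall>i<m. k i \<le> p) \<and> (\<forall>i\<ge>m. k i = p)}"

lemma finite_kuhn_grid: "finite (kuhn_grid p m)"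
proof -
  have "finite {k::nat \<Rightarrow> nat. \<forall>i. (i \<in> {..<m} \<longrightarrow> k i \<in> {..p}) \<and> (i \<notin> {..<m} \<longrightarrow> k i = p)}"
    by (rule finite_set_of_finite_funs) auto
  moreover have "kuhn_grid p m \<subseteq> {k. \<forall>i. (i \<in> {..<m} \<longrightarrow> k i \<in> {..p}) \<and> (i \<notin> {..<m} \<longrightarrow> k i = p)}"
    by (auto simp: kuhn_grid_def)
  ultimately show ?thesis by (rule finite_subset[rotated])
qed

lemma ksimplex_subset_grid: "ksimplex p m s \<Longrightarrow> s \<subseteq> kuhn_grid p m"
  unfolding kuhn_grid_def
  by (elim ksimplex.cases) (auto simp: kuhn_simplex.s_le_p kuhn_simplex.out_eq_p)

lemma ksimplex_finite: "ksimplex p m s \<Longrightarrow> finite s"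
  using ksimplex_subset_grid finite_kuhn_grid finite_subset by metis

text \<open>Interior facets are shared by two simplices, so the parity of the simplices whose image
  contains the origin is that of the boundary facets crossed by a generic ray. This is a degree
  modulo 2 read off the boundary.\<close>

lemma kuhn_parity_boundary:
  fixes v :: "(nat \<Rightarrow> nat) \<Rightarrow> 'w::real_normed_vector"
  assumes m: "0 < m" and B: "finite B" "card B = m"
    and gen: "\<And>t. t \<subseteq> kuhn_grid p m \<Longrightarrow> card t \<le> m \<Longrightarrow> fam_indep v t" and vB: "v ` kuhn_grid p m \<subseteq> span B"
    and d: "d \<in> span B" "\<And>t. t \<subseteq> kuhn_grid p m \<Longrightarrow> card t < m \<Longrightarrow> d \<notin> span (v ` t)"
  defines "bnd f \<equiv> (\<exists>j<m. \<forall>x\<in>f. x j = 0) \<or> (\<exists>j<m. \<forall>x\<in>f. x j = p)"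
  shows "even (card {s. ksimplex p m s \<and> conv0 v s}) \<longleftrightarrow>
    even (card {f. (\<exists>s. ksimplex p m s \<and> (\<exists>a\<in>s. f = s - {a})) \<and> cone_hit v d f \<and> bnd f})"
proof -
  define S where "S = {s. ksimplex p m s}"
  define F where "F = {f. \<exists>s. ksimplex p m s \<and> (\<exists>a\<in>s. f = s - {a})}"
  let ?face = "\<lambda>f s. \<exists>a\<in>s. f = s - {a}"
  have fS: "finite S" unfolding S_def by (rule finite_ksimplexes)
  have F_eq: "F = (\<Union>s\<in>S. (\<lambda>a. s - {a}) ` s)" by (auto simp: F_def S_def)
  have fF: "finite F" unfolding F_eq using fS ksimplex_finite by (auto simp: S_def)
  have cc: "{s\<in>S. ?face f s} = {s'. ksimplex p m s' \<and> (\<exists>b\<in>s'. s' - {b} = f)}" for f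
    by (auto simp: S_def)
  have nF: "card {f\<in>F. ?face f s \<and> cone_hit v d f} = card {k\<in>s. cone_hit v d (s - {k})}" if s: "s \<in> S" for s
  proof -
    have "{f\<in>F. ?face f s \<and> cone_hit v d f} = (\<lambda>k. s - {k}) ` {k\<in>s. cone_hit v d (s - {k})}"
      using s by (auto simp: F_def S_def)
    moreover have "inj_on (\<lambda>k. s - {k}) {k\<in>s. cone_hit v d (s - {k})}"
      by (auto simp: inj_on_def)
    ultimately show ?thesis by (simp add: card_image)
  qed
  have fc: "conv0 v s \<Longrightarrow> card {k\<in>s. cone_hit v d (s - {k})} = 1"
    "\<not> conv0 v s \<Longrightarrow> card {k\<in>s. cone_hit v d (s - {k})} = 0 \<or> card {k\<in>s. cone_hit v d (s - {k})} = 2"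
    if s: "s \<in> S" for s
  proof -
    have ks: "ksimplex p m s" using s by (simp add: S_def)
    note sub = ksimplex_subset_grid[OF ks] and fs = ksimplex_finite[OF ks]
    have cs: "card s = Suc m" using ksimplex_card[OF ks] by simp
    have ind: "fam_indep v t" if "t \<subset> s" for t
      using gen[of t] psubset_card_mono[OF fs that] cs that sub by auto
    have vs: "v ` s \<subseteq> span B" using vB sub by auto
    have dd: "d \<notin> span (v ` t)" if "t \<subseteq> s" "card t < m" for t using d(2) that sub by auto
    show "conv0 v s \<Longrightarrow> card {k\<in>s. cone_hit v d (s - {k})} = 1"
      "\<not> conv0 v s \<Longrightarrow> card {k\<in>s. cone_hit v d (s - {k})} = 0 \<or> card {k\<in>s. cone_hit v d (s - {k})} = 2"
      using facet_count[OF fs cs B vs ind d(1) dd] by simp_all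
  qed
  have "even (card {s\<in>S. conv0 v s}) \<longleftrightarrow> even (card {f\<in>F. cone_hit v d f \<and> bnd f})"
  proof (rule counting_parity[where face = ?face])
    show "card {s\<in>S. ?face f s} = 1" if f: "f \<in> F" "bnd f" for f
    proof -
      obtain s a where s: "ksimplex p m s" "a \<in> s" "f = s - {a}" using f(1) by (auto simp: F_def)
      from f(2)[unfolded bnd_def] show ?thesis
      proof (elim disjE exE conjE)
        fix j assume "j < m" "\<forall>x\<in>f. x j = 0"
        then show ?thesis unfolding cc using ksimplex_replace_0[OF s(1,2), of j] s(3) by simp
      next
        fix j assume "j < m" "\<forall>x\<in>f. x j = p"
        then show ?thesis unfolding cc using ksimplex_replace_1[OF s(1,2), of j] s(3) by simp
      qed
    qed
    show "card {s\<in>S. ?face f s} = 2" if f: "f \<in> F" "\<not> bnd f" for f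
    proof -
      obtain s a where s: "ksimplex p m s" "a \<in> s" "f = s - {a}" using f(1) by (auto simp: F_def)
      show ?thesis unfolding cc using ksimplex_replace_2[OF s(1,2)] m f(2) s(3) by (auto simp: bnd_def)
    qed
  qed (use fS fF nF fc in auto)
  then show ?thesis by (simp add: S_def F_def)
qed

text \<open>One direction \<open>d\<close> is chosen generic for both families. On boundary facets
  the families agree, and so do the crossings of the ray.\<close>

lemma kuhn_parity:
  fixes v v' :: "(nat \<Rightarrow> nat) \<Rightarrow> 'w::real_normed_vector"
  assumes m: "0 < m" and B: "finite B" "independent B" "card B = m"
    and gen: "\<And>t. t \<subseteq> kuhn_grid p m \<Longrightarrow> card t \<le> m \<Longrightarrow> fam_indep v t"
    and gen': "\<And>t. t \<subseteq> kuhn_grid p m \<Longrightarrow> card t \<le> m \<Longrightarrow> fam_indep v' t"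
    and vB: "v ` kuhn_grid p m \<subseteq> span B" "v' ` kuhn_grid p m \<subseteq> span B"
    and bd: "\<And>k i. k \<in> kuhn_grid p m \<Longrightarrow> i < m \<Longrightarrow> k i = 0 \<or> k i = p \<Longrightarrow> v k = v' k"
  shows "even (card {s. ksimplex p m s \<and> conv0 v s}) \<longleftrightarrow> even (card {s. ksimplex p m s \<and> conv0 v' s})"
proof -
  define \<T> where "\<T> = {t. t \<subseteq> kuhn_grid p m \<and> card t < m}"
  define \<P> where "\<P> = (\<lambda>t. (0::'w, span (v ` t))) ` \<T> \<union> (\<lambda>t. (0, span (v' ` t))) ` \<T>"
  have "finite \<T>" using finite_kuhn_grid by (simp add: \<T>_def)
  then have f\<P>: "finite \<P>" by (simp add: \<P>_def)
  have small: "\<not> span B \<subseteq> span (u ` t)" if "t \<in> \<T>" for t and u :: "(nat \<Rightarrow> nat) \<Rightarrow> 'w"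
    using small_span_not_superset[OF B(1,2), of t u] finite_subset[OF _ finite_kuhn_grid, of t p m] that B(3)
    by (simp add: \<T>_def)
  have \<P>: "subspace S \<and> \<not> span B \<subseteq> S" if "(x, S) \<in> \<P>" for x S
    using that small by (auto simp: \<P>_def)
  obtain d where d: "d \<in> span B" "norm d < 1" "\<And>x S. (x, S) \<in> \<P> \<Longrightarrow> x + d \<notin> S"
    by (rule perturbation_avoiding_subspaces[OF f\<P> subspace_span \<P> zero_less_one]) (auto intro: that)
  have d1: "d \<notin> span (v ` t)" and d2: "d \<notin> span (v' ` t)" if "t \<subseteq> kuhn_grid p m" "card t < m" for t
    using that d(3)[of 0] by (auto simp: \<P>_def \<T>_def)
  define bnd where "bnd = (\<lambda>f. (\<exists>j<m. \<forall>x\<in>f. x j = (0::nat)) \<or> (\<exists>j<m. \<forall>x\<in>f. x j = p))"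
  have eq: "cone_hit v d f = cone_hit v' d f" if f: "f \<subseteq> kuhn_grid p m" "bnd f" for f
  proof -
    have vv: "v k = v' k" if "k \<in> f" for k using f(2) bd[of k] that f(1) unfolding bnd_def by blast
    have "(\<Sum>k\<in>f. a k *\<^sub>R v k) = (\<Sum>k\<in>f. a k *\<^sub>R v' k)" for a
      by (rule sum.cong[OF refl]) (simp add: vv)
    then show ?thesis by (simp add: cone_hit_def)
  qed
  have "{f. (\<exists>s. ksimplex p m s \<and> (\<exists>a\<in>s. f = s - {a})) \<and> cone_hit v d f \<and> bnd f}
      = {f. (\<exists>s. ksimplex p m s \<and> (\<exists>a\<in>s. f = s - {a})) \<and> cone_hit v' d f \<and> bnd f}"
  proof -
    have "f \<subseteq> kuhn_grid p m" if "\<exists>s. ksimplex p m s \<and> (\<exists>a\<in>s. f = s - {a})" for f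
      using that ksimplex_subset_grid by blast
    then show ?thesis using eq by blast
  qed
  then show ?thesis
    using kuhn_parity_boundary[OF m B(1,3) gen vB(1) d(1) d1] kuhn_parity_boundary[OF m B(1,3) gen' vB(2) d(1) d2]
    unfolding bnd_def by simp
qed

text \<open>
  The piecewise affine interpolation on Kuhn's triangulation of the grid is the average of the
  values at the integer points \<open>\<lfloor>x + t\<rfloor>\<close>, \<open>0 \<le> t \<le> 1\<close>.
\<close>

definition grid_floor :: "nat \<Rightarrow> nat \<Rightarrow> (nat \<Rightarrow> real) \<Rightarrow> real \<Rightarrow> nat \<Rightarrow> nat" where
  "grid_floor p m x t = (\<lambda>i. if i < m then min p (nat \<lfloor>x i + t\<rfloor>) else p)"

definition kuhn_interp :: "nat \<Rightarrow> nat \<Rightarrow> ((nat \<Rightarrow> nat) \<Rightarrow> 'w::real_normed_vector) \<Rightarrow> (nat \<Rightarrow> real) \<Rightarrow> 'w" where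
  "kuhn_interp p m v x = integral {0..1} (\<lambda>t. v (grid_floor p m x t))"

text \<open>Barycentric weights become lengths of consecutive intervals; the values at their right
  ends do not affect the integral.\<close>

lemma step_function_integral:
  fixes g :: "real \<Rightarrow> 'w::banach"
  assumes lam: "\<And>j. j < n \<Longrightarrow> 0 \<le> lam j"
    and g: "\<And>j t. j < n \<Longrightarrow> (\<Sum>i<j. lam i) \<le> t \<Longrightarrow> t < (\<Sum>i<Suc j. lam i) \<Longrightarrow> g t = w j"
  shows "(g has_integral (\<Sum>j<n. lam j *\<^sub>R w j)) {0..(\<Sum>i<n. lam i)}"
  using assms
proof (induction n)
  case 0
  show ?case using has_integral_refl(2)[of g "0::real"] by simp
next
  case (Suc n)
  let ?c = "\<lambda>j. \<Sum>i<j. lam i"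
  have IH: "(g has_integral (\<Sum>j<n. lam j *\<^sub>R w j)) {0..?c n}"
    by (rule Suc.IH) (use Suc.prems in auto)
  have le: "0 \<le> ?c n" "?c n \<le> ?c (Suc n)" using Suc.prems(1) by (auto intro!: sum_nonneg)
  have "((\<lambda>t. w n) has_integral (?c (Suc n) - ?c n) *\<^sub>R w n) {?c n..?c (Suc n)}"
    using has_integral_const_real[of "w n" "?c n" "?c (Suc n)"] le(2) by simp
  then have "(g has_integral (?c (Suc n) - ?c n) *\<^sub>R w n) {?c n..?c (Suc n)}"
  proof (rule has_integral_spike_finite[of "{?c (Suc n)}", rotated 2])
    show "g t = w n" if "t \<in> {?c n..?c (Suc n)} - {?c (Suc n)}" for t
      using Suc.prems(2)[of n t] that by auto
  qed simp
  then have "(g has_integral lam n *\<^sub>R w n) {?c n..?c (Suc n)}" by simp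
  from has_integral_combine[OF le IH this] show ?case by simp
qed

context kuhn_simplex
begin

lemma enum_upd: "l < n \<Longrightarrow> enum j (upd l) = base (upd l) + (if l < j then 1 else 0)"
proof -
  assume l: "l < n"
  have "x = l" if "x < j" "upd l = upd x" "\<not> l < j" for x
    using upd_inj[of l x] l that by simp
  then have "upd l \<in> upd ` {..<j} \<longleftrightarrow> l < j" by fastforce
  then show ?thesis by (simp add: enum_def)
qed

text \<open>Along the chain of vertices the coordinate \<open>upd l\<close> rises once, from vertex
  \<open>l\<close> to vertex \<open>l + 1\<close>. Its offset above the base is therefore 1 minus
  the sum of the first \<open>l + 1\<close> weights, and the shifted floor jumps exactly when
  \<open>t\<close> reaches this sum. As \<open>t\<close> runs through \<open>[0, 1)\<close>, the
  floor visits the vertices in order, each for a time equal to its weight.\<close>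

lemma grid_floor_barycentric:
  assumes lam: "\<And>j. j \<le> n \<Longrightarrow> 0 \<le> lam j" "(\<Sum>j\<le>n. lam j) = 1"
    and x: "\<And>i. i < n \<Longrightarrow> x i = (\<Sum>j\<le>n. lam j * real (enum j i))"
    and j: "j \<le> n" and t: "(\<Sum>i<j. lam i) \<le> t" "t < (\<Sum>i<Suc j. lam i)"
  shows "grid_floor p n x t = enum j"
proof
  fix i
  let ?c = "\<lambda>j. \<Sum>i<j. lam i"
  have c_mono: "?c a \<le> ?c b" if "a \<le> b" "b \<le> Suc n" for a b
    using that lam(1) by (intro sum_mono2) auto
  have c_last: "?c (Suc n) = 1" using lam(2) by (simp add: lessThan_Suc_atMost)
  show "grid_floor p n x t i = enum j i"
  proof (cases "i < n")
    case False
    then show ?thesis using enum_eq_p[OF j, of i] by (simp add: grid_floor_def)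
  next
    case True
    then obtain l where l: "l < n" "i = upd l" using upd_surj by (metis imageE lessThan_iff)
    have xi: "x i = real (base i) + (1 - ?c (Suc l))"
    proof -
      have "x i = (\<Sum>j\<le>n. lam j * (real (base i) + (if l < j then 1 else 0)))"
        unfolding x[OF True] using l by (intro sum.cong) (auto simp: enum_upd)
      also have "\<dots> = (\<Sum>j\<le>n. lam j) * real (base i) + (\<Sum>j\<le>n. lam j * (if l < j then 1 else 0))"
        by (simp add: distrib_left sum.distrib sum_distrib_right)
      also have "(\<Sum>j\<le>n. lam j * (if l < j then 1 else 0)) = (\<Sum>j\<le>n. lam j) - (\<Sum>j\<le>n. if j < Suc l then lam j else 0)"
        unfolding sum_subtractf[symmetric] by (intro sum.cong) auto
      also have "(\<Sum>j\<le>n. if j < Suc l then lam j else 0) = ?c (Suc l)"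
        using l(1) by (intro sum.mono_neutral_cong_right) auto
      finally show ?thesis using lam(2) by simp
    qed
    have cb: "0 \<le> ?c (Suc l)" "?c (Suc l) \<le> 1" "0 \<le> t" "t < 1"
      using c_mono[of 0 "Suc l"] c_mono[of "Suc l" "Suc n"] c_mono[of 0 j] c_mono[of "Suc j" "Suc n"] l(1) j t c_last by auto
    have bp: "base i < p" using base True by auto
    show ?thesis
    proof (cases "l < j")
      case lj: True
      then have "?c (Suc l) \<le> t" using c_mono[of "Suc l" j] j t(1) by simp
      then have "\<lfloor>x i + t\<rfloor> = int (base i) + 1" unfolding xi using cb by (intro floor_unique) auto
      then show ?thesis using True lj l bp by (simp add: grid_floor_def enum_upd)
    next
      case lj: False
      then have "t < ?c (Suc l)" using c_mono[of "Suc j" "Suc l"] l(1) t(2) by simp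
      then have "\<lfloor>x i + t\<rfloor> = int (base i)" unfolding xi using cb by (intro floor_unique) auto
      then show ?thesis using True lj l bp by (simp add: grid_floor_def enum_upd)
    qed
  qed
qed

lemma interp_barycentric:
  fixes v :: "(nat \<Rightarrow> nat) \<Rightarrow> 'w::banach"
  assumes lam: "\<And>j. j \<le> n \<Longrightarrow> 0 \<le> lam j" "(\<Sum>j\<le>n. lam j) = 1"
    and x: "\<And>i. i < n \<Longrightarrow> x i = (\<Sum>j\<le>n. lam j * real (enum j i))"
  shows "((\<lambda>t. v (grid_floor p n x t)) has_integral (\<Sum>j\<le>n. lam j *\<^sub>R v (enum j))) {0..1}"
proof -
  have "((\<lambda>t. v (grid_floor p n x t)) has_integral (\<Sum>j<Suc n. lam j *\<^sub>R v (enum j))) {0..(\<Sum>i<Suc n. lam i)}"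
  proof (rule step_function_integral)
    fix j t assume j: "j < Suc n" "(\<Sum>i<j. lam i) \<le> t" "t < (\<Sum>i<Suc j. lam i)"
    have "grid_floor p n x t = enum j"
      by (rule grid_floor_barycentric[OF lam x _ j(2,3)]) (use j(1) in auto)
    then show "v (grid_floor p n x t) = v (enum j)" by simp
  qed (use lam in simp)
  then show ?thesis using lam(2) by (simp add: lessThan_Suc_atMost)
qed

text \<open>For positive weights no vertex is skipped, so an interior point determines its simplex.
  The set of floors is the map that later sends a zero to its simplex.\<close>

lemma grid_floor_image:
  assumes lam: "\<And>j. j \<le> n \<Longrightarrow> 0 < lam j" "(\<Sum>j\<le>n. lam j) = 1"
    and x: "\<And>i. i < n \<Longrightarrow> x i = (\<Sum>j\<le>n. lam j * real (enum j i))"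
  shows "grid_floor p n x ` {0..<1} = S"
proof
  let ?c = "\<lambda>j. \<Sum>i<j. lam i"
  have lam': "\<And>j. j \<le> n \<Longrightarrow> 0 \<le> lam j" using lam(1) by (simp add: less_imp_le)
  have c_last: "?c (Suc n) = 1" using lam(2) by (simp add: lessThan_Suc_atMost)
  show "grid_floor p n x ` {0..<1} \<subseteq> S"
  proof safe
    fix t :: real assume t: "t \<in> {0..<1}"
    define j where "j = (LEAST j. t < ?c (Suc j))"
    have ex: "t < ?c (Suc n)" using t c_last by simp
    have j: "t < ?c (Suc j)" "j \<le> n" unfolding j_def using LeastI[of "\<lambda>j. t < ?c (Suc j)", OF ex] Least_le[of "\<lambda>j. t < ?c (Suc j)", OF ex] by auto
    have "?c j \<le> t"
    proof (cases j)
      case (Suc i)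
      then have "\<not> t < ?c (Suc i)" using not_less_Least[of i "\<lambda>j. t < ?c (Suc j)"] by (simp add: j_def)
      then show ?thesis using Suc by simp
    qed (use t in simp)
    then have "grid_floor p n x t = enum j" using grid_floor_barycentric[OF lam' lam(2) x j(2)] j(1) by blast
    then show "grid_floor p n x t \<in> S" using enum_in j(2) by simp
  qed
  show "S \<subseteq> grid_floor p n x ` {0..<1}"
  proof
    fix k assume "k \<in> S"
    then obtain j where j: "j \<le> n" "k = enum j" by (auto simp: s_eq)
    have lt: "?c j < ?c (Suc j)" using lam(1)[OF j(1)] by simp
    have "grid_floor p n x (?c j) = enum j" by (rule grid_floor_barycentric[OF lam' lam(2) x j(1) order_refl lt])
    moreover have "0 \<le> ?c j" using lam' j(1) by (intro sum_nonneg) auto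
    moreover have "?c (Suc j) \<le> ?c (Suc n)" using lam' j(1) by (intro sum_mono2) auto
    ultimately show "k \<in> grid_floor p n x ` {0..<1}" using j(2) lt c_last by (intro image_eqI[of _ _ "?c j"]) auto
  qed
qed

text \<open>Barycentric coordinates of the point with fractional parts \<open>f\<close>.\<close>

definition bary :: "(nat \<Rightarrow> real) \<Rightarrow> nat \<Rightarrow> real" where
  "bary f j = (if j = 0 then 1 else f (upd (j - 1))) - (if j = n then 0 else f (upd j))"

text \<open>Summation by parts: the weights are differences of consecutive fractions, with 1 before
  the first and 0 after the last.\<close>

lemma bary_sum:
  fixes w :: "nat \<Rightarrow> 'w::real_vector"
  shows "(\<Sum>j\<le>n. bary f j *\<^sub>R w j) = w 0 + (\<Sum>l<n. f (upd l) *\<^sub>R (w (Suc l) - w l))"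
proof -
  let ?g = "\<lambda>j. if j = 0 then 1 else f (upd (j - 1))"
  have "(\<Sum>j<k. (?g j - ?g (Suc j)) *\<^sub>R w j) + ?g k *\<^sub>R w k = w 0 + (\<Sum>l<k. f (upd l) *\<^sub>R (w (Suc l) - w l))" for k
  proof (induction k)
    case (Suc k)
    have "(\<Sum>j<Suc k. (?g j - ?g (Suc j)) *\<^sub>R w j) + ?g (Suc k) *\<^sub>R w (Suc k)
       = ((\<Sum>j<k. (?g j - ?g (Suc j)) *\<^sub>R w j) + ?g k *\<^sub>R w k) + f (upd k) *\<^sub>R (w (Suc k) - w k)"
      by (simp add: algebra_simps)
    then show ?case using Suc by (simp add: algebra_simps)
  qed simp
  from this[of n] show ?thesis
    by (simp add: bary_def atMost_Suc_eq_insert_0 lessThan_Suc_atMost[symmetric])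
qed

lemma bary_total: "(\<Sum>j\<le>n. bary f j) = 1"
  using bary_sum[of f "\<lambda>_. 1::real"] by simp

lemma bary_point:
  assumes "i < n"
  shows "real (base i) + f i = (\<Sum>j\<le>n. bary f j * real (enum j i))"
proof -
  obtain l where l: "l < n" "i = upd l" using assms upd_surj by (metis imageE lessThan_iff)
  have "(\<Sum>j\<le>n. bary f j * real (enum j i)) = real (enum 0 i) + (\<Sum>k<n. f (upd k) * (real (enum (Suc k) i) - real (enum k i)))"
    using bary_sum[of f "\<lambda>j. real (enum j i)"] by simp
  also have "(\<Sum>k<n. f (upd k) * (real (enum (Suc k) i) - real (enum k i))) = (\<Sum>k<n. if k = l then f (upd l) else 0)"
    using l by (intro sum.cong) (auto simp: enum_upd)
  finally show ?thesis using l by (simp add: enum_0)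
qed

end


section \<open>Points of the cube, estimates and zeros of the interpolant\<close>

definition xbox :: "nat \<Rightarrow> nat \<Rightarrow> (nat \<Rightarrow> real) set" where
  "xbox p m = {x. \<forall>i<m. 0 \<le> x i \<and> x i \<le> real p}"

lemma kuhn_simplex_ksimplex: "kuhn_simplex p m base upd s \<Longrightarrow> ksimplex p m s"
  by (rule ksimplex.intros)

text \<open>The integer parts give the cell, and sorting the fractional parts decreasingly gives the
  order in which coordinates are raised; the weights are the successive drops, hence
  nonnegative.\<close>

lemma kuhn_simplex_cover:
  assumes p: "0 < p" and x: "x \<in> xbox p m"
  shows "\<exists>base upd s f. kuhn_simplex p m base upd s \<and> (\<forall>i<m. x i = real (base i) + f i) \<and>
    (\<forall>j\<le>m. 0 \<le> kuhn_simplex.bary m upd f j)"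
proof -
  \<comment> \<open>The cap \<open>p - 1\<close> assigns points of an upper face to the last cell,
    where the fraction is 1.\<close>
  define base where "base i = (if i < m then min (p - 1) (nat \<lfloor>x i\<rfloor>) else p)" for i
  define f where "f i = x i - real (base i)" for i
  have f01: "0 \<le> f i \<and> f i \<le> 1" if i: "i < m" for i
  proof -
    have xi: "0 \<le> x i" "x i \<le> real p" using x i by (auto simp: xbox_def)
    show ?thesis
    proof (cases "nat \<lfloor>x i\<rfloor> \<le> p - 1")
      case True
      then have "real (base i) = of_int \<lfloor>x i\<rfloor>" using i xi by (simp add: base_def)
      then show ?thesis unfolding f_def by linarith
    next
      case False
      then have "real p \<le> x i" using xi p by linarith
      moreover have "real (base i) = real p - 1" using False i p by (simp add: base_def)
      ultimately show ?thesis using xi unfolding f_def by linarith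
    qed
  qed
  define xs where "xs = sort_key (\<lambda>i. - f i) [0..<m]"
  define upd where "upd l = xs ! l" for l
  have xs: "distinct xs" "set xs = {..<m}" "length xs = m" by (auto simp: xs_def)
  have bij: "bij_betw upd {..<m} {..<m}"
    unfolding upd_def[abs_def] by (rule bij_betw_nth[OF xs(1)]) (simp_all add: xs)
  have srt: "sorted (map (\<lambda>i. - f i) xs)" unfolding xs_def by simp
  have dec: "f (upd (Suc l)) \<le> f (upd l)" if "Suc l < m" for l
    using sorted_nth_mono[OF srt, of l "Suc l"] that xs(3) by (simp add: upd_def)
  define s where "s = (\<lambda>i j. if j \<in> upd`{..< i} then Suc (base j) else base j) ` {.. m}"
  have ks: "kuhn_simplex p m base upd s"
    by standard (use p bij in \<open>auto simp: base_def s_def\<close>)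
  have updm: "upd l < m" if "l < m" for l using bij that bij_betwE by blast
  have "0 \<le> kuhn_simplex.bary m upd f j" if j: "j \<le> m" for j
  proof (cases j)
    case 0
    then show ?thesis using f01[OF updm[of 0]] j by (auto simp: kuhn_simplex.bary_def[OF ks])
  next
    case (Suc l)
    then show ?thesis using f01[OF updm[of l]] dec[of l] j by (auto simp: kuhn_simplex.bary_def[OF ks])
  qed
  moreover have "x i = real (base i) + f i" for i by (simp add: f_def)
  ultimately show ?thesis using ks by (intro exI conjI) auto
qed

lemma ksimplex_interp:
  fixes v :: "(nat \<Rightarrow> nat) \<Rightarrow> 'w::banach"
  assumes s: "ksimplex p m s" and a: "\<And>k. k \<in> s \<Longrightarrow> 0 \<le> a k" "sum a s = 1"
    and x: "\<And>i. i < m \<Longrightarrow> x i = (\<Sum>k\<in>s. a k * real (k i))"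
  shows "((\<lambda>t. v (grid_floor p m x t)) has_integral (\<Sum>k\<in>s. a k *\<^sub>R v k)) {0..1}"
    and "(\<And>k. k \<in> s \<Longrightarrow> 0 < a k) \<Longrightarrow> grid_floor p m x ` {0..<1} = s"
    and "k \<in> s \<Longrightarrow> i < m \<Longrightarrow> \<bar>real (k i) - x i\<bar> \<le> 1"
proof -
  obtain base upd where ks: "kuhn_simplex p m base upd s" using s by (auto elim: ksimplex.cases)
  then interpret kuhn_simplex p m base upd s .
  have re: "sum g s = (\<Sum>j\<le>m. g (enum j))" for g :: "(nat \<Rightarrow> nat) \<Rightarrow> 'b::comm_monoid_add"
    unfolding s_eq by (rule sum.reindex[OF inj_enum, unfolded o_def])
  have en: "enum j \<in> s" if "j \<le> m" for j using enum_in that .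
  have lam: "\<And>j. j \<le> m \<Longrightarrow> 0 \<le> a (enum j)" "(\<Sum>j\<le>m. a (enum j)) = 1"
    using a en by (auto simp: re)
  have x': "\<And>i. i < m \<Longrightarrow> x i = (\<Sum>j\<le>m. a (enum j) * real (enum j i))" using x by (simp add: re)
  show "((\<lambda>t. v (grid_floor p m x t)) has_integral (\<Sum>k\<in>s. a k *\<^sub>R v k)) {0..1}"
    unfolding re by (rule interp_barycentric[OF lam x'])
  show "grid_floor p m x ` {0..<1} = s" if "\<And>k. k \<in> s \<Longrightarrow> 0 < a k"
    by (rule grid_floor_image[OF _ lam(2) x']) (use that en in auto)
  show "\<bar>real (k i) - x i\<bar> \<le> 1" if k: "k \<in> s" "i < m"
  proof -
    have kb: "real (base i) \<le> real (k i)" "real (k i) \<le> real (base i) + 1" if "k \<in> s" for k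
      using base_le[OF that, of i] le_Suc_base[OF that, of i] by auto
    have "(\<Sum>k\<in>s. a k * real (base i)) \<le> x i"
      unfolding x[OF k(2)] by (intro sum_mono mult_left_mono) (use kb a in auto)
    moreover have "x i \<le> (\<Sum>k\<in>s. a k * (real (base i) + 1))"
      unfolding x[OF k(2)] by (intro sum_mono mult_left_mono) (use kb a in auto)
    ultimately have "real (base i) \<le> x i" "x i \<le> real (base i) + 1"
      using a(2) by (simp_all add: sum_distrib_right[symmetric])
    then show ?thesis using kb[OF k(1)] by linarith
  qed
qed

lemma interp_repr:
  assumes p: "0 < p" and x: "x \<in> xbox p m"
  shows "\<exists>s a. ksimplex p m s \<and> (\<forall>k\<in>s. 0 \<le> a k) \<and> sum a s = 1 \<and>
    (\<forall>i<m. x i = (\<Sum>k\<in>s. a k * real (k i)))"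
proof -
  obtain base upd s f where ks: "kuhn_simplex p m base upd s" and xf': "\<forall>i<m. x i = real (base i) + f i"
    and pos': "\<forall>j\<le>m. 0 \<le> kuhn_simplex.bary m upd f j"
    using kuhn_simplex_cover[OF p x] by (elim exE conjE) (rule that)
  note xf = xf'[rule_format] and pos = pos'[rule_format]
  interpret kuhn_simplex p m base upd s by (rule ks)
  define a where "a = (\<lambda>k. bary f (inv_into {..m} enum k))"
  have ae: "a (enum j) = bary f j" if "j \<le> m" for j
    using inv_into_f_f[OF inj_enum, of j] that by (simp add: a_def)
  have re: "sum g s = (\<Sum>j\<le>m. g (enum j))" for g :: "(nat \<Rightarrow> nat) \<Rightarrow> real"
    unfolding s_eq by (rule sum.reindex[OF inj_enum, unfolded o_def])
  show ?thesis
  proof (intro exI[of _ s] exI[of _ a] conjI ballI allI impI)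
    show "ksimplex p m s" by (rule kuhn_simplex_ksimplex[OF ks])
    show "0 \<le> a k" if "k \<in> s" for k using that pos ae by (auto simp: s_eq)
    show "sum a s = 1" unfolding re bary_total[of f, symmetric] by (intro sum.cong refl) (simp add: ae)
    show "x i = (\<Sum>k\<in>s. a k * real (k i))" if "i < m" for i
      unfolding re xf[OF that] bary_point[OF that] by (intro sum.cong refl) (simp add: ae)
  qed
qed

lemma kuhn_interp_has_integral:
  fixes v :: "(nat \<Rightarrow> nat) \<Rightarrow> 'w::banach"
  assumes p: "0 < p" and x: "x \<in> xbox p m"
  shows "((\<lambda>t. v (grid_floor p m x t)) has_integral kuhn_interp p m v x) {0..1}"
proof -
  obtain s a where s1: "ksimplex p m s" and s2: "\<forall>k\<in>s. 0 \<le> a k" and s3: "sum a s = 1"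
    and s4: "\<forall>i<m. x i = (\<Sum>k\<in>s. a k * real (k i))"
    using interp_repr[OF p x] by (elim exE conjE) (rule that)
  note s = s1 s2[rule_format] s3 s4[rule_format]
  from ksimplex_interp(1)[OF s, of v] show ?thesis
    unfolding kuhn_interp_def by (metis integral_unique)
qed

lemma kuhn_interp_ksimplex:
  fixes v :: "(nat \<Rightarrow> nat) \<Rightarrow> 'w::banach"
  assumes "ksimplex p m s" "\<And>k. k \<in> s \<Longrightarrow> 0 \<le> a k" "sum a s = 1"
    "\<And>i. i < m \<Longrightarrow> x i = (\<Sum>k\<in>s. a k * real (k i))"
  shows "kuhn_interp p m v x = (\<Sum>k\<in>s. a k *\<^sub>R v k)"
  unfolding kuhn_interp_def using ksimplex_interp(1)[OF assms, of v] by (rule integral_unique)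

lemma kuhn_interp_close:
  fixes v :: "(nat \<Rightarrow> nat) \<Rightarrow> 'w::banach"
  assumes p: "0 < p" and x: "x \<in> xbox p m"
    and close: "\<And>k. k \<in> kuhn_grid p m \<Longrightarrow> (\<And>i. i < m \<Longrightarrow> \<bar>real (k i) - x i\<bar> \<le> 1) \<Longrightarrow> norm (v k - w) \<le> \<epsilon>"
  shows "norm (kuhn_interp p m v x - w) \<le> \<epsilon>"
proof -
  obtain s a where s1: "ksimplex p m s" and s2: "\<forall>k\<in>s. 0 \<le> a k" and s3: "sum a s = 1"
    and s4: "\<forall>i<m. x i = (\<Sum>k\<in>s. a k * real (k i))"
    using interp_repr[OF p x] by (elim exE conjE) (rule that)
  note s = s1 s2[rule_format] s3 s4[rule_format]
  have "kuhn_interp p m v x - w = (\<Sum>k\<in>s. a k *\<^sub>R v k) - sum a s *\<^sub>R w"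
    using kuhn_interp_ksimplex[OF s, of v] s(3) by simp
  also have "\<dots> = (\<Sum>k\<in>s. a k *\<^sub>R (v k - w))"
    by (simp add: scaleR_diff_right sum_subtractf scaleR_sum_left)
  also have "norm \<dots> \<le> (\<Sum>k\<in>s. a k * \<epsilon>)"
  proof (rule sum_norm_le)
    fix k assume k: "k \<in> s"
    then have "norm (v k - w) \<le> \<epsilon>"
      using close[of k] ksimplex_subset_grid[OF s(1)] ksimplex_interp(3)[OF s k] by auto
    then show "norm (a k *\<^sub>R (v k - w)) \<le> a k * \<epsilon>" using s(2)[OF k] by (simp add: mult_left_mono)
  qed
  also have "\<dots> = \<epsilon>" using s(3) by (simp add: sum_distrib_right[symmetric])
  finally show ?thesis .
qed

lemma grid_floor_near:
  assumes "x \<in> xbox p m" "i < m" "0 \<le> t" "t \<le> 1"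
  shows "\<bar>real (grid_floor p m x t i) - x i\<bar> \<le> 1"
proof -
  have xi: "0 \<le> x i" "x i \<le> real p" using assms by (auto simp: xbox_def)
  have "real (nat \<lfloor>x i + t\<rfloor>) = of_int \<lfloor>x i + t\<rfloor>" using xi assms(3) by simp
  then have "x i + t - 1 < real (nat \<lfloor>x i + t\<rfloor>)" "real (nat \<lfloor>x i + t\<rfloor>) \<le> x i + t" by linarith+
  moreover have "grid_floor p m x t i = p \<and> real p \<le> real (nat \<lfloor>x i + t\<rfloor>) \<or> grid_floor p m x t i = nat \<lfloor>x i + t\<rfloor>"
    using assms(2) by (simp add: grid_floor_def min_def)
  ultimately show ?thesis using assms xi by linarith
qed

lemma grid_floor_in_grid: "grid_floor p m x t \<in> kuhn_grid p m"
  by (auto simp: grid_floor_def kuhn_grid_def)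

text \<open>This is the reason for the integral formula. For each shift both arguments become grid
  points, and since floors are monotone the coordinate differences keep their sign in
  \<open>t\<close>, so their absolute values integrate to the distances of the coordinates. A
  two-point estimate on the grid thus holds with the same constant off the grid.\<close>

lemma kuhn_interp_lipschitz:
  fixes v :: "(nat \<Rightarrow> nat) \<Rightarrow> 'w::banach"
  assumes p: "0 < p" and x: "x \<in> xbox p m" and y: "y \<in> xbox p m"
    and lip: "\<And>t. t \<in> {0..1} \<Longrightarrow> norm (v (grid_floor p m x t) - v (grid_floor p m y t)
        - (\<Sum>i<m. (real (grid_floor p m x t i) - real (grid_floor p m y t i)) *\<^sub>R a i))
      \<le> \<kappa> * (\<Sum>i<m. \<bar>real (grid_floor p m x t i) - real (grid_floor p m y t i)\<bar>)"
  shows "norm (kuhn_interp p m v x - kuhn_interp p m v y - (\<Sum>i<m. (x i - y i) *\<^sub>R a i)) \<le> \<kappa> * (\<Sum>i<m. \<bar>x i - y i\<bar>)"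
proof -
  have coord: "((\<lambda>t. real (grid_floor p m z t i)) has_integral z i) {0..1}" if z: "z \<in> xbox p m" "i < m" for z i
  proof -
    obtain s b where s1: "ksimplex p m s" and s2: "\<forall>k\<in>s. 0 \<le> b k" and s3: "sum b s = 1"
      and s4: "\<forall>i<m. z i = (\<Sum>k\<in>s. b k * real (k i))"
      using interp_repr[OF p z(1)] by (elim exE conjE) (rule that)
    note s = s1 s2[rule_format] s3 s4[rule_format]
    show ?thesis using ksimplex_interp(1)[OF s, of "\<lambda>k. real (k i)"] s(4)[OF z(2)] by simp
  qed
  have mono: "grid_floor p m z t i \<le> grid_floor p m z' t i" if "z i \<le> z' i" for z z' t i
    unfolding grid_floor_def using that by (simp add: min.coboundedI2 floor_mono nat_mono min.coboundedI1 min_le_iff_disj)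
  have dif: "((\<lambda>t. real (grid_floor p m x t i) - real (grid_floor p m y t i)) has_integral x i - y i) {0..1}" if "i < m" for i
    by (intro has_integral_diff coord x y that)
  have absd: "((\<lambda>t. \<bar>real (grid_floor p m x t i) - real (grid_floor p m y t i)\<bar>) has_integral \<bar>x i - y i\<bar>) {0..1}" if i: "i < m" for i
  proof (cases "x i \<le> y i")
    case True
    have "((\<lambda>t. - (real (grid_floor p m x t i) - real (grid_floor p m y t i))) has_integral - (x i - y i)) {0..1}"
      by (intro has_integral_neg dif i)
    moreover have "(\<lambda>t. \<bar>real (grid_floor p m x t i) - real (grid_floor p m y t i)\<bar>) = (\<lambda>t. - (real (grid_floor p m x t i) - real (grid_floor p m y t i)))"
      by (rule ext, rule abs_of_nonpos) (use mono[of x i y] True in simp)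
    moreover have "\<bar>x i - y i\<bar> = - (x i - y i)" using True by simp
    ultimately show ?thesis by (simp only:)
  next
    case False
    then have "(\<lambda>t. \<bar>real (grid_floor p m x t i) - real (grid_floor p m y t i)\<bar>) = (\<lambda>t. real (grid_floor p m x t i) - real (grid_floor p m y t i))"
      by (intro ext abs_of_nonneg) (use mono[of y i x] in simp)
    moreover have "\<bar>x i - y i\<bar> = x i - y i" using False by simp
    ultimately show ?thesis using dif[OF i] by (simp only:)
  qed
  let ?F = "\<lambda>t. v (grid_floor p m x t) - v (grid_floor p m y t)
        - (\<Sum>i<m. (real (grid_floor p m x t i) - real (grid_floor p m y t i)) *\<^sub>R a i)"
  let ?G = "\<lambda>t. \<kappa> * (\<Sum>i<m. \<bar>real (grid_floor p m x t i) - real (grid_floor p m y t i)\<bar>)"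
  have F: "(?F has_integral (kuhn_interp p m v x - kuhn_interp p m v y - (\<Sum>i<m. (x i - y i) *\<^sub>R a i))) {0..1}"
    by (intro has_integral_diff has_integral_sum has_integral_scaleR_left kuhn_interp_has_integral[OF p] x y dif) auto
  have G: "(?G has_integral \<kappa> * (\<Sum>i<m. \<bar>x i - y i\<bar>)) {0..1}"
    by (intro has_integral_mult_right has_integral_sum absd) auto
  have "norm (integral {0..1} ?F) \<le> integral {0..1} ?G"
    by (rule integral_norm_bound_integral) (use F G lip in \<open>auto simp: integrable_on_def\<close>)
  then show ?thesis unfolding integral_unique[OF F] integral_unique[OF G] .
qed

text \<open>A vanishing weight would be a relation among the remaining vertices, against general
  position. Zeros of a generic interpolant therefore lie in the interior of simplices.\<close>

lemma generic_weights_pos: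
  assumes s: "finite s" "card s = Suc m" and gen: "\<And>t. t \<subset> s \<Longrightarrow> fam_indep v t"
    and a: "\<And>k. k \<in> s \<Longrightarrow> 0 \<le> a k" "sum a s = 1" "(\<Sum>k\<in>s. a k *\<^sub>R v k) = 0" and k: "k \<in> s"
  shows "0 < a k"
proof (rule ccontr)
  assume "\<not> ?thesis"
  then have 0: "a k = 0" using a(1)[OF k] by simp
  then have sm: "(\<Sum>j\<in>s - {k}. a j *\<^sub>R v j) = 0" using a(3) s(1) k by (simp add: sum.remove)
  have "fam_indep v (s - {k})" using k by (intro gen) auto
  then have "a j = 0" if "j \<in> s - {k}" for j using fam_indepD[OF _ sm that] by blast
  then have "sum a s = 0" using 0 by (intro sum.neutral) auto
  then show False using a(2) by simp
qed

lemma generic_weights_unique: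
  assumes s: "finite s" "card s = Suc m" and gen: "\<And>t. t \<subset> s \<Longrightarrow> fam_indep v t"
    and a: "\<And>k. k \<in> s \<Longrightarrow> 0 \<le> a k" "sum a s = 1" "(\<Sum>k\<in>s. a k *\<^sub>R v k) = 0"
    and b: "(\<Sum>k\<in>s. b k *\<^sub>R v k) = 0" and k: "k \<in> s"
  shows "b k = sum b s * a k"
proof -
  have pos: "0 < a k" by (rule generic_weights_pos[OF s gen a k])
  define r where "r = b k / a k"
  have "(\<Sum>j\<in>s. (b j - r * a j) *\<^sub>R v j) = (\<Sum>j\<in>s. b j *\<^sub>R v j) - r *\<^sub>R (\<Sum>j\<in>s. a j *\<^sub>R v j)"
    by (simp add: scaleR_diff_left sum_subtractf scaleR_sum_right)
  then have "(\<Sum>j\<in>s. (b j - r * a j) *\<^sub>R v j) = 0" using a(3) b by simp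
  moreover have bk: "b k - r * a k = 0" using pos by (simp add: r_def)
  ultimately have sm: "(\<Sum>j\<in>s - {k}. (b j - r * a j) *\<^sub>R v j) = 0" using s(1) k by (simp add: sum.remove)
  have "fam_indep v (s - {k})" using k by (intro gen) auto
  then have "b j - r * a j = 0" if "j \<in> s - {k}" for j using fam_indepD[OF _ sm that] by blast
  then have "\<forall>j\<in>s. b j = r * a j" using bk by auto
  then have "sum b s = r * sum a s" by (simp add: sum_distrib_left)
  then show ?thesis using a(2) bk by simp
qed

text \<open>Weights of the origin are positive and unique: a simplex whose image contains the origin
  carries exactly one zero, and the zero returns its simplex through the floors.\<close>

lemma kuhn_interp_zeros:
  fixes v :: "(nat \<Rightarrow> nat) \<Rightarrow> 'w::banach"
  assumes p: "0 < p"
    and gen: "\<And>t. t \<subseteq> kuhn_grid p m \<Longrightarrow> card t \<le> m \<Longrightarrow> fam_indep v t"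
  shows "bij_betw (\<lambda>x. grid_floor p m x ` {0..<1})
    {x \<in> xbox p m. (\<forall>i\<ge>m. x i = 0) \<and> kuhn_interp p m v x = 0} {s. ksimplex p m s \<and> conv0 v s}"
proof -
  have gen': "fam_indep v t" if "ksimplex p m s" "t \<subset> s" for s t
    using gen[of t] ksimplex_subset_grid[OF that(1)] psubset_card_mono[OF ksimplex_finite[OF that(1)] that(2)]
      ksimplex_card[OF that(1)] that(2) by auto
  have cs: "card s = Suc m" if "ksimplex p m s" for s using ksimplex_card[OF that] by simp
  have R: "\<exists>s a. ksimplex p m s \<and> (\<forall>k\<in>s. 0 < a k) \<and> sum a s = 1 \<and> (\<Sum>k\<in>s. a k *\<^sub>R v k) = 0 \<and>
      (\<forall>i<m. x i = (\<Sum>k\<in>s. a k * real (k i))) \<and> grid_floor p m x ` {0..<1} = s"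
    if x: "x \<in> xbox p m" "kuhn_interp p m v x = 0" for x
  proof -
    obtain s a where s1: "ksimplex p m s" and s2: "\<forall>k\<in>s. 0 \<le> a k" and s3: "sum a s = 1"
      and s4: "\<forall>i<m. x i = (\<Sum>k\<in>s. a k * real (k i))"
      using interp_repr[OF p x(1)] by (elim exE conjE) (rule that)
    note s = s1 s2[rule_format] s3 s4[rule_format]
    have 0: "(\<Sum>k\<in>s. a k *\<^sub>R v k) = 0" using kuhn_interp_ksimplex[OF s, of v] x(2) by simp
    have pos: "0 < a k" if "k \<in> s" for k
      by (rule generic_weights_pos[OF ksimplex_finite[OF s(1)] cs[OF s(1)] gen'[OF s(1)] s(2,3) 0 that])
    show ?thesis
      by (intro exI[of _ s] exI[of _ a]) (use s pos 0 ksimplex_interp(2)[OF s pos] in auto)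
  qed
  show ?thesis
    unfolding bij_betw_def
  proof
    show "inj_on (\<lambda>x. grid_floor p m x ` {0..<1}) {x \<in> xbox p m. (\<forall>i\<ge>m. x i = 0) \<and> kuhn_interp p m v x = 0}"
    proof (rule inj_onI)
      fix x y assume x: "x \<in> {x \<in> xbox p m. (\<forall>i\<ge>m. x i = 0) \<and> kuhn_interp p m v x = 0}"
        and y: "y \<in> {x \<in> xbox p m. (\<forall>i\<ge>m. x i = 0) \<and> kuhn_interp p m v x = 0}"
        and eq: "grid_floor p m x ` {0..<1} = grid_floor p m y ` {0..<1}"
      obtain s a where s: "ksimplex p m s" "\<forall>k\<in>s. 0 < a k" "sum a s = 1" "(\<Sum>k\<in>s. a k *\<^sub>R v k) = 0"
        "\<forall>i<m. x i = (\<Sum>k\<in>s. a k * real (k i))" "grid_floor p m x ` {0..<1} = s" using R[of x] x by auto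
      obtain s' b where b: "ksimplex p m s'" "\<forall>k\<in>s'. 0 < b k" "sum b s' = 1" "(\<Sum>k\<in>s'. b k *\<^sub>R v k) = 0"
        "\<forall>i<m. y i = (\<Sum>k\<in>s'. b k * real (k i))" "grid_floor p m y ` {0..<1} = s'" using R[of y] y by auto
      have ss: "s' = s" using eq s(6) b(6) by simp
      have "b k = sum b s * a k" if "k \<in> s" for k
        by (rule generic_weights_unique[OF ksimplex_finite[OF s(1)] cs[OF s(1)] gen'[OF s(1)] _ s(3,4) _ that])
          (use s(2) b(4) ss in \<open>auto intro: less_imp_le\<close>)
      then have ba: "b k = a k" if "k \<in> s" for k using b(3) ss that by simp
      show "x = y"
      proof
        fix i show "x i = y i"
          using x y s(5) b(5) ba ss by (cases "i < m") (auto intro!: sum.cong)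
      qed
    qed
    show "(\<lambda>x. grid_floor p m x ` {0..<1}) ` {x \<in> xbox p m. (\<forall>i\<ge>m. x i = 0) \<and> kuhn_interp p m v x = 0}
      = {s. ksimplex p m s \<and> conv0 v s}"
    proof safe
      fix x assume x: "x \<in> xbox p m" "kuhn_interp p m v x = 0"
      obtain s a where s: "ksimplex p m s" "\<forall>k\<in>s. 0 < a k" "sum a s = 1" "(\<Sum>k\<in>s. a k *\<^sub>R v k) = 0"
        "\<forall>i<m. x i = (\<Sum>k\<in>s. a k * real (k i))" "grid_floor p m x ` {0..<1} = s" using R[OF x] by auto
      show "ksimplex p m (grid_floor p m x ` {0..<1})" using s by simp
      show "conv0 v (grid_floor p m x ` {0..<1})" unfolding conv0_def s(6) using s(2-4) by (auto intro: less_imp_le)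
    next
      fix s assume s: "ksimplex p m s" "conv0 v s"
      then obtain a where a: "\<forall>k\<in>s. 0 \<le> a k" "sum a s = 1" "(\<Sum>k\<in>s. a k *\<^sub>R v k) = 0" by (auto simp: conv0_def)
      define x where "x i = (if i < m then \<Sum>k\<in>s. a k * real (k i) else 0)" for i
      have a': "\<And>k. k \<in> s \<Longrightarrow> 0 \<le> a k" using a(1) by blast
      have pos: "0 < a k" if "k \<in> s" for k
        by (rule generic_weights_pos[OF ksimplex_finite[OF s(1)] cs[OF s(1)] gen'[OF s(1)] a' a(2,3) that])
      have xi: "\<And>i. i < m \<Longrightarrow> x i = (\<Sum>k\<in>s. a k * real (k i))" by (simp add: x_def)
      have "x \<in> xbox p m"
        unfolding xbox_def
      proof (safe)
        fix i assume i: "i < m"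
        have kp: "k i \<le> p" if "k \<in> s" for k using ksimplex_subset_grid[OF s(1)] that i by (auto simp: kuhn_grid_def)
        show "0 \<le> x i" unfolding xi[OF i] using a' by (intro sum_nonneg) auto
        have "x i \<le> (\<Sum>k\<in>s. a k * real p)" unfolding xi[OF i] by (intro sum_mono mult_left_mono) (use kp a' in auto)
        then show "x i \<le> real p" using a(2) by (simp add: sum_distrib_right[symmetric])
      qed
      moreover have "kuhn_interp p m v x = 0" using kuhn_interp_ksimplex[OF s(1) a' a(2) xi, of v] a(3) by simp
      moreover have "grid_floor p m x ` {0..<1} = s" by (rule ksimplex_interp(2)[OF s(1) a' a(2) xi pos])
      moreover have "\<forall>i\<ge>m. x i = 0" by (simp add: x_def)
      ultimately show "s \<in> (\<lambda>x. grid_floor p m x ` {0..<1}) ` {x \<in> xbox p m. (\<forall>i\<ge>m. x i = 0) \<and> kuhn_interp p m v x = 0}"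
        by (intro image_eqI[of _ _ x]) auto
    qed
  qed
qed

text \<open>Positive weights keep nearby points in the same simplex, where the map is affine. The
  partial derivatives are independent because a null direction would give a second set of weights
  for the origin.\<close>

lemma kuhn_interp_locally_affine:
  fixes v :: "(nat \<Rightarrow> nat) \<Rightarrow> 'w::banach"
  assumes p: "0 < p"
    and gen: "\<And>t. t \<subseteq> kuhn_grid p m \<Longrightarrow> card t \<le> m \<Longrightarrow> fam_indep v t"
    and vB: "v ` kuhn_grid p m \<subseteq> Y" "subspace Y"
    and x: "x \<in> xbox p m" "kuhn_interp p m v x = 0"
  shows "\<exists>a e. fam_indep a {..<m} \<and> (\<forall>i<m. a i \<in> Y) \<and> 0 < e \<and>
    (\<forall>y. (\<forall>i<m. \<bar>y i - x i\<bar> < e) \<longrightarrow> kuhn_interp p m v y = (\<Sum>i<m. (y i - x i) *\<^sub>R a i))"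
proof -
  obtain base upd s f where ks: "kuhn_simplex p m base upd s" and xf': "\<forall>i<m. x i = real (base i) + f i"
    and nn': "\<forall>j\<le>m. 0 \<le> kuhn_simplex.bary m upd f j"
    using kuhn_simplex_cover[OF p x(1)] by (elim exE conjE) (rule that)
  note xf = xf'[rule_format] and nn = nn'[rule_format]
  interpret kuhn_simplex p m base upd s by (rule ks)
  have kss: "ksimplex p m s" by (rule kuhn_simplex_ksimplex[OF ks])
  define w where "w j = v (enum j)" for j
  have wY: "w j \<in> Y" if "j \<le> m" for j
    using vB(1) ksimplex_subset_grid[OF kss] enum_in[OF that] by (auto simp: w_def)
  have wgen: "fam_indep w t" if t: "t \<subset> {..m}" for t
  proof -
    have it: "inj_on enum t" using inj_enum t by (meson inj_on_subset psubset_imp_subset)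
    have ft: "finite t" using t finite_subset by blast
    have "card t < Suc m" using psubset_card_mono[OF _ t] by simp
    then have "fam_indep v (enum ` t)"
      using t enum_in ksimplex_subset_grid[OF kss] by (intro gen) (auto simp: card_image[OF it])
    then show ?thesis unfolding fam_indep_def
    proof (intro allI impI ballI)
      fix c j assume fi: "\<forall>c. (\<Sum>k\<in>enum ` t. c k *\<^sub>R v k) = 0 \<longrightarrow> (\<forall>k\<in>enum ` t. c k = 0)"
        and 0: "(\<Sum>k\<in>t. c k *\<^sub>R w k) = 0" and j: "j \<in> t"
      have "(\<Sum>k\<in>enum ` t. c (inv_into t enum k) *\<^sub>R v k) = 0"
        using 0 by (simp add: sum.reindex[OF it] w_def inv_into_f_f[OF it] cong: sum.cong)
      then have "c (inv_into t enum (enum j)) = 0"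
        using fi[rule_format, of "\<lambda>k. c (inv_into t enum k)" "enum j"] j by simp
      then show "c j = 0" by (simp add: inv_into_f_f[OF it j])
    qed
  qed
  have interp: "kuhn_interp p m v y = (\<Sum>j\<le>m. bary g j *\<^sub>R w j)"
    if "\<And>j. j \<le> m \<Longrightarrow> 0 \<le> bary g j" "\<And>i. i < m \<Longrightarrow> y i = real (base i) + g i" for y g
    unfolding kuhn_interp_def w_def
    by (rule integral_unique, rule interp_barycentric) (use that bary_total bary_point in auto)
  have 0: "(\<Sum>j\<le>m. bary f j *\<^sub>R w j) = 0" using interp[OF nn xf] x(2) by simp
  have pos: "0 < bary f j" if "j \<le> m" for j
    using generic_weights_pos[of "{..m}" m w "bary f" j] wgen nn bary_total 0 that by simp
  define a where "a i = w (Suc (inv_into {..<m} upd i)) - w (inv_into {..<m} upd i)" for i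
  have au: "a (upd l) = w (Suc l) - w l" if "l < m" for l
    using inv_into_f_f[OF inj_upd, of l] that by (simp add: a_def)
  have bs: "(\<Sum>j\<le>m. bary g j *\<^sub>R w j) = w 0 + (\<Sum>i<m. g i *\<^sub>R a i)" for g
  proof -
    have "(\<Sum>l<m. g (upd l) *\<^sub>R (w (Suc l) - w l)) = (\<Sum>l<m. g (upd l) *\<^sub>R a (upd l))"
      by (intro sum.cong refl) (simp add: au)
    also have "\<dots> = (\<Sum>i<m. g i *\<^sub>R a i)" by (rule sum.reindex_bij_betw[OF upd])
    finally show ?thesis using bary_sum[of g w] by simp
  qed
  have indep: "fam_indep a {..<m}"
    unfolding fam_indep_def
  proof (intro allI impI ballI)
    fix \<eta> i assume \<eta>: "(\<Sum>i<m. \<eta> i *\<^sub>R a i) = 0" and i: "i \<in> {..<m}"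
    let ?g = "\<lambda>i. f i + \<eta> i"
    have "(\<Sum>j\<le>m. bary ?g j *\<^sub>R w j) = 0"
      using \<eta> 0 unfolding bs by (simp add: scaleR_add_left sum.distrib)
    then have "bary ?g j = bary f j" if "j \<le> m" for j
      using generic_weights_unique[of "{..m}" m w "bary f" "bary ?g" j] wgen nn bary_total 0 that by simp
    then have "(\<Sum>j\<le>m. bary ?g j * real (enum j i)) = (\<Sum>j\<le>m. bary f j * real (enum j i))" by (intro sum.cong) auto
    then show "\<eta> i = 0" using bary_point[of i ?g] bary_point[of i f] i by simp
  qed
  \<comment> \<open>Half the least weight: a weight involves at most two coordinates, so moving
    every coordinate by less than \<open>e\<close> changes it by at most
    \<open>2 * e\<close>.\<close>
  define e where "e = Min (bary f ` {..m}) / 2"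
  have eb: "2 * e \<le> bary f j" if "j \<le> m" for j unfolding e_def using that by simp
  have "Min (bary f ` {..m}) \<in> bary f ` {..m}" by (rule Min_in) auto
  then have e: "0 < e" using pos by (auto simp: e_def)
  have "kuhn_interp p m v y = (\<Sum>i<m. (y i - x i) *\<^sub>R a i)" if y: "\<And>i. i < m \<Longrightarrow> \<bar>y i - x i\<bar> < e" for y
  proof -
    define g where "g i = y i - real (base i)" for i
    have gf: "\<bar>g i - f i\<bar> < e" if "i < m" for i using y[OF that] xf[OF that] by (simp add: g_def)
    have "0 \<le> bary g j" if j: "j \<le> m" for j
    proof -
      have u1: "\<bar>g (upd (j - 1)) - f (upd (j - 1))\<bar> < e" if "j \<noteq> 0" by (intro gf upd_space) (use that j in simp)
      have u2: "\<bar>g (upd j) - f (upd j)\<bar> < e" if "j \<noteq> m" by (intro gf upd_space) (use that j in simp)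
      have "\<bar>bary g j - bary f j\<bar> \<le> 2 * e"
        using u1 u2 e unfolding bary_def by (cases "j = 0"; cases "j = m") (simp; linarith)+
      then show ?thesis using eb[OF j] by linarith
    qed
    then have "kuhn_interp p m v y = w 0 + (\<Sum>i<m. g i *\<^sub>R a i)"
      using interp[of g y] bs by (simp add: g_def)
    also have "\<dots> = (w 0 + (\<Sum>i<m. f i *\<^sub>R a i)) + (\<Sum>i<m. (g i - f i) *\<^sub>R a i)"
      by (simp add: scaleR_diff_left sum_subtractf)
    also have "w 0 + (\<Sum>i<m. f i *\<^sub>R a i) = 0" using 0 bs by simp
    also have "(\<Sum>i<m. (g i - f i) *\<^sub>R a i) = (\<Sum>i<m. (y i - x i) *\<^sub>R a i)"
      by (intro sum.cong refl) (simp add: g_def xf)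
    finally show ?thesis by simp
  qed
  moreover have "a i \<in> Y" if "i < m" for i
  proof -
    have "i \<in> upd ` {..<m}" using that upd_surj by simp
    then obtain l where "l < m" "i = upd l" by auto
    then show ?thesis using au wY[of l] wY[of "Suc l"] subspace_diff[OF vB(2)] by simp
  qed
  ultimately show ?thesis using indep e by (intro exI[of _ a] exI[of _ e]) simp
qed


section \<open>Rescaling to cubes of arbitrary radius and mesh\<close>

text \<open>Using functions that vanish beyond \<open>m\<close> lets the dimension be a variable
  number and still gives a compact set.\<close>

definition cubem :: "nat \<Rightarrow> real \<Rightarrow> (nat \<Rightarrow> real) set" where
  "cubem m r = {\<xi>. (\<forall>i<m. \<bar>\<xi> i\<bar> \<le> r) \<and> (\<forall>i\<ge>m. \<xi> i = 0)}"

lemma compact_cubem: "compact (cubem m r)"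
proof -
  have "compactin (product_topology (\<lambda>i. euclidean) (UNIV::nat set)) (PiE UNIV (\<lambda>i. if i < m then {-r..r} else {0}))"
    by (subst compactin_PiE) auto
  moreover have "PiE UNIV (\<lambda>i. if i < m then {-r..r} else {0}) = cubem m r"
  proof (rule Set.set_eqI)
    fix x :: "nat \<Rightarrow> real"
    have "x i \<in> (if i < m then {-r..r} else {0}) \<longleftrightarrow> (i < m \<longrightarrow> \<bar>x i\<bar> \<le> r) \<and> (m \<le> i \<longrightarrow> x i = 0)" for i
      by (auto simp: abs_le_iff)
    then show "x \<in> PiE UNIV (\<lambda>i. if i < m then {-r..r} else {0}) \<longleftrightarrow> x \<in> cubem m r"
      unfolding PiE_UNIV_domain cubem_def Pi_iff mem_Collect_eq by (simp only: ball_UNIV) blast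
  qed
  ultimately show ?thesis by (simp only: euclidean_product_topology compactin_euclidean_iff)
qed

text \<open>The product metric sums coordinate distances with weights \<open>(1/2)^n\<close>, whose
  total is 2.\<close>

lemma dist_fun_le:
  fixes x y :: "nat \<Rightarrow> real"
  assumes "\<And>i. \<bar>x i - y i\<bar> \<le> d"
  shows "dist x y \<le> 2 * d"
proof -
  have d: "0 \<le> d" using assms[of 0] by linarith
  have gs: "(\<lambda>n. (1/2)^n * d) sums (2 * d)"
    using sums_mult2[OF geometric_sums[of "1/2::real"], of d] by simp
  have le: "(1/2)^n * min (dist (x (from_nat n)) (y (from_nat n))) 1 \<le> (1/2)^n * d" for n
    by (intro mult_left_mono) (use assms[of "from_nat n"] in \<open>auto simp: dist_real_def min_def\<close>)
  have "dist x y \<le> suminf (\<lambda>n. (1/2)^n * d)"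
    unfolding dist_fun_def
  proof (rule suminf_le[OF le])
    show "summable (\<lambda>n. (1/2)^n * min (dist (x (from_nat n)) (y (from_nat n))) 1)"
      by (rule summable_comparison_test'[OF sums_summable[OF gs], of 0]) (use le in auto)
  qed (rule sums_summable[OF gs])
  then show ?thesis using sums_unique[OF gs] by simp
qed

lemma cubem_uniformly_continuous:
  fixes \<gamma> :: "(nat \<Rightarrow> real) \<Rightarrow> 'w::real_normed_vector"
  assumes "continuous_on (cubem m r) \<gamma>" "0 < e"
  shows "\<exists>d>0. \<forall>\<xi>\<in>cubem m r. \<forall>\<zeta>\<in>cubem m r. (\<forall>i<m. \<bar>\<xi> i - \<zeta> i\<bar> \<le> d) \<longrightarrow> norm (\<gamma> \<xi> - \<gamma> \<zeta>) < e"
proof -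
  have "uniformly_continuous_on (cubem m r) \<gamma>"
    using compact_uniformly_continuous[OF assms(1) compact_cubem] .
  then obtain d where d: "d > 0" "\<And>\<xi> \<zeta>. \<xi> \<in> cubem m r \<Longrightarrow> \<zeta> \<in> cubem m r \<Longrightarrow> dist \<zeta> \<xi> < d \<Longrightarrow> dist (\<gamma> \<zeta>) (\<gamma> \<xi>) < e"
    using assms(2) unfolding uniformly_continuous_on_def by metis
  show ?thesis
  proof (intro exI[of _ "d/4"] conjI ballI impI)
    fix \<xi> \<zeta> assume x: "\<xi> \<in> cubem m r" "\<zeta> \<in> cubem m r" "\<forall>i<m. \<bar>\<xi> i - \<zeta> i\<bar> \<le> d/4"
    have "\<bar>\<xi> i - \<zeta> i\<bar> \<le> d/4" for i
      using x d(1) by (cases "i < m") (auto simp: cubem_def)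
    then have "dist \<xi> \<zeta> \<le> 2 * (d/4)" by (rule dist_fun_le)
    then show "norm (\<gamma> \<xi> - \<gamma> \<zeta>) < e" using d(2)[OF x(2,1)] d(1) by (simp add: dist_norm)
  qed (use d in simp)
qed

lemma compact_norm_lower_bound:
  fixes \<gamma> :: "'a::topological_space \<Rightarrow> 'w::real_normed_vector"
  assumes "compact S" "continuous_on S \<gamma>" "\<And>x. x \<in> S \<Longrightarrow> \<gamma> x \<noteq> 0"
  obtains \<mu> where "\<mu> > 0" "\<And>x. x \<in> S \<Longrightarrow> \<mu> \<le> norm (\<gamma> x)"
proof (cases "S = {}")
  case True
  then show ?thesis using that[of 1] by simp
next
  case False
  obtain x0 where "x0 \<in> S" "\<forall>x\<in>S. norm (\<gamma> x0) \<le> norm (\<gamma> x)"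
    using continuous_attains_inf[OF assms(1) False continuous_on_norm[OF assms(2)]] by metis
  then show ?thesis using that[of "norm (\<gamma> x0)"] assms(3) by simp
qed

definition grid_pt :: "real \<Rightarrow> real \<Rightarrow> nat \<Rightarrow> (nat \<Rightarrow> nat) \<Rightarrow> nat \<Rightarrow> real" where
  "grid_pt r h m k = (\<lambda>i. if i < m then h * real (k i) - r else 0)"

definition grid_coord :: "real \<Rightarrow> real \<Rightarrow> nat \<Rightarrow> (nat \<Rightarrow> real) \<Rightarrow> nat \<Rightarrow> real" where
  "grid_coord r h m \<xi> = (\<lambda>i. if i < m then (\<xi> i + r) / h else 0)"

definition plin :: "real \<Rightarrow> real \<Rightarrow> nat \<Rightarrow> nat \<Rightarrow> ((nat \<Rightarrow> nat) \<Rightarrow> 'w::real_normed_vector) \<Rightarrow> (nat \<Rightarrow> real) \<Rightarrow> 'w" where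
  "plin r h p m v \<xi> = kuhn_interp p m v (grid_coord r h m \<xi>)"

context
  fixes r h :: real and p m :: nat
  assumes h_pos: "0 < h" and hp: "h * real p = 2 * r" and p: "0 < p"
begin

lemma grid_coord_xbox: "\<xi> \<in> cubem m r \<Longrightarrow> grid_coord r h m \<xi> \<in> xbox p m"
proof -
  assume "\<xi> \<in> cubem m r"
  then have "0 \<le> \<xi> i + r" "\<xi> i + r \<le> h * p" if "i < m" for i
    using that hp by (auto simp: cubem_def abs_le_iff dest!: spec[of _ i])
  then show ?thesis using h_pos by (auto simp: xbox_def grid_coord_def pos_divide_le_eq mult.commute)
qed

lemma grid_pt_cubem: "k \<in> kuhn_grid p m \<Longrightarrow> grid_pt r h m k \<in> cubem m r"
proof -
  assume k: "k \<in> kuhn_grid p m"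
  have "0 \<le> h * real (k i)" "h * real (k i) \<le> h * real p" if "i < m" for i
    using k that h_pos by (auto simp: kuhn_grid_def intro!: mult_left_mono)
  then show ?thesis using hp by (auto simp: cubem_def grid_pt_def abs_le_iff)
qed

lemma grid_diff: "i < m \<Longrightarrow> grid_pt r h m k i - \<xi> i = h * (real (k i) - grid_coord r h m \<xi> i)"
  using h_pos by (simp add: grid_pt_def grid_coord_def field_simps)

lemma grid_diff2: "i < m \<Longrightarrow> grid_pt r h m k i - grid_pt r h m k' i = h * (real (k i) - real (k' i))"
  by (simp add: grid_pt_def right_diff_distrib)

lemma coord_diff: "i < m \<Longrightarrow> \<xi> i - \<zeta> i = h * (grid_coord r h m \<xi> i - grid_coord r h m \<zeta> i)"
  using h_pos by (simp add: grid_coord_def field_simps)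

lemma grid_near_iff: "i < m \<Longrightarrow> \<bar>grid_pt r h m k i - \<xi> i\<bar> \<le> h \<longleftrightarrow> \<bar>real (k i) - grid_coord r h m \<xi> i\<bar> \<le> 1"
  unfolding grid_diff abs_mult using h_pos mult_le_cancel_left_pos[of h "\<bar>real (k i) - grid_coord r h m \<xi> i\<bar>" 1] by simp

lemma plin_close:
  fixes v :: "(nat \<Rightarrow> nat) \<Rightarrow> 'w::banach"
  assumes \<xi>: "\<xi> \<in> cubem m r"
    and close: "\<And>k. k \<in> kuhn_grid p m \<Longrightarrow> (\<And>i. i < m \<Longrightarrow> \<bar>grid_pt r h m k i - \<xi> i\<bar> \<le> h) \<Longrightarrow> norm (v k - w) \<le> \<epsilon>"
  shows "norm (plin r h p m v \<xi> - w) \<le> \<epsilon>"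
  unfolding plin_def
  by (rule kuhn_interp_close[OF p grid_coord_xbox[OF \<xi>]]) (use close grid_near_iff in blast)

lemma plin_lipschitz:
  fixes v :: "(nat \<Rightarrow> nat) \<Rightarrow> 'w::banach"
  assumes \<xi>: "\<xi> \<in> cubem m r" and \<zeta>: "\<zeta> \<in> cubem m r"
    and lip: "\<And>k k'. k \<in> kuhn_grid p m \<Longrightarrow> k' \<in> kuhn_grid p m \<Longrightarrow>
      (\<And>i. i < m \<Longrightarrow> \<bar>grid_pt r h m k i - \<xi> i\<bar> \<le> h) \<Longrightarrow> (\<And>i. i < m \<Longrightarrow> \<bar>grid_pt r h m k' i - \<zeta> i\<bar> \<le> h) \<Longrightarrow>
      norm (v k - v k' - (\<Sum>i<m. (grid_pt r h m k i - grid_pt r h m k' i) *\<^sub>R a i)) \<le> \<kappa> * (\<Sum>i<m. \<bar>grid_pt r h m k i - grid_pt r h m k' i\<bar>)"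
  shows "norm (plin r h p m v \<xi> - plin r h p m v \<zeta> - (\<Sum>i<m. (\<xi> i - \<zeta> i) *\<^sub>R a i)) \<le> \<kappa> * (\<Sum>i<m. \<bar>\<xi> i - \<zeta> i\<bar>)"
proof -
  let ?x = "grid_coord r h m \<xi>" and ?y = "grid_coord r h m \<zeta>"
  have "norm (kuhn_interp p m v ?x - kuhn_interp p m v ?y - (\<Sum>i<m. (?x i - ?y i) *\<^sub>R (h *\<^sub>R a i))) \<le> (\<kappa> * h) * (\<Sum>i<m. \<bar>?x i - ?y i\<bar>)"
  proof (rule kuhn_interp_lipschitz[OF p grid_coord_xbox[OF \<xi>] grid_coord_xbox[OF \<zeta>]])
    fix t :: real assume t: "t \<in> {0..1}"
    let ?k = "grid_floor p m ?x t" and ?k' = "grid_floor p m ?y t"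
    have n1: "\<bar>grid_pt r h m ?k i - \<xi> i\<bar> \<le> h" and n2: "\<bar>grid_pt r h m ?k' i - \<zeta> i\<bar> \<le> h" if "i < m" for i
      using grid_near_iff[OF that] grid_floor_near[OF grid_coord_xbox[OF \<xi>] that] grid_floor_near[OF grid_coord_xbox[OF \<zeta>] that] t by auto
    have "norm (v ?k - v ?k' - (\<Sum>i<m. (grid_pt r h m ?k i - grid_pt r h m ?k' i) *\<^sub>R a i)) \<le> \<kappa> * (\<Sum>i<m. \<bar>grid_pt r h m ?k i - grid_pt r h m ?k' i\<bar>)"
      by (rule lip) (use n1 n2 grid_floor_in_grid in auto)
    moreover have "(\<Sum>i<m. (grid_pt r h m ?k i - grid_pt r h m ?k' i) *\<^sub>R a i) = (\<Sum>i<m. (real (?k i) - real (?k' i)) *\<^sub>R (h *\<^sub>R a i))"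
      by (intro sum.cong refl) (simp only: grid_diff2 lessThan_iff scaleR_scaleR mult.commute)
    moreover have "(\<Sum>i<m. \<bar>grid_pt r h m ?k i - grid_pt r h m ?k' i\<bar>) = h * (\<Sum>i<m. \<bar>real (?k i) - real (?k' i)\<bar>)"
      unfolding sum_distrib_left
    proof (intro sum.cong refl)
      fix i assume "i \<in> {..<m}"
      then show "\<bar>grid_pt r h m ?k i - grid_pt r h m ?k' i\<bar> = h * \<bar>real (?k i) - real (?k' i)\<bar>"
        using grid_diff2[of i ?k ?k'] h_pos by (simp add: abs_mult)
    qed
    ultimately show "norm (v ?k - v ?k' - (\<Sum>i<m. (real (?k i) - real (?k' i)) *\<^sub>R (h *\<^sub>R a i))) \<le> (\<kappa> * h) * (\<Sum>i<m. \<bar>real (?k i) - real (?k' i)\<bar>)"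
      by (simp only: mult.assoc)
  qed
  moreover have "(\<Sum>i<m. (?x i - ?y i) *\<^sub>R (h *\<^sub>R a i)) = (\<Sum>i<m. (\<xi> i - \<zeta> i) *\<^sub>R a i)"
  proof (intro sum.cong refl)
    fix i assume "i \<in> {..<m}"
    then show "(?x i - ?y i) *\<^sub>R (h *\<^sub>R a i) = (\<xi> i - \<zeta> i) *\<^sub>R a i"
      using coord_diff[of i \<xi> \<zeta>] by (simp only: lessThan_iff scaleR_scaleR mult.commute)
  qed
  moreover have "(\<kappa> * h) * (\<Sum>i<m. \<bar>?x i - ?y i\<bar>) = \<kappa> * (\<Sum>i<m. \<bar>\<xi> i - \<zeta> i\<bar>)"
  proof -
    have "h * (\<Sum>i<m. \<bar>?x i - ?y i\<bar>) = (\<Sum>i<m. \<bar>\<xi> i - \<zeta> i\<bar>)"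
      unfolding sum_distrib_left
    proof (intro sum.cong refl)
      fix i assume "i \<in> {..<m}"
      then show "h * \<bar>?x i - ?y i\<bar> = \<bar>\<xi> i - \<zeta> i\<bar>" using coord_diff[of i \<xi> \<zeta>] h_pos by (simp add: abs_mult)
    qed
    then show ?thesis by (simp only: mult.assoc)
  qed
  ultimately show ?thesis unfolding plin_def by (simp only:)
qed

lemma plin_continuous:
  fixes v :: "(nat \<Rightarrow> nat) \<Rightarrow> 'w::banach"
  shows "continuous_on (cubem m r) (plin r h p m v)"
proof -
  define C where "C = (\<Sum>k\<in>kuhn_grid p m. norm (v k))"
  have C: "norm (v k) \<le> C" if "k \<in> kuhn_grid p m" for k
    unfolding C_def using that finite_kuhn_grid by (intro member_le_sum) auto
  have C0: "0 \<le> C" unfolding C_def by (intro sum_nonneg) auto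
  \<comment> \<open>Grid values differ by at most \<open>2 * C\<close>, and distinct grid points are
    at least \<open>h\<close> apart in the sum norm.\<close>
  define \<kappa> where "\<kappa> = 2 * C / h"
  have lip: "norm (plin r h p m v \<xi> - plin r h p m v \<zeta>) \<le> \<kappa> * (\<Sum>i<m. \<bar>\<xi> i - \<zeta> i\<bar>)" if x: "\<xi> \<in> cubem m r" "\<zeta> \<in> cubem m r" for \<xi> \<zeta>
  proof -
    have "norm (plin r h p m v \<xi> - plin r h p m v \<zeta> - (\<Sum>i<m. (\<xi> i - \<zeta> i) *\<^sub>R (0::'w))) \<le> \<kappa> * (\<Sum>i<m. \<bar>\<xi> i - \<zeta> i\<bar>)"
    proof (rule plin_lipschitz[OF x])
      fix k k' assume k: "k \<in> kuhn_grid p m" "k' \<in> kuhn_grid p m"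
      show "norm (v k - v k' - (\<Sum>i<m. (grid_pt r h m k i - grid_pt r h m k' i) *\<^sub>R (0::'w))) \<le> \<kappa> * (\<Sum>i<m. \<bar>grid_pt r h m k i - grid_pt r h m k' i\<bar>)"
      proof (cases "k = k'")
        case False
        then obtain i where i2: "k i \<noteq> k' i" by (auto simp: fun_eq_iff)
        then have "i < m" using k by (cases "i < m") (auto simp: kuhn_grid_def)
        with i2 have i: "i < m" "k i \<noteq> k' i" by auto
        have "1 \<le> \<bar>real (k i) - real (k' i)\<bar>" using i(2) by linarith
        then have "h \<le> \<bar>grid_pt r h m k i - grid_pt r h m k' i\<bar>"
          unfolding grid_diff2[OF i(1)] abs_mult using h_pos mult_left_mono[of 1 "\<bar>real (k i) - real (k' i)\<bar>" h] by simp
        also have "\<dots> \<le> (\<Sum>i<m. \<bar>grid_pt r h m k i - grid_pt r h m k' i\<bar>)"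
          using i(1) by (intro member_le_sum) auto
        finally have "\<kappa> * h \<le> \<kappa> * (\<Sum>i<m. \<bar>grid_pt r h m k i - grid_pt r h m k' i\<bar>)"
          using C0 h_pos by (intro mult_left_mono) (auto simp: \<kappa>_def)
        moreover have "\<kappa> * h = 2 * C" using h_pos by (simp add: \<kappa>_def)
        moreover have "norm (v k - v k') \<le> 2 * C" using norm_triangle_ineq4[of "v k" "v k'"] C k by (smt (verit))
        ultimately show ?thesis by simp
      qed simp
    qed
    then show ?thesis by simp
  qed
  show ?thesis
    unfolding continuous_on_def
  proof
    fix \<xi> assume x: "\<xi> \<in> cubem m r"
    have "((\<lambda>\<zeta>. plin r h p m v \<zeta> - plin r h p m v \<xi>) \<longlongrightarrow> 0) (at \<xi> within cubem m r)"
    proof (rule Lim_null_comparison)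
      show "\<forall>\<^sub>F \<zeta> in at \<xi> within cubem m r. norm (plin r h p m v \<zeta> - plin r h p m v \<xi>) \<le> \<kappa> * (\<Sum>i<m. \<bar>\<zeta> i - \<xi> i\<bar>)"
        unfolding eventually_at_filter using lip x by (intro always_eventually) auto
      have "continuous_on UNIV (\<lambda>\<zeta>::nat \<Rightarrow> real. \<kappa> * (\<Sum>i<m. \<bar>\<zeta> i - \<xi> i\<bar>))"
        by (intro continuous_intros continuous_on_product_coordinates)
      then have "((\<lambda>\<zeta>. \<kappa> * (\<Sum>i<m. \<bar>\<zeta> i - \<xi> i\<bar>)) \<longlongrightarrow> \<kappa> * (\<Sum>i<m. \<bar>\<xi> i - \<xi> i\<bar>)) (at \<xi> within cubem m r)"
        by (meson UNIV_I continuous_on_def subset_UNIV tendsto_within_subset)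
      then show "((\<lambda>\<zeta>. \<kappa> * (\<Sum>i<m. \<bar>\<zeta> i - \<xi> i\<bar>)) \<longlongrightarrow> 0) (at \<xi> within cubem m r)" by simp
    qed
    then show "(plin r h p m v \<longlongrightarrow> plin r h p m v \<xi>) (at \<xi> within cubem m r)"
      by (simp add: LIM_zero_iff)
  qed
qed

lemma plin_in_subspace:
  fixes v :: "(nat \<Rightarrow> nat) \<Rightarrow> 'w::banach"
  assumes "\<xi> \<in> cubem m r" "v ` kuhn_grid p m \<subseteq> Y" "subspace Y"
  shows "plin r h p m v \<xi> \<in> Y"
proof -
  obtain s a where s1: "ksimplex p m s" and s2: "\<forall>k\<in>s. 0 \<le> a k" and s3: "sum a s = 1"
    and s4: "\<forall>i<m. grid_coord r h m \<xi> i = (\<Sum>k\<in>s. a k * real (k i))"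
    using interp_repr[OF p grid_coord_xbox[OF assms(1)]] by (elim exE conjE) (rule that)
  have "plin r h p m v \<xi> = (\<Sum>k\<in>s. a k *\<^sub>R v k)"
    unfolding plin_def by (rule kuhn_interp_ksimplex[OF s1 s2[rule_format] s3 s4[rule_format]])
  also have "\<dots> \<in> Y" using assms(2,3) ksimplex_subset_grid[OF s1] by (intro subspace_sum subspace_scale) auto
  finally show ?thesis .
qed

lemma plin_zeros_card:
  fixes v :: "(nat \<Rightarrow> nat) \<Rightarrow> 'w::banach"
  assumes gen: "\<And>t. t \<subseteq> kuhn_grid p m \<Longrightarrow> card t \<le> m \<Longrightarrow> fam_indep v t"
  shows "card {\<xi>\<in>cubem m r. plin r h p m v \<xi> = 0} = card {s. ksimplex p m s \<and> conv0 v s}"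
    and "finite {\<xi>\<in>cubem m r. plin r h p m v \<xi> = 0}"
proof -
  let ?X = "{x \<in> xbox p m. (\<forall>i\<ge>m. x i = 0) \<and> kuhn_interp p m v x = 0}"
  let ?Z = "{\<xi>\<in>cubem m r. plin r h p m v \<xi> = 0}"
  have bij: "bij_betw (\<lambda>x. grid_floor p m x ` {0..<1}) ?X {s. ksimplex p m s \<and> conv0 v s}"
    by (rule kuhn_interp_zeros[OF p gen])
  have "bij_betw (grid_coord r h m) ?Z ?X"
  proof (rule bij_betwI[where g = "\<lambda>x i. if i < m then h * x i - r else 0"])
    show "grid_coord r h m \<in> ?Z \<rightarrow> ?X"
      using grid_coord_xbox by (auto simp: plin_def) (simp add: grid_coord_def)
    show inv2: "grid_coord r h m (\<lambda>i. if i < m then h * x i - r else 0) = x" if "x \<in> ?X" for x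
      using that h_pos by (auto simp: grid_coord_def)
    show "(\<lambda>i. if i < m then h * grid_coord r h m \<xi> i - r else 0) = \<xi>" if "\<xi> \<in> ?Z" for \<xi>
      using that h_pos by (auto simp: grid_coord_def cubem_def)
    show "(\<lambda>x i. if i < m then h * x i - r else 0) \<in> ?X \<rightarrow> ?Z"
    proof
      fix x assume x: "x \<in> ?X"
      have "0 \<le> h * x i" "h * x i \<le> h * real p" if "i < m" for i
        using x that h_pos by (auto simp: xbox_def intro!: mult_left_mono)
      then have "(\<lambda>i. if i < m then h * x i - r else 0) \<in> cubem m r" using hp by (auto simp: cubem_def abs_le_iff)
      then show "(\<lambda>i. if i < m then h * x i - r else 0) \<in> ?Z" using inv2[OF x] x by (simp add: plin_def)
    qed
  qed
  from bij_betw_trans[OF this bij] have b: "bij_betw ((\<lambda>x. grid_floor p m x ` {0..<1}) \<circ> grid_coord r h m) ?Z {s. ksimplex p m s \<and> conv0 v s}" .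
  then show "card ?Z = card {s. ksimplex p m s \<and> conv0 v s}" by (rule bij_betw_same_card)
  have "finite {s. ksimplex p m s \<and> conv0 v s}" using finite_ksimplexes[of p m] by (rule finite_subset[rotated]) auto
  then show "finite ?Z" using bij_betw_finite[OF b] by simp
qed

lemma plin_locally_affine:
  fixes v :: "(nat \<Rightarrow> nat) \<Rightarrow> 'w::banach"
  assumes gen: "\<And>t. t \<subseteq> kuhn_grid p m \<Longrightarrow> card t \<le> m \<Longrightarrow> fam_indep v t"
    and vB: "v ` kuhn_grid p m \<subseteq> Y" "subspace Y"
    and x: "\<xi>0 \<in> cubem m r" "plin r h p m v \<xi>0 = 0"
  shows "\<exists>a e. fam_indep a {..<m} \<and> (\<forall>i<m. a i \<in> Y) \<and> 0 < e \<and>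
    (\<forall>\<xi>. (\<forall>i<m. \<bar>\<xi> i - \<xi>0 i\<bar> < e) \<longrightarrow> plin r h p m v \<xi> = (\<Sum>i<m. (\<xi> i - \<xi>0 i) *\<^sub>R a i))"
proof -
  have "\<exists>a e. fam_indep a {..<m} \<and> (\<forall>i<m. a i \<in> Y) \<and> 0 < e \<and>
    (\<forall>y. (\<forall>i<m. \<bar>y i - grid_coord r h m \<xi>0 i\<bar> < e) \<longrightarrow> kuhn_interp p m v y = (\<Sum>i<m. (y i - grid_coord r h m \<xi>0 i) *\<^sub>R a i))"
    by (rule kuhn_interp_locally_affine[OF p gen vB grid_coord_xbox[OF x(1)] x(2)[unfolded plin_def]])
  then obtain a e where a1: "fam_indep a {..<m}" and a2: "\<forall>i<m. a i \<in> Y" and a3: "0 < e"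
    and a4: "\<forall>y. (\<forall>i<m. \<bar>y i - grid_coord r h m \<xi>0 i\<bar> < e) \<longrightarrow> kuhn_interp p m v y = (\<Sum>i<m. (y i - grid_coord r h m \<xi>0 i) *\<^sub>R a i)"
    by (elim exE conjE) (rule that)
  note a = a1 a2[rule_format] a3 a4[rule_format]
  show ?thesis
  proof (intro exI[of _ "\<lambda>i. (1/h) *\<^sub>R a i"] exI[of _ "h * e"] conjI allI impI)
    show "fam_indep (\<lambda>i. (1/h) *\<^sub>R a i) {..<m}"
      unfolding fam_indep_def
    proof (intro allI impI ballI)
      fix c i assume c: "(\<Sum>i<m. c i *\<^sub>R (1/h) *\<^sub>R a i) = 0" and i: "i \<in> {..<m}"
      have "(\<Sum>i<m. (c i / h) *\<^sub>R a i) = 0" using c by simp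
      from fam_indepD[OF a(1) this i] show "c i = 0" using h_pos by simp
    qed
    show "(1/h) *\<^sub>R a i \<in> Y" if "i < m" for i using subspace_scale[OF vB(2) a(2)[OF that]] .
    show "0 < h * e" using h_pos a(3) by (rule mult_pos_pos)
    fix \<xi> assume near: "\<forall>i<m. \<bar>\<xi> i - \<xi>0 i\<bar> < h * e"
    have "\<bar>grid_coord r h m \<xi> i - grid_coord r h m \<xi>0 i\<bar> < e" if i: "i < m" for i
    proof -
      have "h * \<bar>grid_coord r h m \<xi> i - grid_coord r h m \<xi>0 i\<bar> = \<bar>\<xi> i - \<xi>0 i\<bar>"
        unfolding coord_diff[OF i, of \<xi> \<xi>0] using h_pos by (simp add: abs_mult)
      then have "h * \<bar>grid_coord r h m \<xi> i - grid_coord r h m \<xi>0 i\<bar> < h * e" using near i by simp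
      then show ?thesis using h_pos by simp
    qed
    then have "plin r h p m v \<xi> = (\<Sum>i<m. (grid_coord r h m \<xi> i - grid_coord r h m \<xi>0 i) *\<^sub>R a i)"
      unfolding plin_def by (rule a(4))
    also have "\<dots> = (\<Sum>i<m. (\<xi> i - \<xi>0 i) *\<^sub>R (1/h) *\<^sub>R a i)"
    proof (intro sum.cong refl)
      fix i assume "i \<in> {..<m}"
      then show "(grid_coord r h m \<xi> i - grid_coord r h m \<xi>0 i) *\<^sub>R a i = (\<xi> i - \<xi>0 i) *\<^sub>R (1/h) *\<^sub>R a i"
        using coord_diff[of i \<xi> \<xi>0] h_pos by simp
    qed
    finally show "plin r h p m v \<xi> = (\<Sum>i<m. (\<xi> i - \<xi>0 i) *\<^sub>R (1/h) *\<^sub>R a i)" .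
  qed
qed

end


section \<open>Interpolation preserves the number of regular zeros\<close>

lemma finite_pos_lower_bound:
  fixes f :: "'a \<Rightarrow> real"
  assumes "finite S" "\<And>x. x \<in> S \<Longrightarrow> 0 < f x"
  shows "\<exists>e>0. \<forall>x\<in>S. e \<le> f x"
proof (cases "S = {}")
  case True
  then show ?thesis by (intro exI[of _ 1]) auto
next
  case False
  have "Min (f ` S) \<in> f ` S" using assms(1) False by (intro Min_in) auto
  then have "0 < Min (f ` S)" using assms(2) by auto
  then show ?thesis using assms(1) by (intro exI[of _ "Min (f ` S)"]) auto
qed

lemma cubem_shift:
  assumes "\<xi>0 \<in> cubem m r" "\<And>i. i < m \<Longrightarrow> \<bar>\<xi>0 i\<bar> + d \<le> r" "\<And>i. i < m \<Longrightarrow> \<bar>\<xi> i - \<xi>0 i\<bar> \<le> d" "\<And>i. m \<le> i \<Longrightarrow> \<xi> i = 0"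
  shows "\<xi> \<in> cubem m r"
proof -
  have "\<bar>\<xi> i\<bar> \<le> r" if "i < m" for i using assms(2,3)[OF that] by linarith
  then show ?thesis using assms(4) by (simp add: cubem_def)
qed

lemma grid_neq_dist:
  assumes "k \<in> kuhn_grid p m" "k' \<in> kuhn_grid p m" "k \<noteq> k'" "0 < h"
  shows "h \<le> (\<Sum>i<m. \<bar>grid_pt r h m k i - grid_pt r h m k' i\<bar>)"
proof -
  obtain i where i2: "k i \<noteq> k' i" using assms(3) by (auto simp: fun_eq_iff)
  then have i: "i < m" using assms by (cases "i < m") (auto simp: kuhn_grid_def)
  have "1 \<le> \<bar>real (k i) - real (k' i)\<bar>" using i2 by linarith
  then have "h * 1 \<le> h * \<bar>real (k i) - real (k' i)\<bar>" using assms(4) by (intro mult_left_mono) auto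
  also have "\<dots> = \<bar>h * (real (k i) - real (k' i))\<bar>" using assms(4) by (simp add: abs_mult)
  also have "\<dots> = \<bar>grid_pt r h m k i - grid_pt r h m k' i\<bar>" using i by (simp add: grid_pt_def right_diff_distrib)
  also have "\<dots> \<le> (\<Sum>i<m. \<bar>grid_pt r h m k i - grid_pt r h m k' i\<bar>)"
    using i by (intro member_le_sum) auto
  finally show ?thesis by simp
qed

definition perturbed_grid :: "real \<Rightarrow> real \<Rightarrow> nat \<Rightarrow> ((nat \<Rightarrow> real) \<Rightarrow> 'w::real_normed_vector) \<Rightarrow> ((nat \<Rightarrow> nat) \<Rightarrow> 'w) \<Rightarrow> (nat \<Rightarrow> nat) \<Rightarrow> 'w" where
  "perturbed_grid r h m \<gamma> \<rho> k = \<gamma> (grid_pt r h m k) + \<rho> k"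

text \<open>Up to an error with Lipschitz constant \<open>c/2\<close> the interpolant is the linear
  map with columns \<open>a i\<close>, whose lower bound is \<open>c\<close>. The remaining half
  makes a zero near \<open>\<xi>0\<close> unique, and a contraction in the target space produces
  one.\<close>

lemma plin_local_unique_zero:
  fixes \<gamma> :: "(nat \<Rightarrow> real) \<Rightarrow> 'w::banach"
  assumes B: "finite B" "card B = m"
    and h: "0 < h" "h * real p = 2 * r" "0 < p"
    and \<gamma>B: "\<And>\<xi>. \<xi> \<in> cubem m r \<Longrightarrow> \<gamma> \<xi> \<in> span B"
    and \<xi>0: "\<xi>0 \<in> cubem m r" and d: "0 < d" "\<And>i. i < m \<Longrightarrow> \<bar>\<xi>0 i\<bar> + d \<le> r"
    and a: "fam_indep a {..<m}" "\<And>i. i < m \<Longrightarrow> a i \<in> span B" and c: "0 < c" "\<And>\<eta>. c * (\<Sum>i<m. \<bar>\<eta> i\<bar>) \<le> norm (\<Sum>i<m. \<eta> i *\<^sub>R a i)"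
    and str: "\<And>\<xi> \<zeta>. \<xi> \<in> cubem m r \<Longrightarrow> \<zeta> \<in> cubem m r \<Longrightarrow> (\<And>i. i < m \<Longrightarrow> \<bar>\<xi> i - \<xi>0 i\<bar> \<le> 2 * d) \<Longrightarrow> (\<And>i. i < m \<Longrightarrow> \<bar>\<zeta> i - \<xi>0 i\<bar> \<le> 2 * d) \<Longrightarrow>
        norm (\<gamma> \<xi> - \<gamma> \<zeta> - (\<Sum>i<m. (\<xi> i - \<zeta> i) *\<^sub>R a i)) \<le> c/4 * (\<Sum>i<m. \<bar>\<xi> i - \<zeta> i\<bar>)"
    and hd: "h \<le> d" and \<rho>: "\<And>k. k \<in> kuhn_grid p m \<Longrightarrow> \<rho> k \<in> span B \<and> norm (\<rho> k) \<le> c * h / 8"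
  defines "L \<equiv> plin r h p m (perturbed_grid r h m \<gamma> \<rho>)"
  assumes L0: "norm (L \<xi>0) \<le> c * d / 2"
  shows "\<exists>\<xi>. \<xi> \<in> cubem m r \<and> (\<forall>i<m. \<bar>\<xi> i - \<xi>0 i\<bar> \<le> d) \<and> L \<xi> = 0"
    and "\<xi> \<in> cubem m r \<Longrightarrow> \<zeta> \<in> cubem m r \<Longrightarrow> (\<And>i. i < m \<Longrightarrow> \<bar>\<xi> i - \<xi>0 i\<bar> \<le> d) \<Longrightarrow> (\<And>i. i < m \<Longrightarrow> \<bar>\<zeta> i - \<xi>0 i\<bar> \<le> d) \<Longrightarrow>
        L \<xi> = 0 \<Longrightarrow> L \<zeta> = 0 \<Longrightarrow> \<xi> = \<zeta>"
proof -
  let ?l1 = "\<lambda>\<xi> \<zeta>. \<Sum>i<m. \<bar>\<xi> i - \<zeta> i\<bar>"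
  have lip: "norm (L \<xi> - L \<zeta> - (\<Sum>i<m. (\<xi> i - \<zeta> i) *\<^sub>R a i)) \<le> c/2 * ?l1 \<xi> \<zeta>"
    if x: "\<xi> \<in> cubem m r" "\<zeta> \<in> cubem m r" "\<And>i. i < m \<Longrightarrow> \<bar>\<xi> i - \<xi>0 i\<bar> \<le> d" "\<And>i. i < m \<Longrightarrow> \<bar>\<zeta> i - \<xi>0 i\<bar> \<le> d" for \<xi> \<zeta>
    unfolding L_def
  proof (rule plin_lipschitz[OF h x(1,2)])
    fix k k' assume k: "k \<in> kuhn_grid p m" "k' \<in> kuhn_grid p m"
      and n1: "\<And>i. i < m \<Longrightarrow> \<bar>grid_pt r h m k i - \<xi> i\<bar> \<le> h" and n2: "\<And>i. i < m \<Longrightarrow> \<bar>grid_pt r h m k' i - \<zeta> i\<bar> \<le> h"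
    let ?g = "grid_pt r h m k" and ?g' = "grid_pt r h m k'"
    have gin: "?g \<in> cubem m r" "?g' \<in> cubem m r" using grid_pt_cubem[OF h] k by auto
    have near: "\<bar>?g i - \<xi>0 i\<bar> \<le> 2 * d" "\<bar>?g' i - \<xi>0 i\<bar> \<le> 2 * d" if "i < m" for i
      using n1[OF that] n2[OF that] x(3)[OF that] x(4)[OF that] hd by linarith+
    have e1: "norm (\<gamma> ?g - \<gamma> ?g' - (\<Sum>i<m. (?g i - ?g' i) *\<^sub>R a i)) \<le> c/4 * ?l1 ?g ?g'"
      by (rule str[OF gin]) (use near in auto)
    \<comment> \<open>The perturbation has no derivative, but it is small against the mesh; since
      distinct grid points are at least \<open>h\<close> apart, it counts as an error with Lipschitz
      constant \<open>c/4\<close>.\<close>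
    have e2: "norm (\<rho> k - \<rho> k') \<le> c/4 * ?l1 ?g ?g'"
    proof (cases "k = k'")
      case False
      have "norm (\<rho> k - \<rho> k') \<le> c * h / 8 + c * h / 8"
        using norm_triangle_ineq4[of "\<rho> k" "\<rho> k'"] \<rho>[OF k(1)] \<rho>[OF k(2)] by linarith
      also have "\<dots> = c/4 * h" by simp
      also have "\<dots> \<le> c/4 * ?l1 ?g ?g'" using c(1) grid_neq_dist[OF k False h(1), of r] by (intro mult_left_mono) auto
      finally show ?thesis .
    qed simp
    have eq: "perturbed_grid r h m \<gamma> \<rho> k - perturbed_grid r h m \<gamma> \<rho> k' - (\<Sum>i<m. (?g i - ?g' i) *\<^sub>R a i)
      = (\<gamma> ?g - \<gamma> ?g' - (\<Sum>i<m. (?g i - ?g' i) *\<^sub>R a i)) + (\<rho> k - \<rho> k')"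
      by (simp add: perturbed_grid_def)
    have "norm (perturbed_grid r h m \<gamma> \<rho> k - perturbed_grid r h m \<gamma> \<rho> k' - (\<Sum>i<m. (?g i - ?g' i) *\<^sub>R a i))
      \<le> c/4 * ?l1 ?g ?g' + c/4 * ?l1 ?g ?g'"
      unfolding eq by (rule norm_triangle_mono[OF e1 e2])
    also have "\<dots> = c/2 * ?l1 ?g ?g'" by simp
    finally show "norm (perturbed_grid r h m \<gamma> \<rho> k - perturbed_grid r h m \<gamma> \<rho> k' - (\<Sum>i<m. (?g i - ?g' i) *\<^sub>R a i)) \<le> c/2 * ?l1 ?g ?g'" .
  qed
  show "\<xi> = \<zeta>" if x: "\<xi> \<in> cubem m r" "\<zeta> \<in> cubem m r" "\<And>i. i < m \<Longrightarrow> \<bar>\<xi> i - \<xi>0 i\<bar> \<le> d" "\<And>i. i < m \<Longrightarrow> \<bar>\<zeta> i - \<xi>0 i\<bar> \<le> d"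
     "L \<xi> = 0" "L \<zeta> = 0"
  proof -
    have "c * ?l1 \<xi> \<zeta> \<le> c/2 * ?l1 \<xi> \<zeta>" using lip[OF x(1-4)] c(2)[of "\<lambda>i. \<xi> i - \<zeta> i"] x(5,6) by simp
    then have "?l1 \<xi> \<zeta> \<le> 0" using c(1) by (simp add: field_simps)
    moreover have "0 \<le> ?l1 \<xi> \<zeta>" by (intro sum_nonneg) auto
    ultimately have "?l1 \<xi> \<zeta> = 0" by simp
    then have "\<forall>i\<in>{..<m}. \<bar>\<xi> i - \<zeta> i\<bar> = 0" by (subst (asm) sum_nonneg_eq_0_iff) auto
    then have "\<xi> i = \<zeta> i" for i using x(1,2) by (cases "i < m") (auto simp: cubem_def)
    then show ?thesis by (rule ext)
  qed
  show "\<exists>\<xi>. \<xi> \<in> cubem m r \<and> (\<forall>i<m. \<bar>\<xi> i - \<xi>0 i\<bar> \<le> d) \<and> L \<xi> = 0"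
  proof -
    have "\<exists>t. (\<Sum>i<m. t i *\<^sub>R a i) = y" if yB: "y \<in> span B" for y
    proof -
      obtain t where "(\<Sum>i<m. t i *\<^sub>R a i) = y"
        by (rule fam_spans[of "{..<m}" B a y]) (use B a yB in \<open>auto intro: that\<close>)
      then show ?thesis by blast
    qed
    then obtain T0 where T0: "\<And>y. y \<in> span B \<Longrightarrow> (\<Sum>i<m. T0 y i *\<^sub>R a i) = y" by metis
    define T where "T y i = (if i < m then T0 y i else 0)" for y i
    have T: "(\<Sum>i<m. T y i *\<^sub>R a i) = y" if "y \<in> span B" for y using T0[OF that] by (simp add: T_def)
    \<comment> \<open>The radius \<open>c * d\<close> is chosen so that the coordinates
      \<open>T y\<close> of a point of \<open>S\<close> stay within \<open>d\<close>.\<close>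
    define S where "S = span B \<inter> cball 0 (c * d)"
    define pt where "pt y i = \<xi>0 i + T y i" for y i
    have ptS: "pt y \<in> cubem m r \<and> (\<forall>i<m. \<bar>pt y i - \<xi>0 i\<bar> \<le> d)" if y: "y \<in> S" for y
    proof -
      have "c * (\<Sum>i<m. \<bar>T y i\<bar>) \<le> c * d" using c(2)[of "T y"] T[of y] y by (simp add: S_def)
      then have sd: "(\<Sum>i<m. \<bar>T y i\<bar>) \<le> d" using c(1) by simp
      have n: "\<bar>pt y i - \<xi>0 i\<bar> \<le> d" if "i < m" for i
        using member_le_sum[of i "{..<m}" "\<lambda>i. \<bar>T y i\<bar>"] that sd by (simp add: pt_def)
      have "pt y \<in> cubem m r" by (rule cubem_shift[OF \<xi>0 d(2) n]) (use \<xi>0 in \<open>auto simp: pt_def T_def cubem_def\<close>)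
      then show ?thesis using n by blast
    qed
    have LB: "L \<xi> \<in> span B" if "\<xi> \<in> cubem m r" for \<xi>
      unfolding L_def
    proof (rule plin_in_subspace[OF h that _ subspace_span])
      show "perturbed_grid r h m \<gamma> \<rho> ` kuhn_grid p m \<subseteq> span B"
        using \<gamma>B grid_pt_cubem[OF h] \<rho> by (auto simp: perturbed_grid_def intro!: span_add)
    qed
    \<comment> \<open>A zero is sought through its linear image \<open>y\<close>: a fixed point of
      \<open>\<Phi>\<close> is a zero of \<open>L\<close> at \<open>pt y\<close>.\<close>
    define \<Phi> where "\<Phi> y = y - L (pt y)" for y
    have contr: "norm (\<Phi> y - \<Phi> y') \<le> 1/2 * norm (y - y')" if y: "y \<in> S" "y' \<in> S" for y y'
    proof -
      have yB: "y \<in> span B" "y' \<in> span B" using y by (auto simp: S_def)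
      have dif: "(\<Sum>i<m. (pt y i - pt y' i) *\<^sub>R a i) = y - y'"
        using T[OF yB(1)] T[OF yB(2)] by (simp add: pt_def scaleR_diff_left sum_subtractf)
      have "norm (\<Phi> y - \<Phi> y') = norm (L (pt y) - L (pt y') - (y - y'))"
        by (simp add: \<Phi>_def norm_minus_commute algebra_simps)
      also have "\<dots> \<le> c/2 * ?l1 (pt y) (pt y')" using lip[of "pt y" "pt y'"] ptS[OF y(1)] ptS[OF y(2)] dif by auto
      also have "\<dots> = 1/2 * (c * ?l1 (pt y) (pt y'))" by simp
      also have "\<dots> \<le> 1/2 * norm (y - y')"
        using c(2)[of "\<lambda>i. pt y i - pt y' i"] dif by (intro mult_left_mono) auto
      finally show ?thesis .
    qed
    have cd: "0 < c * d" using c(1) d(1) by simp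
    have zS: "0 \<in> S" using cd by (simp add: S_def span_zero)
    have pt0: "pt 0 = \<xi>0"
    proof -
      have "c * (\<Sum>i<m. \<bar>T 0 i\<bar>) \<le> 0" using c(2)[of "T 0"] T[OF span_zero] by simp
      then have "(\<Sum>i<m. \<bar>T 0 i\<bar>) \<le> 0" using c(1) by (simp add: mult_le_0_iff)
      moreover have "0 \<le> (\<Sum>i<m. \<bar>T 0 i\<bar>)" by (intro sum_nonneg) auto
      ultimately have "(\<Sum>i<m. \<bar>T 0 i\<bar>) = 0" by simp
      then have "\<forall>i\<in>{..<m}. \<bar>T 0 i\<bar> = 0" by (subst (asm) sum_nonneg_eq_0_iff) auto
      then show ?thesis by (auto simp: pt_def fun_eq_iff T_def)
    qed
    have "\<exists>!y\<in>S. \<Phi> y = y"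
    proof (rule Banach_fix[where c = "1/2"])
      show "complete S" unfolding S_def complete_eq_closed by (intro closed_Int closed_span_finite B closed_cball)
      show "S \<noteq> {}" using zS by blast
      show "\<Phi> ` S \<subseteq> S"
      proof safe
        fix y assume y: "y \<in> S"
        have "norm (\<Phi> y) \<le> norm (\<Phi> y - \<Phi> 0) + norm (\<Phi> 0)" using norm_triangle_sub[of "\<Phi> y" "\<Phi> 0"] by simp
        also have "\<dots> \<le> 1/2 * norm y + c * d / 2"
          using contr[OF y zS] L0 by (simp add: \<Phi>_def pt0)
        also have "\<dots> \<le> c * d" using y by (simp add: S_def)
        finally show "\<Phi> y \<in> S" using LB ptS[OF y] y by (simp add: S_def \<Phi>_def span_diff)
      qed
      show "dist (\<Phi> x) (\<Phi> y) \<le> 1/2 * dist x y" if "x \<in> S" "y \<in> S" for x y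
        using contr[OF that] by (simp add: dist_norm)
    qed auto
    then obtain y where y: "y \<in> S" "\<Phi> y = y" by blast
    then have "L (pt y) = 0" by (simp add: \<Phi>_def)
    then show ?thesis using ptS[OF y(1)] by blast
  qed
qed

text \<open>The \<open>a i\<close> are strict partial derivatives, with two free arguments; this is
  the form that survives interpolation and yields uniqueness of nearby zeros. Independent vectors in
  \<open>Y\<close> are a basis when \<open>Y\<close> has dimension \<open>m\<close>.\<close>

definition strict_reg_zero :: "nat \<Rightarrow> real \<Rightarrow> 'w::real_normed_vector set \<Rightarrow> ((nat \<Rightarrow> real) \<Rightarrow> 'w) \<Rightarrow> (nat \<Rightarrow> real) \<Rightarrow> bool" where
  "strict_reg_zero m r Y \<gamma> \<xi>0 \<longleftrightarrow> (\<exists>a. fam_indep a {..<m} \<and> (\<forall>i<m. a i \<in> Y) \<and>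
    (\<forall>\<kappa>>0. \<exists>d>0. \<forall>\<xi>\<in>cubem m r. \<forall>\<zeta>\<in>cubem m r.
      (\<forall>i<m. \<bar>\<xi> i - \<xi>0 i\<bar> < d) \<longrightarrow> (\<forall>i<m. \<bar>\<zeta> i - \<xi>0 i\<bar> < d) \<longrightarrow>
      norm (\<gamma> \<xi> - \<gamma> \<zeta> - (\<Sum>i<m. (\<xi> i - \<zeta> i) *\<^sub>R a i)) \<le> \<kappa> * (\<Sum>i<m. \<bar>\<xi> i - \<zeta> i\<bar>)))"

lemma plin_approximates:
  fixes \<gamma> :: "(nat \<Rightarrow> real) \<Rightarrow> 'w::banach"
  assumes h: "0 < h" "h * real p = 2 * r" "0 < p"
    and uc: "\<And>\<xi> \<zeta>. \<xi> \<in> cubem m r \<Longrightarrow> \<zeta> \<in> cubem m r \<Longrightarrow> (\<And>i. i < m \<Longrightarrow> \<bar>\<xi> i - \<zeta> i\<bar> \<le> h) \<Longrightarrow> norm (\<gamma> \<xi> - \<gamma> \<zeta>) \<le> \<tau>/2"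
    and \<rho>: "\<And>k. k \<in> kuhn_grid p m \<Longrightarrow> norm (\<rho> k) \<le> \<tau>/2" and \<xi>: "\<xi> \<in> cubem m r"
  shows "norm (plin r h p m (perturbed_grid r h m \<gamma> \<rho>) \<xi> - \<gamma> \<xi>) \<le> \<tau>"
proof (rule plin_close[OF h \<xi>])
  fix k assume k: "k \<in> kuhn_grid p m" "\<And>i. i < m \<Longrightarrow> \<bar>grid_pt r h m k i - \<xi> i\<bar> \<le> h"
  have "norm (\<gamma> (grid_pt r h m k) - \<gamma> \<xi>) \<le> \<tau>/2" by (rule uc[OF grid_pt_cubem[OF h k(1)] \<xi> k(2)])
  moreover have eq: "perturbed_grid r h m \<gamma> \<rho> k - \<gamma> \<xi> = (\<gamma> (grid_pt r h m k) - \<gamma> \<xi>) + \<rho> k" by (simp add: perturbed_grid_def)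
  ultimately show "norm (perturbed_grid r h m \<gamma> \<rho> k - \<gamma> \<xi>) \<le> \<tau>"
    using norm_triangle_ineq[of "\<gamma> (grid_pt r h m k) - \<gamma> \<xi>" "\<rho> k"] \<rho>[OF k(1)] unfolding eq by linarith
qed

text \<open>Around each regular zero the interpolant has exactly one zero, and on the compact rest
  it stays away from 0. The order of quantifiers matters: the mesh is bounded in terms of
  \<open>\<gamma>\<close>, whereas the size \<open>\<eta>\<close> of the perturbation may depend on
  the mesh.\<close>

lemma plin_zero_count:
  fixes \<gamma> :: "(nat \<Rightarrow> real) \<Rightarrow> 'w::banach"
  assumes B: "finite B" "card B = m"
    and cont: "continuous_on (cubem m r) \<gamma>" and \<gamma>B: "\<And>\<xi>. \<xi> \<in> cubem m r \<Longrightarrow> \<gamma> \<xi> \<in> span B"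
  defines "Z0 \<equiv> {\<xi>\<in>cubem m r. \<gamma> \<xi> = 0}"
  assumes fin: "finite Z0" and int: "\<And>\<xi> i. \<xi> \<in> Z0 \<Longrightarrow> i < m \<Longrightarrow> \<bar>\<xi> i\<bar> < r"
    and reg: "\<And>\<xi>. \<xi> \<in> Z0 \<Longrightarrow> strict_reg_zero m r (span B) \<gamma> \<xi>"
  shows "\<exists>h0>0. \<forall>h p. 0 < h \<longrightarrow> h \<le> h0 \<longrightarrow> h * real p = 2 * r \<longrightarrow> 0 < p \<longrightarrow>
    (\<exists>\<eta>>0. \<forall>\<rho>. (\<forall>k\<in>kuhn_grid p m. \<rho> k \<in> span B \<and> norm (\<rho> k) < \<eta>) \<longrightarrow>
      card {\<xi>\<in>cubem m r. plin r h p m (perturbed_grid r h m \<gamma> \<rho>) \<xi> = 0} = card Z0)"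
proof -
  define PP where "PP \<xi>0 a c d \<longleftrightarrow> fam_indep a {..<m} \<and> (\<forall>i<m. a i \<in> span B) \<and> 0 < c \<and> (\<forall>\<eta>. c * (\<Sum>i<m. \<bar>\<eta> i\<bar>) \<le> norm (\<Sum>i<m. \<eta> i *\<^sub>R a i)) \<and>
     0 < d \<and> (\<forall>\<xi>\<in>cubem m r. \<forall>\<zeta>\<in>cubem m r. (\<forall>i<m. \<bar>\<xi> i - \<xi>0 i\<bar> < d) \<longrightarrow> (\<forall>i<m. \<bar>\<zeta> i - \<xi>0 i\<bar> < d) \<longrightarrow>
      norm (\<gamma> \<xi> - \<gamma> \<zeta> - (\<Sum>i<m. (\<xi> i - \<zeta> i) *\<^sub>R a i)) \<le> c/4 * (\<Sum>i<m. \<bar>\<xi> i - \<zeta> i\<bar>))" for \<xi>0 :: "nat \<Rightarrow> real" and a :: "nat \<Rightarrow> 'w" and c d :: real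
  have "\<exists>a c d. PP \<xi>0 a c d" if z: "\<xi>0 \<in> Z0" for \<xi>0
  proof -
    obtain a where a: "fam_indep a {..<m}" "\<forall>i<m. a i \<in> span B"
      "\<forall>\<kappa>>0. \<exists>d>0. \<forall>\<xi>\<in>cubem m r. \<forall>\<zeta>\<in>cubem m r. (\<forall>i<m. \<bar>\<xi> i - \<xi>0 i\<bar> < d) \<longrightarrow> (\<forall>i<m. \<bar>\<zeta> i - \<xi>0 i\<bar> < d) \<longrightarrow>
      norm (\<gamma> \<xi> - \<gamma> \<zeta> - (\<Sum>i<m. (\<xi> i - \<zeta> i) *\<^sub>R a i)) \<le> \<kappa> * (\<Sum>i<m. \<bar>\<xi> i - \<zeta> i\<bar>)"
      using reg[OF z] unfolding strict_reg_zero_def by (elim exE conjE) (rule that)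
    obtain c where c: "c > 0" "\<And>\<eta>. c * (\<Sum>i<m. \<bar>\<eta> i\<bar>) \<le> norm (\<Sum>i<m. \<eta> i *\<^sub>R a i)"
      using independent_family_lower_bound[OF fam_indep_inj[OF a(1)] fam_indep_independent[OF a(1)]] by auto
    have "0 < c/4" using c(1) by simp
    from a(3)[rule_format, OF this] obtain d where d: "d > 0" "\<forall>\<xi>\<in>cubem m r. \<forall>\<zeta>\<in>cubem m r. (\<forall>i<m. \<bar>\<xi> i - \<xi>0 i\<bar> < d) \<longrightarrow> (\<forall>i<m. \<bar>\<zeta> i - \<xi>0 i\<bar> < d) \<longrightarrow>
      norm (\<gamma> \<xi> - \<gamma> \<zeta> - (\<Sum>i<m. (\<xi> i - \<zeta> i) *\<^sub>R a i)) \<le> c/4 * (\<Sum>i<m. \<bar>\<xi> i - \<zeta> i\<bar>)"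
      by (elim exE conjE) (rule that)
    show ?thesis unfolding PP_def by (intro exI[of _ a] exI[of _ c] exI[of _ d] conjI allI a(1,2) c d)
  qed
  then obtain a c d where PP: "\<And>z. z \<in> Z0 \<Longrightarrow> PP z (a z) (c z) (d z)" by metis
  note acd = PP[unfolded PP_def]
  obtain e1 where e1: "e1 > 0" "\<forall>z\<in>Z0. e1 \<le> d z" using finite_pos_lower_bound[OF fin, of d] acd by auto
  obtain cm where cm: "cm > 0" "\<forall>z\<in>Z0. cm \<le> c z" using finite_pos_lower_bound[OF fin, of c] acd by auto
  have "\<exists>e2>0. \<forall>q\<in>Z0 \<times> {..<m}. e2 \<le> r - \<bar>fst q (snd q)\<bar>"
    by (rule finite_pos_lower_bound) (use fin int in auto)
  then obtain e2 where e2: "e2 > 0" "\<forall>z\<in>Z0. \<forall>i<m. e2 \<le> r - \<bar>z i\<bar>" by auto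
  have "\<exists>e3>0. \<forall>q\<in>{q\<in>Z0 \<times> Z0. fst q \<noteq> snd q}. e3 \<le> (\<Sum>i<m. \<bar>fst q i - snd q i\<bar>)"
  proof (rule finite_pos_lower_bound)
    show "finite {q\<in>Z0 \<times> Z0. fst q \<noteq> snd q}" using fin by simp
    fix q assume q: "q \<in> {q\<in>Z0 \<times> Z0. fst q \<noteq> snd q}"
    then obtain i where "fst q i \<noteq> snd q i" by (auto simp: fun_eq_iff)
    moreover have "i < m" using q \<open>fst q i \<noteq> snd q i\<close> by (cases "i < m") (auto simp: Z0_def cubem_def)
    ultimately show "0 < (\<Sum>i<m. \<bar>fst q i - snd q i\<bar>)" by (intro sum_pos2[of _ i]) auto
  qed
  then obtain e3 where e3: "e3 > 0" "\<And>z z'. z \<in> Z0 \<Longrightarrow> z' \<in> Z0 \<Longrightarrow> z \<noteq> z' \<Longrightarrow> e3 \<le> (\<Sum>i<m. \<bar>z i - z' i\<bar>)" by force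
  \<comment> \<open>\<open>D\<close> keeps the strict estimates valid on cubes of radius
    \<open>2 * D\<close>, keeps cubes of radius \<open>D\<close> around the zeros inside
    \<open>cubem m r\<close>, and separates them from one another.\<close>
  define D where "D = min (e1/4) (min e2 (e3 / (4 * (real m + 1))))"
  have D: "0 < D" "D \<le> e1/4" "D \<le> e2" "D \<le> e3 / (4 * (real m + 1))"
    unfolding D_def using e1(1) e2(1) e3(1) by (simp add: add_pos_nonneg, (simp only: min_le_iff_disj order_refl simp_thms)+)
  have sep: "z = z'" if z: "z \<in> Z0" "z' \<in> Z0" "\<And>i. i < m \<Longrightarrow> \<bar>z i - z' i\<bar> \<le> 2 * D" for z z'
  proof (rule ccontr)
    assume "z \<noteq> z'"
    then have "e3 \<le> (\<Sum>i<m. \<bar>z i - z' i\<bar>)" using e3 z by blast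
    also have "\<dots> \<le> (\<Sum>i<m. 2 * D)" by (intro sum_mono) (use z in auto)
    also have "\<dots> = real m * (2 * D)" by simp
    also have "\<dots> \<le> (real m + 1) * (2 * D)" using D(1) by (intro mult_right_mono) auto
    also have "\<dots> \<le> (real m + 1) * (2 * (e3 / (4 * (real m + 1))))" using D(4) by (intro mult_left_mono) auto
    also have "\<dots> = e3 / 2" by (simp add: field_simps)
    finally show False using e3(1) by simp
  qed
  define Aw where "Aw = cubem m r \<inter> (\<Inter>z\<in>Z0. \<Union>i<m. {\<xi>. D \<le> \<bar>\<xi> i - z i\<bar>})"
  have "closed (\<Inter>z\<in>Z0. \<Union>i<m. {\<xi>::nat \<Rightarrow> real. D \<le> \<bar>\<xi> i - z i\<bar>})"
    by (intro closed_INT ballI closed_UN finite_lessThan closed_Collect_le continuous_intros continuous_on_product_coordinates)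
  then have "compact Aw" unfolding Aw_def by (intro compact_Int_closed compact_cubem)
  moreover have "continuous_on Aw \<gamma>" by (rule continuous_on_subset[OF cont]) (auto simp: Aw_def)
  moreover have "\<gamma> \<xi> \<noteq> 0" if x: "\<xi> \<in> Aw" for \<xi>
  proof
    assume "\<gamma> \<xi> = 0"
    then have "\<xi> \<in> Z0" using x by (auto simp: Aw_def Z0_def)
    then have "\<exists>i<m. D \<le> \<bar>\<xi> i - \<xi> i\<bar>" using x unfolding Aw_def by blast
    then show False using D(1) by simp
  qed
  ultimately obtain \<mu> where \<mu>: "\<mu> > 0" "\<And>\<xi>. \<xi> \<in> Aw \<Longrightarrow> \<mu> \<le> norm (\<gamma> \<xi>)"
    using compact_norm_lower_bound[of Aw \<gamma>] by auto
  \<comment> \<open>An error below \<open>\<mu>\<close> excludes zeros on \<open>Aw\<close>; the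
    other bound makes the value at an old zero small enough for the local existence
    argument.\<close>
  define \<tau> where "\<tau> = min (\<mu>/2) (cm * D / 2)"
  have \<tau>: "0 < \<tau>" "\<tau> < \<mu>" "\<tau> \<le> cm * D / 2" using \<mu>(1) cm(1) D(1) by (auto simp: \<tau>_def)
  obtain h1 where h1: "h1 > 0" "\<forall>\<xi>\<in>cubem m r. \<forall>\<zeta>\<in>cubem m r. (\<forall>i<m. \<bar>\<xi> i - \<zeta> i\<bar> \<le> h1) \<longrightarrow> norm (\<gamma> \<xi> - \<gamma> \<zeta>) < \<tau>/2"
    using cubem_uniformly_continuous[OF cont, of "\<tau>/2"] \<tau>(1) by auto
  show ?thesis
  proof (rule exI[of _ "min D h1"], intro conjI allI impI)
    show "0 < min D h1" using D(1) h1(1) by simp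
    fix h :: real and p :: nat assume h: "0 < h" and hle: "h \<le> min D h1" and hp: "h * real p = 2 * r" and p: "0 < p"
    note H = h hp p
    show "\<exists>\<eta>>0. \<forall>\<rho>. (\<forall>k\<in>kuhn_grid p m. \<rho> k \<in> span B \<and> norm (\<rho> k) < \<eta>) \<longrightarrow>
      card {\<xi>\<in>cubem m r. plin r h p m (perturbed_grid r h m \<gamma> \<rho>) \<xi> = 0} = card Z0"
    proof (rule exI[of _ "min (\<tau>/2) (cm * h / 8)"], intro conjI allI impI)
      show "0 < min (\<tau>/2) (cm * h / 8)" using \<tau>(1) cm(1) h by simp
      fix \<rho> :: "(nat \<Rightarrow> nat) \<Rightarrow> 'w" assume \<rho>: "\<forall>k\<in>kuhn_grid p m. \<rho> k \<in> span B \<and> norm (\<rho> k) < min (\<tau>/2) (cm * h / 8)"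
      define L where "L = plin r h p m (perturbed_grid r h m \<gamma> \<rho>)"
      have ap: "norm (L \<xi> - \<gamma> \<xi>) \<le> \<tau>" if "\<xi> \<in> cubem m r" for \<xi>
        unfolding L_def
      proof (rule plin_approximates[OF H _ _ that])
        show "norm (\<gamma> \<xi> - \<gamma> \<zeta>) \<le> \<tau>/2" if "\<xi> \<in> cubem m r" "\<zeta> \<in> cubem m r" "\<And>i. i < m \<Longrightarrow> \<bar>\<xi> i - \<zeta> i\<bar> \<le> h" for \<xi> \<zeta>
          using h1(2)[rule_format, OF that(1,2)] that(3) hle by fastforce
        show "norm (\<rho> k) \<le> \<tau>/2" if "k \<in> kuhn_grid p m" for k using \<rho> that by fastforce
      qed
      have loc: "\<exists>\<xi>. \<xi> \<in> cubem m r \<and> (\<forall>i<m. \<bar>\<xi> i - z i\<bar> \<le> D) \<and> L \<xi> = 0"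
        "\<And>\<xi> \<zeta>. \<xi> \<in> cubem m r \<Longrightarrow> \<zeta> \<in> cubem m r \<Longrightarrow> (\<And>i. i < m \<Longrightarrow> \<bar>\<xi> i - z i\<bar> \<le> D) \<Longrightarrow> (\<And>i. i < m \<Longrightarrow> \<bar>\<zeta> i - z i\<bar> \<le> D) \<Longrightarrow>
        L \<xi> = 0 \<Longrightarrow> L \<zeta> = 0 \<Longrightarrow> \<xi> = \<zeta>" if z: "z \<in> Z0" for z
      proof -
        have zc: "z \<in> cubem m r" "\<gamma> z = 0" using z by (auto simp: Z0_def)
        have ch: "cm * h / 8 \<le> c z * h / 8" using cm(2) z h by (simp add: mult_right_mono)
        have q: "fam_indep (a z) {..<m}" "\<And>i. i < m \<Longrightarrow> a z i \<in> span B" "0 < c z" "\<And>\<eta>. c z * (\<Sum>i<m. \<bar>\<eta> i\<bar>) \<le> norm (\<Sum>i<m. \<eta> i *\<^sub>R a z i)"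
          using acd[OF z] by auto
        have str: "norm (\<gamma> \<xi> - \<gamma> \<zeta> - (\<Sum>i<m. (\<xi> i - \<zeta> i) *\<^sub>R a z i)) \<le> c z/4 * (\<Sum>i<m. \<bar>\<xi> i - \<zeta> i\<bar>)"
          if x: "\<xi> \<in> cubem m r" "\<zeta> \<in> cubem m r" "\<And>i. i < m \<Longrightarrow> \<bar>\<xi> i - z i\<bar> \<le> 2 * D" "\<And>i. i < m \<Longrightarrow> \<bar>\<zeta> i - z i\<bar> \<le> 2 * D" for \<xi> \<zeta>
        proof -
          have lt: "2 * D < d z" using D(1,2) e1 z by fastforce
          have "\<forall>i<m. \<bar>\<xi> i - z i\<bar> < d z" "\<forall>i<m. \<bar>\<zeta> i - z i\<bar> < d z" using x(3,4) lt by fastforce+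
          then show ?thesis using acd[OF z] x(1,2) by blast
        qed
        have rD: "\<bar>z i\<bar> + D \<le> r" if "i < m" for i using e2(2)[rule_format, OF z that] D(3) by linarith
        have rh: "\<rho> k \<in> span B \<and> norm (\<rho> k) \<le> c z * h / 8" if "k \<in> kuhn_grid p m" for k using \<rho>[rule_format, OF that] ch by auto
        have "cm * D \<le> c z * D" using cm(2) z D(1) by (simp add: mult_right_mono)
        then have L0: "norm (L z) \<le> c z * D / 2" using ap[OF zc(1)] zc(2) \<tau>(3) by simp
        show "\<exists>\<xi>. \<xi> \<in> cubem m r \<and> (\<forall>i<m. \<bar>\<xi> i - z i\<bar> \<le> D) \<and> L \<xi> = 0"
          unfolding L_def
          by (rule plin_local_unique_zero(1)[OF B H \<gamma>B zc(1) D(1) rD q str _ rh]) (use hle L0 in \<open>auto simp: L_def\<close>)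
        show "\<xi> = \<zeta>" if x: "\<xi> \<in> cubem m r" "\<zeta> \<in> cubem m r" "\<And>i. i < m \<Longrightarrow> \<bar>\<xi> i - z i\<bar> \<le> D" "\<And>i. i < m \<Longrightarrow> \<bar>\<zeta> i - z i\<bar> \<le> D"
          "L \<xi> = 0" "L \<zeta> = 0" for \<xi> \<zeta>
          by (rule plin_local_unique_zero(2)[OF B H \<gamma>B zc(1) D(1) rD q str _ rh _ x(1-4)]) (use hle L0 x(5,6) in \<open>auto simp: L_def\<close>)
      qed
      obtain f where f: "\<And>z. z \<in> Z0 \<Longrightarrow> f z \<in> cubem m r \<and> (\<forall>i<m. \<bar>f z i - z i\<bar> \<le> D) \<and> L (f z) = 0"
        using loc(1) by metis
      have "bij_betw f Z0 {\<xi>\<in>cubem m r. L \<xi> = 0}"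
        unfolding bij_betw_def
      proof
        show "inj_on f Z0"
        proof (rule inj_onI)
          fix z z' assume z: "z \<in> Z0" "z' \<in> Z0" "f z = f z'"
          show "z = z'"
          proof (rule sep[OF z(1,2)])
            fix i assume "i < m"
            then show "\<bar>z i - z' i\<bar> \<le> 2 * D" using f[OF z(1)] f[OF z(2)] z(3) by (smt (verit))
          qed
        qed
        show "f ` Z0 = {\<xi>\<in>cubem m r. L \<xi> = 0}"
        proof
          show "f ` Z0 \<subseteq> {\<xi>\<in>cubem m r. L \<xi> = 0}" using f by auto
          show "{\<xi>\<in>cubem m r. L \<xi> = 0} \<subseteq> f ` Z0"
          proof
            fix \<xi> assume x: "\<xi> \<in> {\<xi>\<in>cubem m r. L \<xi> = 0}"
            then have "norm (\<gamma> \<xi>) \<le> \<tau>" using ap[of \<xi>] by simp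
            then have "\<xi> \<notin> Aw" using \<mu>(2)[of \<xi>] \<tau>(2) by auto
            then obtain z where z: "z \<in> Z0" "\<not> (\<exists>i<m. D \<le> \<bar>\<xi> i - z i\<bar>)" using x unfolding Aw_def by blast
            have "\<xi> = f z"
              by (rule loc(2)[OF z(1)]) (use x z f[OF z(1)] in \<open>auto simp: not_le less_imp_le\<close>)
            then show "\<xi> \<in> f ` Z0" using z(1) by blast
          qed
        qed
      qed
      then show "card {\<xi>\<in>cubem m r. plin r h p m (perturbed_grid r h m \<gamma> \<rho>) \<xi> = 0} = card Z0"
        by (simp add: bij_betw_same_card[symmetric] L_def)
    qed
  qed
qed


section \<open>Continuation of zeros on manifolds\<close>

text \<open>Both maps are interpolated with the same mesh and perturbation, so the vertex values
  agree on the boundary and the parities coincide; for \<open>\<gamma>\<close> the count is that of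
  its regular zeros. The interpolant of \<open>\<gamma>'\<close> is blended back into
  \<open>\<gamma>'\<close> near the boundary, where no zeros can arise, so that the change can be
  pasted into a manifold.\<close>

lemma chart_modification:
  fixes \<gamma> \<gamma>' :: "(nat \<Rightarrow> real) \<Rightarrow> 'w::banach"
  assumes m: "0 < m" and B: "finite B" "independent B" "card B = m" and r: "0 < r1" "r1 < r"
    and cont: "continuous_on (cubem m r) \<gamma>" "continuous_on (cubem m r) \<gamma>'"
    and \<gamma>B: "\<And>\<xi>. \<xi> \<in> cubem m r \<Longrightarrow> \<gamma> \<xi> \<in> span B" "\<And>\<xi>. \<xi> \<in> cubem m r \<Longrightarrow> \<gamma>' \<xi> \<in> span B"
    and shell: "\<And>\<xi> i. \<xi> \<in> cubem m r \<Longrightarrow> i < m \<Longrightarrow> r1 \<le> \<bar>\<xi> i\<bar> \<Longrightarrow> \<gamma>' \<xi> = \<gamma> \<xi> \<and> \<gamma> \<xi> \<noteq> 0"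
    and fin: "finite {\<xi>\<in>cubem m r. \<gamma> \<xi> = 0}"
    and reg: "\<And>\<xi>. \<xi> \<in> cubem m r \<Longrightarrow> \<gamma> \<xi> = 0 \<Longrightarrow> strict_reg_zero m r (span B) \<gamma> \<xi>" and \<epsilon>: "0 < \<epsilon>"
  shows "\<exists>\<gamma>''. continuous_on (cubem m r) \<gamma>'' \<and> (\<forall>\<xi>\<in>cubem m r. \<gamma>'' \<xi> \<in> span B \<and> norm (\<gamma>'' \<xi> - \<gamma>' \<xi>) < \<epsilon>) \<and>
    (\<forall>\<xi>\<in>cubem m r. \<forall>i<m. \<bar>\<xi> i\<bar> = r \<longrightarrow> \<gamma>'' \<xi> = \<gamma>' \<xi>) \<and> finite {\<xi>\<in>cubem m r. \<gamma>'' \<xi> = 0} \<and>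
    (even (card {\<xi>\<in>cubem m r. \<gamma>'' \<xi> = 0}) \<longleftrightarrow> even (card {\<xi>\<in>cubem m r. \<gamma> \<xi> = 0})) \<and>
    (\<forall>\<xi>0\<in>cubem m r. \<gamma>'' \<xi>0 = 0 \<longrightarrow> (\<forall>i<m. \<bar>\<xi>0 i\<bar> < r1) \<and> (\<exists>a e. fam_indep a {..<m} \<and> 0 < e \<and>
      (\<forall>\<xi>\<in>cubem m r. (\<forall>i<m. \<bar>\<xi> i - \<xi>0 i\<bar> < e) \<longrightarrow> \<gamma>'' \<xi> = (\<Sum>i<m. (\<xi> i - \<xi>0 i) *\<^sub>R a i))))"
proof -
  define Sh where "Sh = cubem m r \<inter> (\<Union>i<m. {\<xi>. r1 \<le> \<bar>\<xi> i\<bar>})"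
  have "closed (\<Union>i<m. {\<xi>::nat \<Rightarrow> real. r1 \<le> \<bar>\<xi> i\<bar>})"
    by (intro closed_UN finite_lessThan ballI closed_Collect_le continuous_intros continuous_on_product_coordinates)
  then have "compact Sh" unfolding Sh_def by (intro compact_Int_closed compact_cubem)
  moreover have "continuous_on Sh \<gamma>" by (rule continuous_on_subset[OF cont(1)]) (auto simp: Sh_def)
  moreover have "\<gamma> \<xi> \<noteq> 0" if "\<xi> \<in> Sh" for \<xi> using shell that by (auto simp: Sh_def)
  ultimately obtain \<mu> where \<mu>: "\<mu> > 0" "\<And>\<xi>. \<xi> \<in> Sh \<Longrightarrow> \<mu> \<le> norm (\<gamma> \<xi>)"
    using compact_norm_lower_bound[of Sh \<gamma>] by auto
  have sh': "\<mu> \<le> norm (\<gamma>' \<xi>)" if "\<xi> \<in> cubem m r" "i < m" "r1 \<le> \<bar>\<xi> i\<bar>" for \<xi> i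
    using shell[OF that] \<mu>(2)[of \<xi>] that by (auto simp: Sh_def)
  define \<tau> where "\<tau> = min (\<epsilon>/2) (\<mu>/2)"
  have \<tau>: "0 < \<tau>" "\<tau> < \<epsilon>" "\<tau> < \<mu>" using \<epsilon> \<mu>(1) by (auto simp: \<tau>_def)
  obtain h1 where h1: "h1 > 0" "\<forall>\<xi>\<in>cubem m r. \<forall>\<zeta>\<in>cubem m r. (\<forall>i<m. \<bar>\<xi> i - \<zeta> i\<bar> \<le> h1) \<longrightarrow> norm (\<gamma>' \<xi> - \<gamma>' \<zeta>) < \<tau>/2"
    using cubem_uniformly_continuous[OF cont(2), of "\<tau>/2"] \<tau>(1) by auto
  have int0: "\<bar>\<xi> i\<bar> < r" if "\<xi> \<in> {\<xi>\<in>cubem m r. \<gamma> \<xi> = 0}" "i < m" for \<xi> i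
    using shell[of \<xi> i] that r by fastforce
  have "\<exists>h0>0. \<forall>h p. 0 < h \<longrightarrow> h \<le> h0 \<longrightarrow> h * real p = 2 * r \<longrightarrow> 0 < p \<longrightarrow>
    (\<exists>\<eta>>0. \<forall>\<rho>. (\<forall>k\<in>kuhn_grid p m. \<rho> k \<in> span B \<and> norm (\<rho> k) < \<eta>) \<longrightarrow>
      card {\<xi>\<in>cubem m r. plin r h p m (perturbed_grid r h m \<gamma> \<rho>) \<xi> = 0} = card {\<xi>\<in>cubem m r. \<gamma> \<xi> = 0})"
  proof (rule plin_zero_count[OF B(1,3) cont(1) _ fin])
    show "\<gamma> \<xi> \<in> span B" if "\<xi> \<in> cubem m r" for \<xi> using \<gamma>B(1) that .
    show "\<bar>\<xi> i\<bar> < r" if "\<xi> \<in> {\<xi>\<in>cubem m r. \<gamma> \<xi> = 0}" "i < m" for \<xi> i using int0 that .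
  qed (use reg in simp)
  then obtain h0 where h0: "h0 > 0" "\<forall>h p. 0 < h \<longrightarrow> h \<le> h0 \<longrightarrow> h * real p = 2 * r \<longrightarrow> 0 < p \<longrightarrow>
    (\<exists>\<eta>>0. \<forall>\<rho>. (\<forall>k\<in>kuhn_grid p m. \<rho> k \<in> span B \<and> norm (\<rho> k) < \<eta>) \<longrightarrow>
      card {\<xi>\<in>cubem m r. plin r h p m (perturbed_grid r h m \<gamma> \<rho>) \<xi> = 0} = card {\<xi>\<in>cubem m r. \<gamma> \<xi> = 0})"
    by (elim exE conjE) (rule that)
  obtain n :: nat where n: "2 * r / min h0 h1 < real n" using reals_Archimedean2 by blast
  define p where "p = Suc n"
  define h where "h = 2 * r / real p"
  have p: "0 < p" by (simp add: p_def)
  have h: "0 < h" using r p by (simp add: h_def)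
  have hp: "h * real p = 2 * r" using p by (simp add: h_def)
  have mpos: "0 < min h0 h1" using h0(1) h1(1) by simp
  have "2 * r < real n * min h0 h1" using n mpos by (simp add: pos_divide_less_eq)
  also have "\<dots> \<le> real p * min h0 h1" using mpos by (intro mult_right_mono) (auto simp: p_def)
  finally have "2 * r \<le> min h0 h1 * real p" by (simp only: mult.commute less_imp_le)
  then have hle: "h \<le> min h0 h1" unfolding h_def by (rule pos_divide_le_eq[THEN iffD2, rotated]) (use p in simp)
  note H = h hp p
  obtain \<eta> where \<eta>: "\<eta> > 0" "\<And>\<rho>. (\<forall>k\<in>kuhn_grid p m. \<rho> k \<in> span B \<and> norm (\<rho> k) < \<eta>) \<Longrightarrow>
      card {\<xi>\<in>cubem m r. plin r h p m (perturbed_grid r h m \<gamma> \<rho>) \<xi> = 0} = card {\<xi>\<in>cubem m r. \<gamma> \<xi> = 0}"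
    using h0(2)[rule_format, OF h _ hp p] hle by auto
  have "0 < min \<eta> (\<tau>/2)" using \<eta>(1) \<tau>(1) by simp
  from generic_perturbation[OF finite_kuhn_grid B(1,2) this, of p m "\<lambda>k. \<gamma> (grid_pt r h m k)" "\<lambda>k. \<gamma>' (grid_pt r h m k)"]
  obtain \<rho> where \<rho>: "\<forall>k\<in>kuhn_grid p m. \<rho> k \<in> span B \<and> norm (\<rho> k) < min \<eta> (\<tau>/2)"
    and gen0: "\<forall>t\<subseteq>kuhn_grid p m. card t \<le> card B \<longrightarrow> fam_indep (\<lambda>k. \<gamma> (grid_pt r h m k) + \<rho> k) t \<and> fam_indep (\<lambda>k. \<gamma>' (grid_pt r h m k) + \<rho> k) t"
    by (elim exE conjE) (rule that)
  have gen: "\<forall>t\<subseteq>kuhn_grid p m. card t \<le> card B \<longrightarrow> fam_indep (perturbed_grid r h m \<gamma> \<rho>) t \<and> fam_indep (perturbed_grid r h m \<gamma>' \<rho>) t"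
    using gen0 unfolding perturbed_grid_def[abs_def] .
  let ?v = "perturbed_grid r h m \<gamma> \<rho>" and ?v' = "perturbed_grid r h m \<gamma>' \<rho>"
  define L where "L = plin r h p m ?v'"
  have g1: "fam_indep ?v t" and g2: "fam_indep ?v' t" if "t \<subseteq> kuhn_grid p m" "card t \<le> m" for t
    using gen that B(3) by auto
  have vB: "?v ` kuhn_grid p m \<subseteq> span B" "?v' ` kuhn_grid p m \<subseteq> span B"
    using \<gamma>B grid_pt_cubem[OF H] \<rho> by (auto simp: perturbed_grid_def intro!: span_add)
  \<comment> \<open>An index 0 or \<open>p\<close> puts the grid point on a face of the cube, which
    belongs to the shell where the two maps agree.\<close>
  have bd: "?v k = ?v' k" if k: "k \<in> kuhn_grid p m" "i < m" "k i = 0 \<or> k i = p" for k i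
  proof -
    have "\<bar>grid_pt r h m k i\<bar> = r" using k hp r by (auto simp: grid_pt_def)
    then show ?thesis using shell[OF grid_pt_cubem[OF H k(1)] k(2)] r by (simp add: perturbed_grid_def)
  qed
  have "even (card {s. ksimplex p m s \<and> conv0 ?v s}) \<longleftrightarrow> even (card {s. ksimplex p m s \<and> conv0 ?v' s})"
    by (rule kuhn_parity[OF m B g1 g2 vB bd])
  then have "even (card {\<xi>\<in>cubem m r. plin r h p m ?v \<xi> = 0}) \<longleftrightarrow> even (card {\<xi>\<in>cubem m r. L \<xi> = 0})"
    using plin_zeros_card(1)[OF H g1] plin_zeros_card(1)[OF H g2] by (simp add: L_def)
  moreover have "card {\<xi>\<in>cubem m r. plin r h p m ?v \<xi> = 0} = card {\<xi>\<in>cubem m r. \<gamma> \<xi> = 0}"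
    by (rule \<eta>(2)) (use \<rho> in auto)
  ultimately have par: "even (card {\<xi>\<in>cubem m r. L \<xi> = 0}) \<longleftrightarrow> even (card {\<xi>\<in>cubem m r. \<gamma> \<xi> = 0})" by simp
  have ap: "norm (L \<xi> - \<gamma>' \<xi>) \<le> \<tau>" if "\<xi> \<in> cubem m r" for \<xi>
    unfolding L_def
  proof (rule plin_approximates[OF H _ _ that])
    show "norm (\<gamma>' \<xi> - \<gamma>' \<zeta>) \<le> \<tau>/2" if "\<xi> \<in> cubem m r" "\<zeta> \<in> cubem m r" "\<And>i. i < m \<Longrightarrow> \<bar>\<xi> i - \<zeta> i\<bar> \<le> h" for \<xi> \<zeta>
      using h1(2)[rule_format, OF that(1,2)] that(3) hle by fastforce
    show "norm (\<rho> k) \<le> \<tau>/2" if "k \<in> kuhn_grid p m" for k using \<rho> that by fastforce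
  qed
  \<comment> \<open>Cutoff for the blending: 1 on the cube of radius \<open>r1\<close>, 0 on the
    faces of the cube of radius \<open>r\<close>.\<close>
  define \<beta> where "\<beta> \<xi> = (\<Prod>i<m. min 1 ((r - \<bar>\<xi> i\<bar>) / (r - r1)))" for \<xi> :: "nat \<Rightarrow> real"
  have \<beta>01: "0 \<le> \<beta> \<xi> \<and> \<beta> \<xi> \<le> 1" if "\<xi> \<in> cubem m r" for \<xi>
    unfolding \<beta>_def using that r by (intro conjI prod_nonneg prod_le_1) (auto simp: cubem_def)
  have \<beta>0: "\<beta> \<xi> = 0" if "i < m" "\<bar>\<xi> i\<bar> = r" for \<xi> i
    unfolding \<beta>_def using that by (intro prod_zero bexI[of _ i]) auto
  have \<beta>1: "\<beta> \<xi> = 1" if "\<And>i. i < m \<Longrightarrow> \<bar>\<xi> i\<bar> \<le> r1" for \<xi>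
    unfolding \<beta>_def using that r by (intro prod.neutral) (auto simp: min_def pos_le_divide_eq)
  have c\<beta>: "continuous_on (cubem m r) \<beta>"
    unfolding \<beta>_def by (rule continuous_on_subset[OF _ subset_UNIV])
      (intro continuous_intros continuous_on_product_coordinates, use r in auto)
  define \<gamma>2 where "\<gamma>2 \<xi> = \<gamma>' \<xi> + \<beta> \<xi> *\<^sub>R (L \<xi> - \<gamma>' \<xi>)" for \<xi>
  have LB: "L \<xi> \<in> span B" if "\<xi> \<in> cubem m r" for \<xi>
    unfolding L_def by (rule plin_in_subspace[OF H that vB(2) subspace_span])
  have dist: "norm (\<gamma>2 \<xi> - \<gamma>' \<xi>) \<le> \<tau>" if x: "\<xi> \<in> cubem m r" for \<xi>
  proof -
    have "norm (\<gamma>2 \<xi> - \<gamma>' \<xi>) = \<beta> \<xi> * norm (L \<xi> - \<gamma>' \<xi>)" using \<beta>01[OF x] by (simp add: \<gamma>2_def)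
    also have "\<dots> \<le> 1 * norm (L \<xi> - \<gamma>' \<xi>)" using \<beta>01[OF x] by (intro mult_right_mono) auto
    finally show ?thesis using ap[OF x] by simp
  qed
  have z1: "\<bar>\<xi> i\<bar> < r1" if x: "\<xi> \<in> cubem m r" "i < m" "norm (w - \<gamma>' \<xi>) \<le> \<tau>" "w = 0" for \<xi> i and w :: 'w
  proof (rule ccontr)
    assume "\<not> ?thesis"
    then have "\<mu> \<le> norm (\<gamma>' \<xi>)" using sh'[OF x(1,2)] by simp
    then show False using x(3,4) \<tau>(3) by simp
  qed
  have eqin: "\<gamma>2 \<xi> = L \<xi>" if "\<And>i. i < m \<Longrightarrow> \<bar>\<xi> i\<bar> < r1" for \<xi>
    using \<beta>1[of \<xi>] that by (simp add: \<gamma>2_def less_imp_le)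
  have zeros: "{\<xi>\<in>cubem m r. \<gamma>2 \<xi> = 0} = {\<xi>\<in>cubem m r. L \<xi> = 0}"
  proof (intro Collect_cong conj_cong refl)
    fix \<xi> assume x: "\<xi> \<in> cubem m r"
    show "\<gamma>2 \<xi> = 0 \<longleftrightarrow> L \<xi> = 0"
      using z1[OF x _ dist[OF x]] z1[OF x _ ap[OF x]] eqin[of \<xi>] by fastforce
  qed
  have fz: "finite {\<xi>\<in>cubem m r. L \<xi> = 0}" unfolding L_def by (rule plin_zeros_card(2)[OF H g2])
  have aff: "(\<forall>i<m. \<bar>\<xi>0 i\<bar> < r1) \<and> (\<exists>a e. fam_indep a {..<m} \<and> 0 < e \<and>
      (\<forall>\<xi>\<in>cubem m r. (\<forall>i<m. \<bar>\<xi> i - \<xi>0 i\<bar> < e) \<longrightarrow> \<gamma>2 \<xi> = (\<Sum>i<m. (\<xi> i - \<xi>0 i) *\<^sub>R a i)))"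
    if x: "\<xi>0 \<in> cubem m r" "\<gamma>2 \<xi>0 = 0" for \<xi>0
  proof
    show in1: "\<forall>i<m. \<bar>\<xi>0 i\<bar> < r1" using z1[OF x(1) _ dist[OF x(1)] x(2)] by blast
    have L0: "plin r h p m ?v' \<xi>0 = 0" using eqin in1 x(2) by (simp add: L_def)
    have "\<exists>a e. fam_indep a {..<m} \<and> (\<forall>i<m. a i \<in> span B) \<and> 0 < e \<and>
      (\<forall>\<xi>. (\<forall>i<m. \<bar>\<xi> i - \<xi>0 i\<bar> < e) \<longrightarrow> plin r h p m ?v' \<xi> = (\<Sum>i<m. (\<xi> i - \<xi>0 i) *\<^sub>R a i))"
      by (rule plin_locally_affine[OF H g2 vB(2) subspace_span x(1) L0])
    then obtain a e where a: "fam_indep a {..<m}" "0 < e"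
      "\<forall>\<xi>. (\<forall>i<m. \<bar>\<xi> i - \<xi>0 i\<bar> < e) \<longrightarrow> plin r h p m ?v' \<xi> = (\<Sum>i<m. (\<xi> i - \<xi>0 i) *\<^sub>R a i)"
      by (elim exE conjE) (rule that)
    have "\<exists>e2>0. \<forall>i\<in>{..<m}. e2 \<le> r1 - \<bar>\<xi>0 i\<bar>"
      by (rule finite_pos_lower_bound) (use in1 in auto)
    then obtain e2 where e2: "e2 > 0" "\<And>i. i < m \<Longrightarrow> e2 \<le> r1 - \<bar>\<xi>0 i\<bar>" by auto
    show "\<exists>a e. fam_indep a {..<m} \<and> 0 < e \<and>
      (\<forall>\<xi>\<in>cubem m r. (\<forall>i<m. \<bar>\<xi> i - \<xi>0 i\<bar> < e) \<longrightarrow> \<gamma>2 \<xi> = (\<Sum>i<m. (\<xi> i - \<xi>0 i) *\<^sub>R a i))"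
    proof (intro exI[of _ a] exI[of _ "min e e2"] conjI ballI impI a(1))
      show "0 < min e e2" using a(2) e2(1) by simp
      fix \<xi> assume near: "\<forall>i<m. \<bar>\<xi> i - \<xi>0 i\<bar> < min e e2"
      have "\<bar>\<xi> i\<bar> < r1" if "i < m" for i using near[rule_format, OF that] e2(2)[OF that] by linarith
      then have "\<gamma>2 \<xi> = L \<xi>" by (rule eqin)
      also have "\<dots> = (\<Sum>i<m. (\<xi> i - \<xi>0 i) *\<^sub>R a i)" unfolding L_def using a(3) near by simp
      finally show "\<gamma>2 \<xi> = (\<Sum>i<m. (\<xi> i - \<xi>0 i) *\<^sub>R a i)" .
    qed
  qed
  show ?thesis
  proof (intro exI[of _ \<gamma>2] conjI)
    show "continuous_on (cubem m r) \<gamma>2" unfolding \<gamma>2_def L_def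
      by (intro continuous_intros cont c\<beta> plin_continuous[OF H])
    show "\<forall>\<xi>\<in>cubem m r. \<gamma>2 \<xi> \<in> span B \<and> norm (\<gamma>2 \<xi> - \<gamma>' \<xi>) < \<epsilon>"
    proof
      fix \<xi> assume x: "\<xi> \<in> cubem m r"
      have "\<gamma>2 \<xi> \<in> span B" unfolding \<gamma>2_def by (intro span_add span_scale span_diff \<gamma>B LB x)
      then show "\<gamma>2 \<xi> \<in> span B \<and> norm (\<gamma>2 \<xi> - \<gamma>' \<xi>) < \<epsilon>" using dist[OF x] \<tau>(2) by simp
    qed
    show "\<forall>\<xi>\<in>cubem m r. \<forall>i<m. \<bar>\<xi> i\<bar> = r \<longrightarrow> \<gamma>2 \<xi> = \<gamma>' \<xi>" using \<beta>0 by (simp add: \<gamma>2_def)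
    show "finite {\<xi>\<in>cubem m r. \<gamma>2 \<xi> = 0}" unfolding zeros by (rule fz)
    show "even (card {\<xi>\<in>cubem m r. \<gamma>2 \<xi> = 0}) \<longleftrightarrow> even (card {\<xi>\<in>cubem m r. \<gamma> \<xi> = 0})" unfolding zeros by (rule par)
    show "\<forall>\<xi>0\<in>cubem m r. \<gamma>2 \<xi>0 = 0 \<longrightarrow> (\<forall>i<m. \<bar>\<xi>0 i\<bar> < r1) \<and> (\<exists>a e. fam_indep a {..<m} \<and> 0 < e \<and>
      (\<forall>\<xi>\<in>cubem m r. (\<forall>i<m. \<bar>\<xi> i - \<xi>0 i\<bar> < e) \<longrightarrow> \<gamma>2 \<xi> = (\<Sum>i<m. (\<xi> i - \<xi>0 i) *\<^sub>R a i)))" using aff by blast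
  qed
qed

section \<open>Regular zeros in charts of a manifold\<close>

text \<open>Formulated with ambient points instead of coordinates, so that regularity passes from
  one chart to another. The lower bound stands for injectivity of the derivative on a tangent space
  that is never formed.\<close>

definition reg_zero :: "'x::real_normed_vector set \<Rightarrow> ('x \<Rightarrow> 'w::real_normed_vector) \<Rightarrow> 'x \<Rightarrow> bool" where
  "reg_zero M g z \<longleftrightarrow> (\<exists>(A :: 'x \<Rightarrow>\<^sub>L 'w) c. 0 < c \<and>
    (\<forall>\<kappa>>0. \<exists>\<delta>>0. \<forall>x\<in>M \<inter> ball z \<delta>. \<forall>y\<in>M \<inter> ball z \<delta>. norm (g x - g y - blinfun_apply A (x - y)) \<le> \<kappa> * norm (x - y)) \<and>
    (\<exists>\<delta>>0. \<forall>x\<in>M \<inter> ball z \<delta>. \<forall>y\<in>M \<inter> ball z \<delta>. c * norm (x - y) \<le> norm (g x - g y)))"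

text \<open>A \<open>C\<^sup>1\<close> chart of \<open>M\<close> around \<open>p\<close>: a parametrization \<open>\<sigma>\<close> by a cube whose inverse is the linear map \<open>x \<mapsto> \<pi> (x - p)\<close>.\<close>

definition coords :: "nat \<Rightarrow> (nat \<Rightarrow> 'x::real_normed_vector \<Rightarrow>\<^sub>L real) \<Rightarrow> 'x \<Rightarrow> 'x \<Rightarrow> nat \<Rightarrow> real" where
  "coords m \<pi> p x = (\<lambda>i. if i < m then blinfun_apply (\<pi> i) (x - p) else 0)"

locale C1_chart =
  fixes m :: nat and M :: "'x::real_normed_vector set" and p :: 'x and \<pi> :: "nat \<Rightarrow> 'x \<Rightarrow>\<^sub>L real"
    and \<sigma> :: "(nat \<Rightarrow> real) \<Rightarrow> 'x" and r C :: real and U :: "'x set"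
  assumes r_pos: "0 < r" and C_pos: "0 < C" and open_U: "open U" and p_in: "p \<in> M \<inter> U"
    and chi_in: "\<And>\<xi>. \<xi> \<in> cubem m r \<Longrightarrow> \<sigma> \<xi> \<in> M"
    and coords_chi: "\<And>\<xi>. \<xi> \<in> cubem m r \<Longrightarrow> coords m \<pi> p (\<sigma> \<xi>) = \<xi>"
    and chi_lipschitz: "\<And>\<xi> \<zeta>. \<xi> \<in> cubem m r \<Longrightarrow> \<zeta> \<in> cubem m r \<Longrightarrow> norm (\<sigma> \<xi> - \<sigma> \<zeta>) \<le> C * (\<Sum>i<m. \<bar>\<xi> i - \<zeta> i\<bar>)"
    and image_open: "M \<inter> U = \<sigma> ` {\<xi>\<in>cubem m r. \<forall>i<m. \<bar>\<xi> i\<bar> < r}"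
    and chi_strict: "\<And>\<xi>0. \<xi>0 \<in> cubem m r \<Longrightarrow> (\<And>i. i < m \<Longrightarrow> \<bar>\<xi>0 i\<bar> < r) \<Longrightarrow> \<exists>D. \<forall>\<kappa>>0. \<exists>d>0. \<forall>\<xi>\<in>cubem m r. \<forall>\<zeta>\<in>cubem m r.
      (\<forall>i<m. \<bar>\<xi> i - \<xi>0 i\<bar> < d) \<longrightarrow> (\<forall>i<m. \<bar>\<zeta> i - \<xi>0 i\<bar> < d) \<longrightarrow>
      norm (\<sigma> \<xi> - \<sigma> \<zeta> - (\<Sum>i<m. (\<xi> i - \<zeta> i) *\<^sub>R D i)) \<le> \<kappa> * (\<Sum>i<m. \<bar>\<xi> i - \<zeta> i\<bar>)"
begin

lemma chi_coords: "x \<in> \<sigma> ` cubem m r \<Longrightarrow> \<sigma> (coords m \<pi> p x) = x"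
  using coords_chi by auto

lemma chi_inj: "inj_on \<sigma> (cubem m r)"
  by (rule inj_on_inverseI[of _ "coords m \<pi> p"]) (rule coords_chi)

lemma coords_continuous: "continuous_on S (coords m \<pi> p)"
proof (rule continuous_on_coordinatewise_then_product)
  fix i show "continuous_on S (\<lambda>x. coords m \<pi> p x i)"
    unfolding coords_def by (cases "i < m") (auto intro!: continuous_intros)
qed

lemma cubem_mono: "s \<le> r \<Longrightarrow> cubem m s \<subseteq> cubem m r"
  by (auto simp: cubem_def intro: order_trans)

lemma chi_continuous: "continuous_on (cubem m r) \<sigma>"
  unfolding continuous_on_def
proof
  fix \<xi> assume x: "\<xi> \<in> cubem m r"
  have "((\<lambda>\<zeta>. \<sigma> \<zeta> - \<sigma> \<xi>) \<longlongrightarrow> 0) (at \<xi> within cubem m r)"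
  proof (rule Lim_null_comparison)
    show "\<forall>\<^sub>F \<zeta> in at \<xi> within cubem m r. norm (\<sigma> \<zeta> - \<sigma> \<xi>) \<le> C * (\<Sum>i<m. \<bar>\<zeta> i - \<xi> i\<bar>)"
      unfolding eventually_at_filter using chi_lipschitz x by (intro always_eventually) auto
    have "continuous_on UNIV (\<lambda>\<zeta>::nat \<Rightarrow> real. C * (\<Sum>i<m. \<bar>\<zeta> i - \<xi> i\<bar>))"
      by (intro continuous_intros continuous_on_product_coordinates)
    then have "((\<lambda>\<zeta>. C * (\<Sum>i<m. \<bar>\<zeta> i - \<xi> i\<bar>)) \<longlongrightarrow> C * (\<Sum>i<m. \<bar>\<xi> i - \<xi> i\<bar>)) (at \<xi> within cubem m r)"
      by (meson UNIV_I continuous_on_def subset_UNIV tendsto_within_subset)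
    then show "((\<lambda>\<zeta>. C * (\<Sum>i<m. \<bar>\<zeta> i - \<xi> i\<bar>)) \<longlongrightarrow> 0) (at \<xi> within cubem m r)" by simp
  qed
  then show "(\<sigma> \<longlongrightarrow> \<sigma> \<xi>) (at \<xi> within cubem m r)" by (simp add: LIM_zero_iff)
qed

lemma image_compact: "s \<le> r \<Longrightarrow> compact (\<sigma> ` cubem m s)"
  by (intro compact_continuous_image compact_cubem continuous_on_subset[OF chi_continuous] cubem_mono)

lemma image_open_subcube:
  assumes "s \<le> r"
  shows "\<sigma> ` {\<xi>\<in>cubem m s. \<forall>i<m. \<bar>\<xi> i\<bar> < s} = M \<inter> (U \<inter> {x. \<forall>i<m. \<bar>blinfun_apply (\<pi> i) (x - p)\<bar> < s})"
proof
  show "\<sigma> ` {\<xi>\<in>cubem m s. \<forall>i<m. \<bar>\<xi> i\<bar> < s} \<subseteq> M \<inter> (U \<inter> {x. \<forall>i<m. \<bar>blinfun_apply (\<pi> i) (x - p)\<bar> < s})"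
  proof
    fix x assume "x \<in> \<sigma> ` {\<xi>\<in>cubem m s. \<forall>i<m. \<bar>\<xi> i\<bar> < s}"
    then obtain \<xi> where x: "\<xi> \<in> cubem m s" "\<forall>i<m. \<bar>\<xi> i\<bar> < s" "x = \<sigma> \<xi>" by auto
    have xr: "\<xi> \<in> cubem m r" using x(1) cubem_mono assms by auto
    have "x \<in> M \<inter> U" unfolding image_open using x xr assms by (intro image_eqI[of _ _ \<xi>]) auto
    moreover have "blinfun_apply (\<pi> i) (x - p) = \<xi> i" if "i < m" for i
      using coords_chi[OF xr] that x(3) by (auto simp: coords_def fun_eq_iff split: if_splits)
    ultimately show "x \<in> M \<inter> (U \<inter> {x. \<forall>i<m. \<bar>blinfun_apply (\<pi> i) (x - p)\<bar> < s})" using x(2) by auto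
  qed
  show "M \<inter> (U \<inter> {x. \<forall>i<m. \<bar>blinfun_apply (\<pi> i) (x - p)\<bar> < s}) \<subseteq> \<sigma> ` {\<xi>\<in>cubem m s. \<forall>i<m. \<bar>\<xi> i\<bar> < s}"
  proof
    fix x assume x: "x \<in> M \<inter> (U \<inter> {x. \<forall>i<m. \<bar>blinfun_apply (\<pi> i) (x - p)\<bar> < s})"
    then have "x \<in> \<sigma> ` {\<xi>\<in>cubem m r. \<forall>i<m. \<bar>\<xi> i\<bar> < r}" using image_open by auto
    then have "\<sigma> (coords m \<pi> p x) = x" using chi_coords by auto
    moreover have "coords m \<pi> p x \<in> cubem m s" "\<forall>i<m. \<bar>coords m \<pi> p x i\<bar> < s"
      using x by (auto simp: coords_def cubem_def less_imp_le)
    ultimately show "x \<in> \<sigma> ` {\<xi>\<in>cubem m s. \<forall>i<m. \<bar>\<xi> i\<bar> < s}" by (intro image_eqI[of _ _ "coords m \<pi> p x"]) auto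
  qed
qed

lemma open_subcube_nbhd: "open (U \<inter> {x. \<forall>i<m. \<bar>blinfun_apply (\<pi> i) (x - p)\<bar> < s})"
proof -
  have "{x. \<forall>i<m. \<bar>blinfun_apply (\<pi> i) (x - p)\<bar> < s} = (\<Inter>i\<in>{..<m}. {x. \<bar>blinfun_apply (\<pi> i) (x - p)\<bar> < s})" by auto
  moreover have "open (\<Inter>i\<in>{..<m}. {x. \<bar>blinfun_apply (\<pi> i) (x - p)\<bar> < s})"
    by (intro open_INT finite_lessThan ballI open_Collect_less continuous_intros)
  ultimately show ?thesis using open_U by (simp add: open_Int)
qed

text \<open>The image of the cube and the complement of its open part are both closed in
  \<open>M\<close> and meet only over the faces, where the two formulas agree.\<close>

lemma paste_continuous:
  assumes s: "s \<le> r" and f: "continuous_on (cubem m s) f" and g: "continuous_on M g"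
    and bd: "\<And>\<xi> i. \<xi> \<in> cubem m s \<Longrightarrow> i < m \<Longrightarrow> \<bar>\<xi> i\<bar> = s \<Longrightarrow> f \<xi> = g (\<sigma> \<xi>)"
  shows "continuous_on M (\<lambda>x. if x \<in> \<sigma> ` cubem m s then f (coords m \<pi> p x) else g x)"
proof -
  let ?A = "\<sigma> ` cubem m s" and ?O = "\<sigma> ` {\<xi>\<in>cubem m s. \<forall>i<m. \<bar>\<xi> i\<bar> < s}"
  let ?B = "M - ?O"
  have AM: "?A \<subseteq> M" using chi_in cubem_mono[OF s] by auto
  have un: "?A \<union> ?B = M" using AM by auto
  have "closedin (top_of_set M) ?A" using AM image_compact[OF s] by (simp add: closed_subset compact_imp_closed)
  moreover have "openin (top_of_set M) ?O" unfolding image_open_subcube[OF s] by (intro openin_open_Int open_subcube_nbhd)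
  then have "closedin (top_of_set M) ?B" by (simp add: closedin_diff)
  moreover have cA: "coords m \<pi> p ` ?A \<subseteq> cubem m s" using coords_chi cubem_mono[OF s] by (auto simp: subset_iff)
  have "continuous_on ?A (\<lambda>x. f (coords m \<pi> p x))"
    by (rule continuous_on_compose2[OF f coords_continuous cA])
  moreover have "continuous_on ?B g" by (rule continuous_on_subset[OF g]) auto
  moreover have "f (coords m \<pi> p x) = g x" if "x \<in> ?A \<and> x \<notin> ?A \<or> x \<in> ?B \<and> x \<in> ?A" for x
  proof -
    obtain \<xi> where x: "\<xi> \<in> cubem m s" "x = \<sigma> \<xi>" "x \<notin> ?O" using \<open>x \<in> ?A \<and> x \<notin> ?A \<or> x \<in> ?B \<and> x \<in> ?A\<close> by auto
    then obtain i where "i < m" "\<not> \<bar>\<xi> i\<bar> < s" by blast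
    then have "f \<xi> = g x" using bd[of \<xi> i] x by (auto simp: cubem_def)
    then show ?thesis using x coords_chi cubem_mono[OF s] by auto
  qed
  ultimately show ?thesis
    using continuous_on_cases_local[of ?A ?B "\<lambda>x. f (coords m \<pi> p x)" g "\<lambda>x. x \<in> ?A"] unfolding un by blast
qed

end


context C1_chart
begin

lemma coord_lower:
  obtains c where "0 < c" "\<And>x y. c * (\<Sum>i<m. \<bar>coords m \<pi> p x i - coords m \<pi> p y i\<bar>) \<le> norm (x - y)"
proof -
  define K where "K = 1 + (\<Sum>i<m. norm (\<pi> i))"
  have K: "0 < K" unfolding K_def by (intro add_pos_nonneg sum_nonneg) auto
  have "(\<Sum>i<m. \<bar>coords m \<pi> p x i - coords m \<pi> p y i\<bar>) \<le> K * norm (x - y)" for x y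
  proof -
    have "(\<Sum>i<m. \<bar>coords m \<pi> p x i - coords m \<pi> p y i\<bar>) \<le> (\<Sum>i<m. norm (\<pi> i) * norm (x - y))"
    proof (rule sum_mono)
      fix i assume i: "i \<in> {..<m}"
      have "coords m \<pi> p x i - coords m \<pi> p y i = blinfun_apply (\<pi> i) (x - y)"
        using i by (simp add: coords_def blinfun.diff_right)
      then show "\<bar>coords m \<pi> p x i - coords m \<pi> p y i\<bar> \<le> norm (\<pi> i) * norm (x - y)"
        using norm_blinfun[of "\<pi> i" "x - y"] by simp
    qed
    also have "\<dots> = (\<Sum>i<m. norm (\<pi> i)) * norm (x - y)" by (simp add: sum_distrib_right)
    also have "\<dots> \<le> K * norm (x - y)" unfolding K_def by (intro mult_right_mono) auto
    finally show ?thesis .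
  qed
  then have "1/K * (\<Sum>i<m. \<bar>coords m \<pi> p x i - coords m \<pi> p y i\<bar>) \<le> norm (x - y)" for x y
    using K by (simp add: field_simps)
  then show ?thesis using that[of "1/K"] K by simp
qed

lemma chi_near:
  assumes "\<xi>0 \<in> cubem m r" "0 < \<delta>"
  shows "\<exists>d>0. \<forall>\<xi>\<in>cubem m r. (\<forall>i<m. \<bar>\<xi> i - \<xi>0 i\<bar> < d) \<longrightarrow> \<sigma> \<xi> \<in> ball (\<sigma> \<xi>0) \<delta>"
proof -
  define d where "d = \<delta> / (C * (real m + 1))"
  have d: "0 < d" using assms(2) C_pos by (simp add: d_def add_nonneg_pos)
  show ?thesis
  proof (intro exI[of _ d] conjI d ballI impI)
    fix \<xi> assume x: "\<xi> \<in> cubem m r" "\<forall>i<m. \<bar>\<xi> i - \<xi>0 i\<bar> < d"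
    have "norm (\<sigma> \<xi> - \<sigma> \<xi>0) \<le> C * (\<Sum>i<m. \<bar>\<xi> i - \<xi>0 i\<bar>)" by (rule chi_lipschitz[OF x(1) assms(1)])
    also have "\<dots> \<le> C * (\<Sum>i<m. d)" using C_pos x(2) by (intro mult_left_mono sum_mono) (auto intro: less_imp_le)
    also have "\<dots> = C * (real m * d)" by simp
    also have "\<dots> < C * ((real m + 1) * d)" using C_pos d by (intro mult_strict_left_mono) auto
    also have "\<dots> = \<delta>" using C_pos by (simp add: d_def)
    finally show "\<sigma> \<xi> \<in> ball (\<sigma> \<xi>0) \<delta>" by (simp add: dist_norm norm_minus_commute)
  qed
qed

text \<open>The chain rule gives the partial derivatives \<open>A (D i)\<close>. A linear relation
  among them would give increments of \<open>g\<close> of smaller order than the displacement,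
  against the lower bound; as limits of difference quotients they lie in the closed subspace
  \<open>Y\<close>.\<close>

lemma reg_zero_in_chart:
  fixes g :: "'x \<Rightarrow> 'w::banach"
  assumes g: "\<And>x. x \<in> M \<Longrightarrow> g x \<in> Y" and Y: "subspace Y" "closed Y"
    and reg: "reg_zero M g (\<sigma> \<xi>0)" and x0: "\<xi>0 \<in> cubem m r" "\<And>i. i < m \<Longrightarrow> \<bar>\<xi>0 i\<bar> < r"
  shows "strict_reg_zero m r Y (\<lambda>\<xi>. g (\<sigma> \<xi>)) \<xi>0"
proof -
  let ?l1 = "\<lambda>\<xi> \<zeta>. \<Sum>i<m. \<bar>\<xi> i - \<zeta> i\<bar>" and ?\<gamma> = "\<lambda>\<xi>. g (\<sigma> \<xi>)"
  obtain A :: "'x \<Rightarrow>\<^sub>L 'w" and c where Ac: "0 < c \<and>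
    (\<forall>\<kappa>>0. \<exists>\<delta>>0. \<forall>x\<in>M \<inter> ball (\<sigma> \<xi>0) \<delta>. \<forall>y\<in>M \<inter> ball (\<sigma> \<xi>0) \<delta>. norm (g x - g y - blinfun_apply A (x - y)) \<le> \<kappa> * norm (x - y)) \<and>
    (\<exists>\<delta>>0. \<forall>x\<in>M \<inter> ball (\<sigma> \<xi>0) \<delta>. \<forall>y\<in>M \<inter> ball (\<sigma> \<xi>0) \<delta>. c * norm (x - y) \<le> norm (g x - g y))"
    using reg unfolding reg_zero_def by (elim exE) (rule that)
  note c = conjunct1[OF Ac] and Aa = conjunct1[OF conjunct2[OF Ac]] and Ab = conjunct2[OF conjunct2[OF Ac]]
  have "\<exists>D. \<forall>\<kappa>>0. \<exists>d>0. \<forall>\<xi>\<in>cubem m r. \<forall>\<zeta>\<in>cubem m r.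
      (\<forall>i<m. \<bar>\<xi> i - \<xi>0 i\<bar> < d) \<longrightarrow> (\<forall>i<m. \<bar>\<zeta> i - \<xi>0 i\<bar> < d) \<longrightarrow>
      norm (\<sigma> \<xi> - \<sigma> \<zeta> - (\<Sum>i<m. (\<xi> i - \<zeta> i) *\<^sub>R D i)) \<le> \<kappa> * ?l1 \<xi> \<zeta>"
    by (rule chi_strict[OF x0(1)]) (rule x0(2))
  then obtain D where D: "\<forall>\<kappa>>0. \<exists>d>0. \<forall>\<xi>\<in>cubem m r. \<forall>\<zeta>\<in>cubem m r.
      (\<forall>i<m. \<bar>\<xi> i - \<xi>0 i\<bar> < d) \<longrightarrow> (\<forall>i<m. \<bar>\<zeta> i - \<xi>0 i\<bar> < d) \<longrightarrow>
      norm (\<sigma> \<xi> - \<sigma> \<zeta> - (\<Sum>i<m. (\<xi> i - \<zeta> i) *\<^sub>R D i)) \<le> \<kappa> * ?l1 \<xi> \<zeta>"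
    by (elim exE) (rule that)
  define a where "a i = blinfun_apply A (D i)" for i
  have str: "\<exists>d>0. \<forall>\<xi>\<in>cubem m r. \<forall>\<zeta>\<in>cubem m r.
      (\<forall>i<m. \<bar>\<xi> i - \<xi>0 i\<bar> < d) \<longrightarrow> (\<forall>i<m. \<bar>\<zeta> i - \<xi>0 i\<bar> < d) \<longrightarrow>
      norm (?\<gamma> \<xi> - ?\<gamma> \<zeta> - (\<Sum>i<m. (\<xi> i - \<zeta> i) *\<^sub>R a i)) \<le> \<kappa> * ?l1 \<xi> \<zeta>" if k: "0 < \<kappa>" for \<kappa>
  proof -
    define N where "N = norm A + 1"
    have N: "0 < N" by (simp add: N_def add_nonneg_pos)
    have "0 < \<kappa> / (2 * C)" using k C_pos by simp
    with Aa obtain \<delta> where \<delta>: "\<delta> > 0" "\<forall>x\<in>M \<inter> ball (\<sigma> \<xi>0) \<delta>. \<forall>y\<in>M \<inter> ball (\<sigma> \<xi>0) \<delta>. norm (g x - g y - blinfun_apply A (x - y)) \<le> \<kappa> / (2 * C) * norm (x - y)" by blast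
    obtain d1 where d1: "d1 > 0" "\<forall>\<xi>\<in>cubem m r. (\<forall>i<m. \<bar>\<xi> i - \<xi>0 i\<bar> < d1) \<longrightarrow> \<sigma> \<xi> \<in> ball (\<sigma> \<xi>0) \<delta>"
      using chi_near[OF x0(1) \<delta>(1)] by auto
    have "0 < \<kappa> / (2 * N)" using k N by simp
    with D obtain d2 where d2: "d2 > 0" "\<forall>\<xi>\<in>cubem m r. \<forall>\<zeta>\<in>cubem m r.
      (\<forall>i<m. \<bar>\<xi> i - \<xi>0 i\<bar> < d2) \<longrightarrow> (\<forall>i<m. \<bar>\<zeta> i - \<xi>0 i\<bar> < d2) \<longrightarrow>
      norm (\<sigma> \<xi> - \<sigma> \<zeta> - (\<Sum>i<m. (\<xi> i - \<zeta> i) *\<^sub>R D i)) \<le> \<kappa> / (2 * N) * ?l1 \<xi> \<zeta>" by blast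
    show ?thesis
    proof (intro exI[of _ "min d1 d2"] conjI ballI impI)
      show "0 < min d1 d2" using d1(1) d2(1) by simp
      fix \<xi> \<zeta> assume x: "\<xi> \<in> cubem m r" "\<zeta> \<in> cubem m r" "\<forall>i<m. \<bar>\<xi> i - \<xi>0 i\<bar> < min d1 d2" "\<forall>i<m. \<bar>\<zeta> i - \<xi>0 i\<bar> < min d1 d2"
      have in1: "\<sigma> \<xi> \<in> M \<inter> ball (\<sigma> \<xi>0) \<delta>" "\<sigma> \<zeta> \<in> M \<inter> ball (\<sigma> \<xi>0) \<delta>"
        using d1(2) x chi_in by auto
      have "norm (?\<gamma> \<xi> - ?\<gamma> \<zeta> - blinfun_apply A (\<sigma> \<xi> - \<sigma> \<zeta>)) \<le> \<kappa> / (2 * C) * norm (\<sigma> \<xi> - \<sigma> \<zeta>)"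
        using \<delta>(2) in1 by blast
      also have "\<dots> \<le> \<kappa> / (2 * C) * (C * ?l1 \<xi> \<zeta>)"
        using chi_lipschitz[OF x(1,2)] k C_pos by (intro mult_left_mono) auto
      also have "\<dots> = \<kappa>/2 * ?l1 \<xi> \<zeta>" using C_pos by simp
      finally have e1: "norm (?\<gamma> \<xi> - ?\<gamma> \<zeta> - blinfun_apply A (\<sigma> \<xi> - \<sigma> \<zeta>)) \<le> \<kappa>/2 * ?l1 \<xi> \<zeta>" .
      have l0: "0 \<le> ?l1 \<xi> \<zeta>" by (intro sum_nonneg) auto
      have "norm (blinfun_apply A (\<sigma> \<xi> - \<sigma> \<zeta> - (\<Sum>i<m. (\<xi> i - \<zeta> i) *\<^sub>R D i))) \<le> norm A * norm (\<sigma> \<xi> - \<sigma> \<zeta> - (\<Sum>i<m. (\<xi> i - \<zeta> i) *\<^sub>R D i))"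
        by (rule norm_blinfun)
      also have "\<dots> \<le> N * (\<kappa> / (2 * N) * ?l1 \<xi> \<zeta>)"
        using d2(2) x by (intro mult_mono) (auto simp: N_def)
      also have "\<dots> = \<kappa>/2 * ?l1 \<xi> \<zeta>" using N by simp
      finally have e2: "norm (blinfun_apply A (\<sigma> \<xi> - \<sigma> \<zeta> - (\<Sum>i<m. (\<xi> i - \<zeta> i) *\<^sub>R D i))) \<le> \<kappa>/2 * ?l1 \<xi> \<zeta>" .
      have eq: "?\<gamma> \<xi> - ?\<gamma> \<zeta> - (\<Sum>i<m. (\<xi> i - \<zeta> i) *\<^sub>R a i) = (?\<gamma> \<xi> - ?\<gamma> \<zeta> - blinfun_apply A (\<sigma> \<xi> - \<sigma> \<zeta>)) + blinfun_apply A (\<sigma> \<xi> - \<sigma> \<zeta> - (\<Sum>i<m. (\<xi> i - \<zeta> i) *\<^sub>R D i))"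
        by (simp add: a_def blinfun.diff_right blinfun.sum_right blinfun.scaleR_right)
      show "norm (?\<gamma> \<xi> - ?\<gamma> \<zeta> - (\<Sum>i<m. (\<xi> i - \<zeta> i) *\<^sub>R a i)) \<le> \<kappa> * ?l1 \<xi> \<zeta>"
        unfolding eq using norm_triangle_mono[OF e1 e2] by simp
    qed
  qed
  have "\<exists>e>0. \<forall>i\<in>{..<m}. e \<le> r - \<bar>\<xi>0 i\<bar>" by (rule finite_pos_lower_bound) (use x0 in auto)
  then obtain e0 where e0: "e0 > 0" "\<And>i. i < m \<Longrightarrow> e0 \<le> r - \<bar>\<xi>0 i\<bar>" by auto
  \<comment> \<open>Since \<open>\<xi>0\<close> is interior, small steps in any direction stay in
    the cube. The directions needed are a supposed linear relation and the coordinate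
    vectors.\<close>
  have dir: "\<exists>s>0. (\<lambda>i. if i < m then \<xi>0 i + s * t i else 0) \<in> cubem m r \<and> (\<forall>i<m. \<bar>(\<xi>0 i + s * t i) - \<xi>0 i\<bar> < d)" if d: "0 < d" for t :: "nat \<Rightarrow> real" and d
  proof -
    define T where "T = 1 + (\<Sum>i<m. \<bar>t i\<bar>)"
    have T: "0 < T" unfolding T_def by (intro add_pos_nonneg sum_nonneg) auto
    define s where "s = min d e0 / (2 * T)"
    have s: "0 < s" using d e0(1) T by (simp add: s_def)
    have st: "\<bar>s * t i\<bar> < min d e0" if "i < m" for i
    proof -
      have "\<bar>t i\<bar> \<le> T" unfolding T_def using member_le_sum[of i "{..<m}" "\<lambda>i. \<bar>t i\<bar>"] that by simp
      then have "\<bar>s * t i\<bar> \<le> s * T" using s by (simp add: abs_mult mult_left_mono)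
      also have "\<dots> = min d e0 / 2" using T by (simp add: s_def)
      also have "\<dots> < min d e0" using min_less_iff_conj[of 0 d e0] d e0(1) by linarith
      finally show ?thesis .
    qed
    have "\<bar>\<xi>0 i + s * t i\<bar> \<le> r" if "i < m" for i using st[OF that] e0(2)[OF that] by linarith
    then show ?thesis using s st by (intro exI[of _ s]) (auto simp: cubem_def)
  qed
  obtain cl where cl: "0 < cl" "\<And>x y. cl * (\<Sum>i<m. \<bar>coords m \<pi> p x i - coords m \<pi> p y i\<bar>) \<le> norm (x - y)"
    using coord_lower by auto
  have indep: "fam_indep a {..<m}"
    unfolding fam_indep_def
  proof (rule ccontr)
    assume "\<not> (\<forall>t. (\<Sum>k<m. t k *\<^sub>R a k) = 0 \<longrightarrow> (\<forall>k\<in>{..<m}. t k = 0))"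
    then obtain t k where t: "(\<Sum>k<m. t k *\<^sub>R a k) = 0" "k < m" "t k \<noteq> 0" by auto
    obtain \<delta> where \<delta>: "\<delta> > 0" "\<forall>x\<in>M \<inter> ball (\<sigma> \<xi>0) \<delta>. \<forall>y\<in>M \<inter> ball (\<sigma> \<xi>0) \<delta>. c * norm (x - y) \<le> norm (g x - g y)"
      using Ab by auto
    obtain d1 where d1: "d1 > 0" "\<forall>\<xi>\<in>cubem m r. (\<forall>i<m. \<bar>\<xi> i - \<xi>0 i\<bar> < d1) \<longrightarrow> \<sigma> \<xi> \<in> ball (\<sigma> \<xi>0) \<delta>"
      using chi_near[OF x0(1) \<delta>(1)] by auto
    have "0 < c * cl / 2" using c cl(1) by simp
    from str[OF this] obtain d2 where d2: "d2 > 0" "\<forall>\<xi>\<in>cubem m r. \<forall>\<zeta>\<in>cubem m r.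
      (\<forall>i<m. \<bar>\<xi> i - \<xi>0 i\<bar> < d2) \<longrightarrow> (\<forall>i<m. \<bar>\<zeta> i - \<xi>0 i\<bar> < d2) \<longrightarrow>
      norm (?\<gamma> \<xi> - ?\<gamma> \<zeta> - (\<Sum>i<m. (\<xi> i - \<zeta> i) *\<^sub>R a i)) \<le> c * cl / 2 * ?l1 \<xi> \<zeta>" by auto
    have "0 < min d1 d2" using d1(1) d2(1) by simp
    from dir[OF this, of t] obtain s where s: "s > 0" "(\<lambda>i. if i < m then \<xi>0 i + s * t i else 0) \<in> cubem m r" "\<forall>i<m. \<bar>(\<xi>0 i + s * t i) - \<xi>0 i\<bar> < min d1 d2" by auto
    define \<xi> where "\<xi> = (\<lambda>i. if i < m then \<xi>0 i + s * t i else 0)"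
    have x: "\<xi> \<in> cubem m r" "\<forall>i<m. \<bar>\<xi> i - \<xi>0 i\<bar> < min d1 d2" using s by (auto simp: \<xi>_def)
    have "(\<Sum>i<m. (\<xi> i - \<xi>0 i) *\<^sub>R a i) = s *\<^sub>R (\<Sum>i<m. t i *\<^sub>R a i)"
      unfolding scaleR_sum_right by (intro sum.cong refl) (simp add: \<xi>_def)
    then have z: "(\<Sum>i<m. (\<xi> i - \<xi>0 i) *\<^sub>R a i) = 0" using t(1) by simp
    have "norm (?\<gamma> \<xi> - ?\<gamma> \<xi>0 - (\<Sum>i<m. (\<xi> i - \<xi>0 i) *\<^sub>R a i)) \<le> c * cl / 2 * ?l1 \<xi> \<xi>0"
      using d2 x x0(1) by auto
    then have u: "norm (?\<gamma> \<xi> - ?\<gamma> \<xi>0) \<le> c * cl / 2 * ?l1 \<xi> \<xi>0" using z by simp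
    have "c * (cl * ?l1 \<xi> \<xi>0) \<le> c * norm (\<sigma> \<xi> - \<sigma> \<xi>0)"
      using cl(2)[of "\<sigma> \<xi>" "\<sigma> \<xi>0"] c coords_chi[OF x(1)] coords_chi[OF x0(1)] by (intro mult_left_mono) auto
    also have "\<dots> \<le> norm (?\<gamma> \<xi> - ?\<gamma> \<xi>0)"
    proof -
      have "\<sigma> \<xi> \<in> ball (\<sigma> \<xi>0) \<delta>" using d1(2) x by auto
      then show ?thesis using \<delta> x x0(1) chi_in by auto
    qed
    finally have "c * cl * ?l1 \<xi> \<xi>0 \<le> c * cl / 2 * ?l1 \<xi> \<xi>0" using u by simp
    moreover have "0 < c * cl" using c cl(1) by simp
    moreover have "0 < ?l1 \<xi> \<xi>0"
      by (rule sum_pos2[of _ k]) (use t s(1) in \<open>auto simp: \<xi>_def\<close>)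
    ultimately have "0 < c * cl * ?l1 \<xi> \<xi>0" "c * cl * ?l1 \<xi> \<xi>0 \<le> c * cl / 2 * ?l1 \<xi> \<xi>0"
      by (simp_all only: mult_pos_pos)
    moreover have "c * cl / 2 * ?l1 \<xi> \<xi>0 = (c * cl * ?l1 \<xi> \<xi>0) / 2" by simp
    ultimately show False by linarith
  qed
  have aY: "a i \<in> Y" if i: "i < m" for i
  proof -
    have "\<exists>y\<in>Y. dist y (a i) < e" if e: "0 < e" for e
    proof -
      have "0 < e/2" using e by simp
      from str[OF this] obtain d2 where d2: "d2 > 0" "\<forall>\<xi>\<in>cubem m r. \<forall>\<zeta>\<in>cubem m r.
        (\<forall>i<m. \<bar>\<xi> i - \<xi>0 i\<bar> < d2) \<longrightarrow> (\<forall>i<m. \<bar>\<zeta> i - \<xi>0 i\<bar> < d2) \<longrightarrow>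
        norm (?\<gamma> \<xi> - ?\<gamma> \<zeta> - (\<Sum>i<m. (\<xi> i - \<zeta> i) *\<^sub>R a i)) \<le> e / 2 * ?l1 \<xi> \<zeta>" by auto
      define t where "t = (\<lambda>j. if j = i then 1 else (0::real))"
      from dir[OF d2(1), of t] obtain s where s: "s > 0" "(\<lambda>i. if i < m then \<xi>0 i + s * t i else 0) \<in> cubem m r" "\<forall>i<m. \<bar>(\<xi>0 i + s * t i) - \<xi>0 i\<bar> < d2" by auto
      define \<xi> where "\<xi> = (\<lambda>i. if i < m then \<xi>0 i + s * t i else 0)"
      have x: "\<xi> \<in> cubem m r" "\<forall>i<m. \<bar>\<xi> i - \<xi>0 i\<bar> < d2" using s by (auto simp: \<xi>_def)
      have dxi: "\<xi> j - \<xi>0 j = (if j = i then s else 0)" if "j < m" for j using that by (simp add: \<xi>_def t_def)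
      have s1: "(\<Sum>j<m. (\<xi> j - \<xi>0 j) *\<^sub>R a j) = s *\<^sub>R a i"
      proof -
        have "(\<Sum>j<m. (\<xi> j - \<xi>0 j) *\<^sub>R a j) = (\<Sum>j<m. if j = i then s *\<^sub>R a j else 0)"
          by (intro sum.cong refl) (simp add: dxi)
        then show ?thesis using i by simp
      qed
      have s2: "?l1 \<xi> \<xi>0 = s"
      proof -
        have "?l1 \<xi> \<xi>0 = (\<Sum>j<m. if j = i then s else 0)"
          by (intro sum.cong refl) (use s(1) in \<open>simp add: dxi\<close>)
        then show ?thesis using i by simp
      qed
      have "norm (?\<gamma> \<xi> - ?\<gamma> \<xi>0 - s *\<^sub>R a i) \<le> e / 2 * s"
        using d2 x x0(1) s1 s2 by fastforce
      moreover have "?\<gamma> \<xi> - ?\<gamma> \<xi>0 - s *\<^sub>R a i = s *\<^sub>R ((1/s) *\<^sub>R (?\<gamma> \<xi> - ?\<gamma> \<xi>0) - a i)"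
        using s(1) by (simp add: scaleR_diff_right)
      ultimately have "s * norm ((1/s) *\<^sub>R (?\<gamma> \<xi> - ?\<gamma> \<xi>0) - a i) \<le> s * (e/2)" using s(1) by (simp add: mult.commute)
      then have "norm ((1/s) *\<^sub>R (?\<gamma> \<xi> - ?\<gamma> \<xi>0) - a i) \<le> e/2" by (rule mult_left_le_imp_le) (rule s(1))
      then have "norm ((1/s) *\<^sub>R (?\<gamma> \<xi> - ?\<gamma> \<xi>0) - a i) < e" using e by linarith
      moreover have "(1/s) *\<^sub>R (?\<gamma> \<xi> - ?\<gamma> \<xi>0) \<in> Y"
        using g chi_in x(1) x0(1) by (intro subspace_scale[OF Y(1)] subspace_diff[OF Y(1)]) auto
      ultimately show ?thesis by (auto simp: dist_norm)
    qed
    then have "a i \<in> closure Y" by (simp add: closure_approachable)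
    then show ?thesis using Y(2) by simp
  qed
  show ?thesis unfolding strict_reg_zero_def
    using indep aY str by (intro exI[of _ a]) simp
qed

text \<open>The coordinates are restrictions of linear functionals, so increments of an affine map
  in the chart are given by a linear map of the ambient space, and the Lipschitz bound of the chart
  turns independence into the lower estimate.\<close>

lemma affine_reg_zero:
  fixes g :: "'x \<Rightarrow> 'w::real_normed_vector"
  assumes x0: "\<xi>0 \<in> cubem m s" "\<And>i. i < m \<Longrightarrow> \<bar>\<xi>0 i\<bar> < s" and s: "s \<le> r"
    and a: "fam_indep a {..<m}" and e: "0 < e"
    and g: "\<And>\<xi>. \<xi> \<in> cubem m s \<Longrightarrow> (\<And>i. i < m \<Longrightarrow> \<bar>\<xi> i - \<xi>0 i\<bar> < e) \<Longrightarrow> g (\<sigma> \<xi>) = (\<Sum>i<m. (\<xi> i - \<xi>0 i) *\<^sub>R a i)"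
  shows "reg_zero M g (\<sigma> \<xi>0)"
proof -
  have x0r: "\<xi>0 \<in> cubem m r" using x0(1) cubem_mono[OF s] by auto
  define A where "A = (\<Sum>i<m. blinfun_scaleR_left (a i) o\<^sub>L \<pi> i)"
  have A: "blinfun_apply A x = (\<Sum>i<m. blinfun_apply (\<pi> i) x *\<^sub>R a i)" for x
    by (simp add: A_def blinfun.sum_left)
  obtain c where c: "c > 0" "\<And>\<eta>. c * (\<Sum>i<m. \<bar>\<eta> i\<bar>) \<le> norm (\<Sum>i<m. \<eta> i *\<^sub>R a i)"
    using independent_family_lower_bound[OF fam_indep_inj[OF a] fam_indep_independent[OF a]] by auto
  define N where "N = U \<inter> {x. \<forall>i<m. \<bar>blinfun_apply (\<pi> i) (x - p)\<bar> < s} \<inter> {x. \<forall>i<m. \<bar>blinfun_apply (\<pi> i) (x - \<sigma> \<xi>0)\<bar> < e}"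
  have "open {x. \<forall>i<m. \<bar>blinfun_apply (\<pi> i) (x - \<sigma> \<xi>0)\<bar> < e}"
  proof -
    have "{x. \<forall>i<m. \<bar>blinfun_apply (\<pi> i) (x - \<sigma> \<xi>0)\<bar> < e} = (\<Inter>i\<in>{..<m}. {x. \<bar>blinfun_apply (\<pi> i) (x - \<sigma> \<xi>0)\<bar> < e})" by auto
    moreover have "open (\<Inter>i\<in>{..<m}. {x. \<bar>blinfun_apply (\<pi> i) (x - \<sigma> \<xi>0)\<bar> < e})"
      by (intro open_INT finite_lessThan ballI open_Collect_less continuous_intros)
    ultimately show ?thesis by simp
  qed
  then have "open N" unfolding N_def by (intro open_Int open_subcube_nbhd)
  moreover have "\<sigma> \<xi>0 \<in> M \<inter> (U \<inter> {x. \<forall>i<m. \<bar>blinfun_apply (\<pi> i) (x - p)\<bar> < s})"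
    unfolding image_open_subcube[OF s, symmetric] using x0 by auto
  then have "\<sigma> \<xi>0 \<in> N" using e by (simp add: N_def blinfun.zero_right)
  ultimately obtain \<delta> where \<delta>: "\<delta> > 0" "ball (\<sigma> \<xi>0) \<delta> \<subseteq> N" using open_contains_ball by metis
  have rep: "\<exists>\<xi>\<in>cubem m s. x = \<sigma> \<xi> \<and> (\<forall>i<m. \<bar>\<xi> i - \<xi>0 i\<bar> < e)" if x: "x \<in> M \<inter> ball (\<sigma> \<xi>0) \<delta>" for x
  proof -
    have xN: "x \<in> M" "x \<in> N" using x \<delta>(2) by auto
    then have "x \<in> M \<inter> (U \<inter> {x. \<forall>i<m. \<bar>blinfun_apply (\<pi> i) (x - p)\<bar> < s})" by (auto simp: N_def)
    then obtain \<xi> where \<xi>: "\<xi> \<in> cubem m s" "x = \<sigma> \<xi>" unfolding image_open_subcube[OF s, symmetric] by auto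
    have xr: "\<xi> \<in> cubem m r" using \<xi>(1) cubem_mono[OF s] by auto
    have "\<xi> i - \<xi>0 i = blinfun_apply (\<pi> i) (x - \<sigma> \<xi>0)" if "i < m" for i
    proof -
      have "\<xi> i = blinfun_apply (\<pi> i) (\<sigma> \<xi> - p)" "\<xi>0 i = blinfun_apply (\<pi> i) (\<sigma> \<xi>0 - p)"
        using coords_chi[OF xr] coords_chi[OF x0r] that by (auto simp: coords_def fun_eq_iff split: if_splits)
      then show ?thesis using \<xi>(2) by (simp add: blinfun.diff_right)
    qed
    then show ?thesis using \<xi> xN(2) by (auto simp: N_def)
  qed
  have main: "g x - g y = blinfun_apply A (x - y) \<and> c / C * norm (x - y) \<le> norm (g x - g y)"
    if xy: "x \<in> M \<inter> ball (\<sigma> \<xi>0) \<delta>" "y \<in> M \<inter> ball (\<sigma> \<xi>0) \<delta>" for x y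
  proof -
    obtain \<xi> where \<xi>: "\<xi> \<in> cubem m s" "x = \<sigma> \<xi>" "\<forall>i<m. \<bar>\<xi> i - \<xi>0 i\<bar> < e" using rep[OF xy(1)] by auto
    obtain \<zeta> where \<zeta>: "\<zeta> \<in> cubem m s" "y = \<sigma> \<zeta>" "\<forall>i<m. \<bar>\<zeta> i - \<xi>0 i\<bar> < e" using rep[OF xy(2)] by auto
    have r': "\<xi> \<in> cubem m r" "\<zeta> \<in> cubem m r" using \<xi>(1) \<zeta>(1) cubem_mono[OF s] by auto
    have eq: "g x - g y = (\<Sum>i<m. (\<xi> i - \<zeta> i) *\<^sub>R a i)"
      using g[OF \<xi>(1)] g[OF \<zeta>(1)] \<xi>(2,3) \<zeta>(2,3) by (simp add: sum_subtractf[symmetric] scaleR_diff_left[symmetric])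
    have co: "blinfun_apply (\<pi> i) (x - y) = \<xi> i - \<zeta> i" if "i < m" for i
    proof -
      have "\<xi> i = blinfun_apply (\<pi> i) (\<sigma> \<xi> - p)" "\<zeta> i = blinfun_apply (\<pi> i) (\<sigma> \<zeta> - p)"
        using coords_chi[OF r'(1)] coords_chi[OF r'(2)] that by (auto simp: coords_def fun_eq_iff split: if_splits)
      then show ?thesis using \<xi>(2) \<zeta>(2) by (simp add: blinfun.diff_right)
    qed
    have "g x - g y = blinfun_apply A (x - y)" unfolding eq A by (intro sum.cong refl) (simp add: co)
    moreover have "c / C * norm (x - y) \<le> c * (\<Sum>i<m. \<bar>\<xi> i - \<zeta> i\<bar>)"
    proof -
      have "c / C * norm (x - y) \<le> c / C * (C * (\<Sum>i<m. \<bar>\<xi> i - \<zeta> i\<bar>))"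
        using chi_lipschitz[OF r'] \<xi>(2) \<zeta>(2) c(1) C_pos by (intro mult_left_mono) auto
      then show ?thesis using C_pos by simp
    qed
    then have "c / C * norm (x - y) \<le> norm (g x - g y)" unfolding eq using c(2)[of "\<lambda>i. \<xi> i - \<zeta> i"] by simp
    ultimately show ?thesis by blast
  qed
  show ?thesis
    unfolding reg_zero_def
  proof (rule exI[of _ A], rule exI[of _ "c / C"], intro conjI allI impI)
    show "0 < c / C" using c(1) C_pos by simp
    show "\<exists>\<delta>>0. \<forall>x\<in>M \<inter> ball (\<sigma> \<xi>0) \<delta>. \<forall>y\<in>M \<inter> ball (\<sigma> \<xi>0) \<delta>. norm (g x - g y - blinfun_apply A (x - y)) \<le> \<kappa> * norm (x - y)" if "0 < \<kappa>" for \<kappa>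
      using main \<delta>(1) that by (intro exI[of _ \<delta>]) auto
    show "\<exists>\<delta>>0. \<forall>x\<in>M \<inter> ball (\<sigma> \<xi>0) \<delta>. \<forall>y\<in>M \<inter> ball (\<sigma> \<xi>0) \<delta>. c / C * norm (x - y) \<le> norm (g x - g y)"
      by (intro exI[of _ \<delta>] conjI ballI \<delta>(1) conjunct2[OF main])
  qed
qed

end

lemma reg_zero_cong:
  assumes "reg_zero M g z" "open W" "z \<in> W" "\<And>x. x \<in> M \<inter> W \<Longrightarrow> g' x = g x"
  shows "reg_zero M g' z"
proof -
  obtain \<delta>0 where \<delta>0: "\<delta>0 > 0" "ball z \<delta>0 \<subseteq> W" using assms(2,3) open_contains_ball by metis
  have eq: "g' x = g x" if "x \<in> M \<inter> ball z (min \<delta> \<delta>0)" for x \<delta> using assms(4) \<delta>0(2) that by auto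
  obtain A c where Ac: "0 < c \<and>
    (\<forall>\<kappa>>0. \<exists>\<delta>>0. \<forall>x\<in>M \<inter> ball z \<delta>. \<forall>y\<in>M \<inter> ball z \<delta>. norm (g x - g y - blinfun_apply A (x - y)) \<le> \<kappa> * norm (x - y)) \<and>
    (\<exists>\<delta>>0. \<forall>x\<in>M \<inter> ball z \<delta>. \<forall>y\<in>M \<inter> ball z \<delta>. c * norm (x - y) \<le> norm (g x - g y))"
    using assms(1) unfolding reg_zero_def by (elim exE) (rule that)
  note c = conjunct1[OF Ac] and Aa = conjunct1[OF conjunct2[OF Ac]] and Ab = conjunct2[OF conjunct2[OF Ac]]
  show ?thesis
    unfolding reg_zero_def
  proof (rule exI[of _ A], rule exI[of _ c], intro conjI allI impI c)
    fix \<kappa> :: real assume "0 < \<kappa>"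
    then obtain \<delta> where d: "\<delta> > 0" "\<forall>x\<in>M \<inter> ball z \<delta>. \<forall>y\<in>M \<inter> ball z \<delta>. norm (g x - g y - blinfun_apply A (x - y)) \<le> \<kappa> * norm (x - y)"
      using Aa by auto
    show "\<exists>\<delta>>0. \<forall>x\<in>M \<inter> ball z \<delta>. \<forall>y\<in>M \<inter> ball z \<delta>. norm (g' x - g' y - blinfun_apply A (x - y)) \<le> \<kappa> * norm (x - y)"
      using d \<delta>0(1) eq[of _ \<delta>] by (intro exI[of _ "min \<delta> \<delta>0"]) simp
  next
    obtain \<delta> where d: "\<delta> > 0" "\<forall>x\<in>M \<inter> ball z \<delta>. \<forall>y\<in>M \<inter> ball z \<delta>. c * norm (x - y) \<le> norm (g x - g y)" using Ab by auto
    show "\<exists>\<delta>>0. \<forall>x\<in>M \<inter> ball z \<delta>. \<forall>y\<in>M \<inter> ball z \<delta>. c * norm (x - y) \<le> norm (g' x - g' y)"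
      using d \<delta>0(1) eq[of _ \<delta>] by (intro exI[of _ "min \<delta> \<delta>0"]) simp
  qed
qed


lemma strict_reg_zero_subset:
  assumes sub: "cubem m s \<subseteq> cubem m r" and reg: "strict_reg_zero m r Y \<gamma> \<xi>0"
  shows "strict_reg_zero m s Y \<gamma> \<xi>0"
proof -
  obtain a where a: "fam_indep a {..<m} \<and> (\<forall>i<m. a i \<in> Y) \<and>
    (\<forall>\<kappa>>0. \<exists>d>0. \<forall>\<xi>\<in>cubem m r. \<forall>\<zeta>\<in>cubem m r.
      (\<forall>i<m. \<bar>\<xi> i - \<xi>0 i\<bar> < d) \<longrightarrow> (\<forall>i<m. \<bar>\<zeta> i - \<xi>0 i\<bar> < d) \<longrightarrow>
      norm (\<gamma> \<xi> - \<gamma> \<zeta> - (\<Sum>i<m. (\<xi> i - \<zeta> i) *\<^sub>R a i)) \<le> \<kappa> * (\<Sum>i<m. \<bar>\<xi> i - \<zeta> i\<bar>))"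
    using reg unfolding strict_reg_zero_def by (elim exE) (rule that)
  show ?thesis
    unfolding strict_reg_zero_def
  proof (rule exI[of _ a], intro conjI allI impI)
    show "fam_indep a {..<m}" "\<And>i. i < m \<Longrightarrow> a i \<in> Y" using a by simp_all
    fix \<kappa> :: real assume "0 < \<kappa>"
    with a obtain d where d: "d > 0" "\<forall>\<xi>\<in>cubem m r. \<forall>\<zeta>\<in>cubem m r.
      (\<forall>i<m. \<bar>\<xi> i - \<xi>0 i\<bar> < d) \<longrightarrow> (\<forall>i<m. \<bar>\<zeta> i - \<xi>0 i\<bar> < d) \<longrightarrow>
      norm (\<gamma> \<xi> - \<gamma> \<zeta> - (\<Sum>i<m. (\<xi> i - \<zeta> i) *\<^sub>R a i)) \<le> \<kappa> * (\<Sum>i<m. \<bar>\<xi> i - \<zeta> i\<bar>)" by blast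
    show "\<exists>d>0. \<forall>\<xi>\<in>cubem m s. \<forall>\<zeta>\<in>cubem m s.
      (\<forall>i<m. \<bar>\<xi> i - \<xi>0 i\<bar> < d) \<longrightarrow> (\<forall>i<m. \<bar>\<zeta> i - \<xi>0 i\<bar> < d) \<longrightarrow>
      norm (\<gamma> \<xi> - \<gamma> \<zeta> - (\<Sum>i<m. (\<xi> i - \<zeta> i) *\<^sub>R a i)) \<le> \<kappa> * (\<Sum>i<m. \<bar>\<xi> i - \<zeta> i\<bar>)"
    proof (rule exI[of _ d], intro conjI ballI d(1))
      fix \<xi> \<zeta> assume "\<xi> \<in> cubem m s" "\<zeta> \<in> cubem m s"
      then show "(\<forall>i<m. \<bar>\<xi> i - \<xi>0 i\<bar> < d) \<longrightarrow> (\<forall>i<m. \<bar>\<zeta> i - \<xi>0 i\<bar> < d) \<longrightarrow>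
        norm (\<gamma> \<xi> - \<gamma> \<zeta> - (\<Sum>i<m. (\<xi> i - \<zeta> i) *\<^sub>R a i)) \<le> \<kappa> * (\<Sum>i<m. \<bar>\<xi> i - \<zeta> i\<bar>)"
        using d(2) sub by (simp add: subset_iff)
    qed
  qed
qed

context C1_chart
begin

text \<open>Only the inner part of one chart is affected, the difference of \<open>g'\<close> and
  \<open>g\<close> being confined to the cube of radius \<open>r0\<close>. As \<open>g\<close> has
  finitely many zeros, there is a shell between \<open>r0\<close> and \<open>r\<close> without any,
  and the modification is made inside it.\<close>

lemma chart_step:
  fixes g g' :: "'x \<Rightarrow> 'w::banach"
  assumes m: "0 < m" and B: "finite B" "independent B" "card B = m" and r0: "0 \<le> r0" "r0 < r"
    and cont: "continuous_on M g" "continuous_on M g'"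
    and gB: "\<And>x. x \<in> M \<Longrightarrow> g x \<in> span B" "\<And>x. x \<in> M \<Longrightarrow> g' x \<in> span B"
    and eq: "\<And>x. x \<in> M \<Longrightarrow> x \<notin> \<sigma> ` cubem m r0 \<Longrightarrow> g' x = g x"
    and fin: "finite {x\<in>M. g x = 0}" and reg: "\<And>x. x \<in> M \<Longrightarrow> g x = 0 \<Longrightarrow> reg_zero M g x" and \<epsilon>: "0 < \<epsilon>"
  shows "\<exists>g2. continuous_on M g2 \<and> (\<forall>x\<in>M. g2 x \<in> span B \<and> norm (g2 x - g' x) < \<epsilon>) \<and>
    (\<forall>x\<in>M. x \<notin> \<sigma> ` cubem m r \<longrightarrow> g2 x = g' x) \<and> finite {x\<in>M. g2 x = 0} \<and>
    (even (card {x\<in>M. g2 x = 0}) \<longleftrightarrow> even (card {x\<in>M. g x = 0})) \<and> (\<forall>x\<in>M. g2 x = 0 \<longrightarrow> reg_zero M g2 x)"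
proof -
  \<comment> \<open>All absolute coordinates of zeros; a number \<open>b\<close> outside this finite
    set is the middle of a shell without zeros.\<close>
  define T where "T = (\<lambda>(x, i). \<bar>coords m \<pi> p x i\<bar>) ` ({x\<in>M. g x = 0} \<times> {..<m})"
  have fT: "finite T" unfolding T_def using fin by simp
  have "infinite {r0<..<r}" using r0 by (simp add: infinite_Ioo)
  then obtain b where b: "b \<in> {r0<..<r}" "b \<notin> T" using fT by (meson finite_subset subsetI)
  have "open (- T)" using fT by (simp add: finite_imp_closed open_Compl)
  then obtain e where e: "e > 0" "ball b e \<subseteq> - T" using b(2) open_contains_ball by (metis ComplI)
  define f where "f = min e (min (b - r0) (r - b)) / 2"
  have f: "0 < f" "f < e" "f < b - r0" "f < r - b" using e(1) b(1) by (auto simp: f_def)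
  define r1 where "r1 = b - f"
  define s where "s = b + f"
  have rs: "r0 < r1" "0 < r1" "r1 < s" "s < r" using f r0 by (auto simp: r1_def s_def)
  have sr: "s \<le> r" using rs by simp
  have csr: "cubem m s \<subseteq> cubem m r" by (rule cubem_mono[OF sr])
  have gap: "t \<notin> T" if "r1 \<le> t" "t \<le> s" for t
  proof -
    have "t \<in> ball b e" using that f by (auto simp: r1_def s_def dist_real_def)
    then show ?thesis using e(2) by blast
  qed
  define \<gamma> where "\<gamma> \<xi> = g (\<sigma> \<xi>)" for \<xi>
  define \<gamma>' where "\<gamma>' \<xi> = g' (\<sigma> \<xi>)" for \<xi>
  have sM: "\<sigma> ` cubem m s \<subseteq> M" using chi_in csr by auto
  have cs: "continuous_on (cubem m s) \<sigma>" by (rule continuous_on_subset[OF chi_continuous csr])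
  have notin: "\<sigma> \<xi> \<notin> \<sigma> ` cubem m r0" if "\<xi> \<in> cubem m s" "i < m" "r1 \<le> \<bar>\<xi> i\<bar>" for \<xi> i
  proof
    assume "\<sigma> \<xi> \<in> \<sigma> ` cubem m r0"
    then obtain \<zeta> where z: "\<zeta> \<in> cubem m r0" "\<sigma> \<xi> = \<sigma> \<zeta>" by auto
    have "\<zeta> \<in> cubem m r" using z(1) cubem_mono[of r0] r0 by auto
    then have "\<xi> = \<zeta>" using inj_onD[OF chi_inj, OF z(2)] that(1) csr by auto
    then show False using z(1) that rs by (auto simp: cubem_def)
  qed
  have regc: "strict_reg_zero m s (span B) \<gamma> \<xi>" if x: "\<xi> \<in> cubem m s" "\<gamma> \<xi> = 0" for \<xi>
  proof -
    have xr: "\<xi> \<in> cubem m r" using x csr by auto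
    have "reg_zero M g (\<sigma> \<xi>)" using reg[OF chi_in[OF xr]] x(2) by (simp add: \<gamma>_def)
    then have "strict_reg_zero m r (span B) \<gamma> \<xi>"
      unfolding \<gamma>_def[abs_def]
    proof (rule reg_zero_in_chart[OF gB(1) subspace_span closed_span_finite[OF B(1)] _ xr, rotated])
      show "\<bar>\<xi> i\<bar> < r" if "i < m" for i using x(1) that rs by (auto simp: cubem_def dest!: spec[of _ i])
    qed auto
    then show ?thesis by (rule strict_reg_zero_subset[OF csr])
  qed
  have finc: "finite {\<xi>\<in>cubem m s. \<gamma> \<xi> = 0}"
  proof (rule finite_imageD[of \<sigma>])
    show "finite (\<sigma> ` {\<xi>\<in>cubem m s. \<gamma> \<xi> = 0})" by (rule finite_subset[OF _ fin]) (use sM in \<open>auto simp: \<gamma>_def\<close>)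
    show "inj_on \<sigma> {\<xi>\<in>cubem m s. \<gamma> \<xi> = 0}" by (rule inj_on_subset[OF chi_inj]) (use csr in auto)
  qed
  have "\<exists>\<gamma>2. continuous_on (cubem m s) \<gamma>2 \<and> (\<forall>\<xi>\<in>cubem m s. \<gamma>2 \<xi> \<in> span B \<and> norm (\<gamma>2 \<xi> - \<gamma>' \<xi>) < \<epsilon>) \<and>
    (\<forall>\<xi>\<in>cubem m s. \<forall>i<m. \<bar>\<xi> i\<bar> = s \<longrightarrow> \<gamma>2 \<xi> = \<gamma>' \<xi>) \<and> finite {\<xi>\<in>cubem m s. \<gamma>2 \<xi> = 0} \<and>
    (even (card {\<xi>\<in>cubem m s. \<gamma>2 \<xi> = 0}) \<longleftrightarrow> even (card {\<xi>\<in>cubem m s. \<gamma> \<xi> = 0})) \<and>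
    (\<forall>\<xi>0\<in>cubem m s. \<gamma>2 \<xi>0 = 0 \<longrightarrow> (\<forall>i<m. \<bar>\<xi>0 i\<bar> < r1) \<and> (\<exists>a e. fam_indep a {..<m} \<and> 0 < e \<and>
      (\<forall>\<xi>\<in>cubem m s. (\<forall>i<m. \<bar>\<xi> i - \<xi>0 i\<bar> < e) \<longrightarrow> \<gamma>2 \<xi> = (\<Sum>i<m. (\<xi> i - \<xi>0 i) *\<^sub>R a i))))"
  proof (rule chart_modification[OF m B rs(2,3) _ _ _ _ _ finc regc \<epsilon>])
    show "continuous_on (cubem m s) \<gamma>" unfolding \<gamma>_def by (rule continuous_on_compose2[OF cont(1) cs sM])
    show "continuous_on (cubem m s) \<gamma>'" unfolding \<gamma>'_def by (rule continuous_on_compose2[OF cont(2) cs sM])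
    show "\<gamma> \<xi> \<in> span B" if "\<xi> \<in> cubem m s" for \<xi> using gB(1) sM that by (auto simp: \<gamma>_def)
    show "\<gamma>' \<xi> \<in> span B" if "\<xi> \<in> cubem m s" for \<xi> using gB(2) sM that by (auto simp: \<gamma>'_def)
    show "\<gamma>' \<xi> = \<gamma> \<xi> \<and> \<gamma> \<xi> \<noteq> 0" if x: "\<xi> \<in> cubem m s" "i < m" "r1 \<le> \<bar>\<xi> i\<bar>" for \<xi> i
    proof
      show "\<gamma>' \<xi> = \<gamma> \<xi>" using eq[OF _ notin[OF x]] sM x(1) by (auto simp: \<gamma>_def \<gamma>'_def)
      have co: "coords m \<pi> p (\<sigma> \<xi>) = \<xi>" using coords_chi csr x(1) by auto
      have "\<bar>\<xi> i\<bar> \<notin> T" by (rule gap) (use x in \<open>auto simp: cubem_def\<close>)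
      then show "\<gamma> \<xi> \<noteq> 0" using sM x(1,2) co unfolding T_def \<gamma>_def by force
    qed
  qed auto
  then obtain \<gamma>2 where c2: "continuous_on (cubem m s) \<gamma>2" and n2: "\<forall>\<xi>\<in>cubem m s. \<gamma>2 \<xi> \<in> span B \<and> norm (\<gamma>2 \<xi> - \<gamma>' \<xi>) < \<epsilon>"
    and b2: "\<forall>\<xi>\<in>cubem m s. \<forall>i<m. \<bar>\<xi> i\<bar> = s \<longrightarrow> \<gamma>2 \<xi> = \<gamma>' \<xi>" and f2: "finite {\<xi>\<in>cubem m s. \<gamma>2 \<xi> = 0}"
    and p2: "even (card {\<xi>\<in>cubem m s. \<gamma>2 \<xi> = 0}) \<longleftrightarrow> even (card {\<xi>\<in>cubem m s. \<gamma> \<xi> = 0})"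
    and a2: "\<forall>\<xi>0\<in>cubem m s. \<gamma>2 \<xi>0 = 0 \<longrightarrow> (\<forall>i<m. \<bar>\<xi>0 i\<bar> < r1) \<and> (\<exists>a e. fam_indep a {..<m} \<and> 0 < e \<and>
      (\<forall>\<xi>\<in>cubem m s. (\<forall>i<m. \<bar>\<xi> i - \<xi>0 i\<bar> < e) \<longrightarrow> \<gamma>2 \<xi> = (\<Sum>i<m. (\<xi> i - \<xi>0 i) *\<^sub>R a i)))"
    by (elim exE conjE) (rule that)
  define A where "A = \<sigma> ` cubem m s"
  define g2 where "g2 x = (if x \<in> A then \<gamma>2 (coords m \<pi> p x) else g' x)" for x
  have AM: "A \<subseteq> M" using sM by (simp add: A_def)
  have clA: "closed A" unfolding A_def using image_compact[OF sr] by (rule compact_imp_closed)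
  have g2s: "g2 (\<sigma> \<xi>) = \<gamma>2 \<xi>" if "\<xi> \<in> cubem m s" for \<xi>
    using that coords_chi csr by (auto simp: g2_def A_def)
  have cg2: "continuous_on M g2"
    unfolding g2_def[abs_def] A_def
    by (rule paste_continuous[OF sr c2 cont(2)]) (use b2 in \<open>auto simp: \<gamma>'_def\<close>)
  have cub0: "cubem m r0 \<subseteq> cubem m s" using rs by (auto simp: cubem_def intro: order_trans)
  have out: "g' x = g x" if "x \<in> M" "x \<notin> A" for x using eq[of x] that cub0 by (auto simp: A_def)
  have injs: "inj_on \<sigma> {\<xi>\<in>cubem m s. P \<xi>}" for P by (rule inj_on_subset[OF chi_inj]) (use csr in auto)
  have Z2: "{x\<in>M. g2 x = 0} = \<sigma> ` {\<xi>\<in>cubem m s. \<gamma>2 \<xi> = 0} \<union> {x\<in>M - A. g x = 0}"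
  proof -
    have "\<sigma> ` {\<xi>\<in>cubem m s. \<gamma>2 \<xi> = 0} = {x\<in>A. g2 x = 0}" using g2s by (auto simp: A_def)
    moreover have "{x\<in>M - A. g2 x = 0} = {x\<in>M - A. g x = 0}" using out by (auto simp: g2_def)
    moreover have "{x\<in>M. g2 x = 0} = {x\<in>A. g2 x = 0} \<union> {x\<in>M - A. g2 x = 0}" using AM by auto
    ultimately show ?thesis by simp
  qed
  have Z1: "{x\<in>M. g x = 0} = \<sigma> ` {\<xi>\<in>cubem m s. \<gamma> \<xi> = 0} \<union> {x\<in>M - A. g x = 0}"
    using sM by (auto simp: \<gamma>_def A_def)
  have fo: "finite {x\<in>M - A. g x = 0}" by (rule finite_subset[OF _ fin]) auto
  have k2: "card {x\<in>M. g2 x = 0} = card {\<xi>\<in>cubem m s. \<gamma>2 \<xi> = 0} + card {x\<in>M - A. g x = 0}"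
    unfolding Z2 using f2 fo by (subst card_Un_disjoint) (auto simp: A_def card_image[OF injs])
  have k1: "card {x\<in>M. g x = 0} = card {\<xi>\<in>cubem m s. \<gamma> \<xi> = 0} + card {x\<in>M - A. g x = 0}"
    unfolding Z1 using finc fo by (subst card_Un_disjoint) (auto simp: A_def card_image[OF injs])
  have reg2: "reg_zero M g2 x" if x: "x \<in> M" "g2 x = 0" for x
  proof (cases "x \<in> A")
    case True
    then obtain \<xi>0 where x0: "\<xi>0 \<in> cubem m s" "x = \<sigma> \<xi>0" by (auto simp: A_def)
    have z: "\<gamma>2 \<xi>0 = 0" using x(2) x0 g2s by simp
    obtain a e where a: "\<forall>i<m. \<bar>\<xi>0 i\<bar> < r1" "fam_indep a {..<m}" "0 < e"
      "\<forall>\<xi>\<in>cubem m s. (\<forall>i<m. \<bar>\<xi> i - \<xi>0 i\<bar> < e) \<longrightarrow> \<gamma>2 \<xi> = (\<Sum>i<m. (\<xi> i - \<xi>0 i) *\<^sub>R a i)"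
      using a2[rule_format, OF x0(1) z] by (elim exE conjE) (rule that)
    show ?thesis unfolding x0(2)
      by (rule affine_reg_zero[OF x0(1) _ sr a(2,3)]) (use a(1,4) rs g2s in \<open>auto intro: less_trans\<close>)
  next
    case False
    show ?thesis
    proof (rule reg_zero_cong[of M g x "- A"])
      show "reg_zero M g x" using reg[OF x(1)] x False out by (simp add: g2_def)
      show "open (- A)" using clA by auto
      show "g2 y = g y" if "y \<in> M \<inter> - A" for y using that out by (auto simp: g2_def)
    qed (use False in auto)
  qed
  show ?thesis
  proof (intro exI[of _ g2] conjI ballI impI)
    show "continuous_on M g2" by (rule cg2)
    show "g2 x \<in> span B" if "x \<in> M" for x
    proof (cases "x \<in> A")
      case True
      then obtain \<xi> where "\<xi> \<in> cubem m s" "x = \<sigma> \<xi>" by (auto simp: A_def)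
      then show ?thesis using g2s n2 by simp
    qed (use gB(2) that in \<open>simp add: g2_def\<close>)
    show "norm (g2 x - g' x) < \<epsilon>" if "x \<in> M" for x
    proof (cases "x \<in> A")
      case True
      then obtain \<xi> where "\<xi> \<in> cubem m s" "x = \<sigma> \<xi>" by (auto simp: A_def)
      then show ?thesis using g2s n2 by (simp add: \<gamma>'_def)
    qed (use \<epsilon> in \<open>simp add: g2_def\<close>)
    show "g2 x = g' x" if "x \<in> M" "x \<notin> \<sigma> ` cubem m r" for x using that csr by (auto simp: g2_def A_def)
    show "finite {x\<in>M. g2 x = 0}" unfolding Z2 using f2 fo by simp
    show "even (card {x\<in>M. g2 x = 0}) \<longleftrightarrow> even (card {x\<in>M. g x = 0})" unfolding k1 k2 using p2 by simp
    show "reg_zero M g2 x" if "x \<in> M" "g2 x = 0" for x using reg2 that .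
  qed
qed

text \<open>A factor is 1 for coordinates up to \<open>r / 2\<close> and 0 from
  \<open>3/4 * r\<close> on. The function is the profile by which the homotopy time is raised to
  \<open>T\<close> in one chart.\<close>

definition bump :: "real \<Rightarrow> 'x \<Rightarrow> real" where
  "bump T x = (if x \<in> \<sigma> ` cubem m r then T * (\<Prod>i<m. max 0 (min 1 (3 - 4 / r * \<bar>coords m \<pi> p x i\<bar>))) else 0)"

lemma bump_props:
  assumes T: "0 \<le> T"
  shows "continuous_on M (bump T)" "0 \<le> bump T x" "bump T x \<le> T"
    "x \<in> M \<Longrightarrow> x \<in> U \<Longrightarrow> (\<And>i. i < m \<Longrightarrow> \<bar>blinfun_apply (\<pi> i) (x - p)\<bar> < r / 2) \<Longrightarrow> bump T x = T"
    "x \<notin> \<sigma> ` cubem m (3/4 * r) \<Longrightarrow> bump T x = 0"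
proof -
  show "continuous_on M (bump T)"
    unfolding bump_def[abs_def]
  proof (rule paste_continuous[where f = "\<lambda>\<xi>. T * (\<Prod>i<m. max 0 (min 1 (3 - 4 / r * \<bar>\<xi> i\<bar>)))" and g = "\<lambda>_. 0"])
    show "continuous_on (cubem m r) (\<lambda>\<xi>. T * (\<Prod>i<m. max 0 (min 1 (3 - 4 / r * \<bar>\<xi> i\<bar>))))"
      by (rule continuous_on_subset[OF _ subset_UNIV]) (intro continuous_intros continuous_on_product_coordinates)
    show "T * (\<Prod>i<m. max 0 (min 1 (3 - 4 / r * \<bar>\<xi> i\<bar>))) = 0" if "i < m" "\<bar>\<xi> i\<bar> = r" for \<xi> i
    proof -
      have "max 0 (min 1 (3 - 4 / r * \<bar>\<xi> i\<bar>)) = 0" using that r_pos by simp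
      then have "(\<Prod>i<m. max 0 (min 1 (3 - 4 / r * \<bar>\<xi> i\<bar>))) = 0" using that(1) by (intro prod_zero bexI[of _ i]) auto
      then show ?thesis by simp
    qed
  qed auto
  have P: "0 \<le> (\<Prod>i<m. max 0 (min 1 (3 - 4 / r * \<bar>\<xi> i\<bar>)))" "(\<Prod>i<m. max 0 (min 1 (3 - 4 / r * \<bar>\<xi> i\<bar>))) \<le> 1" for \<xi> :: "nat \<Rightarrow> real"
    by (intro prod_nonneg prod_le_1; simp)+
  show "0 \<le> bump T x" using T P by (simp add: bump_def)
  show "bump T x \<le> T" using T mult_left_mono[OF P(2) T] by (simp add: bump_def)
  show "bump T x = T" if x: "x \<in> M" "x \<in> U" "\<And>i. i < m \<Longrightarrow> \<bar>blinfun_apply (\<pi> i) (x - p)\<bar> < r / 2"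
  proof -
    have "x \<in> M \<inter> (U \<inter> {x. \<forall>i<m. \<bar>blinfun_apply (\<pi> i) (x - p)\<bar> < r})" using x r_pos by fastforce
    then have "x \<in> \<sigma> ` cubem m r" unfolding image_open_subcube[OF order_refl, symmetric] by auto
    moreover have "(\<Prod>i<m. max 0 (min 1 (3 - 4 / r * \<bar>coords m \<pi> p x i\<bar>))) = 1"
    proof (rule prod.neutral, rule ballI)
      fix i assume i: "i \<in> {..<m}"
      have "4 / r * \<bar>coords m \<pi> p x i\<bar> \<le> 4 / r * (r / 2)"
        using x(3)[of i] i r_pos by (intro mult_left_mono) (auto simp: coords_def)
      also have "\<dots> = 2" using r_pos by simp
      finally show "max 0 (min 1 (3 - 4 / r * \<bar>coords m \<pi> p x i\<bar>)) = 1" by simp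
    qed
    ultimately show ?thesis by (simp add: bump_def)
  qed
  show "bump T x = 0" if x: "x \<notin> \<sigma> ` cubem m (3/4 * r)"
  proof (cases "x \<in> \<sigma> ` cubem m r")
    case True
    then obtain \<xi> where \<xi>: "\<xi> \<in> cubem m r" "x = \<sigma> \<xi>" by auto
    then have "\<xi> \<notin> cubem m (3/4 * r)" using x by auto
    then obtain i where i: "i < m" "3/4 * r < \<bar>\<xi> i\<bar>" using \<xi>(1) by (auto simp: cubem_def not_le)
    have "4 / r * (3/4 * r) \<le> 4 / r * \<bar>\<xi> i\<bar>" using i r_pos by (intro mult_left_mono) auto
    then have "max 0 (min 1 (3 - 4 / r * \<bar>\<xi> i\<bar>)) = 0" using r_pos by simp
    then have "(\<Prod>i<m. max 0 (min 1 (3 - 4 / r * \<bar>\<xi> i\<bar>))) = 0" using i(1) by (intro prod_zero bexI[of _ i]) auto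
    then show ?thesis using \<xi> coords_chi by (simp add: bump_def)
  qed (simp add: bump_def)
qed

end

section \<open>Raising the homotopy time chart by chart\<close>

definition has_C1_chart :: "nat \<Rightarrow> 'x::real_normed_vector set \<Rightarrow> 'x \<Rightarrow> bool" where
  "has_C1_chart m M p \<longleftrightarrow> (\<exists>\<pi> \<sigma> r C U. C1_chart m M p \<pi> \<sigma> r C U)"

text \<open>The time becomes a function \<open>\<tau>\<close> on \<open>M\<close>, raised to
  \<open>T\<close> on one small chart neighbourhood after the other. Once these cover
  \<open>K\<close>, a zero of \<open>h (\<tau> x) x\<close> lies in \<open>K\<close>, has time
  \<open>T\<close> and solves the final equation. Without such a zero, close approximations would
  have no zeros either, although their number is odd.\<close>

lemma odd_zeros_continuation:
  fixes h :: "real \<Rightarrow> 'x::real_normed_vector \<Rightarrow> 'w::banach"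
  assumes m: "0 < m" and B: "finite B" "independent B" "card B = m" and T: "0 \<le> T"
    and K: "compact K" "K \<subseteq> M" and charts: "\<And>p. p \<in> K \<Longrightarrow> has_C1_chart m M p"
    and cont: "continuous_on ({0..T} \<times> M) (\<lambda>(t, x). h t x)"
    and hB: "\<And>t x. t \<in> {0..T} \<Longrightarrow> x \<in> M \<Longrightarrow> h t x \<in> span B"
    and zK: "\<And>t x. t \<in> {0..T} \<Longrightarrow> x \<in> M \<Longrightarrow> h t x = 0 \<Longrightarrow> x \<in> K"
    and fin: "finite {x\<in>M. h 0 x = 0}" and reg: "\<And>x. x \<in> M \<Longrightarrow> h 0 x = 0 \<Longrightarrow> reg_zero M (h 0) x"
    and odd: "odd (card {x\<in>M. h 0 x = 0})"
  shows "\<exists>x\<in>M. h T x = 0"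
proof (rule ccontr)
  assume no: "\<not> ?thesis"
  have "\<forall>p\<in>K. \<exists>\<pi> \<sigma> r C U. C1_chart m M p \<pi> \<sigma> r C U" using charts by (auto simp: has_C1_chart_def)
  then obtain \<pi> \<sigma> r C U where ch: "\<And>p. p \<in> K \<Longrightarrow> C1_chart m M p (\<pi> p) (\<sigma> p) (r p) (C p) (U p)" by metis
  define W where "W p = U p \<inter> {x. \<forall>i<m. \<bar>blinfun_apply (\<pi> p i) (x - p)\<bar> < r p / 2}" for p
  have Wo: "open (W p)" if "p \<in> K" for p
    unfolding W_def by (rule C1_chart.open_subcube_nbhd[OF ch[OF that]])
  have Wp: "p \<in> W p" if "p \<in> K" for p
    using C1_chart.p_in[OF ch[OF that]] C1_chart.r_pos[OF ch[OF that]] by (simp add: W_def blinfun.zero_right)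
  have "K \<subseteq> (\<Union>p\<in>K. W p)" using Wp by auto
  then obtain P where P: "P \<subseteq> K" "finite P" "K \<subseteq> (\<Union>p\<in>P. W p)"
    using compactE_image[OF K(1), of K W] Wo by metis
  have contc: "continuous_on M (\<lambda>x. h (\<tau> x) x)" if "continuous_on M \<tau>" "\<And>x. x \<in> M \<Longrightarrow> \<tau> x \<in> {0..T}" for \<tau>
  proof -
    have "continuous_on M (\<lambda>x. (\<lambda>(t, x). h t x) (\<tau> x, x))"
      by (rule continuous_on_compose2[OF cont]) (use that in \<open>auto intro!: continuous_intros\<close>)
    then show ?thesis by simp
  qed
  \<comment> \<open>Induction over the finite set of charts. Approximations are required at every
    accuracy because each step adds its own error, and they are exact off the charts used so far,
    where no compactness provides a positive lower bound.\<close>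
  have "\<exists>\<tau>. continuous_on M \<tau> \<and> (\<forall>x\<in>M. \<tau> x \<in> {0..T}) \<and> (\<forall>p\<in>Q. \<forall>x\<in>M \<inter> W p. \<tau> x = T) \<and>
    (\<forall>\<epsilon>>0. \<exists>g. continuous_on M g \<and> (\<forall>x\<in>M. g x \<in> span B \<and> norm (g x - h (\<tau> x) x) < \<epsilon>) \<and>
      (\<forall>x\<in>M. (\<forall>p\<in>Q. x \<notin> \<sigma> p ` cubem m (r p)) \<longrightarrow> g x = h (\<tau> x) x) \<and> finite {x\<in>M. g x = 0} \<and>
      odd (card {x\<in>M. g x = 0}) \<and> (\<forall>x\<in>M. g x = 0 \<longrightarrow> reg_zero M g x))" if "finite Q" "Q \<subseteq> P" for Q
    using that
  proof (induction Q)
    case empty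
    have "continuous_on M (h 0)" using contc[of "\<lambda>_. 0"] T by simp
    then show ?case
      using T hB[of 0] fin odd reg by (intro exI[of _ "\<lambda>_. 0"] conjI allI impI exI[of _ "h 0"]) auto
  next
    case (insert p Q)
    have QP: "Q \<subseteq> P" and pK: "p \<in> K" using insert.prems P(1) by auto
    interpret cp: C1_chart m M p "\<pi> p" "\<sigma> p" "r p" "C p" "U p" by (rule ch[OF pK])
    obtain \<tau> where t1: "continuous_on M \<tau>" and t2: "\<forall>x\<in>M. \<tau> x \<in> {0..T}" and t3: "\<forall>p\<in>Q. \<forall>x\<in>M \<inter> W p. \<tau> x = T"
      and t4: "\<forall>\<epsilon>>0. \<exists>g. continuous_on M g \<and> (\<forall>x\<in>M. g x \<in> span B \<and> norm (g x - h (\<tau> x) x) < \<epsilon>) \<and>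
      (\<forall>x\<in>M. (\<forall>p\<in>Q. x \<notin> \<sigma> p ` cubem m (r p)) \<longrightarrow> g x = h (\<tau> x) x) \<and> finite {x\<in>M. g x = 0} \<and>
      odd (card {x\<in>M. g x = 0}) \<and> (\<forall>x\<in>M. g x = 0 \<longrightarrow> reg_zero M g x)"
      using insert.IH[OF QP] by (elim exE conjE) (rule that)
    define \<tau>' where "\<tau>' x = max (\<tau> x) (cp.bump T x)" for x
    have u1: "continuous_on M \<tau>'" unfolding \<tau>'_def by (intro continuous_on_max t1 cp.bump_props(1) T)
    have u2: "\<tau>' x \<in> {0..T}" if "x \<in> M" for x
      using t2[rule_format, OF that] cp.bump_props(2,3)[OF T, of x] by (auto simp: \<tau>'_def)
    have u3: "\<tau>' x = T" if q: "q \<in> insert p Q" "x \<in> M \<inter> W q" for q x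
    proof (cases "q = p")
      case True
      then have "cp.bump T x = T" using q by (intro cp.bump_props(4)[OF T]) (auto simp: W_def)
      then show ?thesis using t2 q by (auto simp: \<tau>'_def)
    next
      case False
      then have "\<tau> x = T" using t3 q by auto
      then show ?thesis using cp.bump_props(3)[OF T, of x] by (simp add: \<tau>'_def)
    qed
    show ?case
    proof (rule exI[of _ \<tau>'], intro conjI allI impI)
      show "continuous_on M \<tau>'" by (rule u1)
      show "\<forall>x\<in>M. \<tau>' x \<in> {0..T}" using u2 by blast
      show "\<forall>q\<in>insert p Q. \<forall>x\<in>M \<inter> W q. \<tau>' x = T" using u3 by blast
      fix \<epsilon> :: real assume \<epsilon>: "0 < \<epsilon>"
      then have "0 < \<epsilon>/2" by simp
      from t4[rule_format, OF this] obtain g where g1: "continuous_on M g" and g2: "\<forall>x\<in>M. g x \<in> span B \<and> norm (g x - h (\<tau> x) x) < \<epsilon>/2"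
        and g3: "\<forall>x\<in>M. (\<forall>p\<in>Q. x \<notin> \<sigma> p ` cubem m (r p)) \<longrightarrow> g x = h (\<tau> x) x" and g4: "finite {x\<in>M. g x = 0}"
        and g5: "odd (card {x\<in>M. g x = 0})" and g6: "\<forall>x\<in>M. g x = 0 \<longrightarrow> reg_zero M g x" by (elim exE conjE) (rule that)
      \<comment> \<open>The approximation is carried along by the increment of the homotopy and
        changes only where the new chart raises the time.\<close>
      define g' where "g' x = g x + (h (\<tau>' x) x - h (\<tau> x) x)" for x
      have "\<exists>k. continuous_on M k \<and> (\<forall>x\<in>M. k x \<in> span B \<and> norm (k x - g' x) < \<epsilon>/2) \<and>
        (\<forall>x\<in>M. x \<notin> \<sigma> p ` cubem m (r p) \<longrightarrow> k x = g' x) \<and> finite {x\<in>M. k x = 0} \<and>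
        (even (card {x\<in>M. k x = 0}) \<longleftrightarrow> even (card {x\<in>M. g x = 0})) \<and> (\<forall>x\<in>M. k x = 0 \<longrightarrow> reg_zero M k x)"
      proof (rule cp.chart_step[OF m B, where ?r0.0 = "3/4 * r p"])
        show "0 \<le> 3/4 * r p" "3/4 * r p < r p" using cp.r_pos by auto
        show "continuous_on M g" by (rule g1)
        show "continuous_on M g'" unfolding g'_def
          by (intro continuous_intros g1 contc u1 t1) (use u2 t2 in auto)
        show "g x \<in> span B" if "x \<in> M" for x using g2 that by blast
        show "g' x \<in> span B" if "x \<in> M" for x
          unfolding g'_def using g2 that hB u2 t2 by (intro span_add span_diff) auto
        show "g' x = g x" if "x \<in> M" "x \<notin> \<sigma> p ` cubem m (3/4 * r p)" for x
          using cp.bump_props(5)[OF T that(2)] t2 that(1) by (simp add: g'_def \<tau>'_def)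
        show "finite {x\<in>M. g x = 0}" by (rule g4)
        show "reg_zero M g x" if "x \<in> M" "g x = 0" for x using g6 that by blast
        show "0 < \<epsilon>/2" using \<epsilon> by simp
      qed
      then obtain k where k1: "continuous_on M k" and k2: "\<forall>x\<in>M. k x \<in> span B \<and> norm (k x - g' x) < \<epsilon>/2"
        and k3: "\<forall>x\<in>M. x \<notin> \<sigma> p ` cubem m (r p) \<longrightarrow> k x = g' x" and k4: "finite {x\<in>M. k x = 0}"
        and k5: "even (card {x\<in>M. k x = 0}) \<longleftrightarrow> even (card {x\<in>M. g x = 0})" and k6: "\<forall>x\<in>M. k x = 0 \<longrightarrow> reg_zero M k x"
        by (elim exE conjE) (rule that)
      show "\<exists>g. continuous_on M g \<and> (\<forall>x\<in>M. g x \<in> span B \<and> norm (g x - h (\<tau>' x) x) < \<epsilon>) \<and>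
        (\<forall>x\<in>M. (\<forall>p\<in>insert p Q. x \<notin> \<sigma> p ` cubem m (r p)) \<longrightarrow> g x = h (\<tau>' x) x) \<and> finite {x\<in>M. g x = 0} \<and>
        odd (card {x\<in>M. g x = 0}) \<and> (\<forall>x\<in>M. g x = 0 \<longrightarrow> reg_zero M g x)"
      proof (rule exI[of _ k], intro conjI ballI impI)
        show "norm (k x - h (\<tau>' x) x) < \<epsilon>" if x: "x \<in> M" for x
        proof -
          have eq: "k x - h (\<tau>' x) x = (k x - g' x) + (g x - h (\<tau> x) x)" by (simp add: g'_def)
          have "norm (k x - g' x) < \<epsilon>/2" "norm (g x - h (\<tau> x) x) < \<epsilon>/2" using k2 g2 x by auto
          then show ?thesis unfolding eq using norm_triangle_ineq[of "k x - g' x" "g x - h (\<tau> x) x"] by linarith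
        qed
        show "k x = h (\<tau>' x) x" if x: "x \<in> M" "\<forall>p\<in>insert p Q. x \<notin> \<sigma> p ` cubem m (r p)" for x
        proof -
          have "k x = g' x" "g x = h (\<tau> x) x" using k3 g3 x by auto
          then show ?thesis by (simp add: g'_def)
        qed
      qed (use k1 k2 k4 k5 k6 g5 in auto)
    qed
  qed
  from this[OF P(2) subset_refl] obtain \<tau> where t1: "continuous_on M \<tau>" and t2: "\<forall>x\<in>M. \<tau> x \<in> {0..T}" and t3: "\<forall>p\<in>P. \<forall>x\<in>M \<inter> W p. \<tau> x = T"
    and t4: "\<forall>\<epsilon>>0. \<exists>g. continuous_on M g \<and> (\<forall>x\<in>M. g x \<in> span B \<and> norm (g x - h (\<tau> x) x) < \<epsilon>) \<and>
      (\<forall>x\<in>M. (\<forall>p\<in>P. x \<notin> \<sigma> p ` cubem m (r p)) \<longrightarrow> g x = h (\<tau> x) x) \<and> finite {x\<in>M. g x = 0} \<and>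
      odd (card {x\<in>M. g x = 0}) \<and> (\<forall>x\<in>M. g x = 0 \<longrightarrow> reg_zero M g x)"
    by (elim exE conjE) (rule that)
  have nz: "h (\<tau> x) x \<noteq> 0" if x: "x \<in> M" for x
  proof
    assume z: "h (\<tau> x) x = 0"
    then have "x \<in> K" using zK[of "\<tau> x" x] t2 x by auto
    then obtain p where "p \<in> P" "x \<in> W p" using P(3) by auto
    then have "\<tau> x = T" using t3 x by auto
    then show False using z no x by auto
  qed
  \<comment> \<open>On this compact set the zero-free map has a positive lower bound
    \<open>\<mu>\<close>; off it the approximation is exact.\<close>
  define A where "A = (\<Union>p\<in>P. \<sigma> p ` cubem m (r p))"
  have AM: "A \<subseteq> M" unfolding A_def using C1_chart.chi_in[OF ch] P(1) by blast
  have "compact A" unfolding A_def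
    using P(1,2) by (intro compact_UN C1_chart.image_compact[OF ch] order_refl) auto
  moreover have "continuous_on A (\<lambda>x. h (\<tau> x) x)" by (rule continuous_on_subset[OF _ AM]) (use contc[OF t1] t2 in auto)
  moreover have "h (\<tau> x) x \<noteq> 0" if "x \<in> A" for x using nz that AM by auto
  ultimately obtain \<mu> where \<mu>: "\<mu> > 0" "\<And>x. x \<in> A \<Longrightarrow> \<mu> \<le> norm (h (\<tau> x) x)"
    using compact_norm_lower_bound[of A "\<lambda>x. h (\<tau> x) x"] by auto
  from t4[rule_format, OF \<mu>(1)] obtain g where g2: "\<forall>x\<in>M. g x \<in> span B \<and> norm (g x - h (\<tau> x) x) < \<mu>"
    and g3: "\<forall>x\<in>M. (\<forall>p\<in>P. x \<notin> \<sigma> p ` cubem m (r p)) \<longrightarrow> g x = h (\<tau> x) x" and g5: "odd (card {x\<in>M. g x = 0})"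
    by (elim exE conjE) (rule that)
  have "g x \<noteq> 0" if x: "x \<in> M" for x
  proof (cases "x \<in> A")
    case True
    then show ?thesis using \<mu>(2)[OF True] g2 x by fastforce
  next
    case False
    then show ?thesis using g3 x nz[OF x] by (auto simp: A_def)
  qed
  then have e: "{x\<in>M. g x = 0} = {}" by auto
  show False using g5 unfolding e by simp
qed


section \<open>Charts of preimages under Fredholm maps\<close>

text \<open>Mean value inequality on a convex ball in which \<open>F'\<close> varies by at most
  \<open>\<kappa>\<close>.\<close>

lemma C1_strict_derivative:
  fixes F :: "'x::real_normed_vector \<Rightarrow> 'v::real_normed_vector"
  assumes deriv: "\<And>x. (F has_derivative blinfun_apply (F' x)) (at x)" and cont: "continuous_on UNIV F'" and \<kappa>: "0 < \<kappa>"
  shows "\<exists>\<delta>>0. (\<forall>x\<in>ball x0 \<delta>. norm (F' x - F' x0) \<le> \<kappa>) \<and>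
    (\<forall>x\<in>ball x0 \<delta>. \<forall>y\<in>ball x0 \<delta>. norm (F x - F y - blinfun_apply (F' x0) (x - y)) \<le> \<kappa> * norm (x - y))"
proof -
  obtain \<delta> where \<delta>: "\<delta> > 0" "\<And>x. dist x x0 < \<delta> \<Longrightarrow> dist (F' x) (F' x0) < \<kappa>"
    using cont \<kappa> unfolding continuous_on_iff by (metis UNIV_I)
  have near: "norm (F' x - F' x0) \<le> \<kappa>" if "x \<in> ball x0 \<delta>" for x
    using \<delta>(2)[of x] that by (simp add: dist_norm norm_minus_commute less_imp_le)
  have "norm (F x - F y - blinfun_apply (F' x0) (x - y)) \<le> \<kappa> * norm (x - y)" if x: "x \<in> ball x0 \<delta>" "y \<in> ball x0 \<delta>" for x y
  proof -
    have "norm (F x - F y - blinfun_apply (F' x0) (x - y)) \<le> norm (x - y) * \<kappa>"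
    proof (rule differentiable_bound_linearization[where S = "ball x0 \<delta>" and f' = "\<lambda>x. blinfun_apply (F' x)"])
      show "y + t *\<^sub>R (x - y) \<in> ball x0 \<delta>" if t: "t \<in> {0..1}" for t
      proof -
        have "(1 - t) *\<^sub>R y + t *\<^sub>R x \<in> ball x0 \<delta>" using convexD_alt[OF convex_ball x(2,1)] t by auto
        then show ?thesis by (simp add: algebra_simps)
      qed
      show "(F has_derivative blinfun_apply (F' z)) (at z within ball x0 \<delta>)" if "z \<in> ball x0 \<delta>" for z
        using deriv has_derivative_at_withinI by blast
      show "onorm (blinfun_apply (F' z) - blinfun_apply (F' x0)) \<le> \<kappa>" if "z \<in> ball x0 \<delta>" for z
        using near[OF that] by (simp add: norm_blinfun.rep_eq minus_blinfun.rep_eq fun_diff_def)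
      show "x0 \<in> ball x0 \<delta>" using \<delta>(1) by simp
    qed
    then show ?thesis by (simp add: mult.commute)
  qed
  then show ?thesis using \<delta>(1) near by blast
qed

text \<open>Solutions of \<open>T x = v\<close> modulo \<open>span B\<close> with controlled norm
  come from the open mapping theorem. They differ by elements of the span of the \<open>e i\<close>,
  which the projection built from the \<open>\<pi> i\<close> removes. The kernel of \<open>J\<close>
  is exactly \<open>span B\<close>, so that membership in \<open>span B\<close> becomes an
  equation.\<close>

lemma complement_inverse:
  fixes T :: "'x::banach \<Rightarrow>\<^sub>L 'v::banach" and \<pi> :: "nat \<Rightarrow> 'x \<Rightarrow>\<^sub>L real"
  assumes B: "finite B" and onto: "\<And>v. \<exists>x. v - blinfun_apply T x \<in> span B"
    and ker: "{x. blinfun_apply T x \<in> span B} = span (e ` {..<m})"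
    and dual: "\<And>i j. i < m \<Longrightarrow> j < m \<Longrightarrow> blinfun_apply (\<pi> i) (e j) = (if i = j then 1 else 0)"
  shows "\<exists>J :: 'v \<Rightarrow>\<^sub>L 'x. (\<forall>x. blinfun_apply J (blinfun_apply T x) = x - (\<Sum>i<m. blinfun_apply (\<pi> i) x *\<^sub>R e i)) \<and>
    (\<forall>y\<in>span B. blinfun_apply J y = 0) \<and> (\<forall>v. blinfun_apply J v = 0 \<longrightarrow> v \<in> span B) \<and>
    (\<forall>v. \<forall>i<m. blinfun_apply (\<pi> i) (blinfun_apply J v) = 0)"
proof -
  define P where "P = (\<Sum>i<m. blinfun_scaleR_left (e i) o\<^sub>L \<pi> i)"
  have P: "blinfun_apply P x = (\<Sum>i<m. blinfun_apply (\<pi> i) x *\<^sub>R e i)" for x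
    by (simp add: P_def blinfun.sum_left)
  have PE: "blinfun_apply P x = x" if x: "x \<in> span (e ` {..<m})" for x
    using x
  proof (induction rule: span_induct_alt)
    case base
    then show ?case by (simp add: blinfun.zero_right)
  next
    case (step c x y)
    then obtain j where j: "j < m" "x = e j" by auto
    have "blinfun_apply P x = (\<Sum>i<m. if i = j then e i else 0)"
      unfolding P j(2) by (intro sum.cong refl) (simp add: dual j(1))
    then have "blinfun_apply P x = x" using j by simp
    then show ?case using step by (simp add: blinfun.add_right blinfun.scaleR_right)
  qed
  have piP: "blinfun_apply (\<pi> i) (blinfun_apply P x) = blinfun_apply (\<pi> i) x" if i: "i < m" for i x
  proof -
    have "blinfun_apply (\<pi> i) (blinfun_apply P x) = (\<Sum>j<m. if j = i then blinfun_apply (\<pi> i) x else 0)"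
      unfolding P blinfun.sum_right by (intro sum.cong refl) (simp add: blinfun.scaleR_right dual i)
    then show ?thesis using i by simp
  qed
  have PinE: "blinfun_apply P x \<in> span (e ` {..<m})" for x unfolding P by (intro span_sum span_scale span_base) auto
  \<comment> \<open>A free summand from \<open>span B\<close> turns surjectivity modulo
    \<open>span B\<close> into surjectivity.\<close>
  define T' where "T' = (T o\<^sub>L fst_blinfun) + snd_blinfun"
  have T': "blinfun_apply T' w = blinfun_apply T (fst w) + snd w" for w by (simp add: T'_def blinfun.add_left)
  have sub: "subspace (UNIV \<times> span B :: ('x \<times> 'v) set)" by (intro subspace_Times subspace_UNIV subspace_span)
  have cl: "closed (UNIV \<times> span B :: ('x \<times> 'v) set)" by (intro closed_Times closed_UNIV closed_span_finite B)
  have "blinfun_apply T' ` (UNIV \<times> span B) = UNIV"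
  proof -
    have "v \<in> blinfun_apply T' ` (UNIV \<times> span B)" for v
    proof -
      obtain x where "v - blinfun_apply T x \<in> span B" using onto by blast
      then show ?thesis by (intro image_eqI[of _ _ "(x, v - blinfun_apply T x)"]) (auto simp: T')
    qed
    then show ?thesis by blast
  qed
  from open_mapping_closed_subspace[OF sub cl this] obtain C where C: "C > 0"
    "\<And>v. \<exists>w\<in>UNIV \<times> span B. blinfun_apply T' w = v \<and> norm w \<le> C * norm v" by metis
  have "\<exists>x. v - blinfun_apply T x \<in> span B \<and> norm x \<le> C * norm v" for v
  proof -
    obtain w where w: "w \<in> UNIV \<times> span B" "blinfun_apply T' w = v" "norm w \<le> C * norm v" using C(2) by blast
    have "v - blinfun_apply T (fst w) = snd w" using w(2) by (auto simp: T')
    moreover have "norm (fst w) \<le> norm w" by (metis norm_fst_le prod.collapse)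
    ultimately show ?thesis using w by (intro exI[of _ "fst w"]) auto
  qed
  then obtain X where X: "\<And>v. v - blinfun_apply T (X v) \<in> span B" "\<And>v. norm (X v) \<le> C * norm v" by metis
  define j where "j v = X v - blinfun_apply P (X v)" for v
  \<comment> \<open>The value does not depend on the chosen solution, because the projection is the
    identity on the difference of two solutions; linearity of \<open>j\<close> follows from
    this.\<close>
  have jeq: "j v = x - blinfun_apply P x" if x: "v - blinfun_apply T x \<in> span B" for v x
  proof -
    have "blinfun_apply T (X v - x) \<in> span B" using span_diff[OF x X(1)[of v]] by (simp add: blinfun.diff_right)
    then have "X v - x \<in> span (e ` {..<m})" using ker by auto
    then have "blinfun_apply P (X v - x) = X v - x" by (rule PE)
    then show ?thesis by (simp add: j_def blinfun.diff_right algebra_simps)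
  qed
  have "bounded_linear j"
  proof (rule bounded_linear_intro[of _ "(1 + norm P) * C"])
    show "j (v + w) = j v + j w" for v w
    proof -
      have "(v + w) - blinfun_apply T (X v + X w) \<in> span B"
        using span_add[OF X(1)[of v] X(1)[of w]] by (simp add: blinfun.add_right algebra_simps)
      from jeq[OF this] show ?thesis by (simp add: j_def blinfun.add_right)
    qed
    show "j (t *\<^sub>R v) = t *\<^sub>R j v" for t v
    proof -
      have "t *\<^sub>R v - blinfun_apply T (t *\<^sub>R X v) \<in> span B"
        using span_scale[OF X(1)[of v], of t] by (simp add: blinfun.scaleR_right algebra_simps)
      from jeq[OF this] show ?thesis by (simp add: j_def blinfun.scaleR_right algebra_simps)
    qed
    show "norm (j v) \<le> norm v * ((1 + norm P) * C)" for v
    proof -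
      have "norm (j v) \<le> norm (X v) + norm P * norm (X v)"
        unfolding j_def using norm_triangle_ineq4[of "X v" "blinfun_apply P (X v)"] norm_blinfun[of P "X v"] by linarith
      also have "\<dots> = (1 + norm P) * norm (X v)" by (simp add: algebra_simps)
      also have "\<dots> \<le> (1 + norm P) * (C * norm v)" using X(2) by (intro mult_left_mono) auto
      finally show ?thesis by (simp add: mult_ac)
    qed
  qed
  then have ap: "blinfun_apply (Blinfun j) = j" by (rule bounded_linear_Blinfun_apply)
  show ?thesis
  proof (intro exI[of _ "Blinfun j"] conjI allI ballI impI, unfold ap)
    show "j (blinfun_apply T x) = x - (\<Sum>i<m. blinfun_apply (\<pi> i) x *\<^sub>R e i)" for x
      using jeq[of "blinfun_apply T x" x] by (simp add: P span_zero)
    show "j y = 0" if "y \<in> span B" for y using jeq[of y 0] that by (simp add: blinfun.zero_right)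
    show "v \<in> span B" if "j v = 0" for v
    proof -
      have "X v = blinfun_apply P (X v)" using that by (simp add: j_def)
      then have "X v \<in> span (e ` {..<m})" using PinE by metis
      then have "blinfun_apply T (X v) \<in> span B" using ker by blast
      then show ?thesis using span_add[OF X(1)[of v]] by fastforce
    qed
    show "blinfun_apply (\<pi> i) (j v) = 0" if "i < m" for i v using piP[OF that] by (simp add: j_def blinfun.diff_right)
  qed
qed

text \<open>Implicit function theorem for \<open>J (F x) = 0\<close>. The coordinates
  \<open>\<xi>\<close> fix the component along the \<open>e i\<close>; the component in the common
  kernel \<open>Z\<close> of the \<open>\<pi> i\<close> is found by a contraction, since
  \<open>J\<close> composed with the derivative at \<open>p\<close> is the identity on
  \<open>Z\<close>.\<close>

lemma preimage_C1_chart: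
  fixes F :: "'x::banach \<Rightarrow> 'v::banach"
  assumes deriv: "\<And>x. (F has_derivative blinfun_apply (F' x)) (at x)" and cont: "continuous_on UNIV F'"
    and \<Omega>: "open \<Omega>" "p \<in> \<Omega>" and B: "finite B" and Fp: "F p \<in> span B"
    and onto: "\<And>v. \<exists>x. v - blinfun_apply (F' p) x \<in> span B"
    and E: "finite E" "independent E" "card E = m" and ker: "{x. blinfun_apply (F' p) x \<in> span B} = span E"
  shows "has_C1_chart m {x\<in>\<Omega>. F x \<in> span B} p"
proof -
  let ?M = "{x\<in>\<Omega>. F x \<in> span B}"
  obtain e where e: "bij_betw e {0..<m} E" using ex_bij_betw_nat_finite[OF E(1)] E(3) by auto
  have eE: "e ` {..<m} = E" "inj_on e {..<m}" using e by (auto simp: bij_betw_def lessThan_atLeast0)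
  obtain \<pi> :: "nat \<Rightarrow> 'x \<Rightarrow>\<^sub>L real" where dual: "\<And>i j. i < m \<Longrightarrow> j < m \<Longrightarrow> blinfun_apply (\<pi> i) (e j) = (if i = j then 1 else 0)"
    using dual_family[OF eE(2)] E(2) eE(1) by metis
  have "\<exists>J :: 'v \<Rightarrow>\<^sub>L 'x. (\<forall>x. blinfun_apply J (blinfun_apply (F' p) x) = x - (\<Sum>i<m. blinfun_apply (\<pi> i) x *\<^sub>R e i)) \<and>
    (\<forall>y\<in>span B. blinfun_apply J y = 0) \<and> (\<forall>v. blinfun_apply J v = 0 \<longrightarrow> v \<in> span B) \<and>
    (\<forall>v. \<forall>i<m. blinfun_apply (\<pi> i) (blinfun_apply J v) = 0)"
    by (rule complement_inverse[OF B onto _ dual]) (use ker eE in auto)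
  then obtain J :: "'v \<Rightarrow>\<^sub>L 'x" where J1: "\<And>x. blinfun_apply J (blinfun_apply (F' p) x) = x - (\<Sum>i<m. blinfun_apply (\<pi> i) x *\<^sub>R e i)"
    and J2: "\<And>y. y \<in> span B \<Longrightarrow> blinfun_apply J y = 0" and J3: "\<And>v. blinfun_apply J v = 0 \<Longrightarrow> v \<in> span B"
    and J4: "\<And>v i. i < m \<Longrightarrow> blinfun_apply (\<pi> i) (blinfun_apply J v) = 0" by blast
  define Z where "Z = {z. \<forall>i<m. blinfun_apply (\<pi> i) z = 0}"
  have Zc: "closed Z"
  proof -
    have "Z = (\<Inter>i\<in>{..<m}. {z. blinfun_apply (\<pi> i) z = 0})" by (auto simp: Z_def)
    moreover have "closed (\<Inter>i\<in>{..<m}. {z. blinfun_apply (\<pi> i) z = 0})"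
      by (intro closed_INT ballI closed_Collect_eq continuous_intros)
    ultimately show ?thesis by simp
  qed
  have Zs: "subspace Z" by (auto simp: Z_def subspace_def blinfun.zero_right blinfun.add_right blinfun.scaleR_right)
  have JZ: "blinfun_apply J v \<in> Z" for v using J4 by (simp add: Z_def)
  have J1Z: "blinfun_apply J (blinfun_apply (F' p) z) = z" if "z \<in> Z" for z using that J1[of z] by (simp add: Z_def)
  define emb where "emb \<xi> = (\<Sum>i<m. \<xi> i *\<^sub>R e i)" for \<xi> :: "nat \<Rightarrow> real"
  have pie: "blinfun_apply (\<pi> i) (emb \<xi>) = \<xi> i" if i: "i < m" for i \<xi>
  proof -
    have "blinfun_apply (\<pi> i) (emb \<xi>) = (\<Sum>j<m. if j = i then \<xi> i else 0)"
      unfolding emb_def blinfun.sum_right by (intro sum.cong refl) (simp add: blinfun.scaleR_right dual i)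
    then show ?thesis using i by simp
  qed
  have Je: "blinfun_apply J (blinfun_apply (F' p) (emb \<xi>)) = 0" for \<xi>
  proof -
    have "(\<Sum>i<m. blinfun_apply (\<pi> i) (emb \<xi>) *\<^sub>R e i) = (\<Sum>i<m. \<xi> i *\<^sub>R e i)" by (rule sum.cong) (simp_all add: pie)
    then have "(\<Sum>i<m. blinfun_apply (\<pi> i) (emb \<xi>) *\<^sub>R e i) = emb \<xi>" by (simp only: emb_def)
    then show ?thesis using J1[of "emb \<xi>"] by (simp only: diff_self)
  qed
  define E1 where "E1 = 1 + (\<Sum>i<m. norm (e i))"
  have E1: "0 < E1" unfolding E1_def by (intro add_pos_nonneg sum_nonneg) auto
  have eb: "norm (emb \<xi>) \<le> E1 * (\<Sum>i<m. \<bar>\<xi> i\<bar>)" for \<xi>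
  proof -
    have "norm (emb \<xi>) \<le> (\<Sum>i<m. \<bar>\<xi> i\<bar> * norm (e i))" unfolding emb_def by (rule sum_norm_le) simp
    also have "\<dots> \<le> (\<Sum>i<m. \<bar>\<xi> i\<bar> * E1)"
    proof (intro sum_mono mult_left_mono)
      fix i assume "i \<in> {..<m}"
      then show "norm (e i) \<le> E1" using member_le_sum[of i "{..<m}" "\<lambda>i. norm (e i)"] by (simp add: E1_def)
    qed auto
    also have "\<dots> = E1 * (\<Sum>i<m. \<bar>\<xi> i\<bar>)" by (simp add: sum_distrib_left mult.commute)
    finally show ?thesis .
  qed
  define a where "a = norm J + 1"
  have a: "0 < a" by (simp add: a_def add_nonneg_pos)
  have Jb: "norm (blinfun_apply J v) \<le> a * norm v" for v
    using norm_blinfun[of J v] by (simp add: a_def distrib_right add_increasing2)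
  have "0 < 1 / (4 * a)" using a by simp
  from C1_strict_derivative[OF deriv cont this, of p] obtain \<delta>1 where \<delta>1: "\<delta>1 > 0"
    "\<forall>x\<in>ball p \<delta>1. norm (F' x - F' p) \<le> 1 / (4 * a)"
    "\<forall>x\<in>ball p \<delta>1. \<forall>y\<in>ball p \<delta>1. norm (F x - F y - blinfun_apply (F' p) (x - y)) \<le> 1 / (4 * a) * norm (x - y)" by auto
  obtain \<delta>2 where \<delta>2: "\<delta>2 > 0" "ball p \<delta>2 \<subseteq> \<Omega>" using \<Omega> open_contains_ball by metis
  define \<delta> where "\<delta> = min \<delta>1 \<delta>2"
  have \<delta>: "0 < \<delta>" "ball p \<delta> \<subseteq> \<Omega>" using \<delta>1(1) \<delta>2 by (auto simp: \<delta>_def)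
  have str: "norm (blinfun_apply J (F x - F y) - blinfun_apply J (blinfun_apply (F' p) (x - y))) \<le> 1/4 * norm (x - y)"
    if x: "x \<in> ball p \<delta>" "y \<in> ball p \<delta>" for x y
  proof -
    have "norm (blinfun_apply J (F x - F y - blinfun_apply (F' p) (x - y))) \<le> a * norm (F x - F y - blinfun_apply (F' p) (x - y))" by (rule Jb)
    also have "\<dots> \<le> a * (1 / (4 * a) * norm (x - y))" using \<delta>1(3) x a by (intro mult_left_mono) (auto simp: \<delta>_def)
    also have "\<dots> = 1/4 * norm (x - y)" using a by simp
    finally show ?thesis by (simp add: blinfun.diff_right)
  qed
  have der: "norm (blinfun_apply J (blinfun_apply (F' x) w) - blinfun_apply J (blinfun_apply (F' p) w)) \<le> 1/4 * norm w"
    if x: "x \<in> ball p \<delta>" for x w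
  proof -
    have "norm (blinfun_apply J (blinfun_apply (F' x - F' p) w)) \<le> a * norm (blinfun_apply (F' x - F' p) w)" by (rule Jb)
    also have "\<dots> \<le> a * (norm (F' x - F' p) * norm w)" using a by (intro mult_left_mono norm_blinfun) auto
    also have "\<dots> \<le> a * (1 / (4 * a) * norm w)" using \<delta>1(2) x a by (intro mult_left_mono mult_right_mono) (auto simp: \<delta>_def)
    also have "\<dots> = 1/4 * norm w" using a by simp
    finally show ?thesis by (simp add: blinfun.diff_right blinfun.diff_left)
  qed
  \<comment> \<open>A third of \<open>\<delta>\<close> for each of the two components keeps
    \<open>p + emb \<xi> + z\<close> inside the ball.\<close>
  define \<rho> where "\<rho> = \<delta> / 3"
  define r where "r = \<rho> / (E1 * (real m + 1))"
  have \<rho>: "0 < \<rho>" using \<delta>(1) by (simp add: \<rho>_def)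
  have r: "0 < r" using \<rho> E1 by (simp add: r_def add_nonneg_pos)
  have embr: "norm (emb \<xi>) \<le> \<rho>" if x: "\<xi> \<in> cubem m r" for \<xi>
  proof -
    have "norm (emb \<xi>) \<le> E1 * (\<Sum>i<m. \<bar>\<xi> i\<bar>)" by (rule eb)
    also have "\<dots> \<le> E1 * (\<Sum>i<m. r)" using x E1 by (intro mult_left_mono sum_mono) (auto simp: cubem_def)
    also have "\<dots> = E1 * (real m * r)" by simp
    also have "\<dots> \<le> E1 * ((real m + 1) * r)" using E1 r by (intro mult_left_mono mult_right_mono) auto
    also have "\<dots> = \<rho>" using E1 by (simp add: r_def)
    finally show ?thesis .
  qed
  have inball: "p + emb \<xi> + z \<in> ball p \<delta>" if "\<xi> \<in> cubem m r" "norm z \<le> \<rho>" for \<xi> z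
  proof -
    have "norm (emb \<xi> + z) \<le> \<rho> + \<rho>" using norm_triangle_mono[OF embr[OF that(1)] that(2)] .
    also have "\<dots> < \<delta>" using \<delta>(1) by (simp add: \<rho>_def)
    finally have "dist (p + (emb \<xi> + z)) p < \<delta>" by (simp add: dist_norm)
    then show ?thesis by (metis add.assoc dist_commute mem_ball)
  qed
  define Zr where "Zr = Z \<inter> cball 0 \<rho>"
  have "\<exists>z\<in>Zr. blinfun_apply J (F (p + emb \<xi> + z)) = 0" if x: "\<xi> \<in> cubem m r" for \<xi>
  proof -
    define G where "G z = z - blinfun_apply J (F (p + emb \<xi> + z))" for z
    have con: "norm (G z - G z') \<le> 1/4 * norm (z - z')" if z: "z \<in> Zr" "z' \<in> Zr" for z z'
    proof -
      have "z - z' \<in> Z" using z subspace_diff[OF Zs] by (auto simp: Zr_def)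
      then have "G z - G z' = - (blinfun_apply J (F (p + emb \<xi> + z) - F (p + emb \<xi> + z')) - blinfun_apply J (blinfun_apply (F' p) (z - z')))"
        using J1Z[of "z - z'"] by (simp add: G_def blinfun.diff_right)
      then show ?thesis using str[OF inball[OF x] inball[OF x], of z z'] z by (simp only: norm_minus_cancel) (simp add: Zr_def)
    qed
    have z0: "0 \<in> Zr" using subspace_0[OF Zs] \<rho> by (simp add: Zr_def)
    have G0: "norm (G 0) \<le> 1/4 * \<rho>"
    proof -
      have pb: "p \<in> ball p \<delta>" using \<delta>(1) by simp
      have "G 0 = - (blinfun_apply J (F (p + emb \<xi> + 0) - F p) - blinfun_apply J (blinfun_apply (F' p) (p + emb \<xi> + 0 - p)))"
        using J2[OF Fp] Je[of \<xi>] by (simp add: G_def blinfun.diff_right)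
      then have "norm (G 0) \<le> 1/4 * norm (emb \<xi>)" using str[OF inball[OF x, of 0] pb] \<rho> by (simp only: norm_minus_cancel) simp
      then show ?thesis using embr[OF x] by linarith
    qed
    have "\<exists>!z\<in>Zr. G z = z"
    proof (rule Banach_fix[where c = "1/4"])
      show "complete Zr" unfolding Zr_def complete_eq_closed by (intro closed_Int Zc closed_cball)
      show "Zr \<noteq> {}" using z0 by blast
      show "G ` Zr \<subseteq> Zr"
      proof safe
        fix z assume z: "z \<in> Zr"
        have "norm (G z) \<le> norm (G z - G 0) + norm (G 0)" using norm_triangle_sub[of "G z" "G 0"] by simp
        also have "\<dots> \<le> 1/4 * norm z + 1/4 * \<rho>" using con[OF z z0] G0 by simp
        also have "\<dots> \<le> \<rho>" using z \<rho> by (simp add: Zr_def)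
        finally show "G z \<in> Zr" using z JZ subspace_diff[OF Zs] by (simp add: Zr_def G_def)
      qed
      show "dist (G x) (G y) \<le> 1/4 * dist x y" if "x \<in> Zr" "y \<in> Zr" for x y using con[OF that] by (simp add: dist_norm)
    qed auto
    then obtain z where "z \<in> Zr" "G z = z" by blast
    then show ?thesis by (intro bexI[of _ z]) (auto simp: G_def)
  qed
  then obtain \<zeta> where \<zeta>: "\<And>\<xi>. \<xi> \<in> cubem m r \<Longrightarrow> \<zeta> \<xi> \<in> Zr \<and> blinfun_apply J (F (p + emb \<xi> + \<zeta> \<xi>)) = 0" by metis
  define \<sigma> where "\<sigma> \<xi> = p + emb \<xi> + \<zeta> \<xi>" for \<xi>
  have sball: "\<sigma> \<xi> \<in> ball p \<delta>" if "\<xi> \<in> cubem m r" for \<xi>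
    unfolding \<sigma>_def by (rule inball[OF that]) (use \<zeta>[OF that] in \<open>simp add: Zr_def\<close>)
  have sM: "\<sigma> \<xi> \<in> ?M" if "\<xi> \<in> cubem m r" for \<xi>
    using sball[OF that] \<delta>(2) \<zeta>[OF that] J3 by (auto simp: \<sigma>_def)
  have spi: "blinfun_apply (\<pi> i) (\<sigma> \<xi> - p) = \<xi> i" if "\<xi> \<in> cubem m r" "i < m" for \<xi> i
    using \<zeta>[OF that(1)] that(2) pie by (simp add: \<sigma>_def Zr_def Z_def blinfun.diff_right blinfun.add_right)
  \<comment> \<open>Points of \<open>M\<close> near \<open>p\<close> are controlled by their
    coordinates. This gives the Lipschitz bound of \<open>\<sigma>\<close> and shows that its image
    fills \<open>M\<close> near \<open>p\<close>.\<close>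
  have key: "norm (x - y) \<le> 2 * norm (emb (\<lambda>i. blinfun_apply (\<pi> i) (x - y)))"
    if xy: "x \<in> ball p \<delta>" "y \<in> ball p \<delta>" "F x \<in> span B" "F y \<in> span B" for x y
  proof -
    let ?e = "emb (\<lambda>i. blinfun_apply (\<pi> i) (x - y))"
    have "blinfun_apply J (F x - F y) = 0" by (rule J2) (intro span_diff xy)
    then have "norm (x - y - ?e) \<le> 1/4 * norm (x - y)" using str[OF xy(1,2)] J1[of "x - y"] by (simp add: emb_def norm_minus_commute)
    moreover have "norm (x - y) \<le> norm (x - y - ?e) + norm ?e" using norm_triangle_sub[of "x - y" ?e] by simp
    ultimately have "3/4 * norm (x - y) \<le> norm ?e" by linarith
    then show ?thesis using norm_ge_zero[of "x - y"] by linarith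
  qed
  define U where "U = ball p \<delta> \<inter> {x. \<forall>i<m. \<bar>blinfun_apply (\<pi> i) (x - p)\<bar> < r}"
  have "C1_chart m ?M p \<pi> \<sigma> r (2 * E1) U"
  proof
    show "0 < r" by (rule r)
    show "0 < 2 * E1" using E1 by simp
    have "{x. \<forall>i<m. \<bar>blinfun_apply (\<pi> i) (x - p)\<bar> < r} = (\<Inter>i\<in>{..<m}. {x. \<bar>blinfun_apply (\<pi> i) (x - p)\<bar> < r})" by auto
    moreover have "open (\<Inter>i\<in>{..<m}. {x. \<bar>blinfun_apply (\<pi> i) (x - p)\<bar> < r})"
      by (intro open_INT finite_lessThan ballI open_Collect_less continuous_intros)
    ultimately show "open U" unfolding U_def by (simp add: open_Int)
    show "p \<in> ?M \<inter> U" using \<Omega>(2) Fp \<delta>(1) r by (simp add: U_def blinfun.zero_right)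
    show "\<sigma> \<xi> \<in> ?M" if "\<xi> \<in> cubem m r" for \<xi> by (rule sM[OF that])
    show cs: "coords m \<pi> p (\<sigma> \<xi>) = \<xi>" if "\<xi> \<in> cubem m r" for \<xi>
    proof
      fix i show "coords m \<pi> p (\<sigma> \<xi>) i = \<xi> i" using spi[OF that] that by (auto simp: coords_def cubem_def)
    qed
    have dpi: "blinfun_apply (\<pi> i) (\<sigma> \<xi> - \<sigma> \<zeta>) = \<xi> i - \<zeta> i" if "\<xi> \<in> cubem m r" "\<zeta> \<in> cubem m r" "i < m" for \<xi> \<zeta> i
      using spi[OF that(1,3)] spi[OF that(2,3)] by (simp add: blinfun.diff_right)
    show lip: "norm (\<sigma> \<xi> - \<sigma> \<zeta>) \<le> 2 * E1 * (\<Sum>i<m. \<bar>\<xi> i - \<zeta> i\<bar>)" if x: "\<xi> \<in> cubem m r" "\<zeta> \<in> cubem m r" for \<xi> \<zeta>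
    proof -
      have "norm (\<sigma> \<xi> - \<sigma> \<zeta>) \<le> 2 * norm (emb (\<lambda>i. blinfun_apply (\<pi> i) (\<sigma> \<xi> - \<sigma> \<zeta>)))"
        by (rule key) (use sball sM x in auto)
      also have "\<dots> \<le> 2 * (E1 * (\<Sum>i<m. \<bar>blinfun_apply (\<pi> i) (\<sigma> \<xi> - \<sigma> \<zeta>)\<bar>))" by (intro mult_left_mono eb) auto
      also have "(\<Sum>i<m. \<bar>blinfun_apply (\<pi> i) (\<sigma> \<xi> - \<sigma> \<zeta>)\<bar>) = (\<Sum>i<m. \<bar>\<xi> i - \<zeta> i\<bar>)"
        by (intro sum.cong refl) (simp add: dpi[OF x])
      finally show ?thesis by (simp add: mult.assoc)
    qed
    show "?M \<inter> U = \<sigma> ` {\<xi>\<in>cubem m r. \<forall>i<m. \<bar>\<xi> i\<bar> < r}"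
    proof
      show "?M \<inter> U \<subseteq> \<sigma> ` {\<xi>\<in>cubem m r. \<forall>i<m. \<bar>\<xi> i\<bar> < r}"
      proof
        fix x assume x: "x \<in> ?M \<inter> U"
        let ?c = "coords m \<pi> p x"
        have c: "?c \<in> cubem m r" "\<forall>i<m. \<bar>?c i\<bar> < r" using x by (auto simp: coords_def cubem_def U_def less_imp_le)
        have "norm (x - \<sigma> ?c) \<le> 2 * norm (emb (\<lambda>i. blinfun_apply (\<pi> i) (x - \<sigma> ?c)))"
          by (rule key) (use x sball[OF c(1)] sM[OF c(1)] in \<open>auto simp: U_def\<close>)
        moreover have "blinfun_apply (\<pi> i) (x - \<sigma> ?c) = 0" if "i < m" for i
          using spi[OF c(1) that] that by (simp add: coords_def blinfun.diff_right)
        ultimately have "x = \<sigma> ?c" by (simp add: emb_def)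
        then show "x \<in> \<sigma> ` {\<xi>\<in>cubem m r. \<forall>i<m. \<bar>\<xi> i\<bar> < r}" using c by (intro image_eqI[of _ _ ?c]) auto
      qed
      show "\<sigma> ` {\<xi>\<in>cubem m r. \<forall>i<m. \<bar>\<xi> i\<bar> < r} \<subseteq> ?M \<inter> U"
        using sM sball spi by (auto simp: U_def)
    qed
    show "\<exists>D. \<forall>\<kappa>>0. \<exists>d>0. \<forall>\<xi>\<in>cubem m r. \<forall>\<zeta>\<in>cubem m r.
      (\<forall>i<m. \<bar>\<xi> i - \<xi>0 i\<bar> < d) \<longrightarrow> (\<forall>i<m. \<bar>\<zeta> i - \<xi>0 i\<bar> < d) \<longrightarrow>
      norm (\<sigma> \<xi> - \<sigma> \<zeta> - (\<Sum>i<m. (\<xi> i - \<zeta> i) *\<^sub>R D i)) \<le> \<kappa> * (\<Sum>i<m. \<bar>\<xi> i - \<zeta> i\<bar>)"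
      if x0: "\<xi>0 \<in> cubem m r" for \<xi>0
    proof -
      define x where "x = \<sigma> \<xi>0"
      have xb: "x \<in> ball p \<delta>" using sball[OF x0] by (simp add: x_def)
      \<comment> \<open>Tangent vectors at \<open>x\<close>: each \<open>e i\<close> is corrected by
        an element of \<open>Z\<close> so that \<open>J\<close> composed with the derivative at
        \<open>x\<close> annihilates it.\<close>
      have "\<exists>d\<in>Z. blinfun_apply J (blinfun_apply (F' x) (w + d)) = 0" for w
      proof -
        define G where "G d = d - blinfun_apply J (blinfun_apply (F' x) (w + d))" for d
        have "\<exists>!d\<in>Z. G d = d"
        proof (rule Banach_fix[where c = "1/4"])
          show "complete Z" unfolding complete_eq_closed by (rule Zc)
          show "Z \<noteq> {}" using subspace_0[OF Zs] by blast
          show "G ` Z \<subseteq> Z" using JZ subspace_diff[OF Zs] by (auto simp: G_def)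
          show "dist (G d) (G d') \<le> 1/4 * dist d d'" if d: "d \<in> Z" "d' \<in> Z" for d d'
          proof -
            have "d - d' \<in> Z" using d subspace_diff[OF Zs] by blast
            then have "G d - G d' = - (blinfun_apply J (blinfun_apply (F' x) (d - d')) - blinfun_apply J (blinfun_apply (F' p) (d - d')))"
              using J1Z[of "d - d'"] by (simp add: G_def blinfun.diff_right blinfun.add_right)
            then show ?thesis using der[OF xb, of "d - d'"] by (simp only: dist_norm norm_minus_cancel)
          qed
        qed auto
        then obtain d where "d \<in> Z" "G d = d" by blast
        then show ?thesis by (intro bexI[of _ d]) (auto simp: G_def)
      qed
      then obtain dd where dd: "\<And>w. dd w \<in> Z" "\<And>w. blinfun_apply J (blinfun_apply (F' x) (w + dd w)) = 0" by metis
      define D where "D i = e i + dd (e i)" for i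
      have JD: "blinfun_apply J (blinfun_apply (F' x) (D i)) = 0" for i using dd(2) by (simp add: D_def)
      have piD: "blinfun_apply (\<pi> j) (\<Sum>i<m. t i *\<^sub>R D i) = t j" if "j < m" for j t
      proof -
        have "blinfun_apply (\<pi> j) (\<Sum>i<m. t i *\<^sub>R D i) = (\<Sum>i<m. if i = j then t j else 0)"
          unfolding blinfun.sum_right
          by (intro sum.cong refl) (use dd(1) that in \<open>simp add: blinfun.scaleR_right blinfun.add_right D_def dual Z_def\<close>)
        then show ?thesis using that by simp
      qed
      have low: "norm w \<le> 2 * norm (blinfun_apply J (blinfun_apply (F' x) w))" if w: "w \<in> Z" for w
      proof -
        have "norm (blinfun_apply J (blinfun_apply (F' x) w) - w) \<le> 1/4 * norm w" using der[OF xb, of w] J1Z[OF w] by simp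
        moreover have "norm w \<le> norm (blinfun_apply J (blinfun_apply (F' x) w) - w) + norm (blinfun_apply J (blinfun_apply (F' x) w))"
          using norm_triangle_sub[of w "blinfun_apply J (blinfun_apply (F' x) w)"] by (simp add: norm_minus_commute)
        ultimately show ?thesis using norm_ge_zero[of w] by linarith
      qed
      show ?thesis
      proof (rule exI[of _ D], intro allI impI)
        fix \<kappa> :: real assume \<kappa>: "0 < \<kappa>"
        define \<kappa>' where "\<kappa>' = \<kappa> / (2 * a * (2 * E1))"
        have \<kappa>': "0 < \<kappa>'" using \<kappa> a E1 by (simp add: \<kappa>'_def)
        from C1_strict_derivative[OF deriv cont \<kappa>', of x] obtain d0 where d0: "d0 > 0"
          "\<forall>y\<in>ball x d0. \<forall>z\<in>ball x d0. norm (F y - F z - blinfun_apply (F' x) (y - z)) \<le> \<kappa>' * norm (y - z)" by auto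
        define d where "d = d0 / (2 * E1 * (real m + 1))"
        have d: "0 < d" using d0(1) E1 by (simp add: d_def add_nonneg_pos)
        have near: "\<sigma> \<xi> \<in> ball x d0" if x: "\<xi> \<in> cubem m r" "\<forall>i<m. \<bar>\<xi> i - \<xi>0 i\<bar> < d" for \<xi>
        proof -
          have "norm (\<sigma> \<xi> - \<sigma> \<xi>0) \<le> 2 * E1 * (\<Sum>i<m. \<bar>\<xi> i - \<xi>0 i\<bar>)" by (rule lip[OF x(1) x0])
          also have "\<dots> \<le> 2 * E1 * (\<Sum>i<m. d)" using E1 x(2) by (intro mult_left_mono sum_mono) (auto intro: less_imp_le)
          also have "\<dots> = 2 * E1 * (real m * d)" by simp
          also have "\<dots> < 2 * E1 * ((real m + 1) * d)" using E1 d by (intro mult_strict_left_mono) auto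
          also have "\<dots> = d0" using E1 by (simp add: d_def)
          finally show ?thesis by (simp add: x_def dist_norm norm_minus_commute)
        qed
        show "\<exists>d>0. \<forall>\<xi>\<in>cubem m r. \<forall>\<zeta>\<in>cubem m r.
          (\<forall>i<m. \<bar>\<xi> i - \<xi>0 i\<bar> < d) \<longrightarrow> (\<forall>i<m. \<bar>\<zeta> i - \<xi>0 i\<bar> < d) \<longrightarrow>
          norm (\<sigma> \<xi> - \<sigma> \<zeta> - (\<Sum>i<m. (\<xi> i - \<zeta> i) *\<^sub>R D i)) \<le> \<kappa> * (\<Sum>i<m. \<bar>\<xi> i - \<zeta> i\<bar>)"
        proof (rule exI[of _ d], intro conjI ballI impI d)
          fix \<xi> \<zeta> assume x: "\<xi> \<in> cubem m r" "\<zeta> \<in> cubem m r" "\<forall>i<m. \<bar>\<xi> i - \<xi>0 i\<bar> < d" "\<forall>i<m. \<bar>\<zeta> i - \<xi>0 i\<bar> < d"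
          let ?q = "\<sigma> \<xi> - \<sigma> \<zeta>" and ?t = "\<Sum>i<m. (\<xi> i - \<zeta> i) *\<^sub>R D i"
          have qZ: "?q - ?t \<in> Z" using dpi[OF x(1,2)] piD by (simp add: Z_def blinfun.diff_right)
          have Jt: "blinfun_apply J (blinfun_apply (F' x) ?t) = 0"
            by (simp add: blinfun.sum_right blinfun.scaleR_right JD)
          have J0: "blinfun_apply J (F (\<sigma> \<xi>) - F (\<sigma> \<zeta>)) = 0" by (rule J2) (use sM x in \<open>auto intro!: span_diff\<close>)
          have "norm (?q - ?t) \<le> 2 * norm (blinfun_apply J (blinfun_apply (F' x) (?q - ?t)))" by (rule low[OF qZ])
          also have "blinfun_apply J (blinfun_apply (F' x) (?q - ?t)) = - blinfun_apply J (F (\<sigma> \<xi>) - F (\<sigma> \<zeta>) - blinfun_apply (F' x) ?q)"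
            using Jt J0 by (simp add: blinfun.diff_right)
          also have "norm \<dots> \<le> a * norm (F (\<sigma> \<xi>) - F (\<sigma> \<zeta>) - blinfun_apply (F' x) ?q)" unfolding norm_minus_cancel by (rule Jb)
          also have "norm (F (\<sigma> \<xi>) - F (\<sigma> \<zeta>) - blinfun_apply (F' x) ?q) \<le> \<kappa>' * norm ?q"
            using d0(2) near[OF x(1,3)] near[OF x(2,4)] by blast
          also have "norm ?q \<le> 2 * E1 * (\<Sum>i<m. \<bar>\<xi> i - \<zeta> i\<bar>)" by (rule lip[OF x(1,2)])
          finally have "norm (?q - ?t) \<le> 2 * (a * (\<kappa>' * (2 * E1 * (\<Sum>i<m. \<bar>\<xi> i - \<zeta> i\<bar>))))" using a \<kappa>' by simp
          also have "\<dots> = (\<kappa>' * (2 * a * (2 * E1))) * (\<Sum>i<m. \<bar>\<xi> i - \<zeta> i\<bar>)" by (simp add: mult_ac)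
          also have "\<kappa>' * (2 * a * (2 * E1)) = \<kappa>" using a E1 by (simp add: \<kappa>'_def)
          finally show "norm (?q - ?t) \<le> \<kappa> * (\<Sum>i<m. \<bar>\<xi> i - \<zeta> i\<bar>)" .
        qed
      qed
    qed
  qed
  then show ?thesis unfolding has_C1_chart_def by blast
qed

text \<open>The real parameter adds one dimension: solving for the parameter direction modulo
  \<open>span B\<close> by some \<open>w\<close> yields the additional basis vector
  \<open>(1, - w)\<close>.\<close>

lemma Fredholm0_product_preimage_basis:
  fixes T :: "'u::real_normed_vector \<Rightarrow>\<^sub>L 'v::real_normed_vector" and A :: "(real \<times> 'u) \<Rightarrow>\<^sub>L 'v"
  assumes T: "T \<in> Fredholm0" and B: "finite B" "independent B"
    and onto: "\<And>v. \<exists>x. v - blinfun_apply T x \<in> span B"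
    and A: "\<And>v. blinfun_apply A (0, v) = blinfun_apply T v"
  obtains E where "finite E" "independent E" "card E = Suc (card B)" "{x. blinfun_apply A x \<in> span B} = span E"
proof -
  obtain E where E: "finite E" "independent E" "card E = card B" "{x. blinfun_apply T x \<in> span B} = span E"
    by (rule Fredholm0_preimage_basis[OF T B onto]) (auto intro: that)
  have lin: "linear (Pair (0::real) :: 'u \<Rightarrow> real \<times> 'u)" by (intro linearI) auto
  have inj: "inj (Pair (0::real) :: 'u \<Rightarrow> real \<times> 'u)" by (auto intro: injI)
  define E0 where "E0 = Pair (0::real) ` E"
  have s0: "span E0 = Pair 0 ` span E" unfolding E0_def by (rule linear_span_image[OF lin])
  have i0: "independent E0" unfolding E0_def by (rule linear_independent_injective_image[OF lin E(2)]) (use inj in \<open>auto simp: inj_on_def\<close>)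
  obtain w where w: "blinfun_apply A (1, 0) - blinfun_apply T w \<in> span B" using onto by blast
  have Aw: "blinfun_apply A (t, v) = t *\<^sub>R blinfun_apply A (1, 0) + blinfun_apply T v" for t v
  proof -
    have "(t, v) = t *\<^sub>R (1, 0) + (0, v)" by simp
    then show ?thesis using A by (metis blinfun.add_right blinfun.scaleR_right)
  qed
  have nin: "(1, - w) \<notin> span E0" unfolding s0 by auto
  have "{x. blinfun_apply A x \<in> span B} = span (insert (1, - w) E0)"
  proof
    have sub: "subspace {x. blinfun_apply A x \<in> span B}"
      by (auto simp: subspace_def blinfun.zero_right blinfun.add_right blinfun.scaleR_right span_zero span_add span_scale)
    have "blinfun_apply A (1, - w) \<in> span B" using w Aw[of 1 "- w"] by (simp add: blinfun.minus_right)
    moreover have "blinfun_apply T v \<in> span B" if "v \<in> E" for v using E(4) span_base[OF that] by blast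
    ultimately have "insert (1, - w) E0 \<subseteq> {x. blinfun_apply A x \<in> span B}" using A by (auto simp: E0_def)
    then show "span (insert (1, - w) E0) \<subseteq> {x. blinfun_apply A x \<in> span B}" using sub by (rule span_minimal)
    show "{x. blinfun_apply A x \<in> span B} \<subseteq> span (insert (1, - w) E0)"
    proof
      fix x assume "x \<in> {x. blinfun_apply A x \<in> span B}"
      then obtain t v where x: "x = (t, v)" "blinfun_apply A (t, v) \<in> span B" by (cases x) auto
      have "blinfun_apply T (v + t *\<^sub>R w) = blinfun_apply A (t, v) - t *\<^sub>R (blinfun_apply A (1, 0) - blinfun_apply T w)"
        using Aw[of t v] by (simp add: blinfun.add_right blinfun.scaleR_right algebra_simps)
      then have "blinfun_apply T (v + t *\<^sub>R w) \<in> span B" using span_diff[OF x(2) span_scale[OF w]] by simp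
      then have "v + t *\<^sub>R w \<in> span E" using E(4) by blast
      then have "(0, v + t *\<^sub>R w) \<in> span E0" unfolding s0 by blast
      moreover have "(t, v) - t *\<^sub>R (1, - w) = (0, v + t *\<^sub>R w)" by simp
      ultimately show "x \<in> span (insert (1, - w) E0)" unfolding span_insert x(1) by (auto intro!: exI[of _ t])
    qed
  qed
  moreover have "finite (insert (1, - w) E0)" using E(1) by (simp add: E0_def)
  moreover have "independent (insert (1, - w) E0)" using i0 nin by (simp add: independent_insert)
  moreover have "card (insert (1, - w) E0) = Suc (card B)"
  proof -
    have "(1, - w) \<notin> E0" using nin span_base by blast
    moreover have "card E0 = card E" unfolding E0_def by (rule card_image) (auto simp: inj_on_def)
    ultimately show ?thesis using E(1,3) by (simp add: E0_def)
  qed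
  ultimately show ?thesis using that by blast
qed


lemma compact_closed_gap:
  fixes S T :: "'a::metric_space set"
  assumes S: "compact S" and T: "closed T" and ST: "S \<inter> T = {}"
  shows "\<exists>d>0. \<forall>x\<in>S. \<forall>y\<in>T. d \<le> dist x y"
proof (cases "S = {} \<or> T = {}")
  case True
  then show ?thesis by (intro exI[of _ 1]) auto
next
  case False
  then obtain a where a: "a \<in> S" "\<And>x. x \<in> S \<Longrightarrow> infdist a T \<le> infdist x T"
    using continuous_attains_inf[OF S, of "\<lambda>x. infdist x T"] continuous_on_infdist[OF continuous_on_id, of S T] by blast
  have "0 < infdist a T" using infdist_pos_not_in_closed[OF T] False a(1) ST by blast
  moreover have "infdist a T \<le> dist x y" if "x \<in> S" "y \<in> T" for x y
    using a(2)[OF that(1)] infdist_le[OF that(2), of x] by linarith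
  ultimately show ?thesis by blast
qed

section \<open>Stability of Fredholm operators of index zero\<close>

lemma dim_zero: "dim {0 :: 'v::real_vector} = 0"
  by (rule dim_unique[of "{}"]) (auto simp: independent_empty)

lemma codim_attained:
  assumes "finite_codim S"
  shows "\<exists>C. finite C \<and> card C = codim S \<and> span (S \<union> C) = UNIV"
proof -
  have "\<exists>n C. finite C \<and> card C = n \<and> span (S \<union> C) = UNIV" using assms by (auto simp: finite_codim_def)
  then show ?thesis unfolding codim_def by (rule LeastI_ex)
qed

lemma subspace_range_blinfun: "subspace (range (blinfun_apply T))"
  by (rule linear_subspace_image[OF bounded_linear.linear[OF blinfun.bounded_linear_right] subspace_UNIV])

text \<open>A trivial kernel and index zero force codimension 0, hence surjectivity, and the lower
  bound makes the inverse continuous.\<close>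

lemma Fredholm0_bounded_below_GL:
  fixes T :: "'u::banach \<Rightarrow>\<^sub>L 'v::banach"
  assumes T: "T \<in> Fredholm0" and c: "0 < c" "\<And>x. c * norm x \<le> norm (blinfun_apply T x)"
  shows "T \<in> GL"
proof -
  have ker: "x = 0" if "blinfun_apply T x = 0" for x
    using c(2)[of x] c(1) that by (simp add: mult_le_0_iff)
  then have "null_space T = {0}" by (auto simp: null_space_def blinfun.zero_right)
  then have "codim (range (blinfun_apply T)) = 0" using T by (simp add: Fredholm0_def fredholm_index_def dim_zero)
  moreover have "finite_codim (range (blinfun_apply T))" using T by (simp add: Fredholm0_def fredholm_def)
  ultimately obtain C where "finite C" "card C = 0" "span (range (blinfun_apply T) \<union> C) = UNIV"
    using codim_attained by metis
  then have surj: "surj (blinfun_apply T)" using span_eq_iff[THEN iffD2, OF subspace_range_blinfun[of T]] by simp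
  have inj: "x = y" if "blinfun_apply T x = blinfun_apply T y" for x y
    using ker[of "x - y"] that by (simp add: blinfun.diff_right)
  define G where "G = inv_into UNIV (blinfun_apply T)"
  have TG: "blinfun_apply T (G y) = y" for y unfolding G_def by (rule surj_f_inv_f[OF surj])
  have "bounded_linear G"
  proof (rule bounded_linear_intro[where K = "1 / c"])
    show "G (x + y) = G x + G y" for x y by (rule inj) (simp add: TG blinfun.add_right)
    show "G (r *\<^sub>R x) = r *\<^sub>R G x" for r x by (rule inj) (simp add: TG blinfun.scaleR_right)
    show "norm (G x) \<le> norm x * (1 / c)" for x using c(2)[of "G x"] c(1) by (simp add: TG field_simps)
  qed
  then have "blinfun_apply (Blinfun G) y = G y" for y by (simp add: bounded_linear_Blinfun_apply)
  moreover have "G (blinfun_apply T x) = x" for x by (rule inj) (rule TG)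
  ultimately have "T o\<^sub>L Blinfun G = id_blinfun" "Blinfun G o\<^sub>L T = id_blinfun"
    by (auto intro!: blinfun_eqI simp: TG)
  then show ?thesis unfolding GL_def by blast
qed

lemma GL_bounded_below:
  assumes "T \<in> GL"
  shows "\<exists>c>0. \<forall>x. c * norm x \<le> norm (blinfun_apply T x)"
proof -
  obtain B where B: "B o\<^sub>L T = id_blinfun" using assms by (auto simp: GL_def)
  have p: "0 < norm B + 1" by (simp add: add_nonneg_pos)
  have "norm x \<le> (norm B + 1) * norm (blinfun_apply T x)" for x
  proof -
    have "x = blinfun_apply B (blinfun_apply T x)" using B by (metis blinfun_apply_blinfun_compose blinfun_apply_id_blinfun id_apply)
    then have "norm x \<le> norm B * norm (blinfun_apply T x)" using norm_blinfun[of B "blinfun_apply T x"] by simp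
    then show ?thesis by (simp add: distrib_right add_increasing2)
  qed
  then have "1 / (norm B + 1) * norm x \<le> norm (blinfun_apply T x)" for x
    using p by (simp add: divide_le_eq mult.commute)
  then show ?thesis using p by (intro exI[of _ "1 / (norm B + 1)"]) simp
qed

text \<open>\<open>T\<close> composed with \<open>J\<close> is the identity modulo
  \<open>span B\<close>. For \<open>T'\<close> near \<open>T\<close> the error
  \<open>(T' - T) o\<^sub>L J\<close> has norm at most 1/2, and a fixed point corrects the
  right-hand side.\<close>

lemma Fredholm0_onto_modulo_open:
  fixes T :: "'u::banach \<Rightarrow>\<^sub>L 'v::banach"
  assumes T: "T \<in> Fredholm0" and B: "finite B" "independent B"
    and onto: "\<And>v. \<exists>x. v - blinfun_apply T x \<in> span B"
  shows "\<exists>\<delta>>0. \<forall>T'. norm (T' - T) < \<delta> \<longrightarrow> (\<forall>v. \<exists>x. v - blinfun_apply T' x \<in> span B)"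
proof -
  obtain E where E: "finite E" "independent E" "card E = card B" "{x. blinfun_apply T x \<in> span B} = span E"
    by (rule Fredholm0_preimage_basis[OF T B onto]) (auto intro: that)
  obtain e where e: "bij_betw e {0..<card E} E" using ex_bij_betw_nat_finite[OF E(1)] by auto
  have eE: "e ` {..<card E} = E" "inj_on e {..<card E}" using e by (auto simp: bij_betw_def lessThan_atLeast0)
  obtain \<pi> :: "nat \<Rightarrow> 'u \<Rightarrow>\<^sub>L real" where dual: "\<And>i j. i < card E \<Longrightarrow> j < card E \<Longrightarrow> blinfun_apply (\<pi> i) (e j) = (if i = j then 1 else 0)"
    using dual_family[OF eE(2)] E(2) eE(1) by metis
  have ker: "{x. blinfun_apply T x \<in> span B} = span (e ` {..<card E})" using E(4) eE(1) by simp
  obtain J :: "'v \<Rightarrow>\<^sub>L 'u" where J: "\<forall>x. blinfun_apply J (blinfun_apply T x) = x - (\<Sum>i<card E. blinfun_apply (\<pi> i) x *\<^sub>R e i)"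
      "\<forall>v. blinfun_apply J v = 0 \<longrightarrow> v \<in> span B" "\<forall>v. \<forall>i<card E. blinfun_apply (\<pi> i) (blinfun_apply J v) = 0"
  proof -
    have "\<exists>J :: 'v \<Rightarrow>\<^sub>L 'u. (\<forall>x. blinfun_apply J (blinfun_apply T x) = x - (\<Sum>i<card E. blinfun_apply (\<pi> i) x *\<^sub>R e i)) \<and>
      (\<forall>y\<in>span B. blinfun_apply J y = 0) \<and> (\<forall>v. blinfun_apply J v = 0 \<longrightarrow> v \<in> span B) \<and>
      (\<forall>v. \<forall>i<card E. blinfun_apply (\<pi> i) (blinfun_apply J v) = 0)"
      by (rule complement_inverse[OF B(1) onto ker]) (rule dual)
    then show ?thesis by (elim exE conjE) (rule that)
  qed
  have TJ: "v - blinfun_apply T (blinfun_apply J v) \<in> span B" for v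
    using J(1)[rule_format, of "blinfun_apply J v"] J(3) by (intro J(2)[rule_format]) (simp add: blinfun.diff_right)
  define \<delta> where "\<delta> = 1 / (2 * (norm J + 1))"
  have p: "0 < norm J + 1" by (simp add: add_nonneg_pos)
  then have \<delta>: "0 < \<delta>" by (simp add: \<delta>_def)
  have "\<exists>x. w - blinfun_apply T' x \<in> span B" if T': "norm (T' - T) < \<delta>" for T' w
  proof -
    define G where "G = (T' - T) o\<^sub>L J"
    have "norm G \<le> norm (T' - T) * norm J" unfolding G_def by (rule norm_blinfun_compose)
    also have "\<dots> \<le> \<delta> * (norm J + 1)" using T' \<delta> by (intro mult_mono) auto
    also have "\<dots> = 1 / 2" using p by (simp add: \<delta>_def)
    finally have G: "norm G \<le> 1 / 2" .
    have "\<exists>!v. w - blinfun_apply G v = v"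
    proof (rule banach_fix_type[where c = "1 / 2"])
      show "\<forall>x y. dist (w - blinfun_apply G x) (w - blinfun_apply G y) \<le> 1 / 2 * dist x y"
      proof (intro allI)
        fix x y
        have "dist (w - blinfun_apply G x) (w - blinfun_apply G y) = norm (blinfun_apply G (y - x))"
          by (simp add: dist_norm blinfun.diff_right)
        also have "\<dots> \<le> norm G * norm (y - x)" by (rule norm_blinfun)
        also have "\<dots> \<le> 1 / 2 * norm (y - x)" by (rule mult_right_mono[OF G]) simp
        finally show "dist (w - blinfun_apply G x) (w - blinfun_apply G y) \<le> 1 / 2 * dist x y"
          by (simp only: dist_norm norm_minus_commute[of y])
      qed
    qed auto
    then obtain v where "w - blinfun_apply G v = v" by blast
    then have "w = v + (blinfun_apply T' (blinfun_apply J v) - blinfun_apply T (blinfun_apply J v))"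
      by (simp add: G_def blinfun.diff_left algebra_simps)
    then have "w - blinfun_apply T' (blinfun_apply J v) = v - blinfun_apply T (blinfun_apply J v)" by simp
    then show ?thesis using TJ by metis
  qed
  then show ?thesis using \<delta> by blast
qed

text \<open>Finitely many local choices cover the compact set, and a basis of the span of their
  union serves everywhere. In the application \<open>c\<close> is \<open>L' \<phi>0\<close>,
  multiples of which the homotopy adds to \<open>F\<close>.\<close>

lemma Fredholm0_family_common_complement:
  fixes T :: "'a::metric_space \<Rightarrow> 'u::banach \<Rightarrow>\<^sub>L 'v::banach"
  assumes K: "compact K" and T: "continuous_on UNIV T" "\<And>x. T x \<in> Fredholm0"
  shows "\<exists>B. finite B \<and> independent B \<and> c \<in> span B \<and> (\<forall>x\<in>K. \<forall>v. \<exists>y. v - blinfun_apply (T x) y \<in> span B)"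
proof -
  have "\<exists>B \<delta>. finite B \<and> 0 < \<delta> \<and> (\<forall>T'. norm (T' - T x) < \<delta> \<longrightarrow> (\<forall>v. \<exists>y. v - blinfun_apply T' y \<in> span B))" for x
  proof -
    obtain C where C: "finite C" "span (range (blinfun_apply (T x)) \<union> C) = UNIV"
      using T(2)[of x] by (auto simp: Fredholm0_def fredholm_def finite_codim_def)
    obtain B where B: "B \<subseteq> C" "independent B" "C \<subseteq> span B" using maximal_independent_subset[of C] by blast
    have fB: "finite B" using B(1) C(1) finite_subset by blast
    have "\<exists>y. v - blinfun_apply (T x) y \<in> span B" for v
    proof -
      have "v \<in> {a + b |a b. a \<in> span (range (blinfun_apply (T x))) \<and> b \<in> span C}" using C(2) unfolding span_Un by blast
      then obtain a b where ab: "v = a + b" "a \<in> span (range (blinfun_apply (T x)))" "b \<in> span C" by blast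
      have "a \<in> range (blinfun_apply (T x))" using ab(2) subspace_range_blinfun[of "T x"] by (simp add: span_eq_iff[THEN iffD2])
      then obtain y where "a = blinfun_apply (T x) y" by blast
      moreover have "b \<in> span B" using ab(3) span_minimal[OF B(3) subspace_span] by blast
      ultimately show ?thesis using ab(1) by (intro exI[of _ y]) simp
    qed
    from Fredholm0_onto_modulo_open[OF T(2) fB B(2) this] show ?thesis using fB by blast
  qed
  then obtain B \<delta> where B: "\<And>x. finite (B x)" "\<And>x. 0 < \<delta> x"
      "\<And>x T' v. norm (T' - T x) < \<delta> x \<Longrightarrow> \<exists>y. v - blinfun_apply T' y \<in> span (B x)" by metis
  define U where "U x = T -` ball (T x) (\<delta> x)" for x
  have "open (U x)" for x unfolding U_def by (rule open_vimage[OF open_ball T(1)])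
  moreover have "K \<subseteq> (\<Union>x\<in>K. U x)" using B(2) by (auto simp: U_def)
  ultimately obtain D where D: "D \<subseteq> K" "finite D" "K \<subseteq> (\<Union>x\<in>D. U x)"
    using compactE_image[OF K, of K U] by metis
  define C where "C = insert c (\<Union>x\<in>D. B x)"
  have fC: "finite C" using D(2) B(1) by (simp add: C_def)
  obtain B' where B': "B' \<subseteq> C" "independent B'" "C \<subseteq> span B'" using maximal_independent_subset[of C] by blast
  have sC: "span C \<subseteq> span B'" by (rule span_minimal[OF B'(3) subspace_span])
  have "\<exists>y. v - blinfun_apply (T x) y \<in> span B'" if xK: "x \<in> K" for x v
  proof -
    obtain d where d: "d \<in> D" "x \<in> U d" using D(3) xK by blast
    then have "norm (T x - T d) < \<delta> d" by (simp add: U_def dist_norm norm_minus_commute[of "T x"])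
    then obtain y where y: "v - blinfun_apply (T x) y \<in> span (B d)" using B(3) by blast
    have "span (B d) \<subseteq> span C" using d(1) by (intro span_mono) (auto simp: C_def)
    then show ?thesis using y sC by blast
  qed
  moreover have "finite B'" using B'(1) fC finite_subset by blast
  moreover have "c \<in> span B'" using B'(3) by (auto simp: C_def)
  ultimately show ?thesis using B'(2) by blast
qed

lemma id_Fredholm0: "(id_blinfun :: 'v::real_normed_vector \<Rightarrow>\<^sub>L 'v) \<in> Fredholm0"
proof -
  have "null_space (id_blinfun :: 'v \<Rightarrow>\<^sub>L 'v) = {0}" by (auto simp: null_space_def)
  moreover have "range (blinfun_apply (id_blinfun :: 'v \<Rightarrow>\<^sub>L 'v)) = UNIV" by auto
  moreover have "codim (UNIV :: 'v set) = 0" using codim_eq_card_complement[of "UNIV :: 'v set" "{}"] by (simp add: independent_empty)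
  moreover have "finite_codim (UNIV :: 'v set)" unfolding finite_codim_def by (intro exI[of _ "{}"]) simp
  moreover have "finite_dim {0 :: 'v}" unfolding finite_dim_def by (intro exI[of _ "{}"]) simp
  ultimately show ?thesis by (simp add: Fredholm0_def fredholm_def fredholm_index_def dim_zero)
qed

text \<open>The homotopy takes values in pairs of a level of \<open>\<phi>s\<close> and a vector of
  \<open>span N\<close>; this space must have the dimension of the manifold. Both dimensions come
  from the same preimage lemma, here with the identity as the operator.\<close>

lemma real_times_span_basis:
  fixes B :: "'v::real_normed_vector set"
  assumes B: "finite B" "independent B"
  obtains E :: "(real \<times> 'v) set" where "finite E" "independent E" "card E = Suc (card B)" "\<And>x. x \<in> span E \<longleftrightarrow> snd x \<in> span B"
proof -
  have on: "\<exists>x. v - blinfun_apply id_blinfun x \<in> span B" for v by (rule exI[of _ v]) (simp add: span_zero)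
  have sb: "blinfun_apply (Blinfun (snd :: real \<times> 'v \<Rightarrow> 'v)) x = snd x" for x
    by (simp add: bounded_linear_Blinfun_apply bounded_linear_snd)
  obtain E where E: "finite E" "independent E" "card E = Suc (card B)"
      "{x. blinfun_apply (Blinfun (snd :: real \<times> 'v \<Rightarrow> 'v)) x \<in> span B} = span E"
    by (rule Fredholm0_product_preimage_basis[OF id_Fredholm0 B, of "Blinfun snd"]) (use on in \<open>auto simp: sb intro: that\<close>)
  from E(4) have "x \<in> span E \<longleftrightarrow> snd x \<in> span B" for x unfolding sb by blast
  with E(1-3) show ?thesis by (rule that)
qed


section \<open>Solutions near a simple eigenvalue\<close>

text \<open>The hypotheses form a locale so that they can be interpreted a second time with
  \<open>\<phi>0\<close> and \<open>\<phi>s\<close> negated, which gives the other branch.\<close>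

locale simple_eigenvalue =
  fixes F :: "real \<times> 'u::banach \<Rightarrow> 'v::banach" and F' :: "real \<times> 'u \<Rightarrow> ((real \<times> 'u) \<Rightarrow>\<^sub>L 'v)"
    and l0 :: real and \<phi>0 :: 'u and L' :: "'u \<Rightarrow>\<^sub>L 'v" and \<phi>s :: "'u \<Rightarrow>\<^sub>L real"
  assumes deriv: "\<And>x. (F has_derivative blinfun_apply (F' x)) (at x)"
    and cont_deriv: "continuous_on UNIV F'"
    and trivial: "\<And>l. F (l, 0) = 0"
    and Fredholm: "\<And>x. D_u F x \<in> Fredholm0"
    and proper: "proper_on_closed_bounded F"
    and isolated: "l0 isolated_in gen_spectrum (linearization F)"
    and ker: "null_space (linearization F l0) = span {\<phi>0}"
    and norm_\<phi>0: "norm \<phi>0 = 1"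
    and deriv_L: "(linearization F has_vector_derivative L') (at l0)"
    and transversal: "blinfun_apply L' \<phi>0 \<notin> range (blinfun_apply (linearization F l0))"
    and \<phi>s_\<phi>0: "blinfun_apply \<phi>s \<phi>0 = 1"
begin

abbreviation "p0 \<equiv> (l0, 0 :: 'u)"
abbreviation "S \<equiv> nontrivial_solutions F"
abbreviation "L0 \<equiv> linearization F l0"

lemma D_u_apply: "blinfun_apply (D_u F x) v = blinfun_apply (F' x) (0, v)"
proof -
  have "((\<lambda>w. (fst x, w)) has_derivative (\<lambda>v. (0, v))) (at (snd x))"
    by (rule has_derivative_Pair[OF has_derivative_const has_derivative_ident])
  from has_derivative_compose[OF this, of F "blinfun_apply (F' x)"] deriv[of x]
  have d: "((\<lambda>w. F (fst x, w)) has_derivative (\<lambda>v. blinfun_apply (F' x) (0, v))) (at (snd x))" by simp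
  show ?thesis unfolding D_u_def frechet_derivative_at[OF d, symmetric]
    by (simp add: bounded_linear_Blinfun_apply has_derivative_bounded_linear[OF d])
qed

lemma continuous_D_u: "continuous_on UNIV (D_u F)"
proof -
  define I :: "'u \<Rightarrow>\<^sub>L (real \<times> 'u)" where "I = Blinfun (\<lambda>v. (0, v))"
  have "bounded_linear (\<lambda>v :: 'u. (0 :: real, v))" by (rule bounded_linear_Pair[OF bounded_linear_zero bounded_linear_ident])
  then have "D_u F = (\<lambda>x. F' x o\<^sub>L I)"
    by (intro ext blinfun_eqI) (simp add: D_u_apply I_def bounded_linear_Blinfun_apply)
  moreover have "continuous_on UNIV (\<lambda>x. F' x o\<^sub>L I)"
    by (rule bounded_bilinear.continuous_on[OF bounded_bilinear_blinfun_compose cont_deriv continuous_on_const])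
  ultimately show ?thesis by simp
qed

lemma continuous_F: "continuous_on UNIV F"
  using has_derivative_continuous_on[of UNIV F "\<lambda>x. blinfun_apply (F' x)"] deriv by simp

text \<open>\<open>F\<close> vanishes along the trivial line, so its derivative there does not see
  the parameter direction.\<close>

lemma derivative_at_trivial: "blinfun_apply (F' (l, 0)) x = blinfun_apply (linearization F l) (snd x)"
proof -
  have "((\<lambda>l. (l, 0 :: 'u)) has_derivative (\<lambda>a. (a, 0))) (at l)"
    by (rule has_derivative_Pair[OF has_derivative_ident has_derivative_const])
  from has_derivative_compose[OF this, of F "blinfun_apply (F' (l, 0))"] deriv[of "(l, 0)"]
  have "((\<lambda>l. F (l, 0)) has_derivative (\<lambda>a. blinfun_apply (F' (l, 0)) (a, 0))) (at l)" by simp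
  moreover have "((\<lambda>l. F (l, 0)) has_derivative (\<lambda>a. 0)) (at l)" unfolding trivial by (rule has_derivative_const)
  ultimately have "(\<lambda>a. blinfun_apply (F' (l, 0)) (a, 0)) = (\<lambda>a. 0)" by (rule has_derivative_unique)
  then have z: "blinfun_apply (F' (l, 0)) (fst x, 0) = 0" by meson
  have "x = (fst x, 0) + (0, snd x)" by (cases x) simp
  then have "blinfun_apply (F' (l, 0)) x = blinfun_apply (F' (l, 0)) (fst x, 0) + blinfun_apply (F' (l, 0)) (0, snd x)"
    by (metis blinfun.add_right)
  then show ?thesis using z by (simp add: linearization_def D_u_apply)
qed

lemma strict_estimate:
  assumes "0 < \<kappa>"
  shows "\<exists>\<delta>>0. \<forall>x\<in>ball (l, 0) \<delta>. \<forall>y\<in>ball (l, 0) \<delta>.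
    norm (F x - F y - blinfun_apply (linearization F l) (snd x - snd y)) \<le> \<kappa> * norm (x - y)"
  using C1_strict_derivative[OF deriv cont_deriv assms, of "(l, 0)"] by (auto simp: derivative_at_trivial)

text \<open>Comparison with the trivial solution at the same parameter \<open>l'\<close> makes the
  error proportional to \<open>norm u\<close> alone.\<close>

lemma linearization_estimate:
  assumes "0 < \<kappa>"
  shows "\<exists>\<delta>>0. \<forall>l' u. (l', u) \<in> ball (l, 0) \<delta> \<longrightarrow> norm (F (l', u) - blinfun_apply (linearization F l) u) \<le> \<kappa> * norm u"
proof -
  obtain \<delta> where \<delta>: "\<delta> > 0" "\<forall>x\<in>ball (l, 0) \<delta>. \<forall>y\<in>ball (l, 0) \<delta>.
    norm (F x - F y - blinfun_apply (linearization F l) (snd x - snd y)) \<le> \<kappa> * norm (x - y)"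
    using strict_estimate[OF assms] by blast
  have "norm (F (l', u) - blinfun_apply (linearization F l) u) \<le> \<kappa> * norm u" if x: "(l', u) \<in> ball (l, 0) \<delta>" for l' u
  proof -
    have "dist (l, 0) (l', 0 :: 'u) \<le> dist (l, 0) (l', u)" using dist_fst_le[of "(l, 0)" "(l', u)"] by (simp add: dist_Pair_Pair)
    then have "(l', 0) \<in> ball (l, 0 :: 'u) \<delta>" using x by simp
    from \<delta>(2)[rule_format, OF x this] show ?thesis by (simp add: trivial norm_Pair)
  qed
  then show ?thesis using \<delta>(1) by blast
qed

text \<open>Lyapunov-Schmidt splitting. Transversality and index zero make \<open>L' \<phi>0\<close>
  span a complement of the range; \<open>J\<close> solves modulo this line, and
  \<open>\<omega>\<close> reads off the remaining component.\<close>

lemma splitting: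
  "\<exists>(J :: 'v \<Rightarrow>\<^sub>L 'u) (\<omega> :: 'v \<Rightarrow>\<^sub>L real). (\<forall>u. blinfun_apply J (blinfun_apply L0 u) = u - blinfun_apply \<phi>s u *\<^sub>R \<phi>0) \<and>
    (\<forall>v. blinfun_apply \<phi>s (blinfun_apply J v) = 0) \<and> blinfun_apply J (blinfun_apply L' \<phi>0) = 0 \<and>
    blinfun_apply \<omega> (blinfun_apply L' \<phi>0) = 1 \<and> (\<forall>u. blinfun_apply \<omega> (blinfun_apply L0 u) = 0) \<and>
    (\<forall>v. blinfun_apply J v = 0 \<longrightarrow> v = blinfun_apply \<omega> v *\<^sub>R blinfun_apply L' \<phi>0)"
proof -
  let ?c = "blinfun_apply L' \<phi>0" and ?R = "range (blinfun_apply L0)"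
  have L0F: "L0 \<in> Fredholm0" using Fredholm by (simp add: linearization_def)
  have sub: "subspace ?R" by (rule subspace_range_blinfun)
  obtain \<omega> :: "'v \<Rightarrow>\<^sub>L real" where \<omega>: "blinfun_apply \<omega> ?c = 1" "\<And>r. r \<in> ?R \<Longrightarrow> blinfun_apply \<omega> r = 0"
    using hahn_banach_separation[OF sub _ transversal] L0F by (auto simp: Fredholm0_def fredholm_def)
  have "\<phi>0 \<noteq> 0" using norm_\<phi>0 by auto
  then have "dim (null_space L0) = 1" unfolding ker by (intro dim_unique[of "{\<phi>0}"]) (auto simp: span_base)
  then have cd: "codim ?R = 1" "finite_codim ?R" using L0F by (auto simp: Fredholm0_def fredholm_def fredholm_index_def)
  then obtain C where C: "finite C" "card C = 1" "span (?R \<union> C) = UNIV" using codim_attained by metis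
  then obtain c where c: "C = {c}" by (auto simp: card_1_singleton_iff)
  have sp: "\<exists>x a. v = blinfun_apply L0 x + a *\<^sub>R c" for v
  proof -
    have "v \<in> {a + b |a b. a \<in> span ?R \<and> b \<in> span C}" using C(3) unfolding span_Un by blast
    then obtain a b where "v = a + b" "a \<in> span ?R" "b \<in> span {c}" unfolding c by blast
    then show ?thesis using span_eq_iff[THEN iffD2, OF sub] by (auto simp: span_singleton)
  qed
  obtain x0 a0 where a0: "?c = blinfun_apply L0 x0 + a0 *\<^sub>R c" using sp by blast
  have a0n: "a0 \<noteq> 0" using a0 transversal by auto
  have onto: "\<exists>x. v - blinfun_apply L0 x \<in> span {?c}" for v
  proof -
    obtain x a where v: "v = blinfun_apply L0 x + a *\<^sub>R c" using sp by blast
    have "c = (1 / a0) *\<^sub>R (?c - blinfun_apply L0 x0)" using a0 a0n by simp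
    then have "v - blinfun_apply L0 (x - (a / a0) *\<^sub>R x0) = (a / a0) *\<^sub>R ?c"
      using v by (simp add: blinfun.diff_right blinfun.scaleR_right scaleR_diff_right)
    then show ?thesis using span_scale[OF span_base] by (metis insertI1)
  qed
  have kr: "{x. blinfun_apply L0 x \<in> span {?c}} = span ((\<lambda>_. \<phi>0) ` {..<1::nat})"
  proof -
    have "blinfun_apply L0 x = 0" if Lx: "blinfun_apply L0 x \<in> span {?c}" for x
    proof -
      obtain k where k: "blinfun_apply L0 x = k *\<^sub>R ?c" using Lx by (auto simp: span_singleton)
      have "blinfun_apply \<omega> (blinfun_apply L0 x) = 0" by (rule \<omega>(2)) simp
      then have "k = 0" using \<omega>(1) unfolding k by (simp add: blinfun.scaleR_right)
      then show ?thesis using k by simp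
    qed
    then have "{x. blinfun_apply L0 x \<in> span {?c}} = null_space L0" by (auto simp: null_space_def span_zero)
    then show ?thesis using ker by (simp add: lessThan_Suc)
  qed
  have "\<exists>J :: 'v \<Rightarrow>\<^sub>L 'u. (\<forall>x. blinfun_apply J (blinfun_apply L0 x) = x - (\<Sum>i<1::nat. blinfun_apply \<phi>s x *\<^sub>R \<phi>0)) \<and>
      (\<forall>y\<in>span {?c}. blinfun_apply J y = 0) \<and> (\<forall>v. blinfun_apply J v = 0 \<longrightarrow> v \<in> span {?c}) \<and>
      (\<forall>v. \<forall>i<1::nat. blinfun_apply \<phi>s (blinfun_apply J v) = 0)"
    by (rule complement_inverse[OF _ onto kr]) (auto simp: \<phi>s_\<phi>0)
  then obtain J :: "'v \<Rightarrow>\<^sub>L 'u" where J: "\<forall>x. blinfun_apply J (blinfun_apply L0 x) = x - (\<Sum>i<1::nat. blinfun_apply \<phi>s x *\<^sub>R \<phi>0)"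
      "\<forall>y\<in>span {?c}. blinfun_apply J y = 0" "\<forall>v. blinfun_apply J v = 0 \<longrightarrow> v \<in> span {?c}"
      "\<forall>v. \<forall>i<1::nat. blinfun_apply \<phi>s (blinfun_apply J v) = 0" by (elim exE conjE) (rule that)
  have "v = blinfun_apply \<omega> v *\<^sub>R ?c" if Jv: "blinfun_apply J v = 0" for v
  proof -
    obtain k where k: "v = k *\<^sub>R ?c" using J(3) Jv by (auto simp: span_singleton)
    then show ?thesis using \<omega>(1) by (simp add: blinfun.scaleR_right)
  qed
  moreover have "blinfun_apply J ?c = 0" using J(2) by (simp add: span_base)
  ultimately show ?thesis using J(1,4) \<omega> by (intro exI[of _ J] exI[of _ \<omega>] conjI allI impI) auto
qed

lemma solution_zero: "x \<in> S \<Longrightarrow> F x = 0"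
  using trivial by (auto simp: nontrivial_solutions_def)

lemma zero_solution: "F x = 0 \<Longrightarrow> snd x \<noteq> 0 \<Longrightarrow> x \<in> S"
  by (cases x) (auto simp: nontrivial_solutions_def trivial_branch_def)

text \<open>Near an invertible linearization its lower bound excludes nonzero solutions, and
  invertibility of nearby operators excludes trivial points of the spectrum. Closedness of
  \<open>S\<close> depends on this.\<close>

lemma regular_trivial_nbhd:
  assumes GL: "linearization F l \<in> GL"
  shows "\<exists>\<delta>>0. ball (l, 0) \<delta> \<inter> S = {}"
proof -
  obtain c where c: "c > 0" "\<And>x. c * norm x \<le> norm (blinfun_apply (linearization F l) x)" using GL_bounded_below[OF GL] by blast
  obtain \<delta>1 where \<delta>1: "\<delta>1 > 0" "\<And>l' u. (l', u) \<in> ball (l, 0) \<delta>1 \<Longrightarrow> norm (F (l', u) - blinfun_apply (linearization F l) u) \<le> c / 2 * norm u"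
    using linearization_estimate[of "c / 2" l] c(1) by auto
  obtain \<delta>2 where \<delta>2: "\<delta>2 > 0" "\<And>x. dist x (l, 0) < \<delta>2 \<Longrightarrow> dist (D_u F x) (D_u F (l, 0)) < c / 2"
    using continuous_D_u c(1) unfolding continuous_on_iff by (metis UNIV_I half_gt_zero)
  have "x \<notin> S" if x: "x \<in> ball (l, 0) (min \<delta>1 \<delta>2)" for x
  proof
    assume xS: "x \<in> S"
    obtain l' u where lu: "x = (l', u)" by (cases x) auto
    have "norm (blinfun_apply (linearization F l) u) \<le> c / 2 * norm u"
      using \<delta>1(2)[of l' u] x solution_zero[OF xS] lu by simp
    then have "c * norm u \<le> c / 2 * norm u" using c(2)[of u] by linarith
    then have "u = 0" using c(1) by (simp add: field_simps mult_le_0_iff)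
    then have nGL: "linearization F l' \<notin> GL" using xS lu by (auto simp: nontrivial_solutions_def trivial_branch_def gen_spectrum_def)
    have nn: "norm (D_u F x - D_u F (l, 0)) \<le> c / 2" using \<delta>2(2)[of x] x by (simp add: dist_norm norm_minus_commute less_imp_le)
    have "c / 2 * norm w \<le> norm (blinfun_apply (D_u F x) w)" for w
    proof -
      have "norm (blinfun_apply (D_u F x - D_u F (l, 0)) w) \<le> c / 2 * norm w"
        using norm_blinfun[of "D_u F x - D_u F (l, 0)" w] mult_right_mono[OF nn norm_ge_zero[of w]] by linarith
      then have "norm (blinfun_apply (D_u F (l, 0)) w - blinfun_apply (D_u F x) w) \<le> c / 2 * norm w"
        by (simp add: blinfun.diff_left norm_minus_commute)
      then show ?thesis using c(2)[of w] norm_triangle_ineq2[of "blinfun_apply (D_u F (l, 0)) w" "blinfun_apply (D_u F x) w"]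
        by (simp add: linearization_def)
    qed
    then have "D_u F x \<in> GL" using c(1) by (intro Fredholm0_bounded_below_GL[OF Fredholm, of "c / 2"]) auto
    then show False using nGL lu \<open>u = 0\<close> by (simp add: linearization_def)
  qed
  then show ?thesis using \<delta>1(1) \<delta>2(1) by (intro exI[of _ "min \<delta>1 \<delta>2"]) auto
qed

lemma closed_S: "closed S"
  unfolding closed_def open_contains_ball
proof
  fix x assume x: "x \<in> - S"
  show "\<exists>e>0. ball x e \<subseteq> - S"
  proof (cases "F x = 0")
    case True
    then have "snd x = 0" using x zero_solution by blast
    then obtain l where l: "x = (l, 0)" by (cases x) auto
    then have "linearization F l \<in> GL" using x by (auto simp: nontrivial_solutions_def gen_spectrum_def)
    then show ?thesis using regular_trivial_nbhd l by blast
  next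
    case False
    have "open (F -` (- {0}))" by (rule open_vimage[OF _ continuous_F]) auto
    then obtain e where "e > 0" "ball x e \<subseteq> F -` (- {0})" using open_contains_ball[THEN iffD1, rule_format, of "F -` (- {0})" x] False by auto
    then show ?thesis using solution_zero by blast
  qed
qed

lemma compact_subset_S: "closed A \<Longrightarrow> bounded A \<Longrightarrow> A \<subseteq> S \<Longrightarrow> compact A"
proof -
  assume A: "closed A" "bounded A" "A \<subseteq> S"
  have "{p \<in> A. F p \<in> {0}} = A" using A(3) solution_zero by auto
  moreover have "compact {p \<in> A. F p \<in> {0}}"
    by (rule proper[unfolded proper_on_closed_bounded_def, rule_format]) (use A in auto)
  ultimately show "compact A" by simp
qed

lemma p0_S: "p0 \<in> S"
  using isolated by (auto simp: nontrivial_solutions_def isolated_in_def)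

text \<open>Applying \<open>J\<close> to the equation bounds
  \<open>u - \<phi>s u *\<^sub>R \<phi>0\<close> by a small multiple of \<open>norm u\<close>.
  Trivial points of \<open>S\<close> other than \<open>p0\<close> stay away because
  \<open>l0\<close> is isolated.\<close>

lemma cone_near_p0:
  assumes \<theta>: "\<theta> < 1"
  shows "\<exists>\<delta>>0. \<forall>x \<in> (S - {p0}) \<inter> ball p0 \<delta>. snd x \<noteq> 0 \<and> \<theta> * norm (snd x) < \<bar>blinfun_apply \<phi>s (snd x)\<bar>"
proof -
  obtain J :: "'v \<Rightarrow>\<^sub>L 'u" where J: "\<And>u. blinfun_apply J (blinfun_apply L0 u) = u - blinfun_apply \<phi>s u *\<^sub>R \<phi>0"
    using splitting by (elim exE conjE) (rule that, blast)
  define \<kappa> where "\<kappa> = (1 - \<theta>) / (2 * (norm J + 1))"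
  have p: "0 < norm J + 1" by (simp add: add_nonneg_pos)
  have \<kappa>: "0 < \<kappa>" "norm J * \<kappa> < 1 - \<theta>" 
  proof -
    show \<kappa>0: "0 < \<kappa>" using \<theta> p by (simp add: \<kappa>_def)
    have "norm J * \<kappa> < (norm J + 1) * \<kappa>" using \<kappa>0 by simp
    also have "\<dots> = (1 - \<theta>) / 2" unfolding \<kappa>_def using p by (simp add: field_simps)
    also have "\<dots> < 1 - \<theta>" using \<theta> by simp
    finally show "norm J * \<kappa> < 1 - \<theta>" .
  qed
  obtain \<delta>1 where \<delta>1: "\<delta>1 > 0" "\<And>l u. (l, u) \<in> ball p0 \<delta>1 \<Longrightarrow> norm (F (l, u) - blinfun_apply L0 u) \<le> \<kappa> * norm u"
    using linearization_estimate[OF \<kappa>(1), of l0] by blast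
  obtain \<delta>2 where \<delta>2: "\<delta>2 > 0" "\<And>l. l \<in> gen_spectrum (linearization F) \<Longrightarrow> dist l0 l < \<delta>2 \<Longrightarrow> l = l0"
    using isolated by (auto simp: isolated_in_dist_Ex_iff dist_commute)
  have "snd x \<noteq> 0 \<and> \<theta> * norm (snd x) < \<bar>blinfun_apply \<phi>s (snd x)\<bar>" if x: "x \<in> S" "x \<noteq> p0" "x \<in> ball p0 (min \<delta>1 \<delta>2)" for x
  proof -
    obtain l u where lu: "x = (l, u)" by (cases x) auto
    have u0: "u \<noteq> 0"
    proof
      assume u: "u = 0"
      then have "l \<in> gen_spectrum (linearization F)" using x(1) lu by (auto simp: nontrivial_solutions_def trivial_branch_def)
      moreover have "dist l0 l < \<delta>2" using x(3) lu u dist_fst_le[of p0 x] by simp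
      ultimately show False using \<delta>2(2) x(2) lu u by blast
    qed
    have "norm (blinfun_apply L0 u) \<le> \<kappa> * norm u" using \<delta>1(2)[of l u] x(3) solution_zero[OF x(1)] lu by simp
    then have "norm J * norm (blinfun_apply L0 u) \<le> norm J * (\<kappa> * norm u)" by (rule mult_left_mono) simp
    then have "norm (u - blinfun_apply \<phi>s u *\<^sub>R \<phi>0) \<le> norm J * \<kappa> * norm u" using norm_blinfun[of J "blinfun_apply L0 u"] J by (simp add: mult.assoc)
    also have "\<dots> < (1 - \<theta>) * norm u" using u0 \<kappa>(2) by (intro mult_strict_right_mono) auto
    finally have "norm (u - blinfun_apply \<phi>s u *\<^sub>R \<phi>0) < norm u - \<theta> * norm u" by (simp add: left_diff_distrib)
    moreover have "norm u \<le> norm (u - blinfun_apply \<phi>s u *\<^sub>R \<phi>0) + \<bar>blinfun_apply \<phi>s u\<bar>"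
      using norm_triangle_sub[of u "blinfun_apply \<phi>s u *\<^sub>R \<phi>0"] norm_\<phi>0 by simp
    ultimately show ?thesis using u0 lu by simp
  qed
  then show ?thesis using \<delta>1(1) \<delta>2(1) by (intro exI[of _ "min \<delta>1 \<delta>2"]) auto
qed

end


section \<open>Local estimates at the eigenvalue and the parity argument\<close>

lemma norm_le_fst_snd: "norm x \<le> norm (fst x) + norm (snd x)"
  for x :: "'a::real_normed_vector \<times> 'b::real_normed_vector"
  using norm_Pair_le[of "fst x" "snd x"] by simp

context simple_eigenvalue
begin

lemma linearization_derivative_estimate:
  assumes "0 < \<kappa>"
  shows "\<exists>d>0. \<forall>l. \<bar>l - l0\<bar> < d \<longrightarrow> norm (linearization F l - L0 - (l - l0) *\<^sub>R L') \<le> \<kappa> * \<bar>l - l0\<bar>"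
  using deriv_L assms unfolding has_vector_derivative_def has_derivative_at_alt by (simp add: real_norm_def)

definition Sp :: "(real \<times> 'u) set" where
  "Sp = {x\<in>S. 0 \<le> blinfun_apply \<phi>s (snd x)}"

definition box :: "real \<Rightarrow> real \<Rightarrow> (real \<times> 'u) set" where
  "box \<alpha> \<rho> = {x. \<bar>fst x - l0\<bar> \<le> \<alpha> \<and> norm (snd x) \<le> \<rho>}"

lemma box_dist:
  assumes "x \<in> box \<alpha> \<rho>"
  shows "dist p0 x \<le> \<alpha> + \<rho>"
proof -
  have "dist x p0 \<le> \<bar>fst x - l0\<bar> + norm (snd x)"
    using norm_le_fst_snd[of "x - p0"] by (simp add: dist_norm)
  then show ?thesis using assms by (simp add: box_def dist_commute)
qed

text \<open>The sign on the sides of the box holds because \<open>\<omega> (F (l, u))\<close> is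
  close to \<open>(l - l0) * \<phi>s u\<close> once \<open>J (F (l, u)) = 0\<close>: the range of
  \<open>L0\<close> is invisible to \<open>\<omega>\<close>, and
  \<open>\<omega> (L' \<phi>0) = 1\<close>.\<close>

lemma local_constants:
  assumes J: "\<And>u. blinfun_apply J (blinfun_apply L0 u) = u - blinfun_apply \<phi>s u *\<^sub>R \<phi>0"
    and \<omega>: "blinfun_apply \<omega> (blinfun_apply L' \<phi>0) = 1" "\<And>u. blinfun_apply \<omega> (blinfun_apply L0 u) = 0"
    and \<delta>: "0 < \<delta>"
  shows "\<exists>\<alpha> \<rho> \<kappa>. 0 < \<alpha> \<and> 0 < \<rho> \<and> 0 < \<kappa> \<and> \<alpha> + \<rho> < \<delta> \<and>
    (\<forall>x\<in>box \<alpha> \<rho>. \<forall>y\<in>box \<alpha> \<rho>.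
      norm (F x - F y - blinfun_apply L0 (snd x - snd y)) \<le> \<kappa> * norm (x - y)) \<and>
    (\<forall>x\<in>box \<alpha> \<rho>. \<forall>y\<in>box \<alpha> \<rho>.
      norm (blinfun_apply J (F x - F y) - ((snd x - snd y) - blinfun_apply \<phi>s (snd x - snd y) *\<^sub>R \<phi>0)) \<le> 1 / 8 * norm (x - y)) \<and>
    (\<forall>l u. \<bar>l - l0\<bar> = \<alpha> \<and> norm u \<le> \<rho> \<and> blinfun_apply J (F (l, u)) = 0 \<and> 0 < blinfun_apply \<phi>s u \<longrightarrow>
      0 < blinfun_apply \<omega> (F (l, u)) * (l - l0))"
proof -
  define nJ n\<omega> nL where "nJ = norm J + 1" and "n\<omega> = norm \<omega> + 1" and "nL = norm L' + 1"
  have n1: "1 \<le> nJ" "1 \<le> n\<omega>" "1 \<le> nL" by (auto simp: nJ_def n\<omega>_def nL_def)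
  have Jb: "norm (blinfun_apply J v) \<le> nJ * norm v" for v
    using norm_blinfun[of J v] by (simp add: nJ_def distrib_right add_increasing2)
  have \<omega>b: "\<bar>blinfun_apply \<omega> v\<bar> \<le> n\<omega> * norm v" for v
    using norm_blinfun[of \<omega> v] by (simp add: n\<omega>_def distrib_right add_increasing2)
  have Lb: "norm (blinfun_apply L' v) \<le> nL * norm v" for v
    using norm_blinfun[of L' v] by (simp add: nL_def distrib_right add_increasing2)
  \<comment> \<open>Chosen so that the error passed through \<open>J\<close>, \<open>L'\<close> and
    \<open>\<omega>\<close> has factor 1/8; as the three bounds are at least 1, the factor through
    \<open>J\<close> alone is no larger.\<close>
  define \<kappa> where "\<kappa> = 1 / (8 * nJ * n\<omega> * nL)"
  have pos: "0 < nJ" "0 < n\<omega>" "0 < nL" using n1 by auto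
  have \<kappa>: "0 < \<kappa>" using pos by (simp add: \<kappa>_def)
  have \<kappa>e: "n\<omega> * (nL * (nJ * \<kappa>)) = 1 / 8" using pos by (simp add: \<kappa>_def)
  have "1 \<le> n\<omega> * nL" using mult_mono[of 1 n\<omega> 1 nL] n1 by simp
  then have "nJ * \<kappa> \<le> (n\<omega> * nL) * (nJ * \<kappa>)" using mult_right_mono[of 1 "n\<omega> * nL" "nJ * \<kappa>"] pos \<kappa> by simp
  then have \<kappa>8: "nJ * \<kappa> \<le> 1 / 8" using \<kappa>e by (simp add: mult.assoc)
  obtain \<delta>1 where \<delta>1: "\<delta>1 > 0" "\<forall>x\<in>ball p0 \<delta>1. \<forall>y\<in>ball p0 \<delta>1. norm (F x - F y - blinfun_apply L0 (snd x - snd y)) \<le> \<kappa> * norm (x - y)"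
    using strict_estimate[OF \<kappa>] by blast
  define \<kappa>1 where "\<kappa>1 = 1 / (16 * n\<omega>)"
  have \<kappa>1: "0 < \<kappa>1" "n\<omega> * \<kappa>1 = 1 / 16" using pos by (auto simp: \<kappa>1_def)
  obtain d where d: "d > 0" "\<And>l. \<bar>l - l0\<bar> < d \<Longrightarrow> norm (linearization F l - L0 - (l - l0) *\<^sub>R L') \<le> \<kappa>1 * \<bar>l - l0\<bar>"
    using linearization_derivative_estimate[OF \<kappa>1(1)] by blast
  define \<alpha> where "\<alpha> = Min {\<delta> / 4, \<delta>1 / 4, d / 2}"
  have \<alpha>: "0 < \<alpha>" "\<alpha> \<le> \<delta> / 4" "\<alpha> \<le> \<delta>1 / 4" "\<alpha> < d" using \<delta> \<delta>1(1) d(1) by (auto simp: \<alpha>_def min_def)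
  \<comment> \<open>\<open>\<alpha>\<close> is fixed before \<open>\<rho>\<close>: the estimates at
    \<open>l0 + \<alpha>\<close> and \<open>l0 - \<alpha>\<close> must be accurate relative to
    \<open>\<alpha>\<close>, the size of the leading term.\<close>
  define \<kappa>2 where "\<kappa>2 = \<alpha> / (16 * n\<omega>)"
  have \<kappa>2: "0 < \<kappa>2" "n\<omega> * \<kappa>2 = \<alpha> / 16" using pos \<alpha> by (auto simp: \<kappa>2_def)
  obtain r1 where r1: "r1 > 0" "\<And>l' u. (l', u) \<in> ball (l0 + \<alpha>, 0) r1 \<Longrightarrow> norm (F (l', u) - blinfun_apply (linearization F (l0 + \<alpha>)) u) \<le> \<kappa>2 * norm u"
    using linearization_estimate[OF \<kappa>2(1)] by blast
  obtain r2 where r2: "r2 > 0" "\<And>l' u. (l', u) \<in> ball (l0 - \<alpha>, 0) r2 \<Longrightarrow> norm (F (l', u) - blinfun_apply (linearization F (l0 - \<alpha>)) u) \<le> \<kappa>2 * norm u"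
    using linearization_estimate[OF \<kappa>2(1)] by blast
  define \<rho> where "\<rho> = Min {\<delta> / 4, \<delta>1 / 4, r1 / 2, r2 / 2}"
  have \<rho>: "0 < \<rho>" "\<rho> \<le> \<delta> / 4" "\<rho> \<le> \<delta>1 / 4" "\<rho> < r1" "\<rho> < r2" using \<delta> \<delta>1(1) r1(1) r2(1) by (auto simp: \<rho>_def min_def)
  have inb: "x \<in> ball p0 \<delta>1" if "x \<in> box \<alpha> \<rho>" for x
  proof -
    show ?thesis using box_dist[OF that] \<alpha>(3) \<rho>(3) \<delta>1(1) by simp
  qed
  have est: "norm (F x - F y - blinfun_apply L0 (snd x - snd y)) \<le> \<kappa> * norm (x - y)"
    if "x \<in> box \<alpha> \<rho>" "y \<in> box \<alpha> \<rho>" for x y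
    using \<delta>1(2) inb that by blast
  have estJ: "norm (blinfun_apply J (F x - F y) - ((snd x - snd y) - blinfun_apply \<phi>s (snd x - snd y) *\<^sub>R \<phi>0)) \<le> nJ * \<kappa> * norm (x - y)"
    if xy: "x \<in> box \<alpha> \<rho>" "y \<in> box \<alpha> \<rho>" for x y
  proof -
    have "norm (blinfun_apply J (F x - F y - blinfun_apply L0 (snd x - snd y))) \<le> nJ * (\<kappa> * norm (x - y))"
      using Jb[of "F x - F y - blinfun_apply L0 (snd x - snd y)"] mult_left_mono[OF est[OF xy], of nJ] pos(1) by linarith
    then show ?thesis by (simp only: blinfun.diff_right[of J "F x - F y"] J mult.assoc)
  qed
  have estJ8: "norm (blinfun_apply J (F x - F y) - ((snd x - snd y) - blinfun_apply \<phi>s (snd x - snd y) *\<^sub>R \<phi>0)) \<le> 1 / 8 * norm (x - y)"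
    if xy: "x \<in> box \<alpha> \<rho>" "y \<in> box \<alpha> \<rho>" for x y
    using estJ[OF xy] mult_right_mono[OF \<kappa>8 norm_ge_zero[of "x - y"]] by linarith
  have sign: "0 < blinfun_apply \<omega> (F (l, u)) * (l - l0)"
    if lu: "\<bar>l - l0\<bar> = \<alpha>" "norm u \<le> \<rho>" "blinfun_apply J (F (l, u)) = 0" "0 < blinfun_apply \<phi>s u" for l u
  proof -
    define s where "s = blinfun_apply \<phi>s u"
    define w where "w = u - s *\<^sub>R \<phi>0"
    have "norm (blinfun_apply J (F (l, u) - F (l, 0)) - ((u - 0) - blinfun_apply \<phi>s (u - 0) *\<^sub>R \<phi>0)) \<le> nJ * \<kappa> * norm ((l, u) - (l, 0))"
      using estJ[of "(l, u)" "(l, 0)"] lu \<rho>(1) by (simp add: box_def)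
    then have w: "norm w \<le> nJ * \<kappa> * norm u" by (simp add: lu(3) trivial w_def s_def norm_Pair norm_minus_commute)
    also have "\<dots> \<le> 1 / 8 * norm u" using \<kappa>8 by (rule mult_right_mono) simp
    finally have w8: "norm w \<le> 1 / 8 * norm u" .
    have "norm u \<le> norm w + s" using norm_triangle_sub[of u "s *\<^sub>R \<phi>0"] norm_\<phi>0 lu(4) by (simp add: w_def s_def)
    then have us: "norm u \<le> 2 * s" using w8 norm_ge_zero[of u] by linarith
    have "norm (blinfun_apply L' w) \<le> nL * (nJ * \<kappa> * norm u)" using Lb[of w] mult_left_mono[OF w, of nL] pos by linarith
    then have "\<bar>blinfun_apply \<omega> (blinfun_apply L' w)\<bar> \<le> n\<omega> * (nL * (nJ * \<kappa> * norm u))"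
      using \<omega>b[of "blinfun_apply L' w"] mult_left_mono[of "norm (blinfun_apply L' w)" "nL * (nJ * \<kappa> * norm u)" n\<omega>] pos(2) by linarith
    also have "\<dots> = n\<omega> * (nL * (nJ * \<kappa>)) * norm u" by (simp add: mult.assoc)
    finally have e1: "\<bar>blinfun_apply \<omega> (blinfun_apply L' w)\<bar> \<le> norm u / 8" by (simp add: \<kappa>e)
    have lin: "norm (F (l, u) - blinfun_apply (linearization F l) u) \<le> \<kappa>2 * norm u"
    proof -
      have "(l, u) \<in> ball (l, 0) r1" "(l, u) \<in> ball (l, 0) r2" using lu(2) \<rho>(4,5) by (auto simp: dist_norm norm_Pair)
      moreover have "l = l0 + \<alpha> \<or> l = l0 - \<alpha>" using lu(1) by linarith
      ultimately show ?thesis using r1(2) r2(2) by blast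
    qed
    have "\<bar>blinfun_apply \<omega> (F (l, u) - blinfun_apply (linearization F l) u)\<bar> \<le> n\<omega> * (\<kappa>2 * norm u)"
      using \<omega>b[of "F (l, u) - blinfun_apply (linearization F l) u"] mult_left_mono[OF lin, of n\<omega>] pos(2) by linarith
    then have e2: "\<bar>blinfun_apply \<omega> (F (l, u) - blinfun_apply (linearization F l) u)\<bar> \<le> \<alpha> / 16 * norm u"
      using \<kappa>2(2) by (metis mult.assoc)
    have "norm (linearization F l - L0 - (l - l0) *\<^sub>R L') \<le> \<kappa>1 * \<alpha>" using d(2)[of l] lu(1) \<alpha>(4) by simp
    then have "norm (blinfun_apply (linearization F l - L0 - (l - l0) *\<^sub>R L') u) \<le> \<kappa>1 * \<alpha> * norm u"
      using norm_blinfun[of "linearization F l - L0 - (l - l0) *\<^sub>R L'" u] mult_right_mono[OF _ norm_ge_zero[of u]] order_trans by blast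
    then have "\<bar>blinfun_apply \<omega> (blinfun_apply (linearization F l - L0 - (l - l0) *\<^sub>R L') u)\<bar> \<le> n\<omega> * (\<kappa>1 * \<alpha> * norm u)"
      using \<omega>b[of "blinfun_apply (linearization F l - L0 - (l - l0) *\<^sub>R L') u"] mult_left_mono[of "norm (blinfun_apply (linearization F l - L0 - (l - l0) *\<^sub>R L') u)" "\<kappa>1 * \<alpha> * norm u" n\<omega>] pos(2) by linarith
    also have "\<dots> = \<alpha> / 16 * norm u" using \<kappa>1(2) by (simp add: mult.assoc[symmetric])
    finally have e3: "\<bar>blinfun_apply \<omega> (blinfun_apply (linearization F l - L0 - (l - l0) *\<^sub>R L') u)\<bar> \<le> \<alpha> / 16 * norm u" .
    have "u = s *\<^sub>R \<phi>0 + w" by (simp add: w_def)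
    then have "blinfun_apply \<omega> (blinfun_apply L' u) = s + blinfun_apply \<omega> (blinfun_apply L' w)"
      using \<omega>(1) by (metis blinfun.add_right blinfun.scaleR_right mult.right_neutral real_scaleR_def)
    \<comment> \<open>The leading term is \<open>(l - l0) * s\<close>; the three corrections amount
      to at most \<open>\<alpha> * s / 8\<close>, \<open>\<alpha> * s / 8\<close> and
      \<open>\<alpha> * s / 4\<close>.\<close>
    then have decomp: "blinfun_apply \<omega> (F (l, u)) = blinfun_apply \<omega> (F (l, u) - blinfun_apply (linearization F l) u)
        + blinfun_apply \<omega> (blinfun_apply (linearization F l - L0 - (l - l0) *\<^sub>R L') u) + (l - l0) * (s + blinfun_apply \<omega> (blinfun_apply L' w))"
      using \<omega>(2)[of u] by (simp add: blinfun.diff_right blinfun.diff_left blinfun.scaleR_left blinfun.scaleR_right)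
    define A B C where "A = blinfun_apply \<omega> (F (l, u) - blinfun_apply (linearization F l) u)"
      and "B = blinfun_apply \<omega> (blinfun_apply (linearization F l - L0 - (l - l0) *\<^sub>R L') u)" and "C = blinfun_apply \<omega> (blinfun_apply L' w)"
    have su: "norm u \<le> 2 * s" "0 < s" using us lu(4) by (auto simp: s_def)
    have "\<alpha> / 16 * norm u \<le> \<alpha> / 16 * (2 * s)" using su(1) \<alpha>(1) by (intro mult_left_mono) auto
    then have AB: "\<bar>A\<bar> \<le> \<alpha> * s / 8" "\<bar>B\<bar> \<le> \<alpha> * s / 8" using e2 e3 by (auto simp: A_def B_def)
    have C: "\<bar>C\<bar> \<le> s / 4" using e1 su(1) by (simp add: C_def)
    have "\<alpha> * (s - s / 4) \<le> \<alpha> * (s + C)" using C \<alpha>(1) by (intro mult_left_mono) auto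
    then have big: "3 * (\<alpha> * s) / 4 \<le> \<alpha> * (s + C)" by (simp add: algebra_simps)
    have as: "0 < \<alpha> * s" using su(2) \<alpha>(1) by simp
    show ?thesis
    proof (cases "l - l0 = \<alpha>")
      case True
      have "0 < A + B + \<alpha> * (s + C)" using AB big as by linarith
      then show ?thesis using decomp True \<alpha>(1) unfolding A_def B_def C_def by simp
    next
      case False
      then have l: "l - l0 = - \<alpha>" using lu(1) by linarith
      have "A + B + - \<alpha> * (s + C) < 0" using AB big as by simp
      then have "blinfun_apply \<omega> (F (l, u)) < 0" using decomp unfolding l A_def B_def C_def by simp
      then show ?thesis using l \<alpha>(1) by (simp add: mult_neg_pos)
    qed
  qed
  have "\<alpha> + \<rho> < \<delta>" using \<alpha>(2) \<rho>(2) \<delta> by linarith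
  then show ?thesis
    by (intro exI[of _ \<alpha>] exI[of _ \<rho>] exI[of _ \<kappa>] conjI ballI allI impI)
      (rule \<alpha>(1) \<rho>(1) \<kappa> | assumption | rule est estJ8 sign; (elim conjE)?; assumption)+
qed

text \<open>The difficulty is to keep the zeros of the whole deformation in a compact set. The two
  stages have different reasons for it: the sign on the sides of the box while the model is deformed
  into \<open>F\<close>, and the isolation of \<open>B\<close> while the level is raised.\<close>

lemma no_isolated_compact_part:
  assumes B: "compact B" "p0 \<in> B" "B \<subseteq> Sp" and cl: "closed (Sp - B)"
    and B0: "\<And>x. x \<in> B \<Longrightarrow> blinfun_apply \<phi>s (snd x) = 0 \<Longrightarrow> x = p0"
  shows False
proof -
  let ?c = "blinfun_apply L' \<phi>0"
  obtain J :: "'v \<Rightarrow>\<^sub>L 'u" and \<omega> :: "'v \<Rightarrow>\<^sub>L real" where J': "\<forall>u. blinfun_apply J (blinfun_apply L0 u) = u - blinfun_apply \<phi>s u *\<^sub>R \<phi>0"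
    and J\<phi>: "\<forall>v. blinfun_apply \<phi>s (blinfun_apply J v) = 0" and Jc: "blinfun_apply J ?c = 0"
    and \<omega>c: "blinfun_apply \<omega> ?c = 1" and \<omega>L': "\<forall>u. blinfun_apply \<omega> (blinfun_apply L0 u) = 0"
    and Jk: "\<forall>v. blinfun_apply J v = 0 \<longrightarrow> v = blinfun_apply \<omega> v *\<^sub>R ?c"
    using splitting by (elim exE conjE) (rule that)
  have J: "\<And>u. blinfun_apply J (blinfun_apply L0 u) = u - blinfun_apply \<phi>s u *\<^sub>R \<phi>0" and \<omega>L: "\<And>u. blinfun_apply \<omega> (blinfun_apply L0 u) = 0"
    using J' \<omega>L' by blast+
  obtain d where d: "d > 0" "\<And>x y. x \<in> B \<Longrightarrow> y \<in> Sp - B \<Longrightarrow> d \<le> dist x y"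
    using compact_closed_gap[OF B(1) cl] by blast
  \<comment> \<open>Half the gap between \<open>B\<close> and the rest of \<open>Sp\<close>: points
    of \<open>Sp\<close> in \<open>W\<close> belong to \<open>B\<close>.\<close>
  define W where "W = (\<Union>b\<in>B. ball b (d / 2))"
  have oW: "open W" unfolding W_def by auto
  have BW: "B \<subseteq> W" using d(1) by (auto simp: W_def)
  have WB: "x \<in> B" if x: "x \<in> W" "x \<in> Sp" for x
  proof (rule ccontr)
    assume "x \<notin> B"
    obtain b where b: "b \<in> B" "dist b x < d / 2" using x(1) by (auto simp: W_def)
    have "d \<le> dist b x" using d(2)[OF b(1)] x(2) \<open>x \<notin> B\<close> by blast
    then show False using b(2) d(1) by linarith
  qed
  obtain R0 where R0: "\<And>b. b \<in> B \<Longrightarrow> norm b \<le> R0" using compact_imp_bounded[OF B(1)] unfolding bounded_iff by blast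
  have WR: "norm (snd x) \<le> R0 + d" if x: "x \<in> W" for x
  proof -
    obtain b where b: "b \<in> B" "dist b x < d / 2" using x by (auto simp: W_def)
    have "norm x \<le> norm b + dist b x" using norm_triangle_sub[of x b] by (simp add: dist_norm norm_minus_commute)
    then have "norm x \<le> R0 + d" using R0[OF b(1)] b(2) d(1) by linarith
    then show ?thesis using norm_snd_le[of "snd x" "fst x"] by simp
  qed
  obtain \<delta> where \<delta>: "\<delta> > 0" "ball p0 \<delta> \<subseteq> W" using open_contains_ball[THEN iffD1, OF oW] BW B(2) by blast
  obtain \<alpha> \<rho> \<kappa> where \<alpha>: "0 < \<alpha>" and \<rho>: "0 < \<rho>" and \<kappa>: "0 < \<kappa>" and \<alpha>\<rho>: "\<alpha> + \<rho> < \<delta>"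
    and est: "\<forall>x\<in>box \<alpha> \<rho>. \<forall>y\<in>box \<alpha> \<rho>. norm (F x - F y - blinfun_apply L0 (snd x - snd y)) \<le> \<kappa> * norm (x - y)"
    and estJ: "\<forall>x\<in>box \<alpha> \<rho>. \<forall>y\<in>box \<alpha> \<rho>. norm (blinfun_apply J (F x - F y) - ((snd x - snd y) - blinfun_apply \<phi>s (snd x - snd y) *\<^sub>R \<phi>0)) \<le> 1 / 8 * norm (x - y)"
    and sign: "\<forall>l u. \<bar>l - l0\<bar> = \<alpha> \<and> norm u \<le> \<rho> \<and> blinfun_apply J (F (l, u)) = 0 \<and> 0 < blinfun_apply \<phi>s u \<longrightarrow> 0 < blinfun_apply \<omega> (F (l, u)) * (l - l0)"
    using local_constants[OF J \<omega>c \<omega>L \<delta>(1)] by (elim exE conjE) (rule that)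
  have boxW: "box \<alpha> \<rho> \<subseteq> W" using box_dist \<alpha>\<rho> \<delta>(2) by fastforce
  have cfs: "continuous_on A (\<lambda>x. blinfun_apply \<phi>s (snd x))" for A :: "(real \<times> 'u) set"
    by (intro continuous_intros)
  have cF: "continuous_on A F" for A using continuous_F continuous_on_subset by blast
  \<comment> \<open>On the compact set \<open>B\<close> the functional \<open>\<phi>s\<close>
    vanishes only at \<open>p0\<close>, so small values of it force a point into the box.\<close>
  obtain m where m: "0 < m" "\<And>x. x \<in> B \<Longrightarrow> blinfun_apply \<phi>s (snd x) < m \<Longrightarrow> \<bar>fst x - l0\<bar> < \<alpha> \<and> norm (snd x) < \<rho>"
  proof -
    define B1 where "B1 = B \<inter> {x. \<alpha> \<le> \<bar>fst x - l0\<bar> \<or> \<rho> \<le> norm (snd x)}"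
    have "closed {x :: real \<times> 'u. \<alpha> \<le> \<bar>fst x - l0\<bar> \<or> \<rho> \<le> norm (snd x)}"
      by (intro closed_Collect_disj closed_Collect_le continuous_intros)
    then have cB1: "compact B1" unfolding B1_def by (rule compact_Int_closed[OF B(1)])
    show ?thesis
    proof (cases "B1 = {}")
      case True
      then have "\<bar>fst x - l0\<bar> < \<alpha> \<and> norm (snd x) < \<rho>" if "x \<in> B" for x using that by (auto simp: B1_def)
      then show ?thesis using that[of 1] by simp
    next
      case False
      obtain b where b: "b \<in> B1" "\<forall>y\<in>B1. blinfun_apply \<phi>s (snd b) \<le> blinfun_apply \<phi>s (snd y)"
        using continuous_attains_inf[OF cB1 False cfs] by blast
      have "b \<noteq> p0" using b(1) \<alpha> \<rho> by (auto simp: B1_def)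
      moreover have "b \<in> B" using b(1) by (simp add: B1_def)
      ultimately have "blinfun_apply \<phi>s (snd b) \<noteq> 0" "0 \<le> blinfun_apply \<phi>s (snd b)" using B0[of b] B(3) unfolding Sp_def by blast+
      then have "0 < blinfun_apply \<phi>s (snd b)" by simp
      moreover have "\<bar>fst x - l0\<bar> < \<alpha> \<and> norm (snd x) < \<rho>" if x: "x \<in> B" "blinfun_apply \<phi>s (snd x) < blinfun_apply \<phi>s (snd b)" for x
        using b(2) x by (force simp: B1_def)
      ultimately show ?thesis by (rule that)
    qed
  qed
  \<comment> \<open>The factor 3 leaves room: points of the box at level \<open>s0\<close> with
    \<open>J (F x) = 0\<close> have norm at most \<open>2 * s0 < \<rho>\<close>, and points of
    \<open>B\<close> outside the open box lie above level \<open>2 * s0\<close>.\<close>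
  define s0 where "s0 = min (\<rho> / 3) (m / 3)"
  have s0: "0 < s0" "3 * s0 \<le> \<rho>" "3 * s0 \<le> m" using \<rho> m(1) by (auto simp: s0_def)
  define s1 where "s1 = max s0 (norm \<phi>s * (R0 + d) + 1)"
  have s1: "s0 \<le> s1" by (simp add: s1_def)
  have Ws1: "blinfun_apply \<phi>s (snd x) < s1" if "x \<in> W" for x
  proof -
    have "\<bar>blinfun_apply \<phi>s (snd x)\<bar> \<le> norm \<phi>s * norm (snd x)" using norm_blinfun[of \<phi>s "snd x"] by simp
    also have "\<dots> \<le> norm \<phi>s * (R0 + d)" using WR[OF that] by (rule mult_left_mono) simp
    finally show ?thesis by (simp add: s1_def)
  qed
  \<comment> \<open>For \<open>t \<le> 1\<close> the homotopy replaces \<open>\<langle>\<omega>, F\<rangle>\<close> by the model \<open>(l - l0) s0\<close>; for \<open>t \<ge> 1\<close> it raises the level of \<open>\<phi>s\<close> from \<open>s0\<close> to \<open>s1\<close>.\<close>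
  define \<kappa>0 where "\<kappa>0 x = - blinfun_apply \<omega> (F x) + (fst x - l0) * s0" for x
  define h where "h t x = (blinfun_apply \<phi>s (snd x) - s0 - max 0 (t - 1) * (s1 - s0), F x + (max 0 (1 - t) * \<kappa>0 x) *\<^sub>R ?c)" for t x
  \<comment> \<open>Up to level \<open>2 * s0\<close> only the part of \<open>W\<close> inside the
    open box is kept, so that zeros at level \<open>s0\<close> are subject to the local
    estimates.\<close>
  define \<Omega> where "\<Omega> = {x\<in>W. s0 / 2 < blinfun_apply \<phi>s (snd x) \<and> (2 * s0 < blinfun_apply \<phi>s (snd x) \<or> (\<bar>fst x - l0\<bar> < \<alpha> \<and> norm (snd x) < \<rho>))}"
  define R where "R = norm \<omega> * ((norm L0 + \<kappa>) * \<rho>)"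
  \<comment> \<open>Contains the zeros of the first stage: there \<open>F\<close> is a bounded
    multiple of \<open>L' \<phi>0\<close>, and \<open>\<omega> (F x)\<close> and
    \<open>l - l0\<close> never have the same strict sign. Properness makes the set compact.\<close>
  define KA where "KA = {x \<in> box \<alpha> \<rho>. F x \<in> (\<lambda>a. a *\<^sub>R ?c) ` {-R..R}} \<inter> {x. blinfun_apply \<phi>s (snd x) = s0} \<inter> {x. blinfun_apply \<omega> (F x) * (fst x - l0) \<le> 0}"
  define KB where "KB = B \<inter> {x. s0 \<le> blinfun_apply \<phi>s (snd x)}"
  define K where "K = KA \<union> KB"
  have o\<Omega>: "open \<Omega>"
  proof -
    have "open {x :: real \<times> 'u. s0 / 2 < blinfun_apply \<phi>s (snd x) \<and> (2 * s0 < blinfun_apply \<phi>s (snd x) \<or> (\<bar>fst x - l0\<bar> < \<alpha> \<and> norm (snd x) < \<rho>))}"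
      by (intro open_Collect_conj open_Collect_disj open_Collect_less continuous_intros)
    moreover have "\<Omega> = W \<inter> {x. s0 / 2 < blinfun_apply \<phi>s (snd x) \<and> (2 * s0 < blinfun_apply \<phi>s (snd x) \<or> (\<bar>fst x - l0\<bar> < \<alpha> \<and> norm (snd x) < \<rho>))}"
      by (auto simp: \<Omega>_def)
    ultimately show ?thesis using oW by (simp add: open_Int)
  qed
  have cK: "compact K"
  proof -
    have "closed (box \<alpha> \<rho>)" unfolding box_def by (intro closed_Collect_conj closed_Collect_le continuous_intros)
    moreover have "bounded (box \<alpha> \<rho>)" using box_dist unfolding bounded_def by blast
    moreover have "compact ((\<lambda>a. a *\<^sub>R ?c) ` {-R..R})" by (intro compact_continuous_image continuous_intros compact_Icc)
    ultimately have "compact {x \<in> box \<alpha> \<rho>. F x \<in> (\<lambda>a. a *\<^sub>R ?c) ` {-R..R}}"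
      using proper unfolding proper_on_closed_bounded_def by blast
    moreover have "closed {x :: real \<times> 'u. blinfun_apply \<phi>s (snd x) = s0}" by (intro closed_Collect_eq continuous_intros)
    moreover have "closed {x :: real \<times> 'u. blinfun_apply \<omega> (F x) * (fst x - l0) \<le> 0}" by (intro closed_Collect_le continuous_intros cF)
    ultimately have "compact KA" unfolding KA_def by (intro compact_Int_closed)
    moreover have "closed {x :: real \<times> 'u. s0 \<le> blinfun_apply \<phi>s (snd x)}" by (intro closed_Collect_le continuous_intros)
    then have "compact KB" unfolding KB_def by (rule compact_Int_closed[OF B(1)])
    ultimately show ?thesis unfolding K_def by (rule compact_Un)
  qed
  have small: "norm u \<le> 2 * s0" if u: "(l, u) \<in> box \<alpha> \<rho>" "blinfun_apply \<phi>s u = s0" "blinfun_apply J (F (l, u)) = 0" for l u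
  proof -
    have "(l, 0) \<in> box \<alpha> \<rho>" using u(1) \<rho> by (simp add: box_def)
    from estJ[rule_format, OF u(1) this] have "norm (u - s0 *\<^sub>R \<phi>0) \<le> 1 / 8 * norm u" by (simp add: trivial u norm_Pair norm_minus_commute)
    moreover have "norm u \<le> norm (u - s0 *\<^sub>R \<phi>0) + s0" using norm_triangle_sub[of u "s0 *\<^sub>R \<phi>0"] norm_\<phi>0 s0(1) by simp
    ultimately show ?thesis using s0(1) by linarith
  qed
  have KA\<Omega>: "x \<in> \<Omega>" if x: "x \<in> KA" for x
  proof -
    obtain l u where lu: "x = (l, u)" by (cases x) auto
    have xb: "(l, u) \<in> box \<alpha> \<rho>" "blinfun_apply \<phi>s u = s0" "blinfun_apply \<omega> (F (l, u)) * (l - l0) \<le> 0" using x lu by (auto simp: KA_def)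
    obtain a where "F (l, u) = a *\<^sub>R ?c" using x lu by (auto simp: KA_def)
    then have JF: "blinfun_apply J (F (l, u)) = 0" using Jc by (simp add: blinfun.scaleR_right)
    have nu: "norm u < \<rho>" using small[OF xb(1,2) JF] s0 by linarith
    \<comment> \<open>Transversality enters here: on a side of the box the product in
      \<open>KA\<close> would be positive.\<close>
    have "\<bar>l - l0\<bar> \<noteq> \<alpha>" using sign[rule_format, of l u] nu JF xb(2,3) s0(1) by force
    then have "\<bar>l - l0\<bar> < \<alpha>" using xb(1) by (simp add: box_def)
    then show ?thesis using nu xb(1,2) boxW s0(1) lu by (auto simp: \<Omega>_def)
  qed
  have KB\<Omega>: "x \<in> \<Omega>" if x: "x \<in> KB" for x
  proof -
    have xB: "x \<in> B" "s0 \<le> blinfun_apply \<phi>s (snd x)" using x by (auto simp: KB_def)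
    have "2 * s0 < blinfun_apply \<phi>s (snd x) \<or> (\<bar>fst x - l0\<bar> < \<alpha> \<and> norm (snd x) < \<rho>)"
      using m(2)[OF xB(1)] s0 by linarith
    then show ?thesis using xB BW s0(1) by (auto simp: \<Omega>_def)
  qed
  \<comment> \<open>With \<open>L' \<phi>0\<close> in \<open>span N\<close> the homotopy maps
    \<open>M\<close> into the reals times \<open>span N\<close>.\<close>
  obtain N where N: "finite N" "independent N" "?c \<in> span N" "\<forall>x\<in>K. \<forall>v. \<exists>y. v - blinfun_apply (D_u F x) y \<in> span N"
    using Fredholm0_family_common_complement[OF cK continuous_D_u Fredholm, of ?c] by (elim exE conjE) (rule that)
  define M where "M = {x\<in>\<Omega>. F x \<in> span N}"
  have Ksub: "K \<subseteq> M"
  proof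
    fix x assume x: "x \<in> K"
    then have "x \<in> \<Omega>" using KA\<Omega>[of x] KB\<Omega>[of x] unfolding K_def by blast
    moreover have "F x \<in> span N"
    proof (cases "x \<in> KA")
      case True
      then show ?thesis using N(3) by (auto simp: KA_def intro: span_scale)
    next
      case False
      then have "x \<in> S" using x B(3) unfolding K_def KB_def Sp_def by blast
      then have "F x = 0" by (rule solution_zero)
      then show ?thesis by (simp add: span_zero)
    qed
    ultimately show "x \<in> M" by (simp add: M_def)
  qed
  have charts: "has_C1_chart (Suc (card N)) M p" if p: "p \<in> K" for p
  proof -
    have on: "\<exists>y. v - blinfun_apply (D_u F p) y \<in> span N" for v using N(4) p by blast
    obtain E where E: "finite E" "independent E" "card E = Suc (card N)" "{x. blinfun_apply (F' p) x \<in> span N} = span E"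
      by (rule Fredholm0_product_preimage_basis[OF Fredholm[of p] N(1,2) on, of "F' p"]) (auto simp: D_u_apply intro: that)
    have "\<exists>x. v - blinfun_apply (F' p) x \<in> span N" for v using on[of v] unfolding D_u_apply by blast
    moreover have "p \<in> \<Omega>" "F p \<in> span N" using p Ksub by (auto simp: M_def)
    ultimately show ?thesis unfolding M_def using preimage_C1_chart[OF deriv cont_deriv o\<Omega> _ N(1) _ _ E] by blast
  qed
  obtain E :: "(real \<times> 'v) set" where E: "finite E" "independent E" "card E = Suc (card N)" "\<And>x. x \<in> span E \<longleftrightarrow> snd x \<in> span N"
    using real_times_span_basis[OF N(1,2)] by blast
  have inbox: "x \<in> box \<alpha> \<rho>" if "x \<in> M" "blinfun_apply \<phi>s (snd x) = s0" for x
    using that s0(1) by (auto simp: M_def \<Omega>_def box_def)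
  have zK: "x \<in> K" if t: "t \<in> {0..2}" and x: "x \<in> M" and z: "h t x = 0" for t x
  proof (cases "t \<le> 1")
    case True
    have \<phi>: "blinfun_apply \<phi>s (snd x) = s0" and e: "F x + ((1 - t) * \<kappa>0 x) *\<^sub>R ?c = 0" using z True t by (auto simp: h_def zero_prod_def)
    have xb: "x \<in> box \<alpha> \<rho>" by (rule inbox[OF x \<phi>])
    have "blinfun_apply J (F x + ((1 - t) * \<kappa>0 x) *\<^sub>R ?c) = 0" unfolding e by (rule blinfun.zero_right)
    then have "blinfun_apply J (F x) = 0" by (simp add: blinfun.add_right blinfun.scaleR_right Jc)
    then have F\<omega>: "F x = blinfun_apply \<omega> (F x) *\<^sub>R ?c" using Jk by blast
    have "blinfun_apply \<omega> (F x + ((1 - t) * \<kappa>0 x) *\<^sub>R ?c) = 0" unfolding e by (rule blinfun.zero_right)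
    then have "blinfun_apply \<omega> (F x) + (1 - t) * \<kappa>0 x = 0" by (simp add: blinfun.add_right blinfun.scaleR_right \<omega>c)
    \<comment> \<open>The model term forbids equal strict signs of \<open>\<omega> (F x)\<close> and
      \<open>l - l0\<close> for positive \<open>t\<close>; for \<open>t = 0\<close> it forces
      \<open>l = l0\<close>.\<close>
    then have te: "t * blinfun_apply \<omega> (F x) = - ((1 - t) * ((fst x - l0) * s0))" by (simp add: \<kappa>0_def algebra_simps)
    have sg: "blinfun_apply \<omega> (F x) * (fst x - l0) \<le> 0"
    proof (cases "t = 0")
      case True
      then show ?thesis using te s0(1) by simp
    next
      case False
      then have t0: "0 < t" using t by simp
      have "t * (blinfun_apply \<omega> (F x) * (fst x - l0)) = (t * blinfun_apply \<omega> (F x)) * (fst x - l0)" by simp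
      also have "\<dots> = - ((1 - t) * s0 * ((fst x - l0) * (fst x - l0)))" unfolding te by (simp add: algebra_simps)
      also have "\<dots> \<le> 0" using \<open>t \<le> 1\<close> s0(1) by simp
      finally show ?thesis using t0 by (simp add: mult_le_0_iff)
    qed
    have x0: "(fst x, 0) \<in> box \<alpha> \<rho>" using xb \<rho> by (simp add: box_def)
    have "norm (F x - blinfun_apply L0 (snd x)) \<le> \<kappa> * norm (snd x)"
      using est[rule_format, OF xb x0] by (cases x) (simp add: trivial norm_Pair)
    then have "norm (F x) \<le> norm L0 * norm (snd x) + \<kappa> * norm (snd x)"
      using norm_triangle_sub[of "F x" "blinfun_apply L0 (snd x)"] norm_blinfun[of L0 "snd x"] by linarith
    also have "\<dots> = (norm L0 + \<kappa>) * norm (snd x)" by (simp add: distrib_right)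
    also have "\<dots> \<le> (norm L0 + \<kappa>) * \<rho>" using xb \<kappa> by (intro mult_left_mono) (auto simp: box_def)
    finally have "norm \<omega> * norm (F x) \<le> R" unfolding R_def by (rule mult_left_mono) simp
    then have "\<bar>blinfun_apply \<omega> (F x)\<bar> \<le> R" using norm_blinfun[of \<omega> "F x"] by simp
    then have "F x \<in> (\<lambda>a. a *\<^sub>R ?c) ` {-R..R}" using F\<omega> by (intro image_eqI[of _ _ "blinfun_apply \<omega> (F x)"]) auto
    then show ?thesis using xb \<phi> sg by (simp add: K_def KA_def)
  next
    case False
    then have "F x = 0" and \<phi>: "blinfun_apply \<phi>s (snd x) = s0 + (t - 1) * (s1 - s0)" using z by (auto simp: h_def zero_prod_def)
    have "0 \<le> (t - 1) * (s1 - s0)" using False s1 by (intro mult_nonneg_nonneg) auto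
    then have s: "s0 \<le> blinfun_apply \<phi>s (snd x)" using \<phi> by simp
    then have "snd x \<noteq> 0" using s0(1) by (auto simp: blinfun.zero_right)
    then have "x \<in> Sp" using zero_solution[OF \<open>F x = 0\<close>] s s0(1) by (simp add: Sp_def)
    then have "x \<in> B" using WB x by (auto simp: M_def \<Omega>_def)
    then show ?thesis using s by (simp add: K_def KB_def)
  qed
  \<comment> \<open>Bound for the inverse of the map at time 0: the level controls
    \<open>\<phi>s\<close>, the \<open>\<omega>\<close> component controls \<open>l\<close> at the
    price of \<open>1 / s0\<close>, and \<open>J\<close> controls the rest up to an error that is
    absorbed.\<close>
  define cb where "cb = 2 * (norm J + 1 + norm \<omega> / s0)"
  have cb: "0 < cb" using s0(1) by (simp add: cb_def add_nonneg_pos add_pos_nonneg)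
  have lower: "norm (x - y) \<le> cb * norm (h 0 x - h 0 y)" if xy: "x \<in> box \<alpha> \<rho>" "y \<in> box \<alpha> \<rho>" for x y
  proof -
    define a v w G where "a = fst x - fst y" and "v = snd x - snd y" and "w = (F x - F y) + (\<kappa>0 x - \<kappa>0 y) *\<^sub>R ?c" and "G = norm (h 0 x - h 0 y)"
    have hd: "h 0 x - h 0 y = (blinfun_apply \<phi>s v, w)" by (simp add: h_def v_def w_def blinfun.diff_right algebra_simps)
    have i1: "\<bar>blinfun_apply \<phi>s v\<bar> \<le> G" using norm_fst_le[of "blinfun_apply \<phi>s v" w] by (simp add: G_def hd)
    have i2: "norm w \<le> G" using norm_snd_le[of w "blinfun_apply \<phi>s v"] by (simp add: G_def hd)
    have "blinfun_apply \<omega> w = a * s0" by (simp add: w_def blinfun.add_right blinfun.diff_right blinfun.scaleR_right \<omega>c \<kappa>0_def a_def algebra_simps)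
    then have "\<bar>a\<bar> * s0 \<le> norm \<omega> * norm w" using norm_blinfun[of \<omega> w] s0(1) by (simp add: abs_mult)
    also have "\<dots> \<le> norm \<omega> * G" using i2 by (rule mult_left_mono) simp
    finally have i3: "\<bar>a\<bar> \<le> norm \<omega> / s0 * G" using s0(1) by (simp add: pos_le_divide_eq)
    have "blinfun_apply J (F x - F y) = blinfun_apply J w" by (simp add: w_def blinfun.add_right blinfun.scaleR_right Jc)
    then have i4: "norm (blinfun_apply J w - (v - blinfun_apply \<phi>s v *\<^sub>R \<phi>0)) \<le> 1 / 8 * norm (x - y)"
      using estJ[rule_format, OF xy] by (simp add: v_def)
    define q where "q = norm J * G"
    have "norm (blinfun_apply J w) \<le> q" unfolding q_def using norm_blinfun[of J w] mult_left_mono[OF i2 norm_ge_zero[of J]] by linarith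
    moreover have "norm (v - blinfun_apply \<phi>s v *\<^sub>R \<phi>0) \<le> norm (blinfun_apply J w) + norm (blinfun_apply J w - (v - blinfun_apply \<phi>s v *\<^sub>R \<phi>0))"
      by (metis norm_minus_commute norm_triangle_sub)
    moreover have "norm v \<le> norm (v - blinfun_apply \<phi>s v *\<^sub>R \<phi>0) + \<bar>blinfun_apply \<phi>s v\<bar>"
      using norm_triangle_sub[of v "blinfun_apply \<phi>s v *\<^sub>R \<phi>0"] norm_\<phi>0 by simp
    moreover have nxy: "norm (x - y) \<le> \<bar>a\<bar> + norm v" using norm_le_fst_snd[of "x - y"] by (simp add: a_def v_def)
    ultimately have "norm v \<le> q + 1 / 8 * norm (x - y) + G" using i1 i4 by linarith
    moreover have "0 \<le> q" "0 \<le> G" by (auto simp: q_def G_def)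
    ultimately have "norm (x - y) \<le> 2 * (q + G + \<bar>a\<bar>)" using nxy by (simp add: field_simps)
    also have "\<dots> \<le> 2 * (norm J * G + G + norm \<omega> / s0 * G)" unfolding q_def using i3 by simp
    also have "\<dots> = cb * G" by (simp add: cb_def algebra_simps)
    finally show ?thesis by (simp add: G_def)
  qed
  \<comment> \<open>At time 0 the parameter must be \<open>l0\<close>; what remains is
    \<open>J (F x) = 0\<close> at level \<open>s0\<close>, solved by a contraction around
    \<open>s0 *\<^sub>R \<phi>0\<close>.\<close>
  obtain z where z: "z \<in> M" "z \<in> box \<alpha> \<rho>" "h 0 z = 0"
  proof -
    define u where "u w = s0 *\<^sub>R \<phi>0 + w" for w
    have ub: "norm (u w) \<le> 2 * s0" if "w \<in> cball 0 s0" for w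
      using norm_triangle_ineq[of "s0 *\<^sub>R \<phi>0" w] that norm_\<phi>0 s0(1) by (simp add: u_def)
    have ubox: "(l0, u w) \<in> box \<alpha> \<rho>" if "w \<in> cball 0 s0" for w using ub[OF that] s0 \<alpha> by (simp add: box_def)
    have z0: "(l0, 0) \<in> box \<alpha> \<rho>" using \<alpha> \<rho> by (simp add: box_def)
    define g where "g w = w - blinfun_apply \<phi>s w *\<^sub>R \<phi>0 - blinfun_apply J (F (l0, u w))" for w
    have "\<exists>!w\<in>cball 0 s0. g w = w"
    proof (rule Banach_fix[where c = "1 / 8"])
      show "complete (cball (0 :: 'u) s0)" by (simp add: complete_eq_closed)
      show "cball (0 :: 'u) s0 \<noteq> {}" using s0(1) by simp
      show "g ` cball 0 s0 \<subseteq> cball 0 s0"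
      proof safe
        fix w :: 'u assume w: "w \<in> cball 0 s0"
        have "u w - blinfun_apply \<phi>s (u w) *\<^sub>R \<phi>0 = w - blinfun_apply \<phi>s w *\<^sub>R \<phi>0"
          by (simp add: u_def blinfun.add_right blinfun.scaleR_right \<phi>s_\<phi>0 algebra_simps)
        then have "norm (g w) \<le> 1 / 8 * norm (u w)" using estJ[rule_format, OF ubox[OF w] z0]
          by (simp add: g_def trivial norm_Pair norm_minus_commute)
        then show "g w \<in> cball 0 s0" using ub[OF w] s0(1) by simp
      qed
      show "dist (g w) (g w') \<le> 1 / 8 * dist w w'" if w: "w \<in> cball 0 s0" "w' \<in> cball 0 s0" for w w'
      proof -
        have "g w - g w' = - (blinfun_apply J (F (l0, u w) - F (l0, u w')) - ((u w - u w') - blinfun_apply \<phi>s (u w - u w') *\<^sub>R \<phi>0))"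
          by (simp add: g_def u_def blinfun.diff_right scaleR_diff_left)
        then have "norm (g w - g w') = norm (blinfun_apply J (F (l0, u w) - F (l0, u w')) - ((u w - u w') - blinfun_apply \<phi>s (u w - u w') *\<^sub>R \<phi>0))"
          by (metis norm_minus_cancel)
        also have "\<dots> \<le> 1 / 8 * norm ((l0, u w) - (l0, u w'))" using estJ[rule_format, OF ubox[OF w(1)] ubox[OF w(2)]] by simp
        also have "\<dots> = 1 / 8 * norm (w - w')" by (simp add: norm_Pair u_def)
        finally show ?thesis by (simp add: dist_norm)
      qed
    qed auto
    then obtain w where w: "w \<in> cball 0 s0" "g w = w" by blast
    \<comment> \<open>The level condition comes for free, as \<open>g\<close> takes values in the
      kernel of \<open>\<phi>s\<close>.\<close>
    have "blinfun_apply \<phi>s (g w) = 0" using J\<phi> by (simp add: g_def blinfun.diff_right blinfun.scaleR_right \<phi>s_\<phi>0)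
    then have \<phi>w: "blinfun_apply \<phi>s w = 0" using w(2) by simp
    then have JF: "blinfun_apply J (F (l0, u w)) = 0" using w(2) by (simp add: g_def)
    have \<phi>u: "blinfun_apply \<phi>s (u w) = s0" by (simp add: u_def blinfun.add_right blinfun.scaleR_right \<phi>s_\<phi>0 \<phi>w)
    have F\<omega>: "F (l0, u w) = blinfun_apply \<omega> (F (l0, u w)) *\<^sub>R ?c" using Jk JF by blast
    have h0: "h 0 (l0, u w) = 0" using F\<omega> by (simp add: h_def zero_prod_def \<phi>u \<kappa>0_def)
    have "norm (u w) < \<rho>" using ub[OF w(1)] s0 by linarith
    then have "(l0, u w) \<in> \<Omega>" using ubox[OF w(1)] boxW s0(1) \<phi>u \<alpha> by (auto simp: \<Omega>_def)
    moreover have "F (l0, u w) \<in> span N" using F\<omega> span_scale[OF N(3)] by metis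
    ultimately have "(l0, u w) \<in> M" by (simp add: M_def)
    then show ?thesis using ubox[OF w(1)] h0 by (rule that)
  qed
  have zeros: "{x\<in>M. h 0 x = 0} = {z}"
  proof -
    have "x = z" if x: "x \<in> M" "h 0 x = 0" for x
    proof -
      have "blinfun_apply \<phi>s (snd x) = s0" using x(2) by (simp add: h_def zero_prod_def)
      then have "x \<in> box \<alpha> \<rho>" by (rule inbox[OF x(1)])
      from lower[OF this z(2)] show ?thesis using x(2) z(3) by simp
    qed
    then show ?thesis using z by blast
  qed
  have reg: "reg_zero M (h 0) z"
  proof -
    define A where "A = (\<lambda>x. (blinfun_apply \<phi>s (snd x), blinfun_apply (F' z) x + (- blinfun_apply \<omega> (blinfun_apply (F' z) x) + fst x * s0) *\<^sub>R ?c))"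
    have bl: "bounded_linear A" unfolding A_def
      by (intro bounded_linear_Pair bounded_linear_add bounded_linear_compose[OF bounded_linear_scaleR_left]
        bounded_linear_minus bounded_linear_compose[OF blinfun.bounded_linear_right] bounded_linear_snd
        bounded_linear_compose[OF bounded_linear_mult_left bounded_linear_fst] bounded_linear_ident blinfun.bounded_linear_right)
    define Q where "Q = 1 + norm \<omega> * norm ?c"
    have Q: "0 < Q" by (simp add: Q_def add_pos_nonneg)
    have strict: "\<exists>\<delta>>0. \<forall>x\<in>M \<inter> ball z \<delta>. \<forall>y\<in>M \<inter> ball z \<delta>. norm (h 0 x - h 0 y - blinfun_apply (Blinfun A) (x - y)) \<le> k * norm (x - y)" if k: "0 < k" for k
    proof -
      have "0 < k / Q" using k Q by simp
      from C1_strict_derivative[OF deriv cont_deriv this, of z] obtain \<delta>' where \<delta>': "\<delta>' > 0"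
        "\<And>x y. x \<in> ball z \<delta>' \<Longrightarrow> y \<in> ball z \<delta>' \<Longrightarrow> norm (F x - F y - blinfun_apply (F' z) (x - y)) \<le> k / Q * norm (x - y)" by blast
      have "norm (h 0 x - h 0 y - blinfun_apply (Blinfun A) (x - y)) \<le> k * norm (x - y)" if xy: "x \<in> ball z \<delta>'" "y \<in> ball z \<delta>'" for x y
      proof -
        define e where "e = F x - F y - blinfun_apply (F' z) (x - y)"
        have "h 0 x - h 0 y - blinfun_apply (Blinfun A) (x - y) = (0, e - blinfun_apply \<omega> e *\<^sub>R ?c)"
          unfolding bounded_linear_Blinfun_apply[OF bl]
          by (simp add: A_def h_def \<kappa>0_def e_def blinfun.diff_right blinfun.add_right algebra_simps)
        then have "norm (h 0 x - h 0 y - blinfun_apply (Blinfun A) (x - y)) \<le> norm e + norm (blinfun_apply \<omega> e *\<^sub>R ?c)"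
          using norm_triangle_ineq4[of e "blinfun_apply \<omega> e *\<^sub>R ?c"] by (simp add: norm_Pair)
        also have "\<dots> \<le> norm e + norm \<omega> * norm e * norm ?c" using norm_blinfun[of \<omega> e] by (simp add: mult_right_mono)
        also have "\<dots> = Q * norm e" by (simp add: Q_def algebra_simps)
        also have "\<dots> \<le> Q * (k / Q * norm (x - y))" using \<delta>'(2)[OF xy] Q by (intro mult_left_mono) (auto simp: e_def)
        also have "\<dots> = k * norm (x - y)" using Q by simp
        finally show ?thesis .
      qed
      then show ?thesis using \<delta>'(1) by (intro exI[of _ \<delta>']) blast
    qed
    have "z \<in> \<Omega> \<inter> {x. blinfun_apply \<phi>s (snd x) < 2 * s0}" using z s0(1) by (auto simp: M_def h_def zero_prod_def)
    moreover have "open (\<Omega> \<inter> {x. blinfun_apply \<phi>s (snd x) < 2 * s0})" by (intro open_Int o\<Omega> open_Collect_less continuous_intros)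
    ultimately obtain \<delta>2 where \<delta>2: "\<delta>2 > 0" "ball z \<delta>2 \<subseteq> \<Omega> \<inter> {x. blinfun_apply \<phi>s (snd x) < 2 * s0}"
      using open_contains_ball by meson
    have bb: "x \<in> box \<alpha> \<rho>" if "x \<in> ball z \<delta>2" for x
    proof -
      have "x \<in> \<Omega>" "blinfun_apply \<phi>s (snd x) < 2 * s0" using subsetD[OF \<delta>2(2) that] by auto
      then show ?thesis by (auto simp: \<Omega>_def box_def)
    qed
    have "1 / cb * norm (x - y) \<le> norm (h 0 x - h 0 y)" if "x \<in> ball z \<delta>2" "y \<in> ball z \<delta>2" for x y
      using lower[OF bb[OF that(1)] bb[OF that(2)]] cb by (simp add: divide_le_eq mult.commute)
    then have "\<exists>\<delta>>0. \<forall>x\<in>M \<inter> ball z \<delta>. \<forall>y\<in>M \<inter> ball z \<delta>. 1 / cb * norm (x - y) \<le> norm (h 0 x - h 0 y)"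
      using \<delta>2(1) by (intro exI[of _ \<delta>2]) blast
    moreover have "0 < 1 / cb" using cb by simp
    ultimately show ?thesis unfolding reg_zero_def using strict by (intro exI[of _ "Blinfun A"] exI[of _ "1 / cb"]) blast
  qed
  \<comment> \<open>At time 2 the level is \<open>s1\<close>, which \<open>\<phi>s\<close> does not
    reach on \<open>W\<close>.\<close>
  have "\<exists>x\<in>M. h 2 x = 0"
  proof (rule odd_zeros_continuation[OF _ E(1,2,3) _ cK Ksub charts _ _ zK])
    show "continuous_on ({0..2} \<times> M) (\<lambda>(t, x). h t x)"
      unfolding h_def \<kappa>0_def split_beta
      by (intro continuous_intros continuous_on_compose2[OF continuous_F]) auto
    show "h t x \<in> span E" if "x \<in> M" for t x
      using that N(3) unfolding E(4) by (auto simp: h_def M_def intro: span_add span_scale)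
    show "finite {x \<in> M. h 0 x = 0}" "odd (card {x \<in> M. h 0 x = 0})" unfolding zeros by auto
    show "reg_zero M (h 0) x" if "x \<in> M" "h 0 x = 0" for x
    proof -
      have "x \<in> {z}" unfolding zeros[symmetric] using that by simp
      then show ?thesis using reg by simp
    qed
  qed auto
  then obtain x where "x \<in> M" "h 2 x = 0" by blast
  then have "x \<in> W" "blinfun_apply \<phi>s (snd x) = s1" by (auto simp: M_def \<Omega>_def h_def zero_prod_def)
  then show False using Ws1 by fastforce
qed

end


section \<open>Connected branches in metric spaces\<close>

text \<open>The obstruction to linking: if no such \<open>B\<close> exists, \<open>A\<close> cannot
  be cut between \<open>p\<close> on one side and \<open>Y\<close> or infinity on the other. In this
  form linking is inherited by intersections of chains.\<close>

definition clopen_part :: "'a::metric_space set \<Rightarrow> 'a \<Rightarrow> 'a set \<Rightarrow> 'a set \<Rightarrow> bool" where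
  "clopen_part A p Y B \<longleftrightarrow> compact B \<and> B \<subseteq> A \<and> closed (A - B) \<and> p \<in> B \<and> B \<inter> Y = {}"

text \<open>A neighbourhood \<open>W\<close> of \<open>B\<close> has a boundary that misses the
  intersection. By compactness the boundary already misses some member \<open>A\<close>, and
  \<open>A \<inter> closure W\<close> is a part of that member.\<close>

lemma clopen_part_Inter_chain:
  fixes \<A> :: "'a::metric_space set set"
  assumes ne: "\<A> \<noteq> {}" and chain: "\<And>A B. A \<in> \<A> \<Longrightarrow> B \<in> \<A> \<Longrightarrow> A \<subseteq> B \<or> B \<subseteq> A"
    and cl: "\<And>A. A \<in> \<A> \<Longrightarrow> closed A" and pA: "\<And>A. A \<in> \<A> \<Longrightarrow> p \<in> A" and Y: "closed Y"
    and comp: "\<And>A C. A \<in> \<A> \<Longrightarrow> closed C \<Longrightarrow> bounded C \<Longrightarrow> C \<subseteq> A \<Longrightarrow> compact C"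
    and B: "clopen_part (\<Inter>\<A>) p Y B"
  shows "\<exists>A\<in>\<A>. \<exists>B. clopen_part A p Y B"
proof -
  have B': "compact B" "B \<subseteq> \<Inter>\<A>" "closed (\<Inter>\<A> - B)" "p \<in> B" "B \<inter> Y = {}" using B by (auto simp: clopen_part_def)
  have "closed ((\<Inter>\<A> - B) \<union> Y)" using B'(3) Y by (rule closed_Un)
  then obtain d where d: "d > 0" "\<And>x y. x \<in> B \<Longrightarrow> y \<in> (\<Inter>\<A> - B) \<union> Y \<Longrightarrow> d \<le> dist x y"
    using compact_closed_gap[OF B'(1), of "(\<Inter>\<A> - B) \<union> Y"] B'(5) by blast
  define W where "W = (\<Union>b\<in>B. ball b (d / 2))"
  have oW: "open W" unfolding W_def by auto
  have BW: "B \<subseteq> W" using d(1) by (auto simp: W_def)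
  have near: "\<exists>b\<in>B. dist b x < d" if x: "x \<in> closure W" for x
  proof -
    obtain y where y: "y \<in> W" "dist y x < d / 2" using x d(1) closure_approachable[of x W] half_gt_zero by blast
    then obtain b where b: "b \<in> B" "dist b y < d / 2" by (auto simp: W_def)
    then show ?thesis using dist_triangle[of b x y] y(2) by (intro bexI[OF _ b(1)]) linarith
  qed
  have off: "x \<notin> (\<Inter>\<A> - B) \<union> Y" if "x \<in> closure W" for x 
  proof
    assume x: "x \<in> (\<Inter>\<A> - B) \<union> Y"
    obtain b where b: "b \<in> B" "dist b x < d" using near[OF \<open>x \<in> closure W\<close>] by blast
    show False using d(2)[OF b(1) x] b(2) by linarith
  qed
  obtain R where R: "\<And>b. b \<in> B \<Longrightarrow> dist p b \<le> R"
    using compact_imp_bounded[OF B'(1)] bounded_any_center[of B p] by blast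
  have bW: "bounded (closure W)" unfolding bounded_def
  proof (intro exI ballI)
    fix x assume "x \<in> closure W"
    then obtain b where "b \<in> B" "dist b x < d" using near by blast
    then show "dist p x \<le> R + d" using R[of b] dist_triangle[of p x b] by linarith
  qed
  obtain A0 where A0: "A0 \<in> \<A>" using ne by blast
  have "\<exists>A\<in>\<A>. A \<inter> (closure W - W) = {}"
  proof (rule ccontr)
    assume no: "\<not> ?thesis"
    let ?T = "A0 \<inter> (closure W - W)"
    have cT: "closed (A \<inter> (closure W - W))" if "A \<in> \<A>" for A
      using cl[OF that] oW by (intro closed_Int closed_Diff closed_closure)
    have "compact ?T" using cT[OF A0] bW by (intro comp[OF A0]) (auto intro: bounded_subset)
    moreover have "closed A" if "A \<in> \<A>" for A by (rule cl[OF that])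
    moreover have "?T \<inter> \<Inter>\<F> \<noteq> {}" if F: "finite \<F>" "\<F> \<subseteq> \<A>" for \<F>
    proof -
      have "\<exists>A\<in>\<A>. A \<subseteq> A0 \<and> A \<subseteq> \<Inter>\<F>" using F
      proof (induction \<F>)
        case empty
        then show ?case using A0 by blast
      next
        case (insert X \<F>)
        then obtain A where A: "A \<in> \<A>" "A \<subseteq> A0" "A \<subseteq> \<Inter>\<F>" by blast
        have X: "X \<in> \<A>" using insert.prems by simp
        from chain[OF A(1) X] show ?case
        proof
          assume "A \<subseteq> X"
          then show ?thesis using A by (intro bexI[OF _ A(1)]) simp
        next
          assume "X \<subseteq> A"
          then show ?thesis using A by (intro bexI[OF _ X]) auto
        qed
      qed
      then obtain A where A: "A \<in> \<A>" "A \<subseteq> A0" "A \<subseteq> \<Inter>\<F>" by blast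
      then obtain x where "x \<in> A" "x \<in> closure W - W" using no by blast
      then have "x \<in> ?T \<inter> \<Inter>\<F>" using A(2,3) by (simp add: subset_iff)
      then show ?thesis by blast
    qed
    ultimately have "?T \<inter> \<Inter>\<A> \<noteq> {}" by (rule compact_imp_fip)
    then obtain x where x: "x \<in> closure W" "x \<notin> W" "x \<in> \<Inter>\<A>" by blast
    then have "x \<in> B" using off by blast
    then show False using x(2) BW by blast
  qed
  then obtain A where A: "A \<in> \<A>" "A \<inter> (closure W - W) = {}" by blast
  then have eq: "A \<inter> closure W = A \<inter> W" using closure_subset by blast
  have "clopen_part A p Y (A \<inter> closure W)" unfolding clopen_part_def
  proof (intro conjI)
    show "compact (A \<inter> closure W)" using cl[OF A(1)] bW by (intro comp[OF A(1)]) (auto intro: bounded_subset)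
    have "A - A \<inter> closure W = A - W" using eq by blast
    then show "closed (A - A \<inter> closure W)" using cl[OF A(1)] oW by (simp add: closed_Diff)
    show "p \<in> A \<inter> closure W" using pA[OF A(1)] B'(4) BW closure_subset by blast
    show "A \<inter> closure W \<inter> Y = {}" using off by blast
  qed auto
  then show ?thesis using A(1) by blast
qed

text \<open>If the rest \<open>D\<close> of a minimal set split into \<open>P\<close> and
  \<open>Q\<close>, then discarding \<open>P\<close> or \<open>Q\<close> would leave two strictly
  smaller sets, each with a part by minimality; the union of the two parts would be a part of the
  whole set.\<close>

lemma connected_branch:
  fixes A :: "'a::metric_space set"
  assumes A: "closed A" "p \<in> A" and comp: "\<And>C. closed C \<Longrightarrow> bounded C \<Longrightarrow> C \<subseteq> A \<Longrightarrow> compact C"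
    and Y: "closed Y" "p \<notin> Y" and no: "\<nexists>B. clopen_part A p Y B"
  shows "\<exists>M\<subseteq>A. closed M \<and> p \<in> M \<and> (\<nexists>B. clopen_part M p Y B) \<and> connected (M - {p} - Y) \<and>
    p \<in> closure (M - {p} - Y) \<and> (bounded (M - {p} - Y) \<longrightarrow> closure (M - {p} - Y) \<inter> Y \<noteq> {})"
proof -
  define \<J> where "\<J> = {X. X \<subseteq> A \<and> closed X \<and> p \<in> X \<and> (\<nexists>B. clopen_part X p Y B)}"
  \<comment> \<open>Complements turn minimal sets into maximal ones.\<close>
  have "\<exists>N\<in>uminus ` \<J>. \<forall>X\<in>uminus ` \<J>. N \<subseteq> X \<longrightarrow> X = N"
  proof (rule subset_Zorn_nonempty)
    have "A \<in> \<J>" using A no by (simp add: \<J>_def)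
    then show "uminus ` \<J> \<noteq> {}" by blast
    fix \<C> :: "'a set set" assume ne: "\<C> \<noteq> {}" and ch: "subset.chain (uminus ` \<J>) \<C>"
    have sub: "\<And>X. X \<in> uminus ` \<C> \<Longrightarrow> X \<in> \<J>" using ch unfolding subset_chain_def by auto
    have lin: "X \<subseteq> Z \<or> Z \<subseteq> X" if "X \<in> uminus ` \<C>" "Z \<in> uminus ` \<C>" for X Z
      using ch that unfolding subset_chain_def by blast
    have "\<nexists>B. clopen_part (\<Inter>(uminus ` \<C>)) p Y B"
    proof
      assume "\<exists>B. clopen_part (\<Inter>(uminus ` \<C>)) p Y B"
      then obtain B where B: "clopen_part (\<Inter>(uminus ` \<C>)) p Y B" by blast
      have "\<exists>X\<in>uminus ` \<C>. \<exists>B. clopen_part X p Y B"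
      proof (rule clopen_part_Inter_chain[OF _ lin _ _ Y(1) _ B])
        show "uminus ` \<C> \<noteq> {}" using ne by blast
        show "closed X" "p \<in> X" if "X \<in> uminus ` \<C>" for X using sub[OF that] by (auto simp: \<J>_def)
        show "compact C" if "X \<in> uminus ` \<C>" "closed C" "bounded C" "C \<subseteq> X" for X C
          using sub[OF that(1)] that(2-) by (intro comp) (auto simp: \<J>_def)
      qed
      then show False using sub unfolding \<J>_def by blast
    qed
    moreover have "\<Inter>(uminus ` \<C>) \<subseteq> A" using ne sub unfolding \<J>_def by blast
    moreover have "closed (\<Inter>(uminus ` \<C>))" using sub unfolding \<J>_def by (intro closed_Inter) blast
    moreover have "p \<in> \<Inter>(uminus ` \<C>)" using sub unfolding \<J>_def by blast
    ultimately have "\<Inter>(uminus ` \<C>) \<in> \<J>" by (simp add: \<J>_def)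
    moreover have "\<Union>\<C> = - \<Inter>(uminus ` \<C>)" by auto
    ultimately show "\<Union>\<C> \<in> uminus ` \<J>" by blast
  qed
  then obtain M where MJ: "M \<in> \<J>" and "\<forall>X\<in>uminus ` \<J>. - M \<subseteq> X \<longrightarrow> X = - M" by blast
  then have min: "X = M" if X: "X \<in> \<J>" "X \<subseteq> M" for X
    using X by (metis compl_le_compl_iff double_complement image_eqI)
  have M: "M \<subseteq> A" "closed M" "p \<in> M" "\<And>B. \<not> clopen_part M p Y B" using MJ by (auto simp: \<J>_def)
  define D where "D = M - {p} - Y"
  have clD: "closure D \<subseteq> D \<union> {p} \<union> (M \<inter> Y)" using closure_minimal[of D M] M(2) by (auto simp: D_def)
  have con: "connected D"
  proof (rule ccontr)
    assume "\<not> connected D"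
    then obtain P' Q' where PQ': "closed P'" "closed Q'" "D \<subseteq> P' \<union> Q'" "P' \<inter> Q' \<inter> D = {}" "P' \<inter> D \<noteq> {}" "Q' \<inter> D \<noteq> {}"
      unfolding connected_closed by blast
    define P Q where "P = P' \<inter> D" and "Q = Q' \<inter> D"
    have "closure P \<subseteq> P'" "closure Q \<subseteq> Q'" unfolding P_def Q_def using PQ'(1,2) by (simp_all add: closure_minimal)
    then have PQ: "P \<noteq> {}" "Q \<noteq> {}" "P \<union> Q = D" "closure P \<inter> Q = {}" "closure Q \<inter> P = {}"
      using PQ' unfolding P_def Q_def by blast+
    have part: "\<exists>B. clopen_part (P \<union> {p} \<union> (M \<inter> Y)) p Y B"
      if PQ: "Q \<noteq> {}" "P \<union> Q = D" "closure P \<inter> Q = {}" for P Q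
    proof (rule ccontr)
      assume no: "\<not> ?thesis"
      let ?X = "P \<union> {p} \<union> (M \<inter> Y)"
      have PD: "P \<subseteq> D" using PQ(2) by blast
      have "closure P \<subseteq> ?X" using closure_mono[OF PD] clD PQ(2,3) by blast
      moreover have "?X = closure P \<union> {p} \<union> (M \<inter> Y)" using \<open>closure P \<subseteq> ?X\<close> closure_subset[of P] by blast
      moreover have "closed (closure P \<union> {p} \<union> (M \<inter> Y))" using M(2) Y(1) by (intro closed_Un closed_Int) auto
      ultimately have "closed ?X" by simp
      moreover have XM: "?X \<subseteq> M" using PQ(2) M(3) by (auto simp: D_def)
      ultimately have "?X \<in> \<J>" using no M(1) by (auto simp: \<J>_def)
      then have "?X = M" using min XM by blast
      moreover obtain q where "q \<in> Q" using PQ(1) by blast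
      ultimately have "q \<in> P" using PQ(2) by (auto simp: D_def)
      then show False using PQ(3) \<open>q \<in> Q\<close> closure_subset[of P] by blast
    qed
    obtain B1 where B1: "clopen_part (P \<union> {p} \<union> (M \<inter> Y)) p Y B1" using part[of Q P] PQ by blast
    obtain B2 where B2: "clopen_part (Q \<union> {p} \<union> (M \<inter> Y)) p Y B2" using part[of P Q] PQ by blast
    have disj: "P \<inter> Q = {}" using PQ(4) closure_subset[of P] by blast
    have MPQ: "M = P \<union> Q \<union> {p} \<union> (M \<inter> Y)" using PQ(3) M(3) by (auto simp: D_def)
    have PQM: "P \<subseteq> M" "Q \<subseteq> M" "P \<inter> Y = {}" "Q \<inter> Y = {}" using PQ(3) by (auto simp: D_def)
    have "M - (B1 \<union> B2) = ((P \<union> {p} \<union> (M \<inter> Y)) - B1) \<union> ((Q \<union> {p} \<union> (M \<inter> Y)) - B2)"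
      using B1 B2 disj MPQ PQM M(3) unfolding clopen_part_def by blast
    moreover have "closed ((P \<union> {p} \<union> (M \<inter> Y)) - B1)" "closed ((Q \<union> {p} \<union> (M \<inter> Y)) - B2)"
      using B1 B2 by (auto simp: clopen_part_def)
    ultimately have "closed (M - (B1 \<union> B2))" by (simp only: closed_Un)
    moreover have "compact (B1 \<union> B2)" using B1 B2 by (intro compact_Un) (auto simp: clopen_part_def)
    moreover have "B1 \<union> B2 \<subseteq> M" "p \<in> B1 \<union> B2" "(B1 \<union> B2) \<inter> Y = {}"
      using B1 B2 MPQ unfolding clopen_part_def by blast+
    ultimately have "clopen_part M p Y (B1 \<union> B2)" by (simp add: clopen_part_def)
    then show False using M(4) by blast
  qed
  \<comment> \<open>Otherwise \<open>{p}\<close> itself would be a part. For the last claim, a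
    bounded \<open>D\<close> whose closure misses \<open>Y\<close> would form a part together with
    \<open>p\<close>.\<close>
  have "p \<in> closure D"
  proof (rule ccontr)
    assume "p \<notin> closure D"
    then have "M - {p} = closure D \<union> (M \<inter> Y)" using clD closure_subset[of D] Y(2) by (auto simp: D_def)
    then have "closed (M - {p})" using M(2) Y(1) by (simp add: closed_Un closed_Int)
    then have "clopen_part M p Y {p}" using M(3) Y(2) by (simp add: clopen_part_def)
    then show False using M(4) by blast
  qed
  moreover have "closure D \<inter> Y \<noteq> {}" if b: "bounded D"
  proof
    assume e: "closure D \<inter> Y = {}"
    then have eq: "insert p D = closure D \<union> {p}" using clD closure_subset[of D] by blast
    have "closed (insert p D)" unfolding eq by auto
    then have "compact (insert p D)" using b M(1,3) by (intro comp) (auto simp: D_def)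
    moreover have "M - insert p D = M \<inter> Y" using Y(2) by (auto simp: D_def)
    then have "closed (M - insert p D)" using M(2) Y(1) by (simp add: closed_Int)
    ultimately have "clopen_part M p Y (insert p D)" using M(3) Y(2) by (auto simp: clopen_part_def D_def)
    then show False using M(4) by blast
  qed
  ultimately show ?thesis using M con unfolding D_def by blast
qed

text \<open>The sphere takes the role of \<open>Y\<close>: a part of the intersection with the ball
  that misses the sphere is also a part of \<open>M\<close>. Boundedness then leaves the sphere as
  the only thing to be linked to.\<close>

lemma connected_branch_in_ball:
  fixes M :: "'a::metric_space set"
  assumes M: "closed M" "p \<in> M" and comp: "\<And>C. closed C \<Longrightarrow> bounded C \<Longrightarrow> C \<subseteq> M \<Longrightarrow> compact C"
    and no: "\<nexists>B. clopen_part M p Y B" and \<delta>: "0 < \<delta>" "M \<inter> Y \<inter> cball p \<delta> = {}"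
  shows "\<exists>C. closed C \<and> connected C \<and> C \<subseteq> M \<inter> cball p \<delta> \<and> p \<in> C \<and> C \<inter> sphere p \<delta> \<noteq> {}"
proof -
  let ?E = "M \<inter> cball p \<delta>" and ?T = "M \<inter> sphere p \<delta>"
  have "closed (sphere p \<delta>)" unfolding sphere_def by (intro closed_Collect_eq continuous_intros)
  then have cE: "closed ?E" "closed ?T" using M(1) by (simp_all add: closed_Int)
  have "\<nexists>B. clopen_part ?E p ?T B"
  proof
    assume "\<exists>B. clopen_part ?E p ?T B"
    then obtain B where B: "compact B" "B \<subseteq> ?E" "closed (?E - B)" "p \<in> B" "B \<inter> ?T = {}" by (auto simp: clopen_part_def)
    have "M - B = (?E - B) \<union> (M - ball p \<delta>)" 
    proof (intro equalityI subsetI)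
      fix x assume "x \<in> (?E - B) \<union> (M - ball p \<delta>)"
      then show "x \<in> M - B" using B(2,5) by (cases "dist p x = \<delta>") force+
    qed auto
    moreover have "closed (M - ball p \<delta>)" using M(1) by (intro closed_Diff) auto
    ultimately have "closed (M - B)" using B(3) by (simp add: closed_Un)
    then have "clopen_part M p Y B" using B \<delta>(2) unfolding clopen_part_def by blast
    then show False using no by blast
  qed
  moreover have "p \<in> ?E" "p \<notin> ?T" using M(2) \<delta>(1) by auto
  moreover have "compact C" if "closed C" "bounded C" "C \<subseteq> ?E" for C using that by (intro comp) auto
  ultimately obtain D where D: "D \<subseteq> ?E" "closed D" "connected (D - {p} - ?T)" "p \<in> closure (D - {p} - ?T)"
      "bounded (D - {p} - ?T) \<longrightarrow> closure (D - {p} - ?T) \<inter> ?T \<noteq> {}"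
    using connected_branch[of ?E p ?T] cE by blast
  let ?C = "closure (D - {p} - ?T)"
  have "bounded (D - {p} - ?T)" by (rule bounded_subset[OF bounded_cball[of p \<delta>]]) (use D(1) in blast)
  then have "?C \<inter> sphere p \<delta> \<noteq> {}" using D(5) by blast
  moreover have "?C \<subseteq> D" using D(2) by (intro closure_minimal) auto
  moreover have "connected ?C" using D(3) by (rule connected_imp_connected_closure)
  ultimately show ?thesis using D(1,4) by (intro exI[of _ ?C]) auto
qed


section \<open>The bifurcating branches\<close>

context simple_eigenvalue
begin

text \<open>One minimal set \<open>M\<close> yields both the component \<open>D\<close> with its
  alternatives and the continua in all balls, so that \<open>D\<close> does not depend on
  \<open>\<delta>\<close>.\<close>

lemma positive_branch:
  "\<exists>D \<in> components (S - {p0}).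
    (\<not> compact (D \<union> {p0}) \<or> (\<exists>l1. l1 \<noteq> l0 \<and> (l1, 0) \<in> D \<union> {p0}) \<or>
      (\<exists>l z. z \<noteq> 0 \<and> blinfun_apply \<phi>s z = 0 \<and> (l, z) \<in> D \<union> {p0})) \<and>
    (\<forall>\<delta>>0. (\<forall>x\<in>S \<inter> cball p0 \<delta>. blinfun_apply \<phi>s (snd x) = 0 \<longrightarrow> x = p0) \<longrightarrow>
      (\<exists>C. closed C \<and> connected C \<and> C \<subseteq> S \<inter> cball p0 \<delta> \<and> p0 \<in> C \<and> C \<inter> sphere p0 \<delta> \<noteq> {} \<and>
        (\<forall>x\<in>C - {p0}. 0 < blinfun_apply \<phi>s (snd x)) \<and> C - {p0} \<subseteq> D))"
proof -
  \<comment> \<open>The target of the branch. Near \<open>p0\<close> the cone estimate keeps other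
    solutions off the hyperplane, so removing \<open>p0\<close> leaves a closed set.\<close>
  define X0 where "X0 = {x\<in>S. blinfun_apply \<phi>s (snd x) = 0} - {p0}"
  obtain r where r: "r > 0" "\<And>x. x \<in> (S - {p0}) \<inter> ball p0 r \<Longrightarrow> 0 < \<bar>blinfun_apply \<phi>s (snd x)\<bar>"
  proof -
    obtain r where r: "r > 0" "\<forall>x\<in>(S - {p0}) \<inter> ball p0 r. snd x \<noteq> 0 \<and> 0 * norm (snd x) < \<bar>blinfun_apply \<phi>s (snd x)\<bar>"
      using cone_near_p0[OF zero_less_one] by (elim exE conjE) (rule that)
    have "0 < \<bar>blinfun_apply \<phi>s (snd x)\<bar>" if "x \<in> (S - {p0}) \<inter> ball p0 r" for x
      using bspec[OF r(2) that] by simp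
    then show ?thesis by (rule that[OF r(1)])
  qed
  have "closed {x :: real \<times> 'u. 0 \<le> blinfun_apply \<phi>s (snd x)}" by (intro closed_Collect_le continuous_intros)
  moreover have "Sp = S \<inter> {x. 0 \<le> blinfun_apply \<phi>s (snd x)}" by (auto simp: Sp_def)
  ultimately have cSp: "closed Sp" using closed_S by (simp add: closed_Int)
  have "closed {x :: real \<times> 'u. blinfun_apply \<phi>s (snd x) = 0}" by (intro closed_Collect_eq continuous_intros)
  then have "closed ((S \<inter> {x. blinfun_apply \<phi>s (snd x) = 0}) - ball p0 r)" using closed_S by (intro closed_Diff closed_Int) auto
  moreover have "X0 = (S \<inter> {x. blinfun_apply \<phi>s (snd x) = 0}) - ball p0 r"
  proof (intro equalityI subsetI)
    fix x assume x: "x \<in> X0"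
    then have "x \<notin> ball p0 r" using r(2)[of x] by (auto simp: X0_def)
    then show "x \<in> (S \<inter> {x. blinfun_apply \<phi>s (snd x) = 0}) - ball p0 r" using x by (simp add: X0_def)
  next
    fix x assume "x \<in> (S \<inter> {x. blinfun_apply \<phi>s (snd x) = 0}) - ball p0 r"
    then show "x \<in> X0" using r(1) by (auto simp: X0_def)
  qed
  ultimately have cX0: "closed X0" by simp
  have p0Sp: "p0 \<in> Sp" using p0_S by (simp add: Sp_def blinfun.zero_right)
  have no: "\<nexists>B. clopen_part Sp p0 X0 B"
  proof
    assume "\<exists>B. clopen_part Sp p0 X0 B"
    then obtain B where B: "compact B" "B \<subseteq> Sp" "closed (Sp - B)" "p0 \<in> B" "B \<inter> X0 = {}" unfolding clopen_part_def by blast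
    have "x = p0" if "x \<in> B" "blinfun_apply \<phi>s (snd x) = 0" for x
      using B(2,5) that unfolding X0_def Sp_def by blast
    then show False by (rule no_isolated_compact_part[OF B(1,4,2,3)])
  qed
  have comp: "compact C" if C: "closed C" "bounded C" "C \<subseteq> Sp" for C
  proof (rule compact_subset_S[OF C(1,2)])
    show "C \<subseteq> S" using C(3) unfolding Sp_def by blast
  qed
  have p0X0: "p0 \<notin> X0" unfolding X0_def by blast
  obtain M where M: "M \<subseteq> Sp" "closed M" "p0 \<in> M" "\<nexists>B. clopen_part M p0 X0 B" "connected (M - {p0} - X0)"
      "p0 \<in> closure (M - {p0} - X0)" "bounded (M - {p0} - X0) \<longrightarrow> closure (M - {p0} - X0) \<inter> X0 \<noteq> {}"
  proof -
    have "\<exists>M\<subseteq>Sp. closed M \<and> p0 \<in> M \<and> (\<nexists>B. clopen_part M p0 X0 B) \<and> connected (M - {p0} - X0) \<and>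
        p0 \<in> closure (M - {p0} - X0) \<and> (bounded (M - {p0} - X0) \<longrightarrow> closure (M - {p0} - X0) \<inter> X0 \<noteq> {})"
      by (rule connected_branch[OF cSp p0Sp _ cX0 p0X0 no]) (rule comp)
    then show ?thesis by (elim exE conjE) (rule that)
  qed
  let ?A = "M - {p0} - X0"
  have AS: "?A \<subseteq> S - {p0}" using M(1) unfolding Sp_def by blast
  have "?A \<noteq> {}" using M(6) by (metis closure_empty empty_iff)
  then have "S - {p0} \<noteq> {}" using AS by blast
  then obtain D where D: "D \<in> components (S - {p0})" "?A \<subseteq> D"
    using exists_component_superset[OF AS _ M(5)] by blast
  \<comment> \<open>A compact branch is bounded, so its closure reaches the target; such a point is
    trivial with another parameter or has a nonzero component in the kernel of
    \<open>\<phi>s\<close>.\<close>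
  have alt: "(\<exists>l1. l1 \<noteq> l0 \<and> (l1, 0) \<in> D \<union> {p0}) \<or> (\<exists>l z. z \<noteq> 0 \<and> blinfun_apply \<phi>s z = 0 \<and> (l, z) \<in> D \<union> {p0})"
    if cD: "compact (D \<union> {p0})"
  proof -
    have "bounded ?A" by (rule bounded_subset[OF compact_imp_bounded[OF cD]]) (use D(2) in blast)
    then obtain x where x: "x \<in> closure ?A" "x \<in> X0" using M(7) by blast
    have "closure ?A \<subseteq> D \<union> {p0}" by (rule closure_minimal[OF _ compact_imp_closed[OF cD]]) (use D(2) in blast)
    then have xD: "x \<in> D \<union> {p0}" using x(1) by blast
    obtain l u where lu: "x = (l, u)" by (cases x) auto
    have u: "blinfun_apply \<phi>s u = 0" "(l, u) \<noteq> p0" using x(2) lu by (auto simp: X0_def)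
    show ?thesis
    proof (cases "u = 0")
      case True
      then have "l \<noteq> l0 \<and> (l, 0) \<in> D \<union> {p0}" using u(2) xD lu by simp
      then show ?thesis by blast
    next
      case False
      then show ?thesis using u(1) xD lu by blast
    qed
  qed
  have ball: "\<exists>C. closed C \<and> connected C \<and> C \<subseteq> S \<inter> cball p0 \<delta> \<and> p0 \<in> C \<and> C \<inter> sphere p0 \<delta> \<noteq> {} \<and>
        (\<forall>x\<in>C - {p0}. 0 < blinfun_apply \<phi>s (snd x)) \<and> C - {p0} \<subseteq> D"
    if \<delta>: "\<delta> > 0" "\<forall>x\<in>S \<inter> cball p0 \<delta>. blinfun_apply \<phi>s (snd x) = 0 \<longrightarrow> x = p0" for \<delta>
  proof -
    have "M \<inter> X0 \<inter> cball p0 \<delta> = {}" using \<delta>(2) unfolding X0_def by blast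
    moreover have "compact C" if "closed C" "bounded C" "C \<subseteq> M" for C using comp[OF that(1,2)] that(3) M(1) by blast
    ultimately obtain C where C: "closed C" "connected C" "C \<subseteq> M \<inter> cball p0 \<delta>" "p0 \<in> C" "C \<inter> sphere p0 \<delta> \<noteq> {}"
      using connected_branch_in_ball[OF M(2,3) _ M(4) \<delta>(1)] by blast
    have pos: "0 < blinfun_apply \<phi>s (snd x)" if x: "x \<in> C - {p0}" for x
    proof -
      have "x \<in> Sp" "x \<in> cball p0 \<delta>" "x \<noteq> p0" using x C(3) M(1) by blast+
      then have "0 \<le> blinfun_apply \<phi>s (snd x)" "blinfun_apply \<phi>s (snd x) \<noteq> 0" using \<delta>(2) unfolding Sp_def by blast+
      then show ?thesis by simp
    qed
    have "C - {p0} \<subseteq> ?A"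
    proof
      fix x assume x: "x \<in> C - {p0}"
      then have "x \<notin> X0" using pos[OF x] by (auto simp: X0_def)
      then show "x \<in> ?A" using x C(3) by blast
    qed
    then have "C - {p0} \<subseteq> D" using D(2) by blast
    moreover have "C \<subseteq> S \<inter> cball p0 \<delta>" using C(3) M(1) unfolding Sp_def by blast
    ultimately show ?thesis using C pos by (intro exI[of _ C]) blast
  qed
  show ?thesis
  proof (rule bexI[OF _ D(1)], intro conjI allI impI)
    show "\<not> compact (D \<union> {p0}) \<or> (\<exists>l1. l1 \<noteq> l0 \<and> (l1, 0) \<in> D \<union> {p0}) \<or>
      (\<exists>l z. z \<noteq> 0 \<and> blinfun_apply \<phi>s z = 0 \<and> (l, z) \<in> D \<union> {p0})" using alt by blast
  qed (rule ball)
qed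

lemma reflected: "simple_eigenvalue F F' l0 (- \<phi>0) L' (- \<phi>s)"
proof (unfold_locales)
  show "null_space L0 = span {- \<phi>0}"
  proof -
    have "span {- \<phi>0} = span {\<phi>0}" by (auto simp: span_singleton intro: range_eqI[of _ _ "- _"])
    then show ?thesis using ker by simp
  qed
  show "blinfun_apply L' (- \<phi>0) \<notin> range (blinfun_apply L0)"
  proof
    assume "blinfun_apply L' (- \<phi>0) \<in> range (blinfun_apply L0)"
    then obtain x where "blinfun_apply L' (- \<phi>0) = blinfun_apply L0 x" by blast
    then have "blinfun_apply L' \<phi>0 = blinfun_apply L0 (- x)" by (simp add: blinfun.minus_right) (metis minus_minus)
    then show False using transversal by blast
  qed
qed (simp_all add: deriv cont_deriv trivial Fredholm proper isolated norm_\<phi>0 deriv_L \<phi>s_\<phi>0 blinfun.minus_left blinfun.minus_right)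

end

lemma sphere_subset_frontier_cball:
  fixes a :: "'a::real_normed_vector"
  assumes "0 < r"
  shows "sphere a r \<subseteq> frontier (cball a r)"
proof
  fix x assume x: "x \<in> sphere a r"
  have "x \<notin> interior (cball a r)"
  proof
    assume "x \<in> interior (cball a r)"
    then obtain e where e: "e > 0" "ball x e \<subseteq> cball a r" by (auto simp: mem_interior)
    define t where "t = e / (2 * r)"
    have t: "0 < t" using e(1) assms by (simp add: t_def)
    have nx: "norm (x - a) = r" using x by (simp add: dist_norm norm_minus_commute)
    have "dist x (x + t *\<^sub>R (x - a)) = t * r" using t nx by (simp add: dist_norm)
    also have "\<dots> < e" using e(1) assms by (simp add: t_def)
    finally have "x + t *\<^sub>R (x - a) \<in> cball a r" using e(2) by auto
    moreover have "(x + t *\<^sub>R (x - a)) - a = (1 + t) *\<^sub>R (x - a)" by (simp add: algebra_simps)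
    then have "norm ((x + t *\<^sub>R (x - a)) - a) = (1 + t) * r" using t nx by simp
    ultimately have "(1 + t) * r \<le> r" by (simp add: dist_norm norm_minus_commute)
    then show False using t assms by simp
  qed
  then show "x \<in> frontier (cball a r)" using x by (simp add: frontier_def)
qed

text \<open>The balls are closed, so that a closed set contained in one can meet its frontier. The
  existence of admissible \<open>\<epsilon>\<close> and \<open>\<delta>\<close> is a separate
  conjunct, which keeps the implication about the two continua from being vacuous.\<close>

theorem theorem9p5:
  fixes F :: "real \<times> 'u::banach \<Rightarrow> 'v::banach"
    and l0 c1 c2 \<eta> :: real
    and \<phi>0 :: 'u
    and L' :: "'u \<Rightarrow>\<^sub>L 'v"
    and Z :: "'u set"
    and \<phi>s :: "'u \<Rightarrow>\<^sub>L real"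
    and \<psi> :: "'u \<Rightarrow> real"
  assumes C1: "C1_on UNIV F"
    and F1: "\<And>l. F (l, 0) = 0"
    and F2: "orientable F"
    and F3: "\<And>l u. D_u F (l, u) \<in> Fredholm0"
    and F4: "proper_on_closed_bounded F"
    and F5: "l0 isolated_in gen_spectrum (linearization F)"
      "null_space (linearization F l0) = span {\<phi>0}"
      "norm \<phi>0 = 1"
      "(linearization F has_vector_derivative L') (at l0)"
      "blinfun_apply L' \<phi>0 \<notin> range (blinfun_apply (linearization F l0))"
    and Z: "closed Z" "direct_sum_decomposition (null_space (linearization F l0)) Z"
    and \<phi>s: "Z = null_space \<phi>s" "blinfun_apply \<phi>s \<phi>0 = 1"
    and \<psi>: "continuous_on UNIV \<psi>" "0 < c1" "c1 < c2" "\<psi> 0 = 0"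
      "\<And>u. c1 * norm u \<le> \<psi> u" "\<And>u. \<psi> u \<le> c2 * norm u"
    and \<psi>_C1: "C1_on (- {0}) \<psi>"
    and \<eta>: "0 < \<eta>" "\<eta> < 1 / c2"
  shows "\<exists>C \<in> components (nontrivial_solutions F). (l0, 0) \<in> C \<and>
    (\<exists>\<epsilon>0>0. \<forall>\<epsilon>\<in>{0<..<\<epsilon>0}. \<exists>\<delta>0>0. \<forall>\<delta>\<in>{0<..<\<delta>0}.
       (nontrivial_solutions F - {(l0, 0)}) \<inter> cball (l0, 0) \<delta> \<subseteq> cone_Q l0 \<phi>s \<psi> \<epsilon> \<eta>) \<and>
    (\<forall>\<epsilon>>0. \<forall>\<delta>>0.
       (nontrivial_solutions F - {(l0, 0)}) \<inter> cball (l0, 0) \<delta> \<subseteq> cone_Q l0 \<phi>s \<psi> \<epsilon> \<eta> \<longrightarrow>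
       (\<exists>Cp Cm.
          closed Cp \<and> connected Cp \<and> Cp \<subseteq> C \<inter> cball (l0, 0) \<delta> \<and>
          closed Cm \<and> connected Cm \<and> Cm \<subseteq> C \<inter> cball (l0, 0) \<delta> \<and>
          Cp \<subseteq> cone_Qplus l0 \<phi>s \<psi> \<epsilon> \<eta> \<union> {(l0, 0)} \<and>
          Cm \<subseteq> cone_Qminus l0 \<phi>s \<psi> \<epsilon> \<eta> \<union> {(l0, 0)} \<and>
          Cp \<inter> Cm = {(l0, 0)} \<and>
          Cp \<inter> frontier (cball (l0, 0) \<delta>) \<noteq> {} \<and>
          Cm \<inter> frontier (cball (l0, 0) \<delta>) \<noteq> {} \<and>
          (\<exists>Dp \<in> components (nontrivial_solutions F - {(l0, 0)}).
           \<exists>Dm \<in> components (nontrivial_solutions F - {(l0, 0)}).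
             Cp - {(l0, 0)} \<subseteq> Dp \<and> Cm - {(l0, 0)} \<subseteq> Dm \<and>
             (\<forall>E \<in> {Dp \<union> {(l0, 0)}, Dm \<union> {(l0, 0)}}.
                \<not> compact E \<or>
                (\<exists>l1. l1 \<noteq> l0 \<and> (l1, 0) \<in> E) \<or>
                (\<exists>l z. z \<in> Z - {0} \<and> (l, z) \<in> E)))))"
proof -
  obtain F' where F': "\<And>x. (F has_derivative blinfun_apply (F' x)) (at x)" "continuous_on UNIV F'"
    using C1 unfolding C1_on_def by blast
  have Fr: "D_u F x \<in> Fredholm0" for x using F3[of "fst x" "snd x"] by simp
  interpret pos: simple_eigenvalue F F' l0 \<phi>0 L' \<phi>s
    by (unfold_locales; fact F' F1 Fr F4 F5 \<phi>s(2))
  interpret neg: simple_eigenvalue F F' l0 "- \<phi>0" L' "- \<phi>s" by (rule pos.reflected)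
  let ?S = "nontrivial_solutions F" and ?p = "(l0, 0 :: 'u)"
  define C where "C = connected_component_set ?S ?p"
  have CS: "C \<in> components ?S" "?p \<in> C" using pos.p0_S by (auto simp: C_def components_def)
  have sub: "X \<subseteq> C" if "connected X" "X \<subseteq> ?S" "?p \<in> X" for X
    unfolding C_def by (rule connected_component_maximal[OF that(3,1,2)])
  have \<psi>0: "0 \<le> \<psi> u" for u using \<psi>(2) \<psi>(5)[of u] order_trans[OF mult_nonneg_nonneg[of c1 "norm u"]] by simp
  \<comment> \<open>The cone estimate is applied with \<open>\<theta> = \<eta> * c2\<close>, which
    is less than 1, because \<open>\<psi> u\<close> is at most \<open>c2 * norm u\<close>.\<close>
  have cone: "\<exists>\<delta>0>0. \<forall>\<delta>\<in>{0<..<\<delta>0}. (?S - {?p}) \<inter> cball ?p \<delta> \<subseteq> cone_Q l0 \<phi>s \<psi> \<epsilon> \<eta>" if \<epsilon>: "0 < \<epsilon>" for \<epsilon>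
  proof -
    have "\<eta> * c2 < 1" using \<eta> \<psi>(2,3) by (simp add: pos_less_divide_eq)
    then obtain r where r: "r > 0" "\<And>x. x \<in> (?S - {?p}) \<inter> ball ?p r \<Longrightarrow> snd x \<noteq> 0 \<and> \<eta> * c2 * norm (snd x) < \<bar>blinfun_apply \<phi>s (snd x)\<bar>"
      using pos.cone_near_p0 by blast
    have "(?S - {?p}) \<inter> cball ?p \<delta> \<subseteq> cone_Q l0 \<phi>s \<psi> \<epsilon> \<eta>" if \<delta>: "\<delta> \<in> {0<..<min r \<epsilon>}" for \<delta>
    proof
      fix x assume x: "x \<in> (?S - {?p}) \<inter> cball ?p \<delta>"
      obtain l u where lu: "x = (l, u)" by (cases x) auto
      have "x \<in> (?S - {?p}) \<inter> ball ?p r" using x \<delta> by auto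
      then have "\<eta> * c2 * norm u < \<bar>blinfun_apply \<phi>s u\<bar>" using r(2) lu by fastforce
      moreover have "\<eta> * \<psi> u \<le> \<eta> * (c2 * norm u)" using \<psi>(6) \<eta>(1) by (intro mult_left_mono) auto
      moreover have "dist l0 l \<le> dist ?p x" using dist_fst_le[of ?p x] lu by simp
      then have "\<bar>l - l0\<bar> < \<epsilon>" using x \<delta> by (simp add: dist_real_def abs_minus_commute)
      ultimately show "x \<in> cone_Q l0 \<phi>s \<psi> \<epsilon> \<eta>" using lu by (simp add: cone_Q_def)
    qed
    then show ?thesis using r(1) \<epsilon> by (intro exI[of _ "min r \<epsilon>"]) auto
  qed
  obtain Dp where Dp: "Dp \<in> components (?S - {?p})"
      "\<not> compact (Dp \<union> {?p}) \<or> (\<exists>l1. l1 \<noteq> l0 \<and> (l1, 0) \<in> Dp \<union> {?p}) \<or> (\<exists>l z. z \<noteq> 0 \<and> blinfun_apply \<phi>s z = 0 \<and> (l, z) \<in> Dp \<union> {?p})"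
      "\<forall>\<delta>>0. (\<forall>x\<in>?S \<inter> cball ?p \<delta>. blinfun_apply \<phi>s (snd x) = 0 \<longrightarrow> x = ?p) \<longrightarrow>
        (\<exists>C. closed C \<and> connected C \<and> C \<subseteq> ?S \<inter> cball ?p \<delta> \<and> ?p \<in> C \<and> C \<inter> sphere ?p \<delta> \<noteq> {} \<and>
          (\<forall>x\<in>C - {?p}. 0 < blinfun_apply \<phi>s (snd x)) \<and> C - {?p} \<subseteq> Dp)"
    using pos.positive_branch by (elim bexE conjE) (rule that)
  obtain Dm where Dm: "Dm \<in> components (?S - {?p})"
      "\<not> compact (Dm \<union> {?p}) \<or> (\<exists>l1. l1 \<noteq> l0 \<and> (l1, 0) \<in> Dm \<union> {?p}) \<or> (\<exists>l z. z \<noteq> 0 \<and> blinfun_apply (- \<phi>s) z = 0 \<and> (l, z) \<in> Dm \<union> {?p})"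
      "\<forall>\<delta>>0. (\<forall>x\<in>?S \<inter> cball ?p \<delta>. blinfun_apply (- \<phi>s) (snd x) = 0 \<longrightarrow> x = ?p) \<longrightarrow>
        (\<exists>C. closed C \<and> connected C \<and> C \<subseteq> ?S \<inter> cball ?p \<delta> \<and> ?p \<in> C \<and> C \<inter> sphere ?p \<delta> \<noteq> {} \<and>
          (\<forall>x\<in>C - {?p}. 0 < blinfun_apply (- \<phi>s) (snd x)) \<and> C - {?p} \<subseteq> Dm)"
    using neg.positive_branch by (elim bexE conjE) (rule that)
  have Zz: "z \<in> Z - {0}" if "z \<noteq> 0" "blinfun_apply \<phi>s z = 0" for z using that \<phi>s(1) by (simp add: null_space_def)
  have alts: "\<not> compact E \<or> (\<exists>l1. l1 \<noteq> l0 \<and> (l1, 0) \<in> E) \<or> (\<exists>l z. z \<in> Z - {0} \<and> (l, z) \<in> E)"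
    if "E \<in> {Dp \<union> {?p}, Dm \<union> {?p}}" for E
    using that
  proof
    assume "E = Dp \<union> {?p}"
    then show ?thesis using Dp(2) Zz by blast
  next
    assume "E \<in> {Dm \<union> {?p}}"
    moreover have "\<not> compact (Dm \<union> {?p}) \<or> (\<exists>l1. l1 \<noteq> l0 \<and> (l1, 0) \<in> Dm \<union> {?p}) \<or> (\<exists>l z. z \<noteq> 0 \<and> blinfun_apply \<phi>s z = 0 \<and> (l, z) \<in> Dm \<union> {?p})"
      using Dm(2) by (simp only: blinfun.minus_left neg_equal_0_iff_equal)
    ultimately show ?thesis using Zz by blast
  qed
  have main: "\<exists>Cp Cm. closed Cp \<and> connected Cp \<and> Cp \<subseteq> C \<inter> cball ?p \<delta> \<and>
          closed Cm \<and> connected Cm \<and> Cm \<subseteq> C \<inter> cball ?p \<delta> \<and>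
          Cp \<subseteq> cone_Qplus l0 \<phi>s \<psi> \<epsilon> \<eta> \<union> {?p} \<and>
          Cm \<subseteq> cone_Qminus l0 \<phi>s \<psi> \<epsilon> \<eta> \<union> {?p} \<and>
          Cp \<inter> Cm = {?p} \<and>
          Cp \<inter> frontier (cball ?p \<delta>) \<noteq> {} \<and>
          Cm \<inter> frontier (cball ?p \<delta>) \<noteq> {} \<and>
          Cp - {?p} \<subseteq> Dp \<and> Cm - {?p} \<subseteq> Dm"
    if \<epsilon>: "0 < \<epsilon>" and \<delta>: "0 < \<delta>" and Q: "(?S - {?p}) \<inter> cball ?p \<delta> \<subseteq> cone_Q l0 \<phi>s \<psi> \<epsilon> \<eta>" for \<epsilon> \<delta>
  proof -
    have inQ: "\<bar>fst x - l0\<bar> < \<epsilon> \<and> \<eta> * \<psi> (snd x) < \<bar>blinfun_apply \<phi>s (snd x)\<bar>" if "x \<in> ?S" "x \<noteq> ?p" "x \<in> cball ?p \<delta>" for x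
    proof -
      have "x \<in> cone_Q l0 \<phi>s \<psi> \<epsilon> \<eta>" using Q that by blast
      then show ?thesis by (cases x) (simp add: cone_Q_def)
    qed
    have \<eta>\<psi>: "0 \<le> \<eta> * \<psi> u" for u using \<psi>0 \<eta>(1) by simp
    \<comment> \<open>Inside the cone \<open>\<phi>s\<close> does not vanish; this is the condition
      under which \<open>positive_branch\<close> provides a continuum in the ball.\<close>
    have z: "x = ?p" if "x \<in> ?S \<inter> cball ?p \<delta>" "blinfun_apply \<phi>s (snd x) = 0" for x
      using inQ[of x] that \<eta>\<psi>[of "snd x"] by force
    have az: "\<forall>x\<in>?S \<inter> cball ?p \<delta>. blinfun_apply \<phi>s (snd x) = 0 \<longrightarrow> x = ?p" by (intro ballI impI) (rule z)
    then have az': "\<forall>x\<in>?S \<inter> cball ?p \<delta>. blinfun_apply (- \<phi>s) (snd x) = 0 \<longrightarrow> x = ?p"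
      by (simp only: blinfun.minus_left neg_equal_0_iff_equal)
    obtain Cp where Cp: "closed Cp" "connected Cp" "Cp \<subseteq> ?S \<inter> cball ?p \<delta>" "?p \<in> Cp" "Cp \<inter> sphere ?p \<delta> \<noteq> {}"
        "\<forall>x\<in>Cp - {?p}. 0 < blinfun_apply \<phi>s (snd x)" "Cp - {?p} \<subseteq> Dp"
      using Dp(3)[THEN spec, THEN mp, OF \<delta>, THEN mp, OF az] by (elim exE conjE) (rule that)
    obtain Cm where Cm: "closed Cm" "connected Cm" "Cm \<subseteq> ?S \<inter> cball ?p \<delta>" "?p \<in> Cm" "Cm \<inter> sphere ?p \<delta> \<noteq> {}"
        "\<forall>x\<in>Cm - {?p}. 0 < blinfun_apply (- \<phi>s) (snd x)" "Cm - {?p} \<subseteq> Dm"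
      using Dm(3)[THEN spec, THEN mp, OF \<delta>, THEN mp, OF az'] by (elim exE conjE) (rule that)
    have Cm6: "blinfun_apply \<phi>s (snd x) < 0" if "x \<in> Cm - {?p}" for x using Cm(6) that by (simp add: blinfun.minus_left)
    have "Cp \<subseteq> cone_Qplus l0 \<phi>s \<psi> \<epsilon> \<eta> \<union> {?p}"
    proof
      fix x assume x: "x \<in> Cp"
      show "x \<in> cone_Qplus l0 \<phi>s \<psi> \<epsilon> \<eta> \<union> {?p}"
      proof (cases "x = ?p")
        case False
        have "x \<in> ?S" "x \<in> cball ?p \<delta>" using subsetD[OF Cp(3) x] by (simp_all only: Int_iff)
        from inQ[OF this(1) False this(2)] have "\<bar>fst x - l0\<bar> < \<epsilon>" "\<eta> * \<psi> (snd x) < \<bar>blinfun_apply \<phi>s (snd x)\<bar>" by simp_all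
        moreover have "0 < blinfun_apply \<phi>s (snd x)" using Cp(6) x False by blast
        ultimately have "x \<in> cone_Qplus l0 \<phi>s \<psi> \<epsilon> \<eta>" by (cases x) (simp add: cone_Qplus_def)
        then show ?thesis by blast
      qed simp
    qed
    moreover have "Cm \<subseteq> cone_Qminus l0 \<phi>s \<psi> \<epsilon> \<eta> \<union> {?p}"
    proof
      fix x assume x: "x \<in> Cm"
      show "x \<in> cone_Qminus l0 \<phi>s \<psi> \<epsilon> \<eta> \<union> {?p}"
      proof (cases "x = ?p")
        case False
        have "x \<in> ?S" "x \<in> cball ?p \<delta>" using subsetD[OF Cm(3) x] by (simp_all only: Int_iff)
        from inQ[OF this(1) False this(2)] have "\<bar>fst x - l0\<bar> < \<epsilon>" "\<eta> * \<psi> (snd x) < \<bar>blinfun_apply \<phi>s (snd x)\<bar>" by simp_all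
        moreover have "blinfun_apply \<phi>s (snd x) < 0" using Cm6 x False by blast
        ultimately have "x \<in> cone_Qminus l0 \<phi>s \<psi> \<epsilon> \<eta>" by (cases x) (simp add: cone_Qminus_def)
        then show ?thesis by blast
      qed simp
    qed
    moreover have "Cp \<inter> Cm = {?p}"
    proof -
      have "x = ?p" if x: "x \<in> Cp" "x \<in> Cm" for x
      proof (rule ccontr)
        assume "x \<noteq> ?p"
        then have "0 < blinfun_apply \<phi>s (snd x)" "blinfun_apply \<phi>s (snd x) < 0" using Cp(6) Cm6 x by blast+
        then show False by simp
      qed
      then show ?thesis using Cp(4) Cm(4) by blast
    qed
    moreover have "Cp \<inter> frontier (cball ?p \<delta>) \<noteq> {}" "Cm \<inter> frontier (cball ?p \<delta>) \<noteq> {}"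
      using Cp(5) Cm(5) sphere_subset_frontier_cball[OF \<delta>, of ?p] by blast+
    moreover have "Cp \<subseteq> C \<inter> cball ?p \<delta>" "Cm \<subseteq> C \<inter> cball ?p \<delta>"
      using sub[OF Cp(2) _ Cp(4)] sub[OF Cm(2) _ Cm(4)] Cp(3) Cm(3) by blast+
    ultimately show ?thesis using Cp(1,2,7) Cm(1,2,7) by (intro exI[of _ Cp] exI[of _ Cm] conjI)
  qed
  show ?thesis
  proof (rule bexI[OF _ CS(1)], intro conjI allI impI)
    show "?p \<in> C" by (rule CS(2))
    show "\<exists>\<epsilon>0>0. \<forall>\<epsilon>\<in>{0<..<\<epsilon>0}. \<exists>\<delta>0>0. \<forall>\<delta>\<in>{0<..<\<delta>0}. (?S - {?p}) \<inter> cball ?p \<delta> \<subseteq> cone_Q l0 \<phi>s \<psi> \<epsilon> \<eta>"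
      using cone by (intro exI[of _ 1]) simp
    fix \<epsilon> \<delta> :: real
    assume "0 < \<epsilon>" "0 < \<delta>" "(?S - {?p}) \<inter> cball ?p \<delta> \<subseteq> cone_Q l0 \<phi>s \<psi> \<epsilon> \<eta>"
    from main[OF this] obtain Cp Cm where CC: "closed Cp" "connected Cp" "Cp \<subseteq> C \<inter> cball ?p \<delta>"
          "closed Cm" "connected Cm" "Cm \<subseteq> C \<inter> cball ?p \<delta>"
          "Cp \<subseteq> cone_Qplus l0 \<phi>s \<psi> \<epsilon> \<eta> \<union> {?p}" "Cm \<subseteq> cone_Qminus l0 \<phi>s \<psi> \<epsilon> \<eta> \<union> {?p}" "Cp \<inter> Cm = {?p}"
          "Cp \<inter> frontier (cball ?p \<delta>) \<noteq> {}" "Cm \<inter> frontier (cball ?p \<delta>) \<noteq> {}" "Cp - {?p} \<subseteq> Dp" "Cm - {?p} \<subseteq> Dm"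
      by (elim exE conjE) (rule that)
    show "\<exists>Cp Cm. closed Cp \<and> connected Cp \<and> Cp \<subseteq> C \<inter> cball ?p \<delta> \<and> closed Cm \<and> connected Cm \<and> Cm \<subseteq> C \<inter> cball ?p \<delta> \<and>
          Cp \<subseteq> cone_Qplus l0 \<phi>s \<psi> \<epsilon> \<eta> \<union> {?p} \<and> Cm \<subseteq> cone_Qminus l0 \<phi>s \<psi> \<epsilon> \<eta> \<union> {?p} \<and> Cp \<inter> Cm = {?p} \<and>
          Cp \<inter> frontier (cball ?p \<delta>) \<noteq> {} \<and> Cm \<inter> frontier (cball ?p \<delta>) \<noteq> {} \<and>
          (\<exists>Dp \<in> components (?S - {?p}). \<exists>Dm \<in> components (?S - {?p}). Cp - {?p} \<subseteq> Dp \<and> Cm - {?p} \<subseteq> Dm \<and>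
             (\<forall>E \<in> {Dp \<union> {?p}, Dm \<union> {?p}}. \<not> compact E \<or> (\<exists>l1. l1 \<noteq> l0 \<and> (l1, 0) \<in> E) \<or> (\<exists>l z. z \<in> Z - {0} \<and> (l, z) \<in> E)))"
      by (rule exI[of _ Cp], rule exI[of _ Cm], intro conjI; (rule CC | rule bexI[OF _ Dp(1)], rule bexI[OF _ Dm(1)], intro conjI ballI; (rule CC alts, assumption?)))
  qed
qed

end
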